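(* Let $M$ be a manifold-with-boundary equipped with a free circle action on a neighbourhood $U_M$ of its boundary, let $M_{\mathrm{cut}} = M/{\sim}$ be the cut space, let $f \colon M \to \mathbb{R}_{\geq 0}$ be an invariant boundary defining function, and let $\mathcal{F}_M$ be the associated set of real-valued functions on $M_{\mathrm{cut}}$. Then there exists a unique (smooth) manifold structure on $M_{\mathrm{cut}}$ such that $\mathcal{F}_M$ is the set of real-valued smooth functions on $M_{\mathrm{cut}}$.
   Context: Manifolds, with or without boundary, are smooth, Hausdorff and second countable. $S^1=\{a\in\mathbb{C}: |a|=1\}$. For a manifold-with-boundary $M$, $\mathring{M}$ denotes the interior and $\partial M$ the boundary. "A free circle action on a neighbourhood $U_M$ of the boundary" means a smooth free action of $S^1$ on an open neighbourhood $U_M$ of $\partial M$ in $M$; necessarily $\partial M$ is $S^1$-invariant. Cut space: let $\sim$ be the equivalence relation on $M$ in which distinct points are equivalent iff they both lie in $\partial M$ and lie in the same $S^1$-orbit. $M_{\mathrm{cut}} := M/{\sim}$ with the quotient topology; $c \colon M \to M_{\mathrm{cut}}$ is the quotient map. An invariant boundary defining function on $M$ is a smooth $f \colon M \to \mathbb{R}_{\ge 0}$ such that $f^{-1}(0)=\partial M$, $df|_{\partial M}$ never vanishes, and $f$ is $S^1$-invariant on some $S^1$-invariant neighbourhood of $\partial M$ in $U_M$. (Such functions always exist.) $\mathcal{F}_M$ is the set of functions $h \colon M_{\mathrm{cut}}\to\mathbb{R}$ such that $\widehat{h} := h\circ c$ satisfies: ($\mathcal{F}1$) $\widehat{h}|_{\mathring{M}}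 \colon \mathring{M}\to\mathbb{R}$ is smooth; ($\mathcal{F}2$) there exist an $S^1$-invariant open neighbourhood $V$ of $\partial M$ in $U_M$ and a smooth function $H \colon V\times\mathbb{C}\to\mathbb{R}$ such that (a) $H(a\cdot x,z)=H(x,az)$ for all $a\in S^1$, $(x,z)\in V\times\mathbb{C}$, and (b) $\widehat{h}(x)=H(x,\sqrt{f(x)})$ for all $x\in V$. The set $\mathcal{F}_M$ does not depend on the choice of $f$. *)

theory Defs
  imports "HOL-Analysis.Analysis"
begin

section \<open>Smooth functions on subsets of Euclidean spaces\<close>

text \<open>
  Dimensions are natural numbers, and \<open>\<real>\<^sup>n\<close> is the library's \<^const>\<open>Euclidean_space\<close> \<open>n\<close>:
  the functions \<^typ>\<open>nat \<Rightarrow> real\<close> that vanish at all \<open>i \<ge> n\<close>.  Unlike a model space given by a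
  type of class \<open>euclidean_space\<close>, this includes dimension \<open>0\<close>.
\<close>

text \<open>\<open>C\<^sup>k\<close> on a set \<open>S\<close> that is open in \<open>\<real>\<^sup>n\<close>: iterated partial derivatives exist and are continuous.\<close>

primrec Ck_open :: "nat \<Rightarrow> nat \<Rightarrow> (nat \<Rightarrow> real) set \<Rightarrow> ((nat \<Rightarrow> real) \<Rightarrow> real) \<Rightarrow> bool" where
  "Ck_open 0 n S f \<longleftrightarrow> continuous_map (subtopology (Euclidean_space n) S) euclideanreal f"
| "Ck_open (Suc k) n S f \<longleftrightarrow>
     continuous_map (subtopology (Euclidean_space n) S) euclideanreal f \<and>
     (\<forall>i<n. \<exists>g. (\<forall>x\<in>S. ((\<lambda>t. f (x(i := t))) has_real_derivative g x) (at (x i))) \<and> Ck_open k n S g)"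

text \<open>
  On an arbitrary \<open>S \<subseteq> \<real>\<^sup>n\<close>, smooth means having local smooth extensions to open subsets of \<open>\<real>\<^sup>n\<close>.
  This is what is needed on relatively open subsets of a half space; only the values on \<open>S\<close> matter.
\<close>

definition smooth_on :: "nat \<Rightarrow> (nat \<Rightarrow> real) set \<Rightarrow> ((nat \<Rightarrow> real) \<Rightarrow> real) \<Rightarrow> bool" where
  "smooth_on n S f \<longleftrightarrow>
     (\<forall>x\<in>S. \<exists>W g. openin (Euclidean_space n) W \<and> x \<in> W \<and> (\<forall>k. Ck_open k n W g) \<and>
                  (\<forall>y\<in>W \<inter> S. g y = f y))"

definition smooth_map_on ::
    "nat \<Rightarrow> (nat \<Rightarrow> real) set \<Rightarrow> ((nat \<Rightarrow> real) \<Rightarrow> nat \<Rightarrow> real) \<Rightarrow> bool" where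
  "smooth_map_on n S F \<longleftrightarrow> (\<forall>j. smooth_on n S (\<lambda>x. F x j))"

section \<open>Manifolds with and without boundary\<close>

text \<open>
  The half space is \<open>x\<^sub>0 \<ge> 0\<close>.  In dimension \<open>0\<close> this is all of \<open>\<real>\<^sup>0\<close>, which has no boundary.
\<close>

definition half_space :: "nat \<Rightarrow> (nat \<Rightarrow> real) topology" where
  "half_space n = subtopology (Euclidean_space n) {x. 0 \<le> x 0}"

definition half_space_boundary :: "nat \<Rightarrow> (nat \<Rightarrow> real) set" where
  "half_space_boundary n = {x \<in> topspace (half_space n). 0 < n \<and> x 0 = 0}"

text \<open>
  A chart \<open>(U, \<phi>)\<close> has \<open>\<phi>\<close> extensional (equal to \<^const>\<open>undefined\<close> off \<open>U\<close>), so that a map on \<open>U\<close> is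
  represented by exactly one HOL function.  Otherwise maximal atlases would not be unique.
\<close>

type_synonym 'a chart = "'a set \<times> ('a \<Rightarrow> nat \<Rightarrow> real)"

definition is_chart :: "(nat \<Rightarrow> real) topology \<Rightarrow> 'a topology \<Rightarrow> 'a chart \<Rightarrow> bool" where
  "is_chart E X = (\<lambda>(U, \<phi>). openin X U \<and> \<phi> \<in> extensional U \<and> openin E (\<phi> ` U) \<and>
     homeomorphic_map (subtopology X U) (subtopology E (\<phi> ` U)) \<phi>)"

definition smoothly_compatible :: "nat \<Rightarrow> 'a chart \<Rightarrow> 'a chart \<Rightarrow> bool" where
  "smoothly_compatible n = (\<lambda>(U, \<phi>) (V, \<psi>).
     smooth_map_on n (\<phi> ` (U \<inter> V)) (\<psi> \<circ> inv_into U \<phi>) \<and>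
     smooth_map_on n (\<psi> ` (U \<inter> V)) (\<phi> \<circ> inv_into V \<psi>))"

definition maximal_atlas ::
    "nat \<Rightarrow> (nat \<Rightarrow> real) topology \<Rightarrow> 'a topology \<Rightarrow> 'a chart set \<Rightarrow> bool" where
  "maximal_atlas n E X A \<longleftrightarrow>
     (\<forall>c\<in>A. is_chart E X c) \<and>
     \<Union> (fst ` A) = topspace X \<and>
     (\<forall>c\<in>A. \<forall>d\<in>A. smoothly_compatible n c d) \<and>
     (\<forall>c. is_chart E X c \<and> (\<forall>d\<in>A. smoothly_compatible n c d) \<longrightarrow> c \<in> A)"

definition manifold :: "nat \<Rightarrow> 'a topology \<Rightarrow> 'a chart set \<Rightarrow> bool" where
  "manifold n X A \<longleftrightarrow>
     Hausdorff_space X \<and> second_countable X \<and> maximal_atlas n (Euclidean_space n) X A"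

definition manifold_with_boundary :: "nat \<Rightarrow> 'a topology \<Rightarrow> 'a chart set \<Rightarrow> bool" where
  "manifold_with_boundary n X A \<longleftrightarrow>
     Hausdorff_space X \<and> second_countable X \<and> maximal_atlas n (half_space n) X A"

definition boundary_of_manifold :: "nat \<Rightarrow> 'a topology \<Rightarrow> 'a chart set \<Rightarrow> 'a set" where
  "boundary_of_manifold n X A =
     {x \<in> topspace X. \<exists>(U, \<phi>)\<in>A. x \<in> U \<and> \<phi> x \<in> half_space_boundary n}"

definition interior_of_manifold :: "nat \<Rightarrow> 'a topology \<Rightarrow> 'a chart set \<Rightarrow> 'a set" where
  "interior_of_manifold n X A = topspace X - boundary_of_manifold n X A"

section \<open>Smooth functions and maps on manifolds\<close>

text \<open>
  These make sense for any atlas of \<open>n\<close>-dimensional charts, maximal or not, and on any open \<open>D\<close>.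
  The set \<open>D\<close> is the actual domain: values off \<open>D\<close> are irrelevant.
\<close>

definition smooth_fun :: "nat \<Rightarrow> 'a chart set \<Rightarrow> 'a set \<Rightarrow> ('a \<Rightarrow> real) \<Rightarrow> bool" where
  "smooth_fun n A D h \<longleftrightarrow> (\<forall>(U, \<phi>)\<in>A. smooth_on n (\<phi> ` (U \<inter> D)) (h \<circ> inv_into U \<phi>))"

definition smooth_map ::
    "nat \<Rightarrow> 'a topology \<Rightarrow> 'a chart set \<Rightarrow> 'a set \<Rightarrow> 'b topology \<Rightarrow> 'b chart set \<Rightarrow> ('a \<Rightarrow> 'b) \<Rightarrow> bool" where
  "smooth_map n X A D Y B F \<longleftrightarrow>
     continuous_map (subtopology X D) Y F \<and>
     (\<forall>(U, \<phi>)\<in>A. \<forall>(V, \<psi>)\<in>B.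
        smooth_map_on n (\<phi> ` {x \<in> U \<inter> D. F x \<in> V}) (\<psi> \<circ> F \<circ> inv_into U \<phi>))"

text \<open>
  The differential of \<open>h\<close> at \<open>x\<close> is nonzero.  The difference quotients are taken within the image of
  the chart because at a boundary point the \<open>0\<close>-th partial derivative is one-sided.
\<close>

definition differential_nonzero_at :: "nat \<Rightarrow> 'a chart set \<Rightarrow> ('a \<Rightarrow> real) \<Rightarrow> 'a \<Rightarrow> bool" where
  "differential_nonzero_at n A h x \<longleftrightarrow>
     (\<forall>(U, \<phi>)\<in>A. x \<in> U \<longrightarrow>
        (\<exists>i<n. \<exists>d. d \<noteq> 0 \<and>
           ((\<lambda>t. h (inv_into U \<phi> ((\<phi> x)(i := t)))) has_real_derivative d)
             (at (\<phi> x i) within {t. (\<phi> x)(i := t) \<in> \<phi> ` U})))"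

text \<open>
  The product charts form an atlas (not a maximal one) for the product manifold: the first \<open>n\<close>
  coordinates come from the first factor.
\<close>

definition product_chart :: "nat \<Rightarrow> 'a chart \<Rightarrow> 'b chart \<Rightarrow> ('a \<times> 'b) chart" where
  "product_chart n = (\<lambda>(U, \<phi>) (V, \<psi>).
     (U \<times> V, restrict (\<lambda>(x, y) i. if i < n then \<phi> x i else \<psi> y (i - n)) (U \<times> V)))"

definition product_atlas :: "nat \<Rightarrow> 'a chart set \<Rightarrow> 'b chart set \<Rightarrow> ('a \<times> 'b) chart set" where
  "product_atlas n A B = {product_chart n c d | c d. c \<in> A \<and> d \<in> B}"

definition complex_atlas :: "complex chart set" where
  "complex_atlas = {(UNIV, \<lambda>z i. if i = 0 then Re z else if i = 1 then Im z else 0)}"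

abbreviation unit_circle :: "complex set" where
  "unit_circle \<equiv> sphere 0 1"

text \<open>Angle charts on the circle minus the point \<open>cis s\<close>.\<close>

definition circle_atlas :: "complex chart set" where
  "circle_atlas = {(cis ` {s<..<s + 2 * pi},
      restrict (\<lambda>a i. if i = 0 then inv_into {s<..<s + 2 * pi} cis a else 0)
        (cis ` {s<..<s + 2 * pi})) | s. True}"

section \<open>Circle actions near the boundary and the cut space\<close>

definition circle_invariant :: "(complex \<Rightarrow> 'a \<Rightarrow> 'a) \<Rightarrow> 'a set \<Rightarrow> bool" where
  "circle_invariant act W \<longleftrightarrow> (\<forall>a\<in>unit_circle. \<forall>x\<in>W. act a x \<in> W)"

definition free_circle_action_near_boundary ::
    "nat \<Rightarrow> 'a topology \<Rightarrow> 'a chart set \<Rightarrow> 'a set \<Rightarrow> (complex \<Rightarrow> 'a \<Rightarrow> 'a) \<Rightarrow> bool" where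
  "free_circle_action_near_boundary n X A UM act \<longleftrightarrow>
     openin X UM \<and> boundary_of_manifold n X A \<subseteq> UM \<and>
     circle_invariant act UM \<and>
     (\<forall>x\<in>UM. act 1 x = x) \<and>
     (\<forall>a\<in>unit_circle. \<forall>b\<in>unit_circle. \<forall>x\<in>UM. act (a * b) x = act a (act b x)) \<and>
     smooth_map (1 + n) (prod_topology (top_of_set unit_circle) X) (product_atlas 1 circle_atlas A)
       (unit_circle \<times> UM) X A (\<lambda>(a, x). act a x) \<and>
     (\<forall>a\<in>unit_circle. \<forall>x\<in>UM. act a x = x \<longrightarrow> a = 1)"

definition cut_relation ::
    "nat \<Rightarrow> 'a topology \<Rightarrow> 'a chart set \<Rightarrow> (complex \<Rightarrow> 'a \<Rightarrow> 'a) \<Rightarrow> ('a \<times> 'a) set" where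
  "cut_relation n X A act =
     {(x, y). x \<in> topspace X \<and> y \<in> topspace X \<and>
        (x = y \<or> x \<in> boundary_of_manifold n X A \<and> y \<in> boundary_of_manifold n X A \<and>
                 (\<exists>a\<in>unit_circle. y = act a x))}"

definition cut_map ::
    "nat \<Rightarrow> 'a topology \<Rightarrow> 'a chart set \<Rightarrow> (complex \<Rightarrow> 'a \<Rightarrow> 'a) \<Rightarrow> 'a \<Rightarrow> 'a set" where
  "cut_map n X A act x = cut_relation n X A act `` {x}"

definition cut_space ::
    "nat \<Rightarrow> 'a topology \<Rightarrow> 'a chart set \<Rightarrow> (complex \<Rightarrow> 'a \<Rightarrow> 'a) \<Rightarrow> 'a set topology" where
  "cut_space n X A act = topology (\<lambda>W. W \<subseteq> topspace X // cut_relation n X A act \<and>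
     openin X {x \<in> topspace X. cut_map n X A act x \<in> W})"

lemma openin_cut_space:
  "openin (cut_space n X A act) W \<longleftrightarrow>
     W \<subseteq> topspace X // cut_relation n X A act \<and> openin X {x \<in> topspace X. cut_map n X A act x \<in> W}"
proof -
  have "istopology (\<lambda>W. W \<subseteq> topspace X // cut_relation n X A act \<and>
     openin X {x \<in> topspace X. cut_map n X A act x \<in> W})"
    unfolding istopology_def
  proof (intro conjI allI impI, goal_cases)
    case (1 S T)
    then show ?case by blast
  next
    case (2 S T)
    have "{x \<in> topspace X. cut_map n X A act x \<in> S \<inter> T} =
      {x \<in> topspace X. cut_map n X A act x \<in> S} \<inter> {x \<in> topspace X. cut_map n X A act x \<in> T}"
      by blast
    then show ?case using 2 by auto
  next
    case (3 K)
    then show ?case by blast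
  next
    case (4 K)
    have "{x \<in> topspace X. cut_map n X A act x \<in> \<Union> K} =
      (\<Union>S\<in>K. {x \<in> topspace X. cut_map n X A act x \<in> S})"
      by blast
    then show ?case using 4 by auto
  qed
  then show ?thesis
    by (simp add: cut_space_def)
qed

lemma topspace_cut_space: "topspace (cut_space n X A act) = topspace X // cut_relation n X A act"
proof -
  have "openin (cut_space n X A act) (topspace X // cut_relation n X A act)"
  proof -
    have "{x \<in> topspace X. cut_map n X A act x \<in> topspace X // cut_relation n X A act} = topspace X"
      by (auto simp: cut_map_def quotientI)
    then show ?thesis
      by (simp add: openin_cut_space)
  qed
  then show ?thesis
    by (meson openin_cut_space openin_subset openin_topspace subset_antisym)
qed

lemma quotient_map_cut_map: "quotient_map X (cut_space n X A act) (cut_map n X A act)"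
  unfolding quotient_map_def topspace_cut_space openin_cut_space
  by (auto simp: cut_map_def quotient_def)

definition invariant_boundary_defining_function ::
    "nat \<Rightarrow> 'a topology \<Rightarrow> 'a chart set \<Rightarrow> 'a set \<Rightarrow> (complex \<Rightarrow> 'a \<Rightarrow> 'a) \<Rightarrow> ('a \<Rightarrow> real) \<Rightarrow> bool" where
  "invariant_boundary_defining_function n X A UM act f \<longleftrightarrow>
     smooth_fun n A (topspace X) f \<and>
     (\<forall>x\<in>topspace X. 0 \<le> f x) \<and>
     {x \<in> topspace X. f x = 0} = boundary_of_manifold n X A \<and>
     (\<forall>x\<in>boundary_of_manifold n X A. differential_nonzero_at n A f x) \<and>
     (\<exists>W. openin X W \<and> boundary_of_manifold n X A \<subseteq> W \<and> W \<subseteq> UM \<and> circle_invariant act W \<and>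
          (\<forall>a\<in>unit_circle. \<forall>x\<in>W. f (act a x) = f x))"

text \<open>
  Functions on the cut space are represented by total functions on \<^typ>\<open>'a set\<close>; both sets below
  depend only on the values at points of the cut space.
\<close>

definition cut_functions ::
    "nat \<Rightarrow> 'a topology \<Rightarrow> 'a chart set \<Rightarrow> 'a set \<Rightarrow> (complex \<Rightarrow> 'a \<Rightarrow> 'a) \<Rightarrow> ('a \<Rightarrow> real) \<Rightarrow>
     ('a set \<Rightarrow> real) set" where
  "cut_functions n X A UM act f =
     {h. smooth_fun n A (interior_of_manifold n X A) (h \<circ> cut_map n X A act) \<and>
         (\<exists>V H. openin X V \<and> boundary_of_manifold n X A \<subseteq> V \<and> V \<subseteq> UM \<and> circle_invariant act V \<and>
            smooth_fun (n + 2) (product_atlas n A complex_atlas) (V \<times> UNIV) H \<and>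
            (\<forall>a\<in>unit_circle. \<forall>x\<in>V. \<forall>z. H (act a x, z) = H (x, a * z)) \<and>
            (\<forall>x\<in>V. (h \<circ> cut_map n X A act) x = H (x, complex_of_real (sqrt (f x)))))}"

definition smooth_functions :: "nat \<Rightarrow> 'a topology \<Rightarrow> 'a chart set \<Rightarrow> ('a \<Rightarrow> real) set" where
  "smooth_functions n X A = {h. smooth_fun n A (topspace X) h}"

end

theory Submission
  imports Defs "HOL-Homology.Invariance_of_Domain" "HOL-Computational_Algebra.Polynomial"
begin

text \<open>
  The set \<open>\<F>\<close> of functions on the cut space is local and closed under composition with smooth
  functions of several variables.  Call a chart of the cut space admissible if \<open>\<F>\<close> pulls back to
  smooth functions and the coordinates locally belong to \<open>\<F>\<close>.  Admissible charts are compatible with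
  each other, and any manifold structure whose smooth functions are \<open>\<F>\<close> has only admissible charts
  (multiply coordinates by bump functions), of the same dimension by invariance of domain.  So if
  admissible charts cover, they form the unique structure.

  Interior charts of \<open>M\<close> are admissible.  Near a boundary orbit, a local slice for the free action
  gives an equivariant phase \<open>\<alpha>\<close> and invariant coordinates \<open>s\<close>; the map \<open>x \<mapsto> (\<surd>f \<cdot> \<alpha>, s)\<close> descends to
  an admissible chart, because the function \<open>H\<close> in the definition of \<open>\<F>\<close> satisfies
  \<open>H (a \<cdot> s, |w|) = H (s, a |w|) = H (s, w)\<close> for \<open>w = |w| a\<close>.
\<close>

section \<open>Calculus on Euclidean spaces of variable dimension\<close>

text \<open>The square root of \<open>f\<close> is not smooth at the boundary, so on
  \<open>M\<close> the boundary coordinates are merely continuous there; this is why the condition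
  on members speaks of a function \<open>H\<close> that is smooth in an additional complex variable.
  Members are functions on the whole cut space, whereas coordinates and extensions \<open>H\<close>
  live on small sets. Hence the recurring pattern of multiplying by a cutoff with compact support,
  whose complement is open because the spaces are Hausdorff; near the boundary the cutoff must in
  addition be invariant, and it is therefore built from \<open>f\<close> and the invariant
  coordinates. Membership also asks for a single \<open>H\<close> on a neighbourhood of the whole
  boundary, so locality of the function space is a gluing problem, solved by an invariant partition
  of unity. Smoothness itself is phrased by iterated partial derivatives of functions on
  \<open>nat \<Rightarrow> real\<close>, with dimension 0 included; the chain rule and the inverse
  of a coordinate change are obtained from the mean value theorem, one coordinate at a time.\<close>

abbreviation eucl :: "nat \<Rightarrow> (nat \<Rightarrow> real) set" where
  "eucl n \<equiv> topspace (Euclidean_space n)"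

lemma in_eucl: "x \<in> eucl n \<longleftrightarrow> (\<forall>i\<ge>n. x i = 0)"
  by (simp add: topspace_Euclidean_space)

lemma eucl_upd: "x \<in> eucl n \<Longrightarrow> i < n \<Longrightarrow> x(i := t) \<in> eucl n"
  by (auto simp: in_eucl)

text \<open>The product topology on \<open>nat \<Rightarrow> real\<close> is the type-class
  topology, which makes \<open>continuous_on\<close> and its library applicable.\<close>

lemma Euclidean_space_eq: "Euclidean_space n = top_of_set {x. \<forall>i\<ge>n. x i = 0}"
  by (simp add: Euclidean_space_def euclidean_product_topology)

lemma openin_eucl_iff: "openin (Euclidean_space n) W \<longleftrightarrow> (\<exists>T. open T \<and> W = eucl n \<inter> T)"
  by (simp add: Euclidean_space_eq openin_open)

lemma openin_eucl_trans:
  "openin (Euclidean_space n) W \<Longrightarrow> openin (top_of_set W) V \<Longrightarrow> openin (Euclidean_space n) V"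
  unfolding Euclidean_space_eq by (rule openin_trans)

lemma openin_eucl_subset: "openin (Euclidean_space n) W \<Longrightarrow> W \<subseteq> eucl n"
  by (rule openin_subset)

lemma continuous_map_eucl:
  "S \<subseteq> eucl n \<Longrightarrow>
   continuous_map (subtopology (Euclidean_space n) S) euclideanreal f \<longleftrightarrow> continuous_on S f"
  by (simp add: Euclidean_space_eq subtopology_subtopology inf_absorb2)

lemma Ck_0: "S \<subseteq> eucl n \<Longrightarrow> Ck_open 0 n S f \<longleftrightarrow> continuous_on S f"
  by (simp add: continuous_map_eucl)

lemma Ck_Suc: "S \<subseteq> eucl n \<Longrightarrow> Ck_open (Suc k) n S f \<longleftrightarrow> continuous_on S f \<and>
     (\<forall>i<n. \<exists>g. (\<forall>x\<in>S. ((\<lambda>t. f (x(i := t))) has_real_derivative g x) (at (x i))) \<and> Ck_open k n S g)"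
  by (simp add: continuous_map_eucl)

lemma Ck_continuous: "S \<subseteq> eucl n \<Longrightarrow> Ck_open k n S f \<Longrightarrow> continuous_on S f"
  by (cases k) (auto simp: continuous_map_eucl)

declare Ck_open.simps [simp del]

lemma Ck_partialE:
  assumes "S \<subseteq> eucl n" "Ck_open (Suc k) n S f" "i < n"
  obtains f' where "\<And>x. x \<in> S \<Longrightarrow> ((\<lambda>t. f (x(i := t))) has_real_derivative f' x) (at (x i))"
    "Ck_open k n S f'"
proof -
  have "\<exists>g. (\<forall>x\<in>S. ((\<lambda>t. f (x(i := t))) has_real_derivative g x) (at (x i))) \<and> Ck_open k n S g"
    using assms(2,3) unfolding Ck_Suc[OF assms(1)] by simp
  then obtain g where "\<forall>x\<in>S. ((\<lambda>t. f (x(i := t))) has_real_derivative g x) (at (x i))" "Ck_open k n S g"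
    by (elim exE conjE)
  then show thesis by (intro that[of g]) simp
qed

lemma Ck_SucI:
  assumes "S \<subseteq> eucl n" "continuous_on S f"
    "\<And>i. i < n \<Longrightarrow> \<exists>g. (\<forall>x\<in>S. ((\<lambda>t. f (x(i := t))) has_real_derivative g x) (at (x i))) \<and> Ck_open k n S g"
  shows "Ck_open (Suc k) n S f"
  unfolding Ck_Suc[OF assms(1)] using assms(2,3) by simp

text \<open>Balls of the maximum norm on the first \<open>n\<close> coordinates. Membership is
  tested coordinatewise, so a point stays in the cube while a single coordinate moves within its
  range; this suits one-variable mean value arguments.\<close>

definition cube :: "nat \<Rightarrow> (nat \<Rightarrow> real) \<Rightarrow> real \<Rightarrow> (nat \<Rightarrow> real) set" where
  "cube n p r = {x \<in> eucl n. \<forall>i<n. \<bar>x i - p i\<bar> < r}"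

lemma openin_cube: "openin (Euclidean_space n) (cube n p r)"
proof -
  have eq: "cube n p r = eucl n \<inter> (\<Inter>i\<in>{..<n}. {x. \<bar>x i - p i\<bar> < r})"
    by (auto simp: cube_def)
  have "open (\<Inter>i\<in>{..<n}. {x :: nat \<Rightarrow> real. \<bar>x i - p i\<bar> < r})"
    by (intro open_INT ballI open_Collect_less continuous_intros continuous_on_product_coordinates) auto
  then show ?thesis
    unfolding eq openin_eucl_iff by blast
qed

lemma cube_mono: "r \<le> s \<Longrightarrow> cube n p r \<subseteq> cube n p s"
  by (force simp: cube_def)

lemma cube_center: "p \<in> eucl n \<Longrightarrow> 0 < r \<Longrightarrow> p \<in> cube n p r"
  by (simp add: cube_def)

lemma cube_upd: "x \<in> cube n p r \<Longrightarrow> i < n \<Longrightarrow> x(i := t) \<in> cube n p r \<longleftrightarrow> \<bar>t - p i\<bar> < r"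
  by (auto simp: cube_def eucl_upd)

lemma openin_contains_cube:
  assumes "openin (Euclidean_space n) W" "p \<in> W"
  obtains r where "r > 0" "cube n p r \<subseteq> W"
proof -
  obtain T where T: "openin (powertop_real UNIV) T" "W = T \<inter> {x. \<forall>i\<ge>n. x i = 0}"
    using assms(1) by (auto simp: Euclidean_space_def openin_subtopology)
  from assms T have "p \<in> T" by auto
  from product_topology_open_contains_basis[OF T(1) this] obtain X where
    X: "p \<in> (\<Pi>\<^sub>E i\<in>UNIV. X i)" "\<And>i. openin euclideanreal (X i)" "(\<Pi>\<^sub>E i\<in>UNIV. X i) \<subseteq> T"
    by auto
  have "\<exists>e>0. \<forall>t. \<bar>t - p i\<bar> < e \<longrightarrow> t \<in> X i" for i
  proof -
    have "p i \<in> X i" "open (X i)" using X by auto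
    then show ?thesis by (auto simp: open_dist dist_real_def)
  qed
  then obtain e where e: "\<And>i. e i > 0" "\<And>i t. \<bar>t - p i\<bar> < e i \<Longrightarrow> t \<in> X i" by metis
  \<comment> \<open>The extra 1 keeps the minimum defined when \<open>n = 0\<close>.\<close>
  define r where "r = Min (insert 1 (e ` {..<n}))"
  have r: "r > 0" using e(1) by (auto simp: r_def)
  have rle: "r \<le> e i" if "i < n" for i
    unfolding r_def using that by (intro Min_le) auto
  have "cube n p r \<subseteq> W"
  proof
    fix x assume x: "x \<in> cube n p r"
    have "x i \<in> X i" for i
    proof (cases "i < n")
      case True then show ?thesis using x rle[OF True] by (intro e(2)) (auto simp: cube_def)
    next
      case False
      then have "x i = p i" using x assms T by (auto simp: cube_def in_eucl)
      then show ?thesis using X(1) by auto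
    qed
    then show "x \<in> W" using X x T by (auto simp: cube_def in_eucl)
  qed
  with r that show thesis by blast
qed

lemma openin_eucl_line:
  assumes "openin (Euclidean_space n) W" "x \<in> W" "i < n"
  obtains e where "e > 0" "\<And>t. \<bar>t - x i\<bar> < e \<Longrightarrow> x(i := t) \<in> W"
proof -
  obtain r where r: "r > 0" "cube n x r \<subseteq> W" using openin_contains_cube assms by metis
  have "x \<in> eucl n" using assms openin_eucl_subset by blast
  then have "x(i := t) \<in> W" if "\<bar>t - x i\<bar> < r" for t
    using r that assms(3) cube_center[of x n r] cube_upd[of x n x r i t] by blast
  with r that show thesis by blast
qed

lemma eventually_line:
  assumes "openin (Euclidean_space n) W" "x \<in> W" "i < n"
  shows "\<forall>\<^sub>F t in nhds (x i). x(i := t) \<in> W"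
proof -
  obtain e where "e > 0" "\<And>t. \<bar>t - x i\<bar> < e \<Longrightarrow> x(i := t) \<in> W"
    using openin_eucl_line assms by metis
  then show ?thesis by (auto simp: eventually_nhds_metric dist_real_def)
qed

lemma continuous_on_cube:
  assumes "openin (Euclidean_space n) W" "continuous_on W f" "p \<in> W" "(e::real) > 0"
  obtains r where "r > 0" "cube n p r \<subseteq> W" "\<And>x. x \<in> cube n p r \<Longrightarrow> \<bar>f x - f p\<bar> < e"
proof -
  have "openin (top_of_set W) {x \<in> W. f x \<in> {t. \<bar>t - f p\<bar> < e}}"
  proof -
    have "openin (top_of_set W) (W \<inter> f -` {t. \<bar>t - f p\<bar> < e})"
      using assms(2) by (intro continuous_openin_preimage_gen open_Collect_less continuous_intros)
    moreover have "W \<inter> f -` {t. \<bar>t - f p\<bar> < e} = {x \<in> W. f x \<in> {t. \<bar>t - f p\<bar> < e}}" by auto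
    ultimately show ?thesis by simp
  qed
  then have "openin (Euclidean_space n) {x \<in> W. \<bar>f x - f p\<bar> < e}"
    using assms(1) by (auto intro: openin_eucl_trans)
  then obtain r where "r > 0" "cube n p r \<subseteq> {x \<in> W. \<bar>f x - f p\<bar> < e}"
    using assms openin_contains_cube[of n "{x \<in> W. \<bar>f x - f p\<bar> < e}" p] by auto
  with that show thesis by blast
qed

lemma openin_eucl_less:
  assumes "openin (Euclidean_space n) W" "continuous_on W f" "continuous_on W g"
  shows "openin (Euclidean_space n) {x \<in> W. f x < (g x :: real)}"
proof -
  have "openin (top_of_set W) (W \<inter> (\<lambda>x. g x - f x) -` {0<..})"
    using assms by (intro continuous_openin_preimage_gen continuous_intros) auto
  moreover have "W \<inter> (\<lambda>x. g x - f x) -` {0<..} = {x \<in> W. f x < g x}" by auto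
  ultimately show ?thesis using assms(1) by (auto intro: openin_eucl_trans)
qed

lemma openin_eucl_vimage:
  assumes "openin (Euclidean_space n) W" "\<And>j. j < m \<Longrightarrow> continuous_on W (\<lambda>x. F x j)"
    "F ` W \<subseteq> eucl m" "openin (Euclidean_space m) W'"
  shows "openin (Euclidean_space n) {x \<in> W. F x \<in> W'}"
proof -
  have "continuous_on W (\<lambda>x. F x j)" for j
  proof (cases "j < m")
    case False
    then have "\<forall>x\<in>W. F x j = 0" using assms(3) by (auto simp: in_eucl)
    then show ?thesis by (metis (no_types, lifting) continuous_on_cong continuous_on_const)
  qed (use assms in auto)
  then have c: "continuous_on W F" by (rule continuous_on_coordinatewise_then_product)
  obtain T where T: "open T" "W' = eucl m \<inter> T"
    using assms(4) by (auto simp: openin_eucl_iff)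
  have "openin (top_of_set W) (W \<inter> F -` T)"
    using c T by (intro continuous_openin_preimage_gen)
  moreover have "W \<inter> F -` T = {x \<in> W. F x \<in> W'}" using T assms(3) by auto
  ultimately show ?thesis using assms(1) by (auto intro: openin_eucl_trans)
qed

section \<open>Functions of class \<open>C^k\<close>: closure properties and chain rule\<close>

lemma Ck_cong:
  assumes "openin (Euclidean_space n) W" "\<And>x. x \<in> W \<Longrightarrow> f x = g x" "Ck_open k n W f"
  shows "Ck_open k n W g"
proof -
  have W: "W \<subseteq> eucl n" using assms openin_eucl_subset by blast
  show ?thesis
  proof (cases k)
    case 0
    then show ?thesis using assms continuous_on_cong[of W W f g] by (simp add: Ck_0[OF W])
  next
    case (Suc l)
    \<comment> \<open>\<open>W\<close> is open, so difference quotients at a point of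
      \<open>W\<close> see only values where \<open>f\<close> and \<open>g\<close> agree.\<close>
    have d: "((\<lambda>t. g (x(i := t))) has_real_derivative D) (at (x i))"
      if "((\<lambda>t. f (x(i := t))) has_real_derivative D) (at (x i))" "x \<in> W" "i < n" for x i D
    proof -
      have "\<forall>\<^sub>F t in nhds (x i). f (x(i := t)) = g (x(i := t))"
        using eventually_line[OF assms(1) that(2,3)] assms(2) by (auto elim: eventually_mono)
      from DERIV_cong_ev[OF refl this refl] show ?thesis using that(1) by blast
    qed
    have "continuous_on W g"
      using continuous_on_cong[of W W f g] Ck_continuous[OF W assms(3)] assms(2) by simp
    moreover have "\<exists>h. (\<forall>x\<in>W. ((\<lambda>t. g (x(i := t))) has_real_derivative h x) (at (x i))) \<and> Ck_open l n W h"
      if i: "i < n" for i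
    proof -
      obtain h where "\<And>x. x \<in> W \<Longrightarrow> ((\<lambda>t. f (x(i := t))) has_real_derivative h x) (at (x i))" "Ck_open l n W h"
        using Ck_partialE[OF W assms(3)[unfolded Suc] i] by metis
      then show ?thesis using d[OF _ _ i] by (intro exI[of _ h]) simp
    qed
    ultimately show ?thesis unfolding Suc Ck_Suc[OF W] by simp
  qed
qed

lemma Ck_subset:
  assumes "W' \<subseteq> W" "W \<subseteq> eucl n" "Ck_open k n W f"
  shows "Ck_open k n W' f"
  using assms(3)
proof (induction k arbitrary: f)
  case 0
  then show ?case using assms by (meson Ck_0 continuous_on_subset order_trans)
next
  case (Suc k)
  have W': "W' \<subseteq> eucl n" using assms by auto
  show ?case using Suc assms unfolding Ck_Suc[OF W'] Ck_Suc[OF assms(2)]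
    by (meson continuous_on_subset subsetD)
qed

lemma Ck_SucD:
  assumes "W \<subseteq> eucl n" "Ck_open (Suc k) n W f"
  shows "Ck_open k n W f"
  using assms(2)
proof (induction k arbitrary: f)
  case 0
  then show ?case using assms Ck_0 Ck_continuous by blast
next
  case (Suc k)
  have "continuous_on W f" using Suc.prems assms(1) Ck_Suc by blast
  moreover have "\<exists>g. (\<forall>x\<in>W. ((\<lambda>t. f (x(i := t))) has_real_derivative g x) (at (x i))) \<and> Ck_open k n W g"
    if "i < n" for i
    using Suc.prems Suc.IH that unfolding Ck_Suc[OF assms(1), of "Suc k"] by meson
  ultimately show ?case unfolding Ck_Suc[OF assms(1)] by blast
qed

lemma Ck_const: "W \<subseteq> eucl n \<Longrightarrow> Ck_open k n W (\<lambda>x. c)"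
proof (induction k arbitrary: c)
  case 0
  then show ?case by (simp add: Ck_0)
next
  case (Suc k)
  show ?case unfolding Ck_Suc[OF Suc.prems]
    using Suc.IH[OF Suc.prems, of 0] by (intro conjI allI impI exI[of _ "\<lambda>x. 0"]) auto
qed

lemma Ck_coord: "W \<subseteq> eucl n \<Longrightarrow> Ck_open k n W (\<lambda>x. x j)"
proof (induction k)
  case 0
  then show ?case
    by (simp add: Ck_0 continuous_on_subset[OF continuous_on_product_coordinates])
next
  case (Suc k)
  have *: "((\<lambda>t. (x(i := t)) j) has_real_derivative (if i = j then 1 else 0)) (at (x i))" for x :: "nat \<Rightarrow> real" and i
    by (cases "i = j") (auto simp del: fun_upd_apply simp: fun_upd_same fun_upd_other)
  then show ?case unfolding Ck_Suc[OF Suc.prems]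
  proof (intro conjI allI impI)
    show "continuous_on W (\<lambda>x. x j)"
      by (rule continuous_on_subset[OF continuous_on_product_coordinates]) simp
    fix i
    show "\<exists>g. (\<forall>x\<in>W. ((\<lambda>t. (x(i := t)) j) has_real_derivative g x) (at (x i))) \<and> Ck_open k n W g"
      by (intro exI[of _ "\<lambda>x. if i = j then 1 else 0"] conjI ballI * Ck_const Suc.prems)
  qed
qed

lemma Ck_add:
  assumes "W \<subseteq> eucl n" "Ck_open k n W f" "Ck_open k n W g"
  shows "Ck_open k n W (\<lambda>x. f x + g x)"
  using assms(2,3)
proof (induction k arbitrary: f g)
  case 0
  then show ?case using assms(1) by (auto simp: Ck_0 intro: continuous_intros)
next
  case (Suc k)
  show ?case unfolding Ck_Suc[OF assms(1)]
  proof (intro conjI allI impI)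
    show "continuous_on W (\<lambda>x. f x + g x)"
      using Suc.prems[THEN Ck_continuous[OF assms(1)]] by (intro continuous_intros)
    fix i assume "i < n"
    then obtain f' g' where
      fg: "\<And>x. x \<in> W \<Longrightarrow> ((\<lambda>t. f (x(i := t))) has_real_derivative f' x) (at (x i))" "Ck_open k n W f'"
      "\<And>x. x \<in> W \<Longrightarrow> ((\<lambda>t. g (x(i := t))) has_real_derivative g' x) (at (x i))" "Ck_open k n W g'"
      using Ck_partialE[OF assms(1) Suc.prems(1)] Ck_partialE[OF assms(1) Suc.prems(2)] by metis
    show "\<exists>h. (\<forall>x\<in>W. ((\<lambda>t. f (x(i := t)) + g (x(i := t))) has_real_derivative h x) (at (x i))) \<and> Ck_open k n W h"
      by (rule exI[of _ "\<lambda>x. f' x + g' x"], rule conjI, rule ballI)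
        (rule DERIV_add[OF fg(1) fg(3)], assumption+, rule Suc.IH[OF fg(2,4)])
  qed
qed

lemma Ck_mult:
  assumes "W \<subseteq> eucl n" "Ck_open k n W f" "Ck_open k n W g"
  shows "Ck_open k n W (\<lambda>x. f x * g x)"
  using assms(2,3)
proof (induction k arbitrary: f g)
  case 0
  then show ?case using assms(1) by (auto simp: Ck_0 intro: continuous_intros)
next
  case (Suc k)
  show ?case unfolding Ck_Suc[OF assms(1)]
  proof (intro conjI allI impI)
    show "continuous_on W (\<lambda>x. f x * g x)"
      using Suc.prems[THEN Ck_continuous[OF assms(1)]] by (intro continuous_intros)
    fix i assume "i < n"
    then obtain f' g' where
      fg: "\<And>x. x \<in> W \<Longrightarrow> ((\<lambda>t. f (x(i := t))) has_real_derivative f' x) (at (x i))" "Ck_open k n W f'"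
      "\<And>x. x \<in> W \<Longrightarrow> ((\<lambda>t. g (x(i := t))) has_real_derivative g' x) (at (x i))" "Ck_open k n W g'"
      using Ck_partialE[OF assms(1) Suc.prems(1)] Ck_partialE[OF assms(1) Suc.prems(2)] by metis
    have *: "((\<lambda>t. f (x(i := t)) * g (x(i := t))) has_real_derivative f' x * g x + g' x * f x) (at (x i))"
      if "x \<in> W" for x
      using DERIV_mult[OF fg(1)[OF that] fg(3)[OF that]] by simp
    show "\<exists>h. (\<forall>x\<in>W. ((\<lambda>t. f (x(i := t)) * g (x(i := t))) has_real_derivative h x) (at (x i))) \<and> Ck_open k n W h"
      by (rule exI[of _ "\<lambda>x. f' x * g x + g' x * f x"], rule conjI, rule ballI, erule *,
          rule Ck_add[OF assms(1) Suc.IH[OF fg(2) Ck_SucD[OF assms(1) Suc.prems(2)]]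
          Suc.IH[OF fg(4) Ck_SucD[OF assms(1) Suc.prems(1)]]])
  qed
qed

lemma Ck_sum:
  assumes "W \<subseteq> eucl n" "\<And>j. j \<in> J \<Longrightarrow> Ck_open k n W (f j)"
  shows "Ck_open k n W (\<lambda>x. \<Sum>j\<in>J. f j x)"
  using assms(2) by (induction J rule: infinite_finite_induct) (use assms(1) in \<open>auto intro: Ck_const Ck_add\<close>)

text \<open>The chain rule for an outer function of one variable. \<open>P\<close> is any family
  closed under differentiation on \<open>D\<close>, so for a concrete function it suffices to name
  such a family: combinations of sine and cosine, multiples of powers, polynomials in
  \<open>1/t\<close> times an exponential.\<close>

lemma Ck_fun1:
  assumes W: "W \<subseteq> eucl n" and f: "Ck_open k n W f" "f ` W \<subseteq> D" and "P \<phi>"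
    and P: "\<And>\<phi>. P \<phi> \<Longrightarrow> \<exists>\<phi>'. P \<phi>' \<and> (\<forall>t\<in>D. (\<phi> has_real_derivative \<phi>' t) (at t))"
  shows "Ck_open k n W (\<lambda>x. \<phi> (f x))"
  using f(1) \<open>P \<phi>\<close>
proof (induction k arbitrary: \<phi>)
  have cont: "continuous_on W (\<lambda>x. \<phi> (f x))" if "continuous_on W f" "P \<phi>" for \<phi>
  proof -
    have "continuous_on D \<phi>" using P[OF that(2)]
      by (meson DERIV_continuous_on has_field_derivative_at_within)
    then show ?thesis using continuous_on_compose2[OF _ that(1) f(2)] by simp
  qed
  {
    case 0
    then show ?case using cont W by (simp add: Ck_0)
  next
    case (Suc k)
    obtain \<phi>' where \<phi>': "P \<phi>'" "\<And>t. t \<in> D \<Longrightarrow> (\<phi> has_real_derivative \<phi>' t) (at t)"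
      using P Suc.prems by meson
    have fk: "Ck_open k n W f" using Ck_SucD W Suc.prems by blast
    show ?case unfolding Ck_Suc[OF W]
    proof (intro conjI allI impI)
      show "continuous_on W (\<lambda>x. \<phi> (f x))" using cont Suc.prems Ck_continuous[OF W] by blast
      fix i assume "i < n"
      then obtain f' where
        f': "\<And>x. x \<in> W \<Longrightarrow> ((\<lambda>t. f (x(i := t))) has_real_derivative f' x) (at (x i))" "Ck_open k n W f'"
        using Ck_partialE[OF W Suc.prems(1)] by metis
      have "((\<lambda>t. \<phi> (f (x(i := t)))) has_real_derivative \<phi>' (f x) * f' x) (at (x i))" if "x \<in> W" for x
      proof (rule DERIV_chain2[where g = "\<lambda>t. f (x(i := t))"])
        show "(\<phi> has_real_derivative \<phi>' (f x)) (at (f (x(i := x i))))" using \<phi>'(2) f(2) that by auto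
        show "((\<lambda>t. f (x(i := t))) has_real_derivative f' x) (at (x i))" using f'(1) that .
      qed
      then show "\<exists>h. (\<forall>x\<in>W. ((\<lambda>t. \<phi> (f (x(i := t)))) has_real_derivative h x) (at (x i))) \<and> Ck_open k n W h"
        using f' fk \<phi>' Suc.IH by (intro exI[of _ "\<lambda>x. \<phi>' (f x) * f' x"] conjI ballI Ck_mult[OF W]) auto
    qed
  }
qed

text \<open>Continuous partial derivatives suffice, and \<open>c\<close> need only be differentiable
  at \<open>t0\<close>: the passage from \<open>c t0\<close> to \<open>c t\<close> changes one
  coordinate at a time, and each change is expressed by the mean value theorem.\<close>

lemma partials_chain_rule:
  assumes W: "openin (Euclidean_space m) W"
    and cont: "\<And>j. j < m \<Longrightarrow> continuous_on W (g' j)"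
    and der: "\<And>j x. j < m \<Longrightarrow> x \<in> W \<Longrightarrow> ((\<lambda>t. g (x(j := t))) has_real_derivative g' j x) (at (x j))"
    and c: "c t0 \<in> W" "\<forall>\<^sub>F t in nhds t0. c t \<in> eucl m"
    and d: "\<And>j. j < m \<Longrightarrow> ((\<lambda>t. c t j) has_real_derivative d j) (at t0)"
  shows "((\<lambda>t. g (c t)) has_real_derivative (\<Sum>j<m. g' j (c t0) * d j)) (at t0)"
proof -
  define p where "p = c t0"
  have p: "p \<in> W" "p \<in> eucl m" using c(1) openin_eucl_subset[OF W] by (auto simp: p_def)
  \<comment> \<open>Staircase path: the first \<open>j\<close> coordinates are already those of
    \<open>c t\<close>, the others still those of \<open>p\<close>. The induction on
    \<open>j\<close> adds one partial derivative per step.\<close>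
  define q where "q j t = (\<lambda>i. if i < j then c t i else p i)" for j t
  have near: "\<forall>\<^sub>F t in nhds t0. \<forall>j\<in>{..<m}. \<bar>c t j - p j\<bar> < r" if "r > 0" for r
  proof (intro eventually_ball_finite ballI)
    fix j assume "j \<in> {..<m}"
    then have "isCont (\<lambda>t. c t j) t0" using d DERIV_isCont by blast
    then have "((\<lambda>t. c t j) \<longlongrightarrow> c t0 j) (nhds t0)" using tendsto_at_iff_tendsto_nhds[of "\<lambda>t. c t j" t0] by (simp add: isCont_def)
    from tendstoD[OF this that] show "\<forall>\<^sub>F t in nhds t0. \<bar>c t j - p j\<bar> < r"
      by (simp add: p_def dist_real_def)
  qed auto
  have "((\<lambda>t. g (q j t)) has_real_derivative (\<Sum>l<j. g' l p * d l)) (at t0)" if "j \<le> m" for j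
    using that
  proof (induction j)
    case 0
    then show ?case by (simp add: q_def)
  next
    case (Suc j)
    then have j: "j < m" by auto
    define D where "D t = g (q (Suc j) t) - g (q j t)" for t
    have qS: "q (Suc j) t = (q j t)(j := c t j)" for t by (auto simp: q_def fun_eq_iff less_Suc_eq)
    have qj: "q j t j = p j" for t by (simp add: q_def)
    have qt0: "q j t0 = p" for j by (auto simp: q_def p_def)
    have "((\<lambda>t. (D t - D t0) / (t - t0)) \<longlongrightarrow> g' j p * d j) (at t0)"
    proof -
      obtain r0 where r0: "r0 > 0" "cube m p r0 \<subseteq> W" using openin_contains_cube W p by metis
      have mvt: "\<exists>z. q j t \<in> eucl m \<and> \<bar>z - p j\<bar> \<le> \<bar>c t j - p j\<bar> \<and> D t = g' j ((q j t)(j := z)) * (c t j - p j)"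
        if t: "\<forall>l\<in>{..<m}. \<bar>c t l - p l\<bar> < r0" for t
      proof -
        have qe: "q j t \<in> eucl m" using p j by (auto simp: q_def in_eucl)
        have qc: "(q j t)(j := z) \<in> cube m p r0" if "\<bar>z - p j\<bar> \<le> \<bar>c t j - p j\<bar>" for z
        proof -
          have "\<bar>c t j - p j\<bar> < r0" using t j by simp
          then have "\<bar>z - p j\<bar> < r0" using that by linarith
          then show ?thesis using t j qe r0 by (auto simp: cube_def eucl_upd) (auto simp: q_def)
        qed
        have dz: "((\<lambda>s. g ((q j t)(j := s))) has_real_derivative g' j ((q j t)(j := z))) (at z)"
          if "\<bar>z - p j\<bar> \<le> \<bar>c t j - p j\<bar>" for z
          using der[OF j, of "(q j t)(j := z)"] qc[OF that] r0 by auto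
        have D: "D t = g ((q j t)(j := c t j)) - g ((q j t)(j := p j))"
          using qj[of t] by (simp add: D_def qS fun_upd_idem)
        consider "c t j = p j" | "p j < c t j" | "c t j < p j" by linarith
        then show ?thesis
        proof cases
          case 1 then show ?thesis using D qe by (intro exI[of _ "p j"]) auto
        next
          case 2
          have "\<exists>z>p j. z < c t j \<and> g ((q j t)(j := c t j)) - g ((q j t)(j := p j)) = (c t j - p j) * g' j ((q j t)(j := z))"
            by (rule MVT2[OF 2], rule dz) simp
          then obtain z where "z > p j" "z < c t j" "g ((q j t)(j := c t j)) - g ((q j t)(j := p j)) = (c t j - p j) * g' j ((q j t)(j := z))"
            by blast
          then show ?thesis using D qe by (intro exI[of _ z]) (auto simp: mult.commute)
        next
          case 3
          have "\<exists>z>c t j. z < p j \<and> g ((q j t)(j := p j)) - g ((q j t)(j := c t j)) = (p j - c t j) * g' j ((q j t)(j := z))"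
            by (rule MVT2[OF 3], rule dz) simp
          then obtain z where z: "z > c t j" "z < p j"
            "g ((q j t)(j := p j)) - g ((q j t)(j := c t j)) = (p j - c t j) * g' j ((q j t)(j := z))" by blast
          then have "D t = g' j ((q j t)(j := z)) * (c t j - p j)" using D by (simp add: algebra_simps)
          then show ?thesis using z qe by (intro exI[of _ z]) auto
        qed
      qed
      \<comment> \<open>The intermediate point has no canonical choice; what matters is that its
        distance from \<open>p j\<close> is at most that of \<open>c t j\<close>, so it tends to
        \<open>p j\<close>.\<close>
      define z where "z t = (SOME z. q j t \<in> eucl m \<and> \<bar>z - p j\<bar> \<le> \<bar>c t j - p j\<bar> \<and> D t = g' j ((q j t)(j := z)) * (c t j - p j))" for t
      have z: "q j t \<in> eucl m" "\<bar>z t - p j\<bar> \<le> \<bar>c t j - p j\<bar>" "D t = g' j ((q j t)(j := z t)) * (c t j - p j)"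
        if "\<forall>l\<in>{..<m}. \<bar>c t l - p l\<bar> < r0" for t
        using someI_ex[OF mvt[OF that]] by (auto simp: z_def)
      have "((\<lambda>t. g' j ((q j t)(j := z t))) \<longlongrightarrow> g' j p) (at t0)"
      proof (rule tendstoI)
        fix e :: real assume "e > 0"
        obtain r where r: "r > 0" "cube m p r \<subseteq> W" "\<And>x. x \<in> cube m p r \<Longrightarrow> \<bar>g' j x - g' j p\<bar> < e"
          using continuous_on_cube[OF W cont[OF j] p(1) \<open>e > 0\<close>] by metis
        have "\<forall>\<^sub>F t in nhds t0. dist (g' j ((q j t)(j := z t))) (g' j p) < e"
          using near[OF r(1)] near[OF r0(1)]
        proof eventually_elim
          case (elim t)
          have "\<bar>c t j - p j\<bar> < r" using elim(1) j by simp
          then have "\<bar>z t - p j\<bar> < r" using z(2)[OF elim(2)] by linarith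
          then have "(q j t)(j := z t) \<in> cube m p r"
            using elim z[OF elim(2)] j r(1) by (auto simp: cube_def eucl_upd) (auto simp: q_def)
          then show ?case using r(3) by (simp add: dist_real_def)
        qed
        then show "\<forall>\<^sub>F t in at t0. dist (g' j ((q j t)(j := z t))) (g' j p) < e"
          by (simp add: eventually_at_filter eventually_mono)
      qed
      moreover have "((\<lambda>t. (c t j - p j) / (t - t0)) \<longlongrightarrow> d j) (at t0)"
        using d[OF j] by (simp add: has_field_derivative_iff p_def)
      ultimately have "((\<lambda>t. g' j ((q j t)(j := z t)) * ((c t j - p j) / (t - t0))) \<longlongrightarrow> g' j p * d j) (at t0)"
        by (intro tendsto_mult)
      moreover have "\<forall>\<^sub>F t in at t0. g' j ((q j t)(j := z t)) * ((c t j - p j) / (t - t0)) = (D t - D t0) / (t - t0)"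
      proof -
        have "D t0 = 0" by (simp add: D_def qt0)
        have "\<forall>\<^sub>F t in nhds t0. g' j ((q j t)(j := z t)) * ((c t j - p j) / (t - t0)) = (D t - D t0) / (t - t0)"
          using near[OF r0(1)]
        proof eventually_elim
          case (elim t)
          show ?case using z(3)[OF elim] \<open>D t0 = 0\<close> by simp
        qed
        then show ?thesis unfolding eventually_at_filter by (rule eventually_mono) blast
      qed
      ultimately show ?thesis by (rule Lim_transform_eventually)
    qed
    then have "(D has_real_derivative g' j p * d j) (at t0)" by (simp add: has_field_derivative_iff)
    from DERIV_add[OF Suc.IH this] show ?case using j by (simp add: D_def)
  qed
  from this[of m] have deriv_q: "((\<lambda>t. g (q m t)) has_real_derivative (\<Sum>j<m. g' j p * d j)) (at t0)" by simp
  have "\<forall>\<^sub>F t in nhds t0. g (q m t) = g (c t)"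
    using c(2)
  proof eventually_elim
    case (elim t)
    then have "q m t = c t" using p by (auto simp: q_def in_eucl fun_eq_iff)
    then show ?case by simp
  qed
  from DERIV_cong_ev[OF refl this refl] deriv_q show ?thesis unfolding p_def by blast
qed

text \<open>Induction on the order with \<open>g\<close> generalised: the partial derivatives of the
  composition are sums of products in which the partial derivatives of \<open>g\<close> are again
  composed with \<open>F\<close>.\<close>

lemma Ck_compose:
  assumes W: "openin (Euclidean_space n) W" and W': "openin (Euclidean_space m) W'"
    and FW: "F ` W \<subseteq> W'" and F: "\<And>j. j < m \<Longrightarrow> Ck_open k n W (\<lambda>x. F x j)" and "Ck_open k m W' g"
  shows "Ck_open k n W (\<lambda>x. g (F x))"
  using F assms(5)
proof (induction k arbitrary: g)
  have Ws: "W \<subseteq> eucl n" and W's: "W' \<subseteq> eucl m" using W W' openin_eucl_subset by auto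
  have cont: "continuous_on W (\<lambda>x. g (F x))"
    if "\<And>j. j < m \<Longrightarrow> continuous_on W (\<lambda>x. F x j)" "continuous_on W' g" for g
  proof -
    have "continuous_on W (\<lambda>x. F x j)" for j
    proof (cases "j < m")
      case False
      then have "\<forall>x\<in>W. F x j = 0" using FW W's by (fastforce simp: in_eucl)
      then show ?thesis by (metis (no_types, lifting) continuous_on_cong continuous_on_const)
    qed (use that in auto)
    then have "continuous_on W F" by (rule continuous_on_coordinatewise_then_product)
    then show ?thesis using that(2) FW continuous_on_compose2 by blast
  qed
  {
    case 0
    then show ?case using cont by (auto simp: Ck_0[OF Ws] Ck_0[OF W's])
  next
    case (Suc k)
    have "\<forall>j\<in>{..<m}. \<exists>h. (\<forall>x\<in>W'. ((\<lambda>t. g (x(j := t))) has_real_derivative h x) (at (x j))) \<and> Ck_open k m W' h"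
      using Suc.prems(2) unfolding Ck_Suc[OF W's] by simp
    from bchoice[OF this] obtain g' where
      g': "\<And>j x. j < m \<Longrightarrow> x \<in> W' \<Longrightarrow> ((\<lambda>t. g (x(j := t))) has_real_derivative g' j x) (at (x j))"
        "\<And>j. j < m \<Longrightarrow> Ck_open k m W' (g' j)"
      by auto
    show ?case unfolding Ck_Suc[OF Ws]
    proof (intro conjI allI impI)
      show "continuous_on W (\<lambda>x. g (F x))" 
        by (rule cont[OF Ck_continuous[OF Ws Suc.prems(1)] Ck_continuous[OF W's Suc.prems(2)]])
      fix i assume i: "i < n"
      have "\<forall>j\<in>{..<m}. \<exists>h. (\<forall>x\<in>W. ((\<lambda>t. F (x(i := t)) j) has_real_derivative h x) (at (x i))) \<and> Ck_open k n W h"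
        using Suc.prems(1) i unfolding Ck_Suc[OF Ws] by simp
      from bchoice[OF this] obtain F' where
        F': "\<And>j x. j < m \<Longrightarrow> x \<in> W \<Longrightarrow> ((\<lambda>t. F (x(i := t)) j) has_real_derivative F' j x) (at (x i))"
          "\<And>j. j < m \<Longrightarrow> Ck_open k n W (F' j)"
        by auto
      have "((\<lambda>t. g (F (x(i := t)))) has_real_derivative (\<Sum>j<m. g' j (F x) * F' j x)) (at (x i))"
        if x: "x \<in> W" for x
      proof -
        have "\<forall>\<^sub>F t in nhds (x i). F (x(i := t)) \<in> eucl m"
          using eventually_line[OF W x i] by eventually_elim (use FW W's in blast)
        then have "((\<lambda>t. g (F (x(i := t)))) has_real_derivative
            (\<Sum>j<m. g' j (F (x(i := x i))) * F' j x)) (at (x i))"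
        proof (intro partials_chain_rule[OF W' Ck_continuous[OF W's g'(2)] g'(1), where c = "\<lambda>t. F (x(i := t))"])
          show "((\<lambda>t. F (x(i := t)) j) has_real_derivative F' j x) (at (x i))" if "j < m" for j
            using F'(1) that x .
          show "F (x(i := x i)) \<in> W'" using FW x by auto
        qed
        then show ?thesis by simp
      qed
      moreover have "Ck_open k n W (\<lambda>x. \<Sum>j<m. g' j (F x) * F' j x)"
      proof (rule Ck_sum[OF Ws])
        fix j assume "j \<in> {..<m}"
        then have "Ck_open k n W (\<lambda>x. g' j (F x))" "Ck_open k n W (F' j)"
          using Suc.IH[of "g' j"] F'(2) g'(2) Ck_SucD[OF Ws Suc.prems(1)] by auto
        then show "Ck_open k n W (\<lambda>x. g' j (F x) * F' j x)" by (rule Ck_mult[OF Ws])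
      qed
      ultimately show "\<exists>h. (\<forall>x\<in>W. ((\<lambda>t. g (F (x(i := t)))) has_real_derivative h x) (at (x i))) \<and> Ck_open k n W h"
        by (intro exI[of _ "\<lambda>x. \<Sum>j<m. g' j (F x) * F' j x"]) simp
    qed
  }
qed

lemma Ck_local:
  assumes W: "openin (Euclidean_space n) W"
    and loc: "\<And>x. x \<in> W \<Longrightarrow> \<exists>V. openin (Euclidean_space n) V \<and> x \<in> V \<and> V \<subseteq> W \<and> Ck_open k n V f"
  shows "Ck_open k n W f"
  using loc
proof (induction k arbitrary: f)
  have Ws: "W \<subseteq> eucl n" using W by (rule openin_eucl_subset)
  have cont: "continuous_on W f"
    if *: "\<And>x. x \<in> W \<Longrightarrow> \<exists>V. openin (Euclidean_space n) V \<and> x \<in> V \<and> V \<subseteq> W \<and> Ck_open k n V f" for k f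
  proof -
    show ?thesis
      unfolding continuous_on_eq_continuous_within
    proof
      fix x assume x: "x \<in> W"
      obtain V where V: "openin (Euclidean_space n) V" "x \<in> V" "V \<subseteq> W" "Ck_open k n V f"
        using *[OF x] by blast
      obtain T where T: "open T" "V = eucl n \<inter> T" using V(1) by (auto simp: openin_eucl_iff)
      have "at x within W = at x within V"
        using at_within_nhd[of x T W V] T V(2,3) Ws by blast
      moreover have "continuous (at x within V) f"
        using Ck_continuous[OF openin_eucl_subset[OF V(1)] V(4)] V(2) by (simp add: continuous_on_eq_continuous_within)
      ultimately show "continuous (at x within W) f" by simp
    qed
  qed
  {
    case 0
    then show ?case using cont[OF 0] Ws by (simp add: Ck_0)
  next
    case (Suc k)
    show ?case
    proof (rule Ck_SucI[OF Ws])
      show "continuous_on W f" using cont[OF Suc.prems] .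
      fix i assume i: "i < n"
      \<comment> \<open>\<open>deriv\<close> is a candidate defined everywhere at once: by
        uniqueness it coincides with every local witness, so the local derivatives glue.\<close>
      define g where "g x = deriv (\<lambda>t. f (x(i := t))) (x i)" for x
      have loc: "\<exists>V. openin (Euclidean_space n) V \<and> x \<in> V \<and> V \<subseteq> W \<and> Ck_open k n V g
          \<and> ((\<lambda>t. f (x(i := t))) has_real_derivative g x) (at (x i))" if x: "x \<in> W" for x
      proof -
        obtain V where V: "openin (Euclidean_space n) V" "x \<in> V" "V \<subseteq> W" "Ck_open (Suc k) n V f"
          using Suc.prems[OF x] by blast
        obtain h where h: "\<And>y. y \<in> V \<Longrightarrow> ((\<lambda>t. f (y(i := t))) has_real_derivative h y) (at (y i))"
          "Ck_open k n V h" using Ck_partialE[OF openin_eucl_subset[OF V(1)] V(4) i] by metis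
        have hg: "h y = g y" if "y \<in> V" for y
          using DERIV_imp_deriv[OF h(1)[OF that]] by (simp add: g_def)
        from Ck_cong[OF V(1) hg h(2)] have "Ck_open k n V g" .
        then show ?thesis using V h(1)[OF V(2)] hg[OF V(2)] by auto
      qed
      have "Ck_open k n W g" by (rule Suc.IH) (use loc in blast)
      then show "\<exists>g. (\<forall>x\<in>W. ((\<lambda>t. f (x(i := t))) has_real_derivative g x) (at (x i))) \<and> Ck_open k n W g"
        using loc by (intro exI[of _ g]) blast
    qed
  }
qed

section \<open>Smooth functions on arbitrary subsets of Euclidean space\<close>

lemma smooth_on_openI:
  assumes "openin (Euclidean_space n) W" "\<And>k. Ck_open k n W f"
  shows "smooth_on n W f"
  unfolding smooth_on_def using assms by blast

text \<open>On an open set a local extension coincides near each point with \<open>f\<close> itself,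
  so the two notions of smoothness agree; this is the way back from extensions to partial
  derivatives.\<close>

lemma smooth_on_openD:
  assumes W: "openin (Euclidean_space n) W" and f: "smooth_on n W f"
  shows "Ck_open k n W f"
proof (rule Ck_local[OF W])
  fix x assume "x \<in> W"
  then obtain V g where V: "openin (Euclidean_space n) V" "x \<in> V" "Ck_open k n V g" "\<forall>y\<in>V \<inter> W. g y = f y"
    using f unfolding smooth_on_def by blast
  have o: "openin (Euclidean_space n) (V \<inter> W)" using V W by blast
  have "Ck_open k n (V \<inter> W) g" using V Ck_subset[of "V \<inter> W" V] openin_eucl_subset by blast
  then have "Ck_open k n (V \<inter> W) f" using Ck_cong[OF o] V by blast
  then show "\<exists>V. openin (Euclidean_space n) V \<and> x \<in> V \<and> V \<subseteq> W \<and> Ck_open k n V f"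
    using o V \<open>x \<in> W\<close> by blast
qed

lemma smooth_on_open_continuous:
  "openin (Euclidean_space n) W \<Longrightarrow> smooth_on n W f \<Longrightarrow> continuous_on W f"
  using smooth_on_openD[of n W f 0] Ck_continuous openin_eucl_subset by blast

text \<open>\<open>Ck_open\<close> may use a different derivative witness for each order; uniqueness
  of derivatives makes one function serve all \<open>k\<close>.\<close>

lemma smooth_on_partialE:
  assumes W: "openin (Euclidean_space n) W" and f: "smooth_on n W f" and i: "i < n"
  obtains f' where "\<And>x. x \<in> W \<Longrightarrow> ((\<lambda>t. f (x(i := t))) has_real_derivative f' x) (at (x i))"
    "smooth_on n W f'"
proof -
  note Ws = openin_eucl_subset[OF W]
  define g where "g x = deriv (\<lambda>t. f (x(i := t))) (x i)" for x
  have *: "Ck_open k n W g \<and> (\<forall>x\<in>W. ((\<lambda>t. f (x(i := t))) has_real_derivative g x) (at (x i)))" for k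
  proof -
    obtain h where h: "\<And>y. y \<in> W \<Longrightarrow> ((\<lambda>t. f (y(i := t))) has_real_derivative h y) (at (y i))"
      "Ck_open k n W h" using Ck_partialE[OF Ws smooth_on_openD[OF W f] i] by metis
    have hg: "h y = g y" if "y \<in> W" for y
      using DERIV_imp_deriv[OF h(1)[OF that]] by (simp add: g_def)
    from Ck_cong[OF W hg h(2)] have "Ck_open k n W g" .
    then show ?thesis using h(1) hg by auto
  qed
  then have "smooth_on n W g" by (intro smooth_on_openI[OF W]) blast
  then show thesis using that[of g] * by blast
qed

lemma smooth_on_openE:
  assumes "smooth_on n S f" "x \<in> S"
  obtains W g where "openin (Euclidean_space n) W" "x \<in> W" "smooth_on n W g" "\<And>y. y \<in> W \<Longrightarrow> y \<in> S \<Longrightarrow> g y = f y"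
proof -
  obtain W g where "openin (Euclidean_space n) W" "x \<in> W" "\<forall>k. Ck_open k n W g" "\<forall>y\<in>W \<inter> S. g y = f y"
    using assms unfolding smooth_on_def by blast
  then show thesis by (intro that[of W g] smooth_on_openI) auto
qed

lemma smooth_on_extI:
  assumes "\<And>x. x \<in> S \<Longrightarrow> \<exists>W g. openin (Euclidean_space n) W \<and> x \<in> W \<and> smooth_on n W g \<and> (\<forall>y\<in>W \<inter> S. g y = f y)"
  shows "smooth_on n S f"
  unfolding smooth_on_def
proof
  fix x assume "x \<in> S"
  then obtain W g where W: "openin (Euclidean_space n) W" "x \<in> W" "smooth_on n W g" "\<forall>y\<in>W \<inter> S. g y = f y"
    using assms by blast
  then have "\<forall>k. Ck_open k n W g" using smooth_on_openD by blast
  then show "\<exists>W g. openin (Euclidean_space n) W \<and> x \<in> W \<and> (\<forall>k. Ck_open k n W g) \<and> (\<forall>y\<in>W \<inter> S. g y = f y)"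
    using W by blast
qed

lemma smooth_on_cong: "(\<And>x. x \<in> S \<Longrightarrow> f x = g x) \<Longrightarrow> smooth_on n S f \<longleftrightarrow> smooth_on n S g"
  unfolding smooth_on_def by auto

lemma smooth_on_eq: "smooth_on n S f \<Longrightarrow> (\<And>x. x \<in> S \<Longrightarrow> f x = g x) \<Longrightarrow> smooth_on n S g"
  using smooth_on_cong by blast

lemma smooth_on_subset:
  assumes "smooth_on n S f" "T \<subseteq> S"
  shows "smooth_on n T f"
proof (rule smooth_on_extI)
  fix x assume "x \<in> T"
  then have "x \<in> S" using assms(2) by blast
  then obtain W g where "openin (Euclidean_space n) W" "x \<in> W" "smooth_on n W g"
    "\<And>y. y \<in> W \<Longrightarrow> y \<in> S \<Longrightarrow> g y = f y"
    using smooth_on_openE[OF assms(1)] by metis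
  then show "\<exists>W g. openin (Euclidean_space n) W \<and> x \<in> W \<and> smooth_on n W g \<and> (\<forall>y\<in>W \<inter> T. g y = f y)"
    using assms(2) by (intro exI[of _ W] exI[of _ g]) auto
qed

lemma smooth_on_localI:
  assumes "\<And>x. x \<in> S \<Longrightarrow> \<exists>W. openin (Euclidean_space n) W \<and> x \<in> W \<and> smooth_on n (S \<inter> W) f"
  shows "smooth_on n S f"
proof (rule smooth_on_extI)
  fix x assume x: "x \<in> S"
  then obtain W where W: "openin (Euclidean_space n) W" "x \<in> W" "smooth_on n (S \<inter> W) f" using assms by blast
  obtain V g where V: "openin (Euclidean_space n) V" "x \<in> V" "smooth_on n V g" "\<And>y. y \<in> V \<Longrightarrow> y \<in> S \<inter> W \<Longrightarrow> g y = f y"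
    using smooth_on_openE[OF W(3)] x W(2) by (metis IntI)
  then show "\<exists>W g. openin (Euclidean_space n) W \<and> x \<in> W \<and> smooth_on n W g \<and> (\<forall>y\<in>W \<inter> S. g y = f y)"
    using W by (intro exI[of _ "V \<inter> W"] exI[of _ g]) (auto intro: smooth_on_subset)
qed

lemma smooth_on_const: "S \<subseteq> eucl n \<Longrightarrow> smooth_on n S (\<lambda>x. c)"
  by (rule smooth_on_subset[of _ "eucl n"]) (auto intro!: smooth_on_openI Ck_const)

lemma smooth_on_coord: "S \<subseteq> eucl n \<Longrightarrow> smooth_on n S (\<lambda>x. x j)"
  by (rule smooth_on_subset[of _ "eucl n"]) (auto intro!: smooth_on_openI Ck_coord)

lemma smooth_on_binop:
  assumes f: "smooth_on n S f" and g: "smooth_on n S g"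
    and op: "\<And>W f g k. W \<subseteq> eucl n \<Longrightarrow> Ck_open k n W f \<Longrightarrow> Ck_open k n W g \<Longrightarrow> Ck_open k n W (\<lambda>x. b (f x) (g x))"
  shows "smooth_on n S (\<lambda>x. b (f x) (g x))"
proof (rule smooth_on_extI)
  fix x assume x: "x \<in> S"
  obtain V f' where V: "openin (Euclidean_space n) V" "x \<in> V" "smooth_on n V f'" "\<And>y. y \<in> V \<Longrightarrow> y \<in> S \<Longrightarrow> f' y = f y"
    using smooth_on_openE[OF f x] by metis
  obtain W g' where W: "openin (Euclidean_space n) W" "x \<in> W" "smooth_on n W g'" "\<And>y. y \<in> W \<Longrightarrow> y \<in> S \<Longrightarrow> g' y = g y"
    using smooth_on_openE[OF g x] by metis
  have o: "openin (Euclidean_space n) (V \<inter> W)" using V W by blast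
  have "smooth_on n (V \<inter> W) f'" "smooth_on n (V \<inter> W) g'" using V W smooth_on_subset by blast+
  then have "smooth_on n (V \<inter> W) (\<lambda>x. b (f' x) (g' x))"
    using smooth_on_openD[OF o] by (intro smooth_on_openI[OF o] op openin_eucl_subset[OF o])
  then show "\<exists>W h. openin (Euclidean_space n) W \<and> x \<in> W \<and> smooth_on n W h \<and> (\<forall>y\<in>W \<inter> S. h y = b (f y) (g y))"
    using o V W by (intro exI[of _ "V \<inter> W"] exI[of _ "\<lambda>x. b (f' x) (g' x)"]) auto
qed

lemma smooth_on_add: "smooth_on n S f \<Longrightarrow> smooth_on n S g \<Longrightarrow> smooth_on n S (\<lambda>x. f x + g x)"
  by (rule smooth_on_binop[where b = "(+)"]) (auto intro: Ck_add)

lemma smooth_on_mult: "smooth_on n S f \<Longrightarrow> smooth_on n S g \<Longrightarrow> smooth_on n S (\<lambda>x. f x * g x)"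
  by (rule smooth_on_binop[where b = "(*)"]) (auto intro: Ck_mult)

lemma smooth_on_minus: "S \<subseteq> eucl n \<Longrightarrow> smooth_on n S f \<Longrightarrow> smooth_on n S (\<lambda>x. - f x)"
  using smooth_on_mult[OF smooth_on_const[of S n "-1"]] by fastforce

lemma smooth_on_diff:
  "S \<subseteq> eucl n \<Longrightarrow> smooth_on n S f \<Longrightarrow> smooth_on n S g \<Longrightarrow> smooth_on n S (\<lambda>x. f x - g x)"
  using smooth_on_add[OF _ smooth_on_minus, of n S f g] by simp

lemma smooth_on_prod:
  "S \<subseteq> eucl n \<Longrightarrow> (\<And>j. j \<in> J \<Longrightarrow> smooth_on n S (f j)) \<Longrightarrow> smooth_on n S (\<lambda>x. \<Prod>j\<in>J. f j x)"
  by (induction J rule: infinite_finite_induct) (auto intro: smooth_on_const smooth_on_mult)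

lemma smooth_on_power: "S \<subseteq> eucl n \<Longrightarrow> smooth_on n S f \<Longrightarrow> smooth_on n S (\<lambda>x. f x ^ k)"
  by (induction k) (auto intro: smooth_on_const smooth_on_mult)

text \<open>The local extensions of the components of \<open>F\<close> need not map into
  \<open>T\<close>. The neighbourhood is therefore cut down to the preimage of the domain of the
  extension of \<open>g\<close>, which is open because the extended map is continuous.\<close>

lemma smooth_on_compose:
  assumes g: "smooth_on m T g" and F: "\<And>j. j < m \<Longrightarrow> smooth_on n S (\<lambda>x. F x j)"
    and FS: "F ` S \<subseteq> T" and T: "T \<subseteq> eucl m" and S: "S \<subseteq> eucl n"
  shows "smooth_on n S (\<lambda>x. g (F x))"
proof (rule smooth_on_extI)
  fix x assume x: "x \<in> S"
  then have "F x \<in> T" using FS by blast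
  then obtain W' g' where W': "openin (Euclidean_space m) W'" "F x \<in> W'" "smooth_on m W' g'"
    "\<And>y. y \<in> W' \<Longrightarrow> y \<in> T \<Longrightarrow> g' y = g y" using smooth_on_openE[OF g] by metis
  have "\<forall>j\<in>{..<m}. \<exists>V f'. openin (Euclidean_space n) V \<and> x \<in> V \<and> smooth_on n V f' \<and> (\<forall>y. y \<in> V \<longrightarrow> y \<in> S \<longrightarrow> f' y = F y j)"
    using smooth_on_openE[OF F x] by (metis lessThan_iff)
  then obtain V F' where V: "\<And>j. j < m \<Longrightarrow> openin (Euclidean_space n) (V j)" "\<And>j. j < m \<Longrightarrow> x \<in> V j"
    "\<And>j. j < m \<Longrightarrow> smooth_on n (V j) (F' j)" "\<And>j y. j < m \<Longrightarrow> y \<in> V j \<Longrightarrow> y \<in> S \<Longrightarrow> F' j y = F y j"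
    unfolding lessThan_iff Ball_def by metis
  define V0 where "V0 = eucl n \<inter> (\<Inter>j\<in>{..<m}. V j)"
  \<comment> \<open>Zero from \<open>m\<close> on, so that the extended map takes values in
    \<open>\<real>^m\<close>.\<close>
  define G where "G y = (\<lambda>j. if j < m then F' j y else 0)" for y
  have V0: "openin (Euclidean_space n) V0"
  proof (cases "m = 0")
    case False
    then have "openin (Euclidean_space n) (\<Inter>j\<in>{..<m}. V j)" using V(1) openin_Inter[of "V ` {..<m}"] by auto
    then show ?thesis unfolding V0_def by blast
  qed (simp add: V0_def)
  have GF: "G y = F y" if "y \<in> V0" "y \<in> S" for y
  proof
    fix j
    have "F y \<in> eucl m" using that FS T by blast
    then show "G y j = F y j" using that V(4)[of j y] by (auto simp: G_def V0_def in_eucl)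
  qed
  have sG: "smooth_on n V0 (\<lambda>y. G y j)" if "j < m" for j
    using V(3)[OF that] that smooth_on_subset[of n "V j" _ V0] by (auto simp: G_def V0_def)
  define W where "W = {y \<in> V0. G y \<in> W'}"
  have W: "openin (Euclidean_space n) W" unfolding W_def
    by (rule openin_eucl_vimage[OF V0 _ _ W'(1)])
      (use sG smooth_on_open_continuous[OF V0] in \<open>auto simp: G_def in_eucl\<close>)
  have xW: "x \<in> W" using x S V(2) W'(2) GF[of x] by (auto simp: W_def V0_def)
  have sGW: "smooth_on n W (\<lambda>y. G y j)" if "j < m" for j
    using sG[OF that] by (rule smooth_on_subset) (auto simp: W_def)
  have "smooth_on n W (\<lambda>y. g' (G y))"
  proof (rule smooth_on_openI[OF W])
    fix k
    show "Ck_open k n W (\<lambda>y. g' (G y))"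
      by (rule Ck_compose[OF W W'(1) _ smooth_on_openD[OF W sGW] smooth_on_openD[OF W'(1,3)]])
        (auto simp: W_def)
  qed
  moreover have "g' (G y) = g (F y)" if "y \<in> W" "y \<in> S" for y
    using that GF[of y] W'(4)[of "G y"] FS by (auto simp: W_def)
  ultimately show "\<exists>W h. openin (Euclidean_space n) W \<and> x \<in> W \<and> smooth_on n W h \<and> (\<forall>y\<in>W \<inter> S. h y = g (F y))"
    using W xW by (intro exI[of _ W] exI[of _ "\<lambda>y. g' (G y)"]) auto
qed

lemma smooth_on_fun1:
  assumes f: "smooth_on n S f" "f ` S \<subseteq> D" and D: "open D" and "P \<phi>"
    and P: "\<And>\<phi>. P \<phi> \<Longrightarrow> \<exists>\<phi>'. P \<phi>' \<and> (\<forall>t\<in>D. (\<phi> has_real_derivative \<phi>' t) (at t))"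
  shows "smooth_on n S (\<lambda>x. \<phi> (f x))"
proof (rule smooth_on_extI)
  fix x assume x: "x \<in> S"
  obtain V g where V: "openin (Euclidean_space n) V" "x \<in> V" "smooth_on n V g" "\<And>y. y \<in> V \<Longrightarrow> y \<in> S \<Longrightarrow> g y = f y"
    using smooth_on_openE[OF f(1) x] by metis
  define W where "W = V \<inter> g -` D"
  have "openin (top_of_set V) W"
    unfolding W_def using smooth_on_open_continuous V D by (intro continuous_openin_preimage_gen) auto
  then have W: "openin (Euclidean_space n) W" using V openin_eucl_trans by blast
  have "smooth_on n W g" using V smooth_on_subset by (auto simp: W_def)
  then have "Ck_open k n W (\<lambda>x. \<phi> (g x))" for k
    by (rule Ck_fun1[OF openin_eucl_subset[OF W] smooth_on_openD[OF W] _ \<open>P \<phi>\<close> P])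
      (auto simp: W_def)
  then have "smooth_on n W (\<lambda>x. \<phi> (g x))" by (rule smooth_on_openI[OF W])
  then show "\<exists>W h. openin (Euclidean_space n) W \<and> x \<in> W \<and> smooth_on n W h \<and> (\<forall>y\<in>W \<inter> S. h y = \<phi> (f y))"
    using W V f(2) x by (intro exI[of _ W] exI[of _ "\<lambda>x. \<phi> (g x)"]) (auto simp: W_def)
qed

section \<open>Elementary functions\<close>

lemma smooth_on_sin_cos:
  assumes "smooth_on n S f"
  shows "smooth_on n S (\<lambda>x. sin (f x))" "smooth_on n S (\<lambda>x. cos (f x))"
proof -
  define P where "P \<phi> \<longleftrightarrow> (\<exists>a b. \<phi> = (\<lambda>t::real. a * sin t + b * cos t))" for \<phi>
  have *: "\<exists>\<phi>'. P \<phi>' \<and> (\<forall>t\<in>UNIV. (\<phi> has_real_derivative \<phi>' t) (at t))" if "P \<phi>" for \<phi>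
  proof -
    obtain a b where ab: "\<phi> = (\<lambda>t. a * sin t + b * cos t)" using \<open>P \<phi>\<close> by (auto simp: P_def)
    have "\<forall>t. (\<phi> has_real_derivative (- b) * sin t + a * cos t) (at t)"
      unfolding ab by (auto intro!: derivative_eq_intros)
    moreover have "P (\<lambda>t. (- b) * sin t + a * cos t)" unfolding P_def by blast
    ultimately show ?thesis by (intro exI[of _ "\<lambda>t. (- b) * sin t + a * cos t"]) simp
  qed
  have Psin: "P sin" unfolding P_def by (intro exI[of _ 1] exI[of _ 0]) auto
  show "smooth_on n S (\<lambda>x. sin (f x))" by (rule smooth_on_fun1[OF assms _ open_UNIV Psin *]) simp
  have Pcos: "P cos" unfolding P_def by (intro exI[of _ 0] exI[of _ 1]) auto
  show "smooth_on n S (\<lambda>x. cos (f x))" by (rule smooth_on_fun1[OF assms _ open_UNIV Pcos *]) simp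
qed

lemma smooth_on_powr:
  assumes "smooth_on n S f" "\<And>x. x \<in> S \<Longrightarrow> 0 < f x"
  shows "smooth_on n S (\<lambda>x. f x powr a)"
proof -
  define P where "P \<phi> \<longleftrightarrow> (\<exists>c a. \<phi> = (\<lambda>t::real. c * t powr a))" for \<phi>
  have *: "\<exists>\<phi>'. P \<phi>' \<and> (\<forall>t\<in>{0<..}. (\<phi> has_real_derivative \<phi>' t) (at t))" if "P \<phi>" for \<phi>
  proof -
    obtain a c where ab: "\<phi> = (\<lambda>t. c * t powr a)" using \<open>P \<phi>\<close> by (auto simp: P_def)
    have "\<forall>t\<in>{0<..}. (\<phi> has_real_derivative (c * a) * t powr (a - 1)) (at t)"
      unfolding ab by (auto intro!: derivative_eq_intros simp: powr_diff)
    moreover have "P (\<lambda>t. (c * a) * t powr (a - 1))" unfolding P_def by blast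
    ultimately show ?thesis by (intro exI[of _ "\<lambda>t. (c * a) * t powr (a - 1)"]) simp
  qed
  have Pp: "P (\<lambda>t. t powr a)" unfolding P_def by (intro exI[of _ 1] exI[of _ a]) auto
  show ?thesis by (rule smooth_on_fun1[OF assms(1) _ open_greaterThan Pp *]) (use assms(2) in auto)
qed

lemma smooth_on_sqrt:
  assumes "smooth_on n S f" "\<And>x. x \<in> S \<Longrightarrow> 0 < f x"
  shows "smooth_on n S (\<lambda>x. sqrt (f x))"
  by (rule smooth_on_eq[OF smooth_on_powr[OF assms, of "1/2"]]) (use assms in \<open>auto simp: powr_half_sqrt less_imp_le\<close>)

lemma smooth_on_inverse:
  assumes "smooth_on n S f" "\<And>x. x \<in> S \<Longrightarrow> f x \<noteq> 0"
  shows "smooth_on n S (\<lambda>x. inverse (f x))"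
proof -
  define P where "P \<phi> \<longleftrightarrow> (\<exists>c k. \<phi> = (\<lambda>t::real. c * inverse t ^ k))" for \<phi>
  have *: "\<exists>\<phi>'. P \<phi>' \<and> (\<forall>t\<in>-{0}. (\<phi> has_real_derivative \<phi>' t) (at t))" if "P \<phi>" for \<phi>
  proof -
    obtain k c where ab: "\<phi> = (\<lambda>t. c * inverse t ^ k)" using \<open>P \<phi>\<close> by (auto simp: P_def)
    have "(\<phi> has_real_derivative (- c * real k) * inverse t ^ Suc k) (at t)" if "t \<noteq> 0" for t
    proof (cases k)
      case 0
      then show ?thesis unfolding ab by (auto intro!: derivative_eq_intros)
    next
      case (Suc l)
      have "((\<lambda>t. c * inverse t ^ k) has_real_derivative
          c * (real k * (- (inverse t ^ Suc (Suc 0)) * inverse t ^ (k - Suc 0)))) (at t)"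
        by (rule DERIV_cmult[OF DERIV_power[OF DERIV_inverse[OF that]]])
      then show ?thesis unfolding ab by (simp add: Suc mult_ac)
    qed
    moreover have "P (\<lambda>t. (- c * real k) * inverse t ^ Suc k)" unfolding P_def by blast
    ultimately show ?thesis by (intro exI[of _ "\<lambda>t. (- c * real k) * inverse t ^ Suc k"]) simp
  qed
  have Pi: "P inverse" unfolding P_def by (intro exI[of _ 1] exI[of _ 1]) auto
  show ?thesis by (rule smooth_on_fun1[OF assms(1) _ open_Compl[OF closed_singleton] Pi *]) (use assms(2) in auto)
qed

lemma smooth_on_divide:
  "smooth_on n S f \<Longrightarrow> smooth_on n S g \<Longrightarrow> (\<And>x. x \<in> S \<Longrightarrow> g x \<noteq> 0) \<Longrightarrow> smooth_on n S (\<lambda>x. f x / g x)"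
  unfolding divide_inverse by (intro smooth_on_mult smooth_on_inverse)

text \<open>For functions whose derivative is of a simpler kind, such as arctan with its rational
  derivative: closure properties apply to the derivative, and smoothness carries over.\<close>

lemma smooth_on_openI_partials:
  assumes W: "openin (Euclidean_space n) W" and c: "continuous_on W f"
    and d: "\<And>i. i < n \<Longrightarrow> \<exists>f'. (\<forall>x\<in>W. ((\<lambda>t. f (x(i := t))) has_real_derivative f' x) (at (x i))) \<and> smooth_on n W f'"
  shows "smooth_on n W f"
proof (rule smooth_on_openI[OF W])
  fix k
  note Ws = openin_eucl_subset[OF W]
  have "Ck_open (Suc k) n W f"
  proof (rule Ck_SucI[OF Ws c])
    fix i assume "i < n"
    then obtain f' where "\<forall>x\<in>W. ((\<lambda>t. f (x(i := t))) has_real_derivative f' x) (at (x i))" "smooth_on n W f'"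
      using d by blast
    then show "\<exists>g. (\<forall>x\<in>W. ((\<lambda>t. f (x(i := t))) has_real_derivative g x) (at (x i))) \<and> Ck_open k n W g"
      using smooth_on_openD[OF W] by blast
  qed
  then show "Ck_open k n W f" using Ck_SucD[OF Ws] by blast
qed

lemma smooth_on_arctan:
  assumes "smooth_on n S f"
  shows "smooth_on n S (\<lambda>x. arctan (f x))"
proof (rule smooth_on_extI)
  fix x assume x: "x \<in> S"
  obtain V g where V: "openin (Euclidean_space n) V" "x \<in> V" "smooth_on n V g" "\<And>y. y \<in> V \<Longrightarrow> y \<in> S \<Longrightarrow> g y = f y"
    using smooth_on_openE[OF assms x] by metis
  note Vs = openin_eucl_subset[OF V(1)]
  have "smooth_on n V (\<lambda>x. arctan (g x))"
  proof (rule smooth_on_openI_partials[OF V(1)])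
    show "continuous_on V (\<lambda>x. arctan (g x))"
      using smooth_on_open_continuous[OF V(1,3)] by (intro continuous_intros)
    fix i assume "i < n"
    then obtain g' where g': "\<And>x. x \<in> V \<Longrightarrow> ((\<lambda>t. g (x(i := t))) has_real_derivative g' x) (at (x i))"
      "smooth_on n V g'" using smooth_on_partialE[OF V(1,3)] by metis
    have "((\<lambda>t. arctan (g (x(i := t)))) has_real_derivative inverse (1 + (g x)\<^sup>2) * g' x) (at (x i))"
      if "x \<in> V" for x
    proof (rule DERIV_chain2[where g = "\<lambda>t. g (x(i := t))"])
      show "(arctan has_real_derivative inverse (1 + (g x)\<^sup>2)) (at (g (x(i := x i))))"
        using DERIV_arctan[of "g x"] by simp
    qed (rule g'(1)[OF that])
    moreover have "1 + (g x)\<^sup>2 \<noteq> 0" for x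
      by (smt (verit) zero_le_power2)
    then have "smooth_on n V (\<lambda>x. inverse (1 + (g x)\<^sup>2) * g' x)"
      using V(3) g'(2) Vs by (intro smooth_on_mult smooth_on_inverse smooth_on_add smooth_on_const smooth_on_power) auto
    ultimately show "\<exists>f'. (\<forall>x\<in>V. ((\<lambda>t. arctan (g (x(i := t)))) has_real_derivative f' x) (at (x i))) \<and> smooth_on n V f'"
      by (intro exI[of _ "\<lambda>x. inverse (1 + (g x)\<^sup>2) * g' x"]) simp
  qed
  then show "\<exists>W h. openin (Euclidean_space n) W \<and> x \<in> W \<and> smooth_on n W h \<and> (\<forall>y\<in>W \<inter> S. h y = arctan (f y))"
    using V by (intro exI[of _ V] exI[of _ "\<lambda>x. arctan (g x)"]) auto
qed

text \<open>
  A one-dimensional inverse function theorem with parameters: the function \<open>G\<close> replaces the \<open>i\<close>-th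
  coordinate, and \<open>g\<close> recovers the old one.  Angle functions and boundary normal forms are both
  obtained from it, so the \<open>n\<close>-dimensional theorem is never needed.
\<close>

lemma coordinate_replacement:
  assumes W: "openin (Euclidean_space n) W" and p: "p \<in> W" and i: "i < n"
    and G: "smooth_on n W G"
    and d: "((\<lambda>t. G (p(i := t))) has_real_derivative d) (at (p i))" "d > 0"
  obtains r g where "r > 0" "cube n p r \<subseteq> W"
    "\<And>x t. x \<in> cube n p r \<Longrightarrow> x(i := t) \<in> cube n p r \<Longrightarrow> x i < t \<Longrightarrow> G x < G (x(i := t))"
    "openin (Euclidean_space n) ((\<lambda>x. x(i := G x)) ` cube n p r)"
    "smooth_on n ((\<lambda>x. x(i := G x)) ` cube n p r) g"
    "\<And>x. x \<in> cube n p r \<Longrightarrow> g (x(i := G x)) = x i"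
proof -
  obtain G' where G': "\<And>j x. j < n \<Longrightarrow> x \<in> W \<Longrightarrow> ((\<lambda>t. G (x(j := t))) has_real_derivative G' j x) (at (x j))"
    "\<And>j. j < n \<Longrightarrow> smooth_on n W (G' j)"
  proof -
    have "\<forall>j\<in>{..<n}. \<exists>h. (\<forall>x\<in>W. ((\<lambda>t. G (x(j := t))) has_real_derivative h x) (at (x j))) \<and> smooth_on n W h"
      using smooth_on_partialE[OF W G] by (metis lessThan_iff)
    from bchoice[OF this] that show thesis by auto
  qed
  have "G' i p = d" using DERIV_unique[OF G'(1)[OF i p] d(1)] .
  then have "G' i p > 0" using d(2) by simp
  \<comment> \<open>A deviation smaller than \<open>G' i p\<close> keeps the \<open>i\<close>-th
    partial derivative positive on the whole cube.\<close>
  then obtain r where r: "r > 0" "cube n p r \<subseteq> W" "\<And>x. x \<in> cube n p r \<Longrightarrow> \<bar>G' i x - G' i p\<bar> < G' i p"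
    using continuous_on_cube[OF W smooth_on_open_continuous[OF W G'(2)[OF i]] p] by metis
  define Q where "Q = cube n p r"
  have Qo: "openin (Euclidean_space n) Q" and QW: "Q \<subseteq> W" and Qe: "Q \<subseteq> eucl n"
    using r openin_cube by (auto simp: Q_def cube_def)
  have pos: "G' i x > 0" if "x \<in> Q" for x using r(3)[of x] that by (simp add: Q_def)
  have Qseg: "x(i := z) \<in> Q" if "x \<in> Q" "x(i := t) \<in> Q" "z \<in> closed_segment (x i) t" for x t z
  proof -
    have "\<bar>x i - p i\<bar> < r" "\<bar>t - p i\<bar> < r" using that cube_upd[of x n p r i] i by (auto simp: Q_def cube_def)
    then have "\<bar>z - p i\<bar> < r" using that(3) by (auto simp: closed_segment_eq_real_ivl split: if_splits)
    then show ?thesis using that(1) cube_upd[of x n p r i] i by (auto simp: Q_def)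
  qed
  have mvt: "\<exists>z \<in> closed_segment (x i) t. G (x(i := t)) - G x = G' i (x(i := z)) * (t - x i)"
    if x: "x \<in> Q" "x(i := t) \<in> Q" for x t
  proof -
    have dz: "((\<lambda>s. G (x(i := s))) has_real_derivative G' i (x(i := z))) (at z)"
      if "z \<in> closed_segment (x i) t" for z
      using G'(1)[OF i, of "x(i := z)"] Qseg[OF x that] QW by auto
    consider "x i = t" | "x i < t" | "t < x i" by linarith
    then show ?thesis
    proof cases
      case 1 then show ?thesis by (intro bexI[of _ t]) auto
    next
      case 2
      have "\<exists>z>x i. z < t \<and> G (x(i := t)) - G (x(i := x i)) = (t - x i) * G' i (x(i := z))"
        by (rule MVT2[OF 2], rule dz) (simp add: closed_segment_eq_real_ivl)
      then obtain z where "z > x i" "z < t" "G (x(i := t)) - G (x(i := x i)) = (t - x i) * G' i (x(i := z))" by blast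
      then show ?thesis by (intro bexI[of _ z]) (auto simp: closed_segment_eq_real_ivl mult.commute)
    next
      case 3
      have "\<exists>z>t. z < x i \<and> G (x(i := x i)) - G (x(i := t)) = (x i - t) * G' i (x(i := z))"
        by (rule MVT2[OF 3], rule dz) (use 3 in \<open>simp add: closed_segment_eq_real_ivl\<close>)
      then obtain z where z: "z > t" "z < x i" "G (x(i := x i)) - G (x(i := t)) = (x i - t) * G' i (x(i := z))" by blast
      then have "G (x(i := t)) - G x = G' i (x(i := z)) * (t - x i)" by (simp add: algebra_simps)
      then show ?thesis using z 3 by (intro bexI[of _ z]) (auto simp: closed_segment_eq_real_ivl)
    qed
  qed
  have mono: "G x < G (x(i := t))" if x: "x \<in> Q" "x(i := t) \<in> Q" "x i < t" for x t
  proof -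
    obtain z where z: "z \<in> closed_segment (x i) t" "G (x(i := t)) - G x = G' i (x(i := z)) * (t - x i)"
      using mvt x by blast
    have "G' i (x(i := z)) * (t - x i) > 0" using pos[OF Qseg[OF x(1,2) z(1)]] x(3) by simp
    then show ?thesis using z by linarith
  qed
  define E where "E x = x(i := G x)" for x
  have inj: "inj_on E Q"
  proof (rule inj_onI)
    fix x y assume xy: "x \<in> Q" "y \<in> Q" "E x = E y"
    have "x k = y k" if "k \<noteq> i" for k using fun_cong[OF xy(3), of k] that by (simp add: E_def)
    then have y: "y = x(i := y i)" "x = y(i := x i)" by auto
    have "G x = G y" using fun_cong[OF xy(3), of i] by (simp add: E_def)
    then have "\<not> x i < y i" "\<not> y i < x i" using mono[of x "y i"] mono[of y "x i"] xy y by auto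
    then have "x i = y i" by linarith
    then show "x = y" using y by simp
  qed
  define Y where "Y = E ` Q"
  define h where "h = inv_into Q E"
  have hE: "h (E x) = x" if "x \<in> Q" for x using inj that by (simp add: h_def)
  have hY: "h y \<in> Q" "E (h y) = y" if "y \<in> Y" for y
    using that by (auto simp: h_def Y_def inv_into_into f_inv_into_f)
  define g where "g y = h y i" for y
  have hg: "h y = y(i := g y)" if "y \<in> Y" for y
  proof
    fix k show "h y k = (y(i := g y)) k"
      using fun_cong[OF hY(2)[OF that], of k] by (auto simp: E_def g_def)
  qed
  have Gg: "G (y(i := g y)) = y i" if "y \<in> Y" for y
    using fun_cong[OF hY(2)[OF that], of i] hg[OF that] by (simp add: E_def)
  \<comment> \<open>Openness of the image and continuity of \<open>g\<close> at once. At heights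
    \<open>a < x i < b\<close> the values of \<open>G\<close> lie strictly below and above
    \<open>y i\<close>; this persists for nearby \<open>y'\<close>, and the intermediate value
    theorem yields a solution between \<open>a\<close> and \<open>b\<close>.\<close>
  have key: "\<exists>N. openin (Euclidean_space n) N \<and> y \<in> N \<and> N \<subseteq> Y \<and> (\<forall>y'\<in>N. \<bar>g y' - g y\<bar> < e)"
    if y: "y \<in> Y" and e: "e > 0" for y e
  proof -
    define x where "x = h y"
    have x: "x \<in> Q" "y = x(i := G x)" "g y = x i" using hY[OF y] by (auto simp: x_def E_def g_def)
    obtain e0 where e0: "e0 > 0" "\<And>t. \<bar>t - x i\<bar> < e0 \<Longrightarrow> x(i := t) \<in> Q"
      using openin_eucl_line[OF Qo x(1) i] by metis
    define a where "a = x i - min e e0 / 2"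
    define b where "b = x i + min e e0 / 2"
    have ab: "a < x i" "x i < b" "x i - e < a" "b < x i + e" using e e0 by (auto simp: a_def b_def)
    have abQ: "x(i := a) \<in> Q" "x(i := b) \<in> Q" using e0 e by (auto intro!: e0(2) simp: a_def b_def)
    define Nc where "Nc c = {y' \<in> eucl n. y'(i := c) \<in> Q}" for c
    have Nc: "openin (Euclidean_space n) (Nc c)" for c
      unfolding Nc_def
    proof (rule openin_eucl_vimage[OF openin_topspace _ _ Qo])
      show "continuous_on (eucl n) (\<lambda>x. (x(i := c)) j)" for j
        by (cases "j = i") (auto intro: continuous_on_subset[OF continuous_on_product_coordinates])
      show "(\<lambda>x. x(i := c)) ` eucl n \<subseteq> eucl n" using i eucl_upd by auto
    qed
    have cN: "continuous_on (Nc c) (\<lambda>y'. G (y'(i := c)))" for c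
    proof (rule continuous_on_compose2[OF smooth_on_open_continuous[OF W G]])
      show "continuous_on (Nc c) (\<lambda>x. x(i := c))"
      proof (rule continuous_on_coordinatewise_then_product)
        show "continuous_on (Nc c) (\<lambda>x. (x(i := c)) j)" for j
          by (cases "j = i") (auto intro: continuous_on_subset[OF continuous_on_product_coordinates])
      qed
      show "(\<lambda>x. x(i := c)) ` Nc c \<subseteq> W" using QW by (auto simp: Nc_def)
    qed
    have ci: "continuous_on S (\<lambda>y'::nat \<Rightarrow> real. y' i)" for S
      by (rule continuous_on_subset[OF continuous_on_product_coordinates]) simp
    define N where "N = {y' \<in> Nc a. G (y'(i := a)) < y' i} \<inter> {y' \<in> Nc b. y' i < G (y'(i := b))}"
    have "openin (Euclidean_space n) N"
      unfolding N_def by (intro openin_Int openin_eucl_less Nc cN ci)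
    moreover have "y \<in> N"
    proof -
      have "G (x(i := a)) < G x" using mono[of "x(i := a)" "x i"] abQ ab x(1) by simp
      moreover have "G x < G (x(i := b))" using mono[of x b] abQ ab x(1) by simp
      ultimately show ?thesis using abQ x Qe eucl_upd[OF _ i] by (auto simp: N_def Nc_def)
    qed
    moreover have "y' \<in> Y \<and> \<bar>g y' - g y\<bar> < e" if y': "y' \<in> N" for y'
    proof -
      have 1: "y'(i := a) \<in> Q" "y'(i := b) \<in> Q" "G (y'(i := a)) < y' i" "y' i < G (y'(i := b))"
        using y' by (auto simp: N_def Nc_def)
      have seg: "y'(i := t) \<in> Q" if "t \<in> {a..b}" for t
        using Qseg[OF 1(1), of b t] 1(2) that ab by (auto simp: closed_segment_eq_real_ivl)
      have "\<exists>t\<ge>a. t \<le> b \<and> G (y'(i := t)) = y' i"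
      proof (rule IVT)
        show "\<forall>t. a \<le> t \<and> t \<le> b \<longrightarrow> isCont (\<lambda>t. G (y'(i := t))) t"
        proof (intro allI impI)
          fix t assume "a \<le> t \<and> t \<le> b"
          then have "y'(i := t) \<in> W" using seg QW by auto
          from DERIV_isCont[OF G'(1)[OF i this]] show "isCont (\<lambda>t. G (y'(i := t))) t" by simp
        qed
      qed (use 1 ab in auto)
      then obtain t where t: "a \<le> t" "t \<le> b" "G (y'(i := t)) = y' i" by blast
      have tQ: "y'(i := t) \<in> Q" using seg t by auto
      have E: "E (y'(i := t)) = y'" using t by (simp add: E_def)
      then have "y' \<in> Y" using tQ by (metis Y_def imageI)
      moreover have "g y' = t" using hE[OF tQ] E by (simp add: g_def)
      ultimately show ?thesis using t ab x by auto
    qed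
    ultimately show ?thesis by (intro exI[of _ N]) auto
  qed
  have Yo: "openin (Euclidean_space n) Y"
  proof (subst openin_subopen, intro ballI)
    fix y assume "y \<in> Y"
    from key[OF this, of 1] show "\<exists>T. openin (Euclidean_space n) T \<and> y \<in> T \<and> T \<subseteq> Y" by auto
  qed
  note Ye = openin_eucl_subset[OF Yo]
  have gcont: "continuous_on Y g"
    unfolding continuous_on_iff
  proof (intro ballI allI impI)
    fix y and e :: real assume y: "y \<in> Y" and e: "e > 0"
    obtain N where N: "openin (Euclidean_space n) N" "y \<in> N" "N \<subseteq> Y" "\<forall>y'\<in>N. \<bar>g y' - g y\<bar> < e"
      using key[OF y e] by blast
    obtain T where T: "open T" "N = eucl n \<inter> T" using N(1) by (auto simp: openin_eucl_iff)
    then obtain d where d: "d > 0" "ball y d \<subseteq> T" using N(2) open_contains_ball by blast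
    have "dist (g y') (g y) < e" if "y' \<in> Y" "dist y' y < d" for y'
    proof -
      have "y' \<in> N" using that d T Ye by (auto simp: subset_iff dist_commute)
      then show ?thesis using N by (simp add: dist_real_def)
    qed
    then show "\<exists>d>0. \<forall>y'\<in>Y. dist y' y < d \<longrightarrow> dist (g y') (g y) < e" using d by blast
  qed
  \<comment> \<open>Implicit differentiation of \<open>G (y(i := g y)) = y i\<close>.\<close>
  define g' where "g' k y = (if k = i then 1 else - G' k (h y)) * inverse (G' i (h y))" for k y
  have gder: "((\<lambda>t. g (y(k := t))) has_real_derivative g' k y) (at (y k))" if y: "y \<in> Y" and k: "k < n" for y k
  proof -
    define x where "x = h y"
    have x: "x \<in> Q" "y = x(i := G x)" "g y = x i" using hY[OF y] by (auto simp: x_def E_def g_def)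
    have xg: "x = y(i := g y)" using hg[OF y] by (simp add: x_def)
    define s where "s t = g (y(k := t))" for t
    \<comment> \<open>The increment of \<open>G\<close> that moving coordinate \<open>i\<close> from
      \<open>x i\<close> to \<open>s t\<close> has to produce. For \<open>k = i\<close> the target
      value moves; for \<open>k \<noteq> i\<close> the target stays and the base point moves. The
      mean value theorem turns it into a multiple of \<open>s t - x i\<close>.\<close>
    define \<nu> where "\<nu> t = (y(k := t)) i - G (if k = i then x else x(k := t))" for t
    define t0 where "t0 = y k"
    have st0: "s t0 = x i" by (simp only: s_def t0_def fun_upd_triv x(3))
    have "\<forall>\<^sub>F t in nhds t0. y(k := t) \<in> Y" unfolding t0_def by (rule eventually_line[OF Yo y k])
    moreover have "\<forall>\<^sub>F t in nhds t0. (if k = i then x else x(k := t)) \<in> Q"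
    proof (cases "k = i")
      case False
      then have "x k = t0" using x by (simp add: t0_def)
      then show ?thesis using eventually_line[OF Qo x(1) k] False by simp
    qed (use x in simp)
    ultimately have ev: "\<forall>\<^sub>F t in nhds t0. y(k := t) \<in> Y \<and> (if k = i then x else x(k := t)) \<in> Q"
      by (rule eventually_conj)
    define base where "base t = (if k = i then x else x(k := t))" for t
    have hh: "h (y(k := t)) = (base t)(i := s t)" if "y(k := t) \<in> Y" for t
    proof -
      have "h (y(k := t)) = (y(k := t))(i := s t)" using hg[OF that] by (simp add: s_def)
      also have "\<dots> = (base t)(i := s t)" by (subst x(2)) (auto simp: base_def fun_eq_iff)
      finally show ?thesis .
    qed
    have bi: "base t i = x i" for t by (simp add: base_def)
    have ex: "\<exists>z. z \<in> closed_segment (x i) (s t) \<and> \<nu> t = G' i ((base t)(i := z)) * (s t - x i)"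
      if "y(k := t) \<in> Y" "base t \<in> Q" for t
    proof -
      have "(base t)(i := s t) \<in> Q" using hY(1)[OF that(1)] hh[OF that(1)] by simp
      from mvt[OF that(2) this] obtain z where z: "z \<in> closed_segment (base t i) (s t)"
        "G ((base t)(i := s t)) - G (base t) = G' i ((base t)(i := z)) * (s t - base t i)" by blast
      have "G ((base t)(i := s t)) = (y(k := t)) i"
        using Gg[OF that(1)] hg[OF that(1)] hh[OF that(1)] by simp
      then show ?thesis using z bi by (auto simp: \<nu>_def base_def)
    qed
    define z where "z t = (SOME z. z \<in> closed_segment (x i) (s t) \<and> \<nu> t = G' i ((base t)(i := z)) * (s t - x i))" for t
    have z: "z t \<in> closed_segment (x i) (s t)" "\<nu> t = G' i ((base t)(i := z t)) * (s t - x i)"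
      if "y(k := t) \<in> Y" "base t \<in> Q" for t
      using someI_ex[OF ex[OF that]] by (auto simp: z_def)
    have scont: "(s \<longlongrightarrow> x i) (nhds t0)"
    proof -
      have "isCont s t0"
      proof -
        obtain e where e: "e > 0" "\<And>t. \<bar>t - y k\<bar> < e \<Longrightarrow> y(k := t) \<in> Y" using openin_eucl_line[OF Yo y k] by metis
        have "continuous_on (ball t0 e) s" unfolding s_def
        proof (rule continuous_on_compose2[OF gcont])
          show "continuous_on (ball t0 e) (\<lambda>t. y(k := t))"
          proof (rule continuous_on_coordinatewise_then_product)
            show "continuous_on (ball t0 e) (\<lambda>t. (y(k := t)) j)" for j
              by (cases "j = k") (auto intro: continuous_intros)
          qed
          show "(\<lambda>t. y(k := t)) ` ball t0 e \<subseteq> Y" using e(2) by (auto simp: t0_def dist_real_def abs_minus_commute)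
        qed
        then show ?thesis using e(1) continuous_on_interior[of "ball t0 e" s t0] by (simp add: interior_open)
      qed
      then show ?thesis using tendsto_at_iff_tendsto_nhds[of s t0] st0 by (simp add: isCont_def)
    qed
    have nu: "(\<nu> has_real_derivative (if k = i then 1 else - G' k x)) (at t0)"
    proof (cases "k = i")
      case True
      then show ?thesis unfolding \<nu>_def by (auto intro!: derivative_eq_intros)
    next
      case False
      have "x k = t0" using x(2) False by (simp add: t0_def)
      have "((\<lambda>t. G (x(k := t))) has_real_derivative G' k x) (at t0)"
        using G'(1)[OF k, of x] x(1) QW \<open>x k = t0\<close> by auto
      from DERIV_diff[OF DERIV_const[of "y i"] this] False show ?thesis by (simp add: \<nu>_def[abs_def])
    qed
    have nu0: "\<nu> t0 = 0"
    proof (cases "k = i")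
      case True
      have "y i = G x" using arg_cong[OF x(2), of "\<lambda>y. y i"] by simp
      then show ?thesis using True by (simp add: \<nu>_def t0_def)
    next
      case False
      then have "x(k := t0) = x" using x(2) by (auto simp: t0_def)
      moreover have "y i = G x" using arg_cong[OF x(2), of "\<lambda>y. y i"] by simp
      ultimately show ?thesis using False by (simp add: \<nu>_def)
    qed
    have lim1: "((\<lambda>t. \<nu> t / (t - t0)) \<longlongrightarrow> (if k = i then 1 else - G' k x)) (at t0)"
      using nu nu0 by (simp add: has_field_derivative_iff)
    have lim2: "((\<lambda>t. G' i ((base t)(i := z t))) \<longlongrightarrow> G' i x) (at t0)"
    proof (rule tendstoI)
      fix e :: real assume "e > 0"
      obtain q where q: "q > 0" "cube n x q \<subseteq> W" "\<And>v. v \<in> cube n x q \<Longrightarrow> \<bar>G' i v - G' i x\<bar> < e"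
        using continuous_on_cube[OF W smooth_on_open_continuous[OF W G'(2)[OF i]] _ \<open>e > 0\<close>, of x] x(1) QW by blast
      have "\<forall>\<^sub>F t in nhds t0. dist t t0 < q" using q(1) by (auto simp: eventually_nhds_metric)
      moreover have "\<forall>\<^sub>F t in nhds t0. dist (s t) (x i) < q" using tendstoD[OF scont q(1)] .
      ultimately have "\<forall>\<^sub>F t in nhds t0. dist (G' i ((base t)(i := z t))) (G' i x) < e"
        using ev
      proof eventually_elim
        case (elim t)
        then have zt: "z t \<in> closed_segment (x i) (s t)" using z by (simp add: base_def)
        then have "\<bar>z t - x i\<bar> < q" using elim(2) by (auto simp: closed_segment_eq_real_ivl dist_real_def split: if_splits)
        moreover have "base t \<in> cube n x q"
        proof -
          have "base t \<in> eucl n" using elim(3) Qe by (auto simp: base_def)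
          moreover have "\<bar>base t l - x l\<bar> < q" for l
          proof (cases "l = k \<and> k \<noteq> i")
            case True
            then have "x k = t0" using x(2) by (simp add: t0_def)
            then show ?thesis using True elim(1) by (simp add: base_def dist_real_def)
          next
            case False
            then show ?thesis using q(1) by (auto simp: base_def)
          qed
          ultimately show ?thesis by (simp add: cube_def)
        qed
        ultimately have "(base t)(i := z t) \<in> cube n x q" using cube_upd[of "base t" n x q i] i by simp
        then show ?case using q(3) by (simp add: dist_real_def)
      qed
      then show "\<forall>\<^sub>F t in at t0. dist (G' i ((base t)(i := z t))) (G' i x) < e"
        unfolding eventually_at_filter by (rule eventually_mono) simp
    qed
    have px: "G' i x \<noteq> 0" using pos[OF x(1)] by simp
    from tendsto_mult[OF lim1 tendsto_inverse[OF lim2 px]]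
    have "((\<lambda>t. \<nu> t / (t - t0) * inverse (G' i ((base t)(i := z t)))) \<longlongrightarrow> g' k y) (at t0)"
      by (simp only: g'_def x_def)
    moreover have "\<forall>\<^sub>F t in at t0. \<nu> t / (t - t0) * inverse (G' i ((base t)(i := z t))) = (s t - s t0) / (t - t0)"
      unfolding eventually_at_filter
      using ev
    proof eventually_elim
      case (elim t)
      then have e: "y(k := t) \<in> Y" "base t \<in> Q" by (auto simp: base_def)
      have "(base t)(i := s t) \<in> Q" using hY(1)[OF e(1)] hh[OF e(1)] by simp
      then have "(base t)(i := z t) \<in> Q" using Qseg[OF e(2), of "s t" "z t"] z(1)[OF e] bi by simp
      then have "G' i ((base t)(i := z t)) \<noteq> 0" using pos by fastforce
      then show ?case unfolding st0 z(2)[OF e] by simp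
    qed
    ultimately have "((\<lambda>t. (s t - s t0) / (t - t0)) \<longlongrightarrow> g' k y) (at t0)"
      by (rule Lim_transform_eventually)
    then show ?thesis by (simp add: has_field_derivative_iff s_def t0_def)
  qed
  \<comment> \<open>Bootstrapping: the partial derivatives of \<open>g\<close> are smooth functions
    of \<open>h\<close>, and \<open>h\<close> differs from the identity only in the coordinate
    \<open>g\<close>, so order \<open>k\<close> yields order \<open>k + 1\<close>.\<close>
  have "Ck_open k n Y g" for k
  proof (induction k)
    case 0
    then show ?case using gcont Ye by (simp add: Ck_0)
  next
    case (Suc k)
    have hj: "Ck_open k n Y (\<lambda>y. h y j)" for j
    proof (cases "j = i")
      case True
      then show ?thesis using Suc by (simp add: g_def[abs_def])
    next
      case False
      then show ?thesis using Ck_cong[OF Yo, of "\<lambda>y. y j" "\<lambda>y. h y j"] Ck_coord[OF Ye] hg by simp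
    qed
    have hQ: "h ` Y \<subseteq> Q" using hY by blast
    show ?case
    proof (rule Ck_SucI[OF Ye gcont])
      fix j assume j: "j < n"
      have "smooth_on n Q (G' l)" if "l < n" for l using smooth_on_subset[OF G'(2)[OF that] QW] .
      then have "smooth_on n Q (\<lambda>x. (if j = i then 1 else - G' j x) * inverse (G' i x))"
        using i j pos by (cases "j = i"; force intro!: smooth_on_mult smooth_on_inverse smooth_on_const smooth_on_minus Qe)
      from Ck_compose[OF Yo Qo hQ hj smooth_on_openD[OF Qo this]] have "Ck_open k n Y (g' j)"
        by (simp add: g'_def[abs_def])
      then show "\<exists>f'. (\<forall>y\<in>Y. ((\<lambda>t. g (y(j := t))) has_real_derivative f' y) (at (y j))) \<and> Ck_open k n Y f'"
        using gder[OF _ j] by (intro exI[of _ "g' j"]) simp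
    qed
  qed
  then have "smooth_on n Y g" by (rule smooth_on_openI[OF Yo])
  then show thesis
    using that[of r g] r mono Yo hE unfolding Y_def E_def Q_def g_def by auto
qed

section \<open>Flat functions and cutoffs\<close>

definition hump :: "real \<Rightarrow> real" where
  "hump t = (if 0 < t then exp (- (1 / t)) else 0)"

lemma poly_exp_tendsto_0: "((\<lambda>u::real. poly p u * exp (- u)) \<longlongrightarrow> 0) at_top"
proof -
  have "((\<lambda>u. \<Sum>i\<le>degree p. Polynomial.coeff p i * (u ^ i / exp u)) \<longlongrightarrow> (\<Sum>i\<le>degree p. Polynomial.coeff p i * 0)) at_top"
    by (intro tendsto_sum tendsto_mult tendsto_const tendsto_power_div_exp_0)
  then show ?thesis
    by (simp add: poly_altdef sum_distrib_right sum_divide_distrib exp_minus field_simps)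
qed

text \<open>The functions \<open>p(1/t) exp(-1/t)\<close>, extended by 0, form a family closed under
  differentiation: the derivative belongs to the polynomial \<open>X^2 (p - p')\<close>, and at 0
  the exponential beats every polynomial.\<close>

lemma smooth_on_hump:
  assumes "smooth_on n S f"
  shows "smooth_on n S (\<lambda>x. hump (f x))"
proof -
  define h where "h p t = (if 0 < t then poly p (1 / t) * exp (- (1 / t)) else 0)" for p and t :: real
  have der: "(h p has_real_derivative h ([:0, 0, 1:] * (p - pderiv p)) t) (at t)" for p t
  proof -
    consider "t > 0" | "t < 0" | "t = 0" by linarith
    then show ?thesis
    proof cases
      case 1
      have "((\<lambda>t. poly p (1 / t) * exp (- (1 / t))) has_real_derivative
          poly p (1 / t) * (exp (- (1 / t)) * (1 / t\<^sup>2)) + poly (pderiv p) (1 / t) * (- (1 / t\<^sup>2)) * exp (- (1 / t))) (at t)"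
      proof (rule DERIV_mult')
        have d: "((\<lambda>t. 1 / t) has_real_derivative - (1 / t\<^sup>2)) (at t)"
          using 1 by (auto intro!: derivative_eq_intros simp: power2_eq_square)
        show "((\<lambda>t. poly p (1 / t)) has_real_derivative poly (pderiv p) (1 / t) * (- (1 / t\<^sup>2))) (at t)"
          by (rule DERIV_chain2[OF poly_DERIV d])
        show "((\<lambda>t. exp (- (1 / t))) has_real_derivative exp (- (1 / t)) * (1 / t\<^sup>2)) (at t)"
          by (rule DERIV_chain2[OF DERIV_exp]) (use DERIV_minus[OF d] in simp)
      qed
      moreover have "poly p (1 / t) * (exp (- (1 / t)) * (1 / t\<^sup>2)) + poly (pderiv p) (1 / t) * (- (1 / t\<^sup>2)) * exp (- (1 / t))
          = h ([:0, 0, 1:] * (p - pderiv p)) t"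
        using 1 by (simp add: h_def algebra_simps power2_eq_square)
      moreover have "\<forall>\<^sub>F s in nhds t. poly p (1 / s) * exp (- (1 / s)) = h p s"
        using eventually_nhds_in_open[of "{0<..}" t] 1 by (auto elim!: eventually_mono simp: h_def)
      ultimately show ?thesis using DERIV_cong_ev[OF refl _ refl] by metis
    next
      case 2
      have "\<forall>\<^sub>F s in nhds t. h p s = 0"
        using eventually_nhds_in_open[of "{..<0}" t] 2 by (auto elim!: eventually_mono simp: h_def)
      from DERIV_cong_ev[OF refl this refl, of 0] have "(h p has_real_derivative 0) (at t)" by simp
      moreover have "h ([:0, 0, 1:] * (p - pderiv p)) t = 0" using 2 by (simp add: h_def)
      ultimately show ?thesis by simp
    next
      case 3
      \<comment> \<open>The factor \<open>[:0, 1:]\<close> absorbs the division by \<open>s\<close>: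
        with \<open>u = 1/s\<close> the quotient is \<open>u p(u) exp(-u)\<close>.\<close>
      have "((\<lambda>s. h p s / s) \<longlongrightarrow> 0) (at_right 0)"
      proof -
        have "((\<lambda>s. poly ([:0, 1:] * p) (inverse s) * exp (- inverse s)) \<longlongrightarrow> 0) (at_right (0::real))"
          by (rule filterlim_compose[OF poly_exp_tendsto_0 filterlim_inverse_at_top_right])
        moreover have "\<forall>\<^sub>F s in at_right 0. poly ([:0, 1:] * p) (inverse s) * exp (- inverse s) = h p s / s"
          by (auto simp: eventually_at_right_field h_def field_simps intro!: exI[of _ 1])
        ultimately show ?thesis by (rule Lim_transform_eventually)
      qed
      moreover have "((\<lambda>s. h p s / s) \<longlongrightarrow> 0) (at_left 0)"
        by (rule Lim_transform_eventually[OF tendsto_const])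
          (auto simp: eventually_at_left_field h_def intro!: exI[of _ "-1"])
      ultimately have "((\<lambda>s. h p s / s) \<longlongrightarrow> 0) (at 0)" by (simp add: filterlim_split_at)
      then show ?thesis using 3 by (simp add: has_field_derivative_iff h_def)
    qed
  qed
  define P where "P \<phi> \<longleftrightarrow> (\<exists>p. \<phi> = h p)" for \<phi>
  have *: "\<exists>\<phi>'. P \<phi>' \<and> (\<forall>t\<in>UNIV. (\<phi> has_real_derivative \<phi>' t) (at t))" if \<phi>: "P \<phi>" for \<phi>
  proof -
    obtain p where "\<phi> = h p" using \<phi> by (auto simp: P_def)
    then show ?thesis using der[of p] by (intro exI[of _ "h ([:0, 0, 1:] * (p - pderiv p))"]) (auto simp: P_def)
  qed
  have "hump = h 1" by (auto simp: hump_def h_def fun_eq_iff)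
  then have "P hump" by (auto simp: P_def)
  show ?thesis by (rule smooth_on_fun1[OF assms _ open_UNIV \<open>P hump\<close> *]) simp
qed

text \<open>A transition from 1 (for \<open>t \<le> 1\<close>) to 0 (for \<open>t \<ge> 2\<close>).
  It is applied to squared distances, which are smooth, rather than to absolute values.\<close>

definition smooth_step :: "real \<Rightarrow> real" where
  "smooth_step t = hump (2 - t) / (hump (2 - t) + hump (t - 1))"

lemma smooth_step_denominator: "hump (2 - t) + hump (t - 1) > 0"
proof -
  have "hump s \<ge> 0" "s > 0 \<Longrightarrow> hump s > 0" for s by (auto simp: hump_def)
  then show ?thesis
    by (cases "t < 2") (auto intro: add_pos_nonneg add_nonneg_pos)
qed

lemma smooth_step_1: "t \<le> 1 \<Longrightarrow> smooth_step t = 1"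
  using smooth_step_denominator[of t] by (auto simp: smooth_step_def hump_def)

lemma smooth_step_0: "t \<ge> 2 \<Longrightarrow> smooth_step t = 0"
  by (auto simp: smooth_step_def hump_def)

lemma smooth_on_smooth_step:
  assumes "S \<subseteq> eucl n" "smooth_on n S f"
  shows "smooth_on n S (\<lambda>x. smooth_step (f x))"
  unfolding smooth_step_def
proof (rule smooth_on_divide)
  show "hump (2 - f x) + hump (f x - 1) \<noteq> 0" for x using smooth_step_denominator[of "f x"] by simp
qed (intro smooth_on_hump smooth_on_add smooth_on_diff smooth_on_const assms)+

text \<open>A product of compact intervals, with the singleton of 0 as factor in every coordinate
  from \<open>n\<close> on.\<close>

lemma compactin_closed_cube: "compactin (Euclidean_space n) {x \<in> eucl n. \<forall>i<n. \<bar>x i - p i\<bar> \<le> r}"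
proof -
  define I where "I i = (if i < n then {p i - r..p i + r} else {0})" for i
  have "{x \<in> eucl n. \<forall>i<n. \<bar>x i - p i\<bar> \<le> r} = (\<Pi>\<^sub>E i\<in>UNIV. I i)"
  proof (rule Set.set_eqI)
    fix x
    have "(\<forall>i. x i \<in> I i) \<longleftrightarrow> (\<forall>i\<ge>n. x i = 0) \<and> (\<forall>i<n. \<bar>x i - p i\<bar> \<le> r)"
      by (auto simp: I_def abs_le_iff not_less split: if_splits)
    then show "x \<in> {x \<in> eucl n. \<forall>i<n. \<bar>x i - p i\<bar> \<le> r} \<longleftrightarrow> x \<in> (\<Pi>\<^sub>E i\<in>UNIV. I i)"
      by (auto simp: in_eucl PiE_UNIV_domain)
  qed
  moreover have "compactin (powertop_real UNIV) (\<Pi>\<^sub>E i\<in>UNIV. I i)"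
    by (auto simp: compactin_PiE I_def compact_sing)
  ultimately show ?thesis
    by (auto simp: Euclidean_space_def compactin_subtopology in_eucl)
qed

text \<open>Replaces a germ at \<open>p\<close> by a function on all of \<open>\<real>^n\<close>
  that vanishes off a compact subset of the domain. Compactness survives transport by a chart and
  becomes closedness in a Hausdorff space, which permits extension by zero there.\<close>

lemma smooth_cutoff:
  assumes W: "openin (Euclidean_space n) W" and p: "p \<in> W" and g: "smooth_on n W g"
  obtains G V K where "smooth_on n (eucl n) G" "openin (Euclidean_space n) V" "p \<in> V" "V \<subseteq> W"
    "\<And>x. x \<in> V \<Longrightarrow> G x = g x" "compactin (Euclidean_space n) K" "K \<subseteq> W"
    "\<And>x. x \<in> eucl n \<Longrightarrow> x \<notin> K \<Longrightarrow> G x = 0"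
proof -
  obtain r where r: "r > 0" "cube n p r \<subseteq> W" using openin_contains_cube[OF W p] by metis
  define K where "K = {x \<in> eucl n. \<forall>i<n. \<bar>x i - p i\<bar> \<le> r / 2}"
  have KW: "K \<subseteq> W" using r by (force simp: K_def cube_def)
  have K: "compactin (Euclidean_space n) K" unfolding K_def by (rule compactin_closed_cube)
  have Kc: "openin (Euclidean_space n) (eucl n - K)"
    using compactin_imp_closedin[OF _ K] metrizable_imp_Hausdorff_space[OF metrizable_Euclidean_space]
    by (auto simp: closedin_def)
  \<comment> \<open>The factor \<open>8 / r^2\<close> makes the argument at least 2 once some
    coordinate is off by \<open>r / 2\<close>, and at most 1 within \<open>r / 4\<close>.\<close>
  define b where "b x = (\<Prod>i<n. smooth_step (8 * (x i - p i)\<^sup>2 / r\<^sup>2))" for x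
  have sb: "smooth_on n (eucl n) b" unfolding b_def
    by (intro smooth_on_prod smooth_on_smooth_step smooth_on_divide smooth_on_mult smooth_on_power
        smooth_on_diff smooth_on_const smooth_on_coord order_refl) (use r in auto)
  have b0: "b x = 0" if x: "x \<in> eucl n" "x \<notin> K" for x
  proof -
    obtain i where i: "i < n" "\<bar>x i - p i\<bar> > r / 2" using x unfolding K_def by (auto simp: not_le)
    have "(r / 2)\<^sup>2 \<le> (x i - p i)\<^sup>2" by (subst abs_le_square_iff[symmetric]) (use i r in auto)
    then have "smooth_step (8 * (x i - p i)\<^sup>2 / r\<^sup>2) = 0"
      using r by (intro smooth_step_0) (simp add: field_simps power2_eq_square)
    then show ?thesis unfolding b_def using i by (intro prod_zero) auto
  qed
  define V where "V = cube n p (r / 4)"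
  have b1: "b x = 1" if "x \<in> V" for x
    unfolding b_def
  proof (intro prod.neutral ballI smooth_step_1)
    fix i assume "i \<in> {..<n}"
    then have "\<bar>x i - p i\<bar> \<le> r / 4" using that by (force simp: V_def cube_def)
    then have "(x i - p i)\<^sup>2 \<le> (r / 4)\<^sup>2" using r by (intro power2_le_iff_abs_le[THEN iffD2]) auto
    then have "16 * (x i - p i)\<^sup>2 \<le> r\<^sup>2" by (simp add: power_divide)
    then have "8 * (x i - p i)\<^sup>2 \<le> r\<^sup>2" using zero_le_power2[of r] by linarith
    then show "8 * (x i - p i)\<^sup>2 / r\<^sup>2 \<le> 1" using r by simp
  qed
  define G where "G x = (if x \<in> W then b x * g x else 0)" for x
  have "smooth_on n (eucl n) G"
  proof (rule smooth_on_localI)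
    fix x assume x: "x \<in> eucl n"
    show "\<exists>W. openin (Euclidean_space n) W \<and> x \<in> W \<and> smooth_on n (eucl n \<inter> W) G"
    proof (cases "x \<in> W")
      case True
      have "smooth_on n W (\<lambda>x. b x * g x)"
        using smooth_on_subset[OF sb openin_eucl_subset[OF W]] g by (rule smooth_on_mult)
      then have "smooth_on n W G" by (rule smooth_on_eq) (simp add: G_def)
      then show ?thesis using True W openin_eucl_subset[OF W] by (intro exI[of _ W]) (simp add: Int_absorb1)
    next
      case False
      have "smooth_on n (eucl n - K) G"
        by (rule smooth_on_eq[OF smooth_on_const[of _ n 0]]) (use b0 in \<open>auto simp: G_def\<close>)
      then show ?thesis using False KW Kc x by (intro exI[of _ "eucl n - K"]) (auto simp: Int_absorb1)
    qed
  qed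
  moreover have "V \<subseteq> W" using r cube_mono[of "r/4" r n p] by (auto simp: V_def)
  moreover have "p \<in> V" using p r openin_eucl_subset[OF W] by (auto simp: V_def intro: cube_center)
  moreover have "G x = g x" if "x \<in> V" for x using b1[OF that] that \<open>V \<subseteq> W\<close> by (auto simp: G_def)
  moreover have "G x = 0" if "x \<in> eucl n" "x \<notin> K" for x using b0[OF that] by (simp add: G_def)
  moreover have "openin (Euclidean_space n) V" unfolding V_def by (rule openin_cube)
  ultimately show thesis using that[of G V K] K KW by blast
qed

section \<open>Manifold structures determined by their smooth functions\<close>

lemma is_chartD:
  assumes "is_chart E X (U, \<phi>)"
  shows "openin X U" "\<phi> \<in> extensional U" "openin E (\<phi> ` U)"
    "homeomorphic_map (subtopology X U) (subtopology E (\<phi> ` U)) \<phi>"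
    "inj_on \<phi> U" "U \<subseteq> topspace X" "\<phi> ` U \<subseteq> topspace E"
proof -
  show *: "openin X U" "\<phi> \<in> extensional U" "openin E (\<phi> ` U)"
    "homeomorphic_map (subtopology X U) (subtopology E (\<phi> ` U)) \<phi>"
    using assms by (auto simp: is_chart_def)
  show U: "U \<subseteq> topspace X" "\<phi> ` U \<subseteq> topspace E" using * openin_subset by auto
  show "inj_on \<phi> U" using homeomorphic_imp_injective_map[OF *(4)] U by (simp add: inf_absorb2)
qed

lemma chart_inv: "is_chart E X (U, \<phi>) \<Longrightarrow> x \<in> U \<Longrightarrow> inv_into U \<phi> (\<phi> x) = x"
  by (simp add: is_chartD(5))

lemma chart_image_open:
  assumes c: "is_chart E X (U, \<phi>)" and N: "openin X N"
  shows "openin E (\<phi> ` (U \<inter> N))"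
proof -
  have "openin (subtopology X U) (U \<inter> N)" using N by (simp add: openin_subtopology_Int2)
  then have "openin (subtopology E (\<phi> ` U)) (\<phi> ` (U \<inter> N))"
    using homeomorphic_imp_open_map[OF is_chartD(4)[OF c]] by (simp add: open_map_def)
  then show ?thesis using is_chartD(3)[OF c] by (meson openin_trans_full)
qed

lemma chart_vimage_open:
  assumes c: "is_chart E X (U, \<phi>)" and W: "openin E W"
  shows "openin X {x \<in> U. \<phi> x \<in> W}"
proof -
  note U = is_chartD[OF c]
  have "continuous_map (subtopology X U) E \<phi>"
    using homeomorphic_imp_continuous_map[OF U(4)] continuous_map_into_fulltopology by blast
  from openin_continuous_map_preimage[OF this W]
  have "openin (subtopology X U) {x \<in> U. \<phi> x \<in> W}" using U(6) by (simp add: inf_absorb2)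
  then show ?thesis using U(1) by (meson openin_trans_full)
qed

lemma chart_inv_continuous:
  assumes c: "is_chart E X (U, \<phi>)"
  shows "continuous_map (subtopology E (\<phi> ` U)) X (inv_into U \<phi>)"
proof -
  note U = is_chartD[OF c]
  obtain g where g: "homeomorphic_maps (subtopology X U) (subtopology E (\<phi> ` U)) \<phi> g"
    using U(4) homeomorphic_map_maps by blast
  have gc: "continuous_map (subtopology E (\<phi> ` U)) X g"
    using g by (auto simp: homeomorphic_maps_def intro: continuous_map_into_fulltopology)
  moreover have "g y = inv_into U \<phi> y" if "y \<in> topspace (subtopology E (\<phi> ` U))" for y
    using that g U by (auto simp: homeomorphic_maps_def)
  ultimately show ?thesis by (rule continuous_map_eq)
qed

text \<open>In this encoding \<open>\<real>^m\<close> is a subset of \<open>\<real>^n\<close> for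
  \<open>m \<le> n\<close>. If \<open>m < n\<close>, the transition map is a continuous injection of
  an open subset of \<open>\<real>^n\<close> into \<open>\<real>^n\<close>, so its image is open by
  invariance of domain, although coordinate \<open>m\<close> vanishes on it. Equality of dimensions
  follows by exchanging the charts.\<close>

lemma chart_dimension_unique:
  assumes c: "is_chart (Euclidean_space n) X (U, \<phi>)" and d: "is_chart (Euclidean_space m) X (V, \<psi>)"
    and p: "p \<in> U" "p \<in> V"
  shows "n \<le> m"
proof (rule ccontr)
  assume "\<not> n \<le> m"
  then have mn: "m < n" by simp
  note U = is_chartD[OF c] and V = is_chartD[OF d]
  define S where "S = \<phi> ` (U \<inter> V)"
  define f where "f = \<psi> \<circ> inv_into U \<phi>"
  have S: "openin (Euclidean_space n) S" unfolding S_def using chart_image_open[OF c V(1)] .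
  have Se: "S \<subseteq> eucl n" using openin_eucl_subset[OF S] .
  have inv: "inv_into U \<phi> ` S = U \<inter> V" using chart_inv[OF c] by (force simp: S_def)
  have c1: "continuous_map (subtopology (Euclidean_space n) S) (subtopology X V) (inv_into U \<phi>)"
    using continuous_map_from_subtopology_mono[OF chart_inv_continuous[OF c], of S] inv
    by (auto simp: S_def continuous_map_in_subtopology)
  have "continuous_map (subtopology X V) (Euclidean_space m) \<psi>"
    using homeomorphic_imp_continuous_map[OF V(4)] continuous_map_into_fulltopology by blast
  from continuous_map_compose[OF c1 this]
  have "continuous_map (subtopology (Euclidean_space n) S) (Euclidean_space m) f" by (simp add: f_def)
  then have fc: "continuous_on S f" "f ` S \<subseteq> eucl m"
    using Se by (auto simp: cm_Euclidean_space_iff_continuous_on inf_absorb2)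
  moreover have "f ` S \<subseteq> eucl n" using fc(2) mn by (auto simp: in_eucl)
  ultimately have "continuous_map (subtopology (Euclidean_space n) S) (Euclidean_space n) f"
    using Se by (auto simp: cm_Euclidean_space_iff_continuous_on inf_absorb2)
  moreover have "inj_on f S"
    unfolding f_def S_def using chart_inv[OF c] V(5) by (auto simp: inj_on_def)
  ultimately have "openin (Euclidean_space n) (f ` S)"
    using S invariance_of_domain_Euclidean_space by blast
  moreover have "f (\<phi> p) \<in> f ` S" using p by (auto simp: S_def)
  ultimately obtain e where e: "e > 0" "\<And>t. \<bar>t - f (\<phi> p) m\<bar> < e \<Longrightarrow> (f (\<phi> p))(m := t) \<in> f ` S"
    using openin_eucl_line mn by metis
  have z: "y m = 0" if "y \<in> f ` S" for y using fc(2) that by (auto simp: in_eucl)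
  have "(f (\<phi> p))(m := f (\<phi> p) m + e / 2) \<in> f ` S" by (rule e(2)) (use e(1) in simp)
  from z[OF this] z[OF \<open>f (\<phi> p) \<in> f ` S\<close>] show False using e(1) by simp
qed

text \<open>
  \<open>F\<close> abstracts the set of smooth functions.  A chart is admissible if \<open>F\<close> pulls back to smooth
  functions and the coordinates are locally members of \<open>F\<close>; then transition maps between any two
  admissible charts are automatically smooth.
\<close>

locale function_sheaf =
  fixes X :: "'a topology" and F :: "('a \<Rightarrow> real) set"
  assumes local: "\<And>h. (\<And>p. p \<in> topspace X \<Longrightarrow> \<exists>N h'. openin X N \<and> p \<in> N \<and> h' \<in> F \<and> (\<forall>q\<in>N. h q = h' q)) \<Longrightarrow> h \<in> F"
    and comp: "\<And>m G hs. smooth_on m (eucl m) G \<Longrightarrow> (\<And>j. j < m \<Longrightarrow> hs j \<in> F) \<Longrightarrow>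
      (\<lambda>q. G (\<lambda>j. if j < m then hs j q else 0)) \<in> F"
begin

definition sheaf_chart :: "nat \<Rightarrow> 'a chart \<Rightarrow> bool" where
  "sheaf_chart n = (\<lambda>(U, \<phi>). is_chart (Euclidean_space n) X (U, \<phi>) \<and>
     (\<forall>h\<in>F. smooth_on n (\<phi> ` U) (h \<circ> inv_into U \<phi>)) \<and>
     (\<forall>p\<in>U. \<forall>j<n. \<exists>h\<in>F. \<exists>N. openin X N \<and> p \<in> N \<and> N \<subseteq> U \<and> (\<forall>q\<in>N. \<phi> q j = h q)))"

lemma sheaf_chartD:
  assumes "sheaf_chart n (U, \<phi>)"
  shows "is_chart (Euclidean_space n) X (U, \<phi>)"
    "\<And>h. h \<in> F \<Longrightarrow> smooth_on n (\<phi> ` U) (h \<circ> inv_into U \<phi>)"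
    "\<And>p j. p \<in> U \<Longrightarrow> j < n \<Longrightarrow> \<exists>h\<in>F. \<exists>N. openin X N \<and> p \<in> N \<and> N \<subseteq> U \<and> (\<forall>q\<in>N. \<phi> q j = h q)"
  using assms by (auto simp: sheaf_chart_def)

text \<open>The coordinates are locally members of \<open>F\<close>, and \<open>F\<close> is closed
  under composition with smooth functions on all of \<open>\<real>^n\<close>;
  \<open>smooth_cutoff\<close> supplies such a function with the germ of \<open>g\<close>.\<close>

lemma sheaf_chart_lift:
  assumes c: "sheaf_chart n (U, \<phi>)" and p: "p \<in> U" and S: "openin (Euclidean_space n) S" "\<phi> p \<in> S"
    and g: "smooth_on n S g"
  shows "\<exists>h\<in>F. \<exists>N. openin X N \<and> p \<in> N \<and> N \<subseteq> U \<and> (\<forall>q\<in>N. \<phi> q \<in> S \<and> h q = g (\<phi> q))"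
proof -
  note ch = sheaf_chartD(1)[OF c] and U = is_chartD[OF sheaf_chartD(1)[OF c]]
  obtain G V where G: "smooth_on n (eucl n) G" "openin (Euclidean_space n) V" "\<phi> p \<in> V" "V \<subseteq> S"
    "\<And>x. x \<in> V \<Longrightarrow> G x = g x" using smooth_cutoff[OF S g] by metis
  have "\<forall>j\<in>{..<n}. \<exists>h N. h \<in> F \<and> openin X N \<and> p \<in> N \<and> N \<subseteq> U \<and> (\<forall>q\<in>N. \<phi> q j = h q)"
    using sheaf_chartD(3)[OF c p] by (meson lessThan_iff)
  then obtain h N where hN: "\<And>j. j < n \<Longrightarrow> h j \<in> F" "\<And>j. j < n \<Longrightarrow> openin X (N j)" "\<And>j. j < n \<Longrightarrow> p \<in> N j"
    "\<And>j q. j < n \<Longrightarrow> q \<in> N j \<Longrightarrow> \<phi> q j = h j q"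
    unfolding Ball_def lessThan_iff by metis
  define M where "M = {x \<in> U. \<phi> x \<in> V} \<inter> (\<Inter>j\<in>{..<n}. N j)"
  have "openin X M"
  proof (cases "n = 0")
    case False
    then have "openin X (\<Inter> (N ` {..<n}))" using hN(2) openin_Inter[of "N ` {..<n}"] by auto
    then show ?thesis using chart_vimage_open[OF ch G(2)] unfolding M_def by blast
  qed (simp add: M_def chart_vimage_open[OF ch G(2)])
  moreover have "p \<in> M" "M \<subseteq> U" using p G(3) hN(3) by (auto simp: M_def)
  moreover have "\<phi> q \<in> S \<and> G (\<lambda>j. if j < n then h j q else 0) = g (\<phi> q)" if q: "q \<in> M" for q
  proof -
    have "\<phi> q \<in> eucl n" using q U(7) by (auto simp: M_def)
    then have "(\<lambda>j. if j < n then h j q else 0) = \<phi> q"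
      using hN(4)[of _ q] q by (auto simp: M_def fun_eq_iff in_eucl)
    then show ?thesis using q G by (auto simp: M_def)
  qed
  moreover have "(\<lambda>q. G (\<lambda>j. if j < n then h j q else 0)) \<in> F" using comp G(1) hN(1) by blast
  ultimately show ?thesis by (intro bexI[of _ "\<lambda>q. G (\<lambda>j. if j < n then h j q else 0)"] exI[of _ M]) auto
qed

text \<open>A coordinate of \<open>\<psi>\<close> is locally a member of \<open>F\<close>, and
  members are smooth when read in \<open>\<phi>\<close>.\<close>

lemma sheaf_chart_transition:
  assumes c: "sheaf_chart n (U, \<phi>)" and d: "sheaf_chart m (V, \<psi>)"
  shows "smooth_map_on n (\<phi> ` (U \<inter> V)) (\<psi> \<circ> inv_into U \<phi>)"
  unfolding smooth_map_on_def
proof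
  fix j
  note ch = sheaf_chartD(1)[OF c] and U = is_chartD[OF sheaf_chartD(1)[OF c]]
  note V = is_chartD[OF sheaf_chartD(1)[OF d]]
  have S: "\<phi> ` (U \<inter> V) \<subseteq> eucl n" using U(7) by blast
  show "smooth_on n (\<phi> ` (U \<inter> V)) (\<lambda>x. (\<psi> \<circ> inv_into U \<phi>) x j)"
  proof (cases "j < m")
    case False
    have "(\<psi> \<circ> inv_into U \<phi>) x j = 0" if "x \<in> \<phi> ` (U \<inter> V)" for x
      using that chart_inv[OF ch] V(7) False by (auto simp: in_eucl image_subset_iff)
    then show ?thesis using smooth_on_eq[OF smooth_on_const[OF S, of 0]] by simp
  next
    case True
    show ?thesis
    proof (rule smooth_on_localI)
      fix x assume "x \<in> \<phi> ` (U \<inter> V)"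
      then obtain p where p: "p \<in> U" "p \<in> V" "x = \<phi> p" by blast
      obtain h N where h: "h \<in> F" "openin X N" "p \<in> N" "\<forall>q\<in>N. \<psi> q j = h q"
        using sheaf_chartD(3)[OF d p(2) True] by blast
      have "smooth_on n (\<phi> ` (U \<inter> V) \<inter> \<phi> ` (U \<inter> N)) (h \<circ> inv_into U \<phi>)"
        using sheaf_chartD(2)[OF c h(1)] by (rule smooth_on_subset) blast
      then have "smooth_on n (\<phi> ` (U \<inter> V) \<inter> \<phi> ` (U \<inter> N)) (\<lambda>x. (\<psi> \<circ> inv_into U \<phi>) x j)"
        by (rule smooth_on_eq) (use chart_inv[OF ch] h(4) in auto)
      then show "\<exists>W. openin (Euclidean_space n) W \<and> x \<in> W \<and>
          smooth_on n (\<phi> ` (U \<inter> V) \<inter> W) (\<lambda>x. (\<psi> \<circ> inv_into U \<phi>) x j)"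
        using chart_image_open[OF ch h(2)] p h(3) by (intro exI[of _ "\<phi> ` (U \<inter> N)"]) auto
    qed
  qed
qed

lemma sheaf_charts_compatible:
  assumes "sheaf_chart n c" "sheaf_chart n d"
  shows "smoothly_compatible n c d"
proof -
  obtain U \<phi> V \<psi> where eq: "c = (U, \<phi>)" "d = (V, \<psi>)" by (cases c, cases d)
  then show ?thesis
    using sheaf_chart_transition[of n U \<phi> n V \<psi>] sheaf_chart_transition[of n V \<psi> n U \<phi>] assms
    by (simp add: smoothly_compatible_def Int_commute)
qed

text \<open>Maximality rests on the fact that admissibility passes to compatible charts: members
  pull back smoothly through an overlapping admissible chart, and the new coordinates, being smooth
  in the old ones, are lifted to members by \<open>sheaf_chart_lift\<close>. Locality of
  \<open>F\<close> puts every smooth function into \<open>F\<close>.\<close>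

lemma sheaf_atlas:
  assumes cover: "\<And>p. p \<in> topspace X \<Longrightarrow> \<exists>c. sheaf_chart n c \<and> p \<in> fst c"
  shows "maximal_atlas n (Euclidean_space n) X {c. sheaf_chart n c}"
    "smooth_functions n X {c. sheaf_chart n c} = F"
proof -
  let ?B = "{c. sheaf_chart n c}"
  have cov: "\<exists>V \<psi>. sheaf_chart n (V, \<psi>) \<and> p \<in> V" if "p \<in> topspace X" for p
    using cover[OF that] by fastforce
  show "maximal_atlas n (Euclidean_space n) X ?B"
    unfolding maximal_atlas_def
  proof (intro conjI ballI allI impI)
    show "is_chart (Euclidean_space n) X c" if "c \<in> ?B" for c
      using that sheaf_chartD(1) by (cases c) auto
    then have "fst c \<subseteq> topspace X" if "c \<in> ?B" for c
      using that is_chartD(6) by (cases c) fastforce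
    then show "\<Union> (fst ` ?B) = topspace X" using cover by blast
    show "smoothly_compatible n c d" if "c \<in> ?B" "d \<in> ?B" for c d
      using that sheaf_charts_compatible by simp
    fix c assume c: "is_chart (Euclidean_space n) X c \<and> (\<forall>d\<in>?B. smoothly_compatible n c d)"
    obtain U \<phi> where c_eq: "c = (U, \<phi>)" by (cases c)
    have ch: "is_chart (Euclidean_space n) X (U, \<phi>)" using c c_eq by simp
    note U = is_chartD[OF ch]
    have comp: "smooth_map_on n (\<phi> ` (U \<inter> V)) (\<psi> \<circ> inv_into U \<phi>)"
      "smooth_map_on n (\<psi> ` (V \<inter> U)) (\<phi> \<circ> inv_into V \<psi>)" if "sheaf_chart n (V, \<psi>)" for V \<psi>
    proof -
      have "smoothly_compatible n c (V, \<psi>)" using c that by blast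
      then show "smooth_map_on n (\<phi> ` (U \<inter> V)) (\<psi> \<circ> inv_into U \<phi>)"
        "smooth_map_on n (\<psi> ` (V \<inter> U)) (\<phi> \<circ> inv_into V \<psi>)"
        by (simp_all add: c_eq smoothly_compatible_def Int_commute)
    qed
    have "smooth_on n (\<phi> ` U) (h \<circ> inv_into U \<phi>)" if h: "h \<in> F" for h
    proof (rule smooth_on_localI)
      fix x assume "x \<in> \<phi> ` U"
      then obtain p where p: "p \<in> U" "x = \<phi> p" by blast
      obtain V \<psi> where V: "sheaf_chart n (V, \<psi>)" "p \<in> V" using cov p U(6) by blast
      note dh = sheaf_chartD(1)[OF V(1)]
      have "smooth_on n (\<phi> ` (U \<inter> V)) (\<lambda>x. (h \<circ> inv_into V \<psi>) ((\<psi> \<circ> inv_into U \<phi>) x))"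
      proof (rule smooth_on_compose[OF sheaf_chartD(2)[OF V(1) h]])
        show "smooth_on n (\<phi> ` (U \<inter> V)) (\<lambda>x. (\<psi> \<circ> inv_into U \<phi>) x j)" for j
          using comp(1)[OF V(1)] by (simp add: smooth_map_on_def)
        show "(\<psi> \<circ> inv_into U \<phi>) ` \<phi> ` (U \<inter> V) \<subseteq> \<psi> ` V" using chart_inv[OF ch] by auto
      qed (use U(7) is_chartD(7)[OF dh] in auto)
      then have "smooth_on n (\<phi> ` U \<inter> \<phi> ` (U \<inter> V)) (h \<circ> inv_into U \<phi>)"
        by (rule smooth_on_eq[OF smooth_on_subset]) (use chart_inv[OF ch] chart_inv[OF dh] in auto)
      then show "\<exists>W. openin (Euclidean_space n) W \<and> x \<in> W \<and> smooth_on n (\<phi> ` U \<inter> W) (h \<circ> inv_into U \<phi>)"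
        using chart_image_open[OF ch is_chartD(1)[OF dh]] p V(2) by (intro exI[of _ "\<phi> ` (U \<inter> V)"]) auto
    qed
    moreover have "\<exists>h\<in>F. \<exists>N. openin X N \<and> p \<in> N \<and> N \<subseteq> U \<and> (\<forall>q\<in>N. \<phi> q j = h q)" if p: "p \<in> U" for p j
    proof -
      obtain V \<psi> where V: "sheaf_chart n (V, \<psi>)" "p \<in> V" using cov p U(6) by blast
      note dh = sheaf_chartD(1)[OF V(1)]
      have "smooth_on n (\<psi> ` (V \<inter> U)) (\<lambda>x. (\<phi> \<circ> inv_into V \<psi>) x j)"
        using comp(2)[OF V(1)] by (simp add: smooth_map_on_def)
      from sheaf_chart_lift[OF V chart_image_open[OF dh U(1)] _ this] p V(2)
      obtain h N where "h \<in> F" "openin X N" "p \<in> N" "N \<subseteq> V" "\<forall>q\<in>N. h q = \<phi> (inv_into V \<psi> (\<psi> q)) j"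
        by auto
      then show ?thesis using chart_inv[OF dh] U(1) p
        by (intro bexI[of _ h] exI[of _ "N \<inter> U"]) auto
    qed
    ultimately show "c \<in> ?B" using ch by (simp add: c_eq sheaf_chart_def)
  qed
  show "smooth_functions n X ?B = F"
  proof (intro equalityI subsetI)
    fix h assume "h \<in> smooth_functions n X ?B"
    then have h: "smooth_on n (\<psi> ` (V \<inter> topspace X)) (h \<circ> inv_into V \<psi>)" if "sheaf_chart n (V, \<psi>)" for V \<psi>
      using that by (auto simp: smooth_functions_def smooth_fun_def)
    show "h \<in> F"
    proof (rule local)
      fix p assume "p \<in> topspace X"
      then obtain V \<psi> where V: "sheaf_chart n (V, \<psi>)" "p \<in> V" using cov by blast
      note dh = sheaf_chartD(1)[OF V(1)]
      have "smooth_on n (\<psi> ` V) (h \<circ> inv_into V \<psi>)" using h[OF V(1)] is_chartD(6)[OF dh] by (simp add: inf_absorb1)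
      from sheaf_chart_lift[OF V is_chartD(3)[OF dh] _ this] V(2)
      obtain h' N where N: "h' \<in> F" "openin X N" "p \<in> N" "N \<subseteq> V" "\<forall>q\<in>N. h' q = h (inv_into V \<psi> (\<psi> q))" by auto
      then show "\<exists>N h'. openin X N \<and> p \<in> N \<and> h' \<in> F \<and> (\<forall>q\<in>N. h q = h' q)"
        using chart_inv[OF dh] by (intro exI[of _ N] exI[of _ h']) auto
    qed
  next
    fix h assume "h \<in> F"
    then show "h \<in> smooth_functions n X ?B"
      using sheaf_chartD(2) is_chartD(6)[OF sheaf_chartD(1)]
      by (auto simp: smooth_functions_def smooth_fun_def inf_absorb1)
  qed
qed

text \<open>Members of \<open>smooth_functions\<close> must be smooth on all of \<open>X\<close>, so
  a coordinate is cut off inside the chart and extended by zero. The support is compact, hence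
  closed because \<open>X\<close> is Hausdorff, and therefore the extension is smooth in every chart
  of the atlas.\<close>

lemma manifold_chart_is_sheaf_chart:
  assumes M: "manifold m X B" and F: "smooth_functions m X B = F" and c: "(V, \<psi>) \<in> B"
  shows "sheaf_chart m (V, \<psi>)"
proof -
  have X: "Hausdorff_space X" and at: "maximal_atlas m (Euclidean_space m) X B"
    using M by (auto simp: manifold_def)
  have ch: "is_chart (Euclidean_space m) X (U, \<phi>)" if "(U, \<phi>) \<in> B" for U \<phi>
    using at that unfolding maximal_atlas_def by blast
  have comp: "smooth_map_on m (\<phi> ` (U \<inter> V)) (\<psi> \<circ> inv_into U \<phi>)" if "(U, \<phi>) \<in> B" for U \<phi>
  proof -
    have "smoothly_compatible m (U, \<phi>) (V, \<psi>)" using at that c unfolding maximal_atlas_def by blast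
    then show ?thesis by (simp add: smoothly_compatible_def)
  qed
  note V = is_chartD[OF ch[OF c]]
  have 1: "smooth_on m (\<psi> ` V) (h \<circ> inv_into V \<psi>)" if "h \<in> F" for h
    using that c V(6) by (fastforce simp: smooth_functions_def smooth_fun_def inf_absorb1 simp flip: F)
  have 2: "\<exists>h\<in>F. \<exists>N. openin X N \<and> p \<in> N \<and> N \<subseteq> V \<and> (\<forall>q\<in>N. \<psi> q j = h q)" if p: "p \<in> V" for p j
  proof -
    obtain G W K where G: "smooth_on m (eucl m) G" "openin (Euclidean_space m) W" "\<psi> p \<in> W" "W \<subseteq> \<psi> ` V"
      "\<And>x. x \<in> W \<Longrightarrow> G x = x j" and K: "compactin (Euclidean_space m) K" "K \<subseteq> \<psi> ` V"
      "\<And>x. x \<in> eucl m \<Longrightarrow> x \<notin> K \<Longrightarrow> G x = 0"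
      using smooth_cutoff[OF V(3) _ smooth_on_coord[OF V(7)], of "\<psi> p" j] p by blast
    define h where "h q = (if q \<in> V then G (\<psi> q) else 0)" for q
    define K' where "K' = inv_into V \<psi> ` K"
    have "compactin (subtopology (Euclidean_space m) (\<psi> ` V)) K" using K by (simp add: compactin_subtopology)
    then have "compactin X K'" unfolding K'_def by (rule image_compactin[OF _ chart_inv_continuous[OF ch[OF c]]])
    then have K': "openin X (topspace X - K')" using X compactin_imp_closedin by (auto simp: closedin_def)
    have h0: "h q = 0" if "q \<notin> K'" for q
    proof (cases "q \<in> V")
      case True
      then have "\<psi> q \<notin> K" using that chart_inv[OF ch[OF c] True] by (force simp: K'_def)
      then show ?thesis using K(3) V(7) True by (auto simp: h_def)
    qed (simp add: h_def)
    have K'V: "K' \<subseteq> V" using K(2) chart_inv[OF ch[OF c]] by (force simp: K'_def)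
    have "smooth_on m (\<phi> ` (U \<inter> topspace X)) (h \<circ> inv_into U \<phi>)" if U': "(U, \<phi>) \<in> B" for U \<phi>
    proof (rule smooth_on_localI)
      note cU = ch[OF U'] and U = is_chartD[OF ch[OF U']]
      fix x assume "x \<in> \<phi> ` (U \<inter> topspace X)"
      then obtain q where q: "q \<in> U" "x = \<phi> q" by blast
      show "\<exists>W. openin (Euclidean_space m) W \<and> x \<in> W \<and> smooth_on m (\<phi> ` (U \<inter> topspace X) \<inter> W) (h \<circ> inv_into U \<phi>)"
      proof (cases "q \<in> V")
        case True
        have "smooth_on m (\<phi> ` (U \<inter> V)) (\<lambda>x. G ((\<psi> \<circ> inv_into U \<phi>) x))"
        proof (rule smooth_on_compose[OF G(1)])
          show "smooth_on m (\<phi> ` (U \<inter> V)) (\<lambda>x. (\<psi> \<circ> inv_into U \<phi>) x j)" for j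
            using comp[OF U'] by (simp add: smooth_map_on_def)
          show "(\<psi> \<circ> inv_into U \<phi>) ` \<phi> ` (U \<inter> V) \<subseteq> eucl m" using chart_inv[OF cU] V(7) by auto
        qed (use U(7) in auto)
        then have "smooth_on m (\<phi> ` (U \<inter> topspace X) \<inter> \<phi> ` (U \<inter> V)) (h \<circ> inv_into U \<phi>)"
          by (rule smooth_on_eq[OF smooth_on_subset]) (use chart_inv[OF cU] in \<open>auto simp: h_def\<close>)
        then show ?thesis using q True chart_image_open[OF cU V(1)] by (intro exI[of _ "\<phi> ` (U \<inter> V)"]) auto
      next
        case False
        have "smooth_on m (\<phi> ` (U \<inter> topspace X) \<inter> \<phi> ` (U \<inter> (topspace X - K'))) (h \<circ> inv_into U \<phi>)"
        proof (rule smooth_on_eq[OF smooth_on_const[of _ m 0]])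
          fix x assume "x \<in> \<phi> ` (U \<inter> topspace X) \<inter> \<phi> ` (U \<inter> (topspace X - K'))"
          then obtain q where "q \<in> U" "q \<notin> K'" "x = \<phi> q" by blast
          then show "0 = (h \<circ> inv_into U \<phi>) x" using h0 chart_inv[OF cU] by simp
        qed (use U(7) in blast)
        then show ?thesis using q False K'V U(6) chart_image_open[OF cU K']
          by (intro exI[of _ "\<phi> ` (U \<inter> (topspace X - K'))"]) auto
      qed
    qed
    then have "h \<in> F" unfolding F[symmetric] smooth_functions_def smooth_fun_def by auto
    moreover have "\<psi> q j = h q" if "q \<in> V" "\<psi> q \<in> W" for q using that G(5) by (simp add: h_def)
    ultimately show ?thesis using chart_vimage_open[OF ch[OF c] G(2)] p G(3)
      by (intro bexI[of _ h] exI[of _ "{x \<in> V. \<psi> x \<in> W}"]) auto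
  qed
  show ?thesis using 1 2 ch[OF c] by (simp add: sheaf_chart_def)
qed

text \<open>A competing structure may come with another dimension \<open>m\<close>; every point lies
  in charts of both kinds, which forces \<open>m = n\<close>. Then \<open>B\<close> consists of
  admissible charts, and its own maximality gives equality.\<close>

theorem sheaf_manifold_unique:
  assumes X: "Hausdorff_space X" "second_countable X"
    and cover: "\<And>p. p \<in> topspace X \<Longrightarrow> \<exists>c. sheaf_chart n c \<and> p \<in> fst c"
  shows "\<exists>!B. \<exists>m. manifold m X B \<and> F = smooth_functions m X B"
proof (rule ex1I[of _ "{c. sheaf_chart n c}"])
  let ?B = "{c. sheaf_chart n c}"
  show "\<exists>m. manifold m X ?B \<and> F = smooth_functions m X ?B"
    using sheaf_atlas[OF cover] X by (auto simp: manifold_def)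
  fix B assume "\<exists>m. manifold m X B \<and> F = smooth_functions m X B"
  then obtain m where m: "manifold m X B" "smooth_functions m X B = F" by auto
  then have at: "maximal_atlas m (Euclidean_space m) X B" by (auto simp: manifold_def)
  have BF: "sheaf_chart m c" if "c \<in> B" for c
    using manifold_chart_is_sheaf_chart[OF m] that by (cases c) auto
  have nm: "n = m" if p: "p \<in> topspace X" for p
  proof -
    obtain U \<phi> where U: "sheaf_chart n (U, \<phi>)" "p \<in> U" using cover[OF p] by fastforce
    have "p \<in> \<Union> (fst ` B)" using at p by (simp add: maximal_atlas_def)
    then obtain V \<psi> where V: "sheaf_chart m (V, \<psi>)" "p \<in> V" using BF by fastforce
    show ?thesis using chart_dimension_unique[OF sheaf_chartD(1)[OF U(1)] sheaf_chartD(1)[OF V(1)] U(2) V(2)]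
      chart_dimension_unique[OF sheaf_chartD(1)[OF V(1)] sheaf_chartD(1)[OF U(1)] V(2) U(2)] by simp
  qed
  \<comment> \<open>The empty space has no point at which dimensions could be compared, but its only
    chart is the empty one, which is admissible in every dimension.\<close>
  have nm': "sheaf_chart n c \<longleftrightarrow> sheaf_chart m c" for c
  proof (cases "topspace X = {}")
    case True
    have "sheaf_chart k (U, \<phi>) \<longleftrightarrow> U = {} \<and> \<phi> \<in> extensional {}" for k U \<phi>
    proof
      assume "sheaf_chart k (U, \<phi>)"
      then have "is_chart (Euclidean_space k) X (U, \<phi>)" by (rule sheaf_chartD)
      then show "U = {} \<and> \<phi> \<in> extensional {}" using is_chartD(2,6) True by fastforce
    next
      assume "U = {} \<and> \<phi> \<in> extensional {}"
      then show "sheaf_chart k (U, \<phi>)"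
        by (auto simp: sheaf_chart_def is_chart_def smooth_on_def homeomorphic_map_def quotient_map_def)
    qed
    then show ?thesis by (cases c) simp
  next
    case False
    then show ?thesis using nm by blast
  qed
  show "B = ?B"
  proof (intro equalityI subsetI)
    fix c assume "c \<in> B" then show "c \<in> ?B" using BF nm' by simp
  next
    fix c assume "c \<in> ?B"
    then have c: "sheaf_chart m c" using nm' by simp
    have "smoothly_compatible m c d" if "d \<in> B" for d
      using sheaf_charts_compatible c BF[OF that] by blast
    moreover have "is_chart (Euclidean_space m) X c" using c sheaf_chartD(1) by (cases c) auto
    ultimately show "c \<in> B" using at unfolding maximal_atlas_def by blast
  qed
qed

end

section \<open>The topology of the cut space\<close>

lemma smooth_on_continuous_on:
  assumes f: "smooth_on n S f" and S: "S \<subseteq> eucl n"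
  shows "continuous_on S f"
  unfolding continuous_on_eq_continuous_within
proof
  fix x assume x: "x \<in> S"
  obtain W g where W: "openin (Euclidean_space n) W" "x \<in> W" "smooth_on n W g" "\<And>y. y \<in> W \<Longrightarrow> y \<in> S \<Longrightarrow> g y = f y"
    using smooth_on_openE[OF f x] by metis
  obtain T where T: "open T" "W = eucl n \<inter> T" using W(1) by (auto simp: openin_eucl_iff)
  have "continuous_on (S \<inter> W) g" using smooth_on_open_continuous[OF W(1,3)] continuous_on_subset by blast
  then have "continuous_on (S \<inter> W) f" using W(4) continuous_on_cong[of "S \<inter> W" "S \<inter> W" g f] by simp
  then have "continuous (at x within S \<inter> W) f" using x W(2) by (simp add: continuous_on_eq_continuous_within)
  moreover have "at x within S = at x within (S \<inter> W)"
    by (rule at_within_nhd[of x T]) (use T W(2) S in auto)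
  ultimately show "continuous (at x within S) f" by simp
qed

lemma topspace_half_space: "topspace (half_space n) = eucl n \<inter> {x. 0 \<le> x 0}"
  by (simp add: half_space_def)

lemma openin_half_space:
  "openin (half_space n) S \<Longrightarrow> \<exists>W. openin (Euclidean_space n) W \<and> S = W \<inter> {x. 0 \<le> x 0}"
  by (auto simp: half_space_def openin_subtopology)

text \<open>Away from the face \<open>x 0 = 0\<close> the half space and Euclidean space have the
  same open sets. For \<open>n = 0\<close> there is no face, so positivity is demanded only for
  \<open>n > 0\<close>.\<close>

lemma openin_half_space_eucl:
  assumes "openin (half_space n) S" and "0 < n \<Longrightarrow> \<forall>x\<in>S. 0 < x 0"
  shows "openin (Euclidean_space n) S"
proof -
  obtain W where W: "openin (Euclidean_space n) W" "S = W \<inter> {x. 0 \<le> x 0}"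
    using openin_half_space assms(1) by blast
  show ?thesis
  proof (cases "n = 0")
    case True
    then have "S = W" using W openin_eucl_subset[OF W(1)] by (auto simp: in_eucl)
    then show ?thesis using W by simp
  next
    case False
    then have "S = {x \<in> W. 0 < x 0}" using W assms(2) by auto
    moreover have "openin (Euclidean_space n) {x \<in> W. 0 < x 0}"
      by (intro openin_eucl_less W) (auto intro: continuous_on_subset[OF continuous_on_product_coordinates])
    ultimately show ?thesis by simp
  qed
qed

lemma smooth_fun_subset: "smooth_fun n A D h \<Longrightarrow> D' \<subseteq> D \<Longrightarrow> smooth_fun n A D' h"
  unfolding smooth_fun_def using smooth_on_subset by (fastforce elim!: smooth_on_subset)

lemma smooth_fun_eq:
  assumes "smooth_fun n A D h" "\<And>x. x \<in> D \<Longrightarrow> h x = k x" "\<And>U \<phi>. (U, \<phi>) \<in> A \<Longrightarrow> inj_on \<phi> U"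
  shows "smooth_fun n A D k"
  unfolding smooth_fun_def
proof clarify
  fix U \<phi> assume c: "(U, \<phi>) \<in> A"
  then have "smooth_on n (\<phi> ` (U \<inter> D)) (h \<circ> inv_into U \<phi>)" using assms(1) by (auto simp: smooth_fun_def)
  then show "smooth_on n (\<phi> ` (U \<inter> D)) (k \<circ> inv_into U \<phi>)"
    by (rule smooth_on_eq) (use assms(2) assms(3)[OF c] in auto)
qed

lemma smooth_fun_compose:
  assumes h: "\<And>j. j < m \<Longrightarrow> smooth_fun n A D (h j)" and G: "smooth_on m T G" "T \<subseteq> eucl m"
    and T: "\<And>x. x \<in> D \<Longrightarrow> (\<lambda>j. if j < m then h j x else 0) \<in> T"
    and A: "\<And>U \<phi>. (U, \<phi>) \<in> A \<Longrightarrow> inj_on \<phi> U \<and> \<phi> ` U \<subseteq> eucl n"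
  shows "smooth_fun n A D (\<lambda>x. G (\<lambda>j. if j < m then h j x else 0))"
  unfolding smooth_fun_def
proof clarify
  fix U \<phi> assume c: "(U, \<phi>) \<in> A"
  have "smooth_on n (\<phi> ` (U \<inter> D)) (\<lambda>y. G ((\<lambda>y j. if j < m then h j (inv_into U \<phi> y) else 0) y))"
  proof (rule smooth_on_compose[OF G(1)])
    show "smooth_on n (\<phi> ` (U \<inter> D)) (\<lambda>y. if j < m then h j (inv_into U \<phi> y) else 0)" if "j < m" for j
      using h[OF that] c that by (auto simp: smooth_fun_def o_def)
    show "(\<lambda>y j. if j < m then h j (inv_into U \<phi> y) else 0) ` \<phi> ` (U \<inter> D) \<subseteq> T"
      using A[OF c] T by (auto intro!: T)
  qed (use G A[OF c] in auto)
  then show "smooth_on n (\<phi> ` (U \<inter> D)) ((\<lambda>x. G (\<lambda>j. if j < m then h j x else 0)) \<circ> inv_into U \<phi>)"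
    by (simp add: o_def)
qed

lemma smooth_fun_const:
  "(\<And>U \<phi>. (U, \<phi>) \<in> A \<Longrightarrow> \<phi> ` U \<subseteq> eucl n) \<Longrightarrow> smooth_fun n A D (\<lambda>x. c)"
  unfolding smooth_fun_def o_def by (auto intro!: smooth_on_const)

lemma smooth_fun_add:
  "smooth_fun n A D f \<Longrightarrow> smooth_fun n A D g \<Longrightarrow> smooth_fun n A D (\<lambda>x. f x + g x)"
  unfolding smooth_fun_def o_def by (auto intro: smooth_on_add)

lemma smooth_fun_mult:
  "smooth_fun n A D f \<Longrightarrow> smooth_fun n A D g \<Longrightarrow> smooth_fun n A D (\<lambda>x. f x * g x)"
  unfolding smooth_fun_def o_def by (auto intro: smooth_on_mult)

lemma smooth_fun_sin_cos:
  assumes "smooth_fun n A D f"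
  shows "smooth_fun n A D (\<lambda>x. sin (f x))" "smooth_fun n A D (\<lambda>x. cos (f x))"
  using assms unfolding smooth_fun_def o_def by (auto intro: smooth_on_sin_cos)

lemma smooth_fun_sqrt:
  assumes "smooth_fun n A D f" "\<And>x. x \<in> D \<Longrightarrow> 0 < f x" "\<And>U \<phi>. (U, \<phi>) \<in> A \<Longrightarrow> inj_on \<phi> U"
  shows "smooth_fun n A D (\<lambda>x. sqrt (f x))"
  unfolding smooth_fun_def o_def
proof clarify
  fix U \<phi> assume c: "(U, \<phi>) \<in> A"
  show "smooth_on n (\<phi> ` (U \<inter> D)) (\<lambda>x. sqrt (f (inv_into U \<phi> x)))"
    by (rule smooth_on_sqrt) (use assms(1,2) assms(3)[OF c] c in \<open>auto simp: smooth_fun_def o_def\<close>)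
qed

text \<open>Fixes a witness \<open>W\<close> for the invariance clause of the defining function;
  slices, tubes and invariant bump functions are constructed inside it.\<close>

locale cut_data =
  fixes n :: nat and M :: "'a topology" and A :: "'a chart set"
    and UM :: "'a set" and act :: "complex \<Rightarrow> 'a \<Rightarrow> 'a" and f :: "'a \<Rightarrow> real" and W :: "'a set"
  assumes mfd: "manifold_with_boundary n M A"
    and free: "free_circle_action_near_boundary n M A UM act"
    and bdf: "invariant_boundary_defining_function n M A UM act f"
    and W: "openin M W" "boundary_of_manifold n M A \<subseteq> W" "W \<subseteq> UM" "circle_invariant act W"
    and f_act: "\<And>a x. a \<in> unit_circle \<Longrightarrow> x \<in> W \<Longrightarrow> f (act a x) = f x"
begin

abbreviation bd where "bd \<equiv> boundary_of_manifold n M A"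
abbreviation cc where "cc \<equiv> cut_map n M A act"
abbreviation Mc where "Mc \<equiv> cut_space n M A act"

lemma hausdorff: "Hausdorff_space M" and second_count: "second_countable M"
  and atlas: "maximal_atlas n (half_space n) M A"
  using mfd by (auto simp: manifold_with_boundary_def)

lemma chart: "(U, \<phi>) \<in> A \<Longrightarrow> is_chart (half_space n) M (U, \<phi>)"
  using atlas unfolding maximal_atlas_def by blast

lemma chart_exists:
  assumes "x \<in> topspace M"
  shows "\<exists>U \<phi>. (U, \<phi>) \<in> A \<and> x \<in> U"
proof -
  have "\<Union> (fst ` A) = topspace M" using atlas by (simp only: maximal_atlas_def)
  then obtain c where "c \<in> A" "x \<in> fst c" using assms by blast
  then show ?thesis by (intro exI[of _ "fst c"] exI[of _ "snd c"]) simp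
qed

lemma chart_eucl: "(U, \<phi>) \<in> A \<Longrightarrow> \<phi> ` U \<subseteq> eucl n"
  using is_chartD(7)[OF chart] by (auto simp: topspace_half_space)

lemma chart_inj: "(U, \<phi>) \<in> A \<Longrightarrow> inj_on \<phi> U"
  using is_chartD(5)[OF chart] .

lemma charts_compatible:
  "(U, \<phi>) \<in> A \<Longrightarrow> (V, \<psi>) \<in> A \<Longrightarrow> smooth_map_on n (\<phi> ` (U \<inter> V)) (\<psi> \<circ> inv_into U \<phi>)"
proof -
  assume "(U, \<phi>) \<in> A" "(V, \<psi>) \<in> A"
  then have "smoothly_compatible n (U, \<phi>) (V, \<psi>)" using atlas unfolding maximal_atlas_def by blast
  then show ?thesis by (simp add: smoothly_compatible_def)
qed

text \<open>The chart image of \<open>N\<close> is open only relative to the half space.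
  \<open>T\<close> is an ambient open set that cuts out the image of \<open>D \<inter> N\<close> for
  every \<open>D \<subseteq> U\<close> at once, in the form that \<open>smooth_on_localI\<close>
  asks for.\<close>

lemma chart_image_open':
  assumes "(U, \<phi>) \<in> A" "openin M N"
  obtains T where "openin (Euclidean_space n) T" "\<And>D. D \<subseteq> U \<Longrightarrow> \<phi> ` D \<inter> T = \<phi> ` (D \<inter> N)"
proof -
  note c = chart[OF assms(1)]
  obtain T where T: "openin (Euclidean_space n) T" "\<phi> ` (U \<inter> N) = T \<inter> {x. 0 \<le> x 0}"
    using openin_half_space chart_image_open[OF c assms(2)] by blast
  have "\<phi> ` D \<inter> T = \<phi> ` (D \<inter> N)" if D: "D \<subseteq> U" for D
  proof (intro equalityI subsetI)
    fix y assume "y \<in> \<phi> ` D \<inter> T"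
    then obtain x where x: "x \<in> D" "y = \<phi> x" "y \<in> T" by blast
    then have "0 \<le> y 0" using D is_chartD(7)[OF c] by (auto simp: topspace_half_space)
    then have "y \<in> \<phi> ` (U \<inter> N)" using x T by blast
    then show "y \<in> \<phi> ` (D \<inter> N)" using x D chart_inj[OF assms(1)] by (auto simp: inj_on_def)
  next
    fix y assume "y \<in> \<phi> ` (D \<inter> N)"
    then show "y \<in> \<phi> ` D \<inter> T" using T(2) D by blast
  qed
  with T(1) that show thesis by blast
qed

lemma smooth_fun_localI:
  assumes "\<And>x. x \<in> D \<Longrightarrow> \<exists>N. openin M N \<and> x \<in> N \<and> smooth_fun n A (D \<inter> N) h"
  shows "smooth_fun n A D h"
  unfolding smooth_fun_def
proof clarify
  fix U \<phi> assume c: "(U, \<phi>) \<in> A"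
  show "smooth_on n (\<phi> ` (U \<inter> D)) (h \<circ> inv_into U \<phi>)"
  proof (rule smooth_on_localI)
    fix y assume "y \<in> \<phi> ` (U \<inter> D)"
    then obtain x where x: "x \<in> U" "x \<in> D" "y = \<phi> x" by blast
    obtain N where N: "openin M N" "x \<in> N" "smooth_fun n A (D \<inter> N) h" using assms x by blast
    obtain T where T: "openin (Euclidean_space n) T" "\<And>D. D \<subseteq> U \<Longrightarrow> \<phi> ` D \<inter> T = \<phi> ` (D \<inter> N)"
      using chart_image_open'[OF c N(1)] by metis
    have "y \<in> T" using T(2)[of "{x}"] x N(2) by auto
    moreover have "smooth_on n (\<phi> ` (U \<inter> D) \<inter> T) (h \<circ> inv_into U \<phi>)"
      using N(3) c T(2)[of "U \<inter> D"] by (auto simp: smooth_fun_def Int_assoc)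
    ultimately show "\<exists>W. openin (Euclidean_space n) W \<and> y \<in> W \<and> smooth_on n (\<phi> ` (U \<inter> D) \<inter> W) (h \<circ> inv_into U \<phi>)"
      using T(1) by blast
  qed
qed

text \<open>Composition with transition maps reduces smoothness in all charts to smoothness in a
  single chart that contains the domain.\<close>

lemma smooth_fun_chartI:
  assumes c: "(V, \<psi>) \<in> A" and D: "D \<subseteq> V" and h: "smooth_on n (\<psi> ` D) (h \<circ> inv_into V \<psi>)"
  shows "smooth_fun n A D h"
  unfolding smooth_fun_def
proof clarify
  fix U \<phi> assume d: "(U, \<phi>) \<in> A"
  have "smooth_on n (\<phi> ` (U \<inter> D)) (\<lambda>y. (h \<circ> inv_into V \<psi>) ((\<psi> \<circ> inv_into U \<phi>) y))"
  proof (rule smooth_on_compose[OF h])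
    show "smooth_on n (\<phi> ` (U \<inter> D)) (\<lambda>x. (\<psi> \<circ> inv_into U \<phi>) x j)" for j
      using charts_compatible[OF d c] D unfolding smooth_map_on_def by (auto elim!: allE[of _ j] smooth_on_subset)
    show "(\<psi> \<circ> inv_into U \<phi>) ` \<phi> ` (U \<inter> D) \<subseteq> \<psi> ` D" using chart_inj[OF d] by auto
  qed (use chart_eucl[OF c] chart_eucl[OF d] D in blast)+
  then show "smooth_on n (\<phi> ` (U \<inter> D)) (h \<circ> inv_into U \<phi>)"
    by (rule smooth_on_eq) (use chart_inj[OF c] chart_inj[OF d] D in auto)
qed

lemma smooth_fun_continuous:
  assumes h: "smooth_fun n A D h" and D: "openin M D"
  shows "continuous_map (subtopology M D) euclideanreal h"
proof -
  have Dt: "topspace (subtopology M D) = D" using openin_subset[OF D] by auto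
  have "openin M {x \<in> D. h x \<in> T}" if T: "open T" for T
  proof (subst openin_subopen, intro ballI)
    fix x assume x: "x \<in> {x \<in> D. h x \<in> T}"
    then obtain U \<phi> where U: "(U, \<phi>) \<in> A" "x \<in> U" using chart_exists openin_subset[OF D] by blast
    note c = chart[OF U(1)]
    let ?S = "\<phi> ` (U \<inter> D)"
    have S: "openin (half_space n) ?S" using chart_image_open[OF c D] .
    have "continuous_on ?S (h \<circ> inv_into U \<phi>)"
      using h U(1) chart_eucl[OF U(1)] by (intro smooth_on_continuous_on[of n]) (auto simp: smooth_fun_def)
    from continuous_openin_preimage_gen[OF this T]
    have "openin (top_of_set ?S) (?S \<inter> (h \<circ> inv_into U \<phi>) -` T)" .
    moreover have "top_of_set ?S = subtopology (half_space n) ?S"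
      using openin_subset[OF S]
      by (simp add: half_space_def Euclidean_space_eq subtopology_subtopology topspace_half_space inf_absorb2 Int_assoc[symmetric])
    ultimately have "openin (half_space n) (?S \<inter> (h \<circ> inv_into U \<phi>) -` T)"
      using S by (simp add: openin_open_subtopology)
    from chart_vimage_open[OF c this] have "openin M {x \<in> U. \<phi> x \<in> ?S \<inter> (h \<circ> inv_into U \<phi>) -` T}" .
    moreover have "{x \<in> U. \<phi> x \<in> ?S \<inter> (h \<circ> inv_into U \<phi>) -` T} \<subseteq> {x \<in> D. h x \<in> T}"
    proof
      fix y assume "y \<in> {x \<in> U. \<phi> x \<in> ?S \<inter> (h \<circ> inv_into U \<phi>) -` T}"
      then have y: "y \<in> U" "\<phi> y \<in> ?S \<inter> (h \<circ> inv_into U \<phi>) -` T" by auto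
      then have "y \<in> D" using chart_inj[OF U(1)] by (auto simp: inj_on_def)
      then show "y \<in> {x \<in> D. h x \<in> T}" using y chart_inj[OF U(1)] by simp
    qed
    ultimately show "\<exists>T'. openin M T' \<and> x \<in> T' \<and> T' \<subseteq> {x \<in> D. h x \<in> T}"
      using x U(2) chart_inj[OF U(1)] by (intro exI conjI) auto
  qed
  then show ?thesis using D unfolding continuous_map_def Dt
    by (auto simp: openin_open_subtopology simp del: topspace_subtopology)
qed

section \<open>Defining function and circle action\<close>

lemma f_smooth: "smooth_fun n A (topspace M) f" and f_nonneg: "x \<in> topspace M \<Longrightarrow> 0 \<le> f x"
  and f_zero: "x \<in> topspace M \<Longrightarrow> f x = 0 \<longleftrightarrow> x \<in> bd"
  and f_deriv: "x \<in> bd \<Longrightarrow> differential_nonzero_at n A f x"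
  using bdf by (auto simp: invariant_boundary_defining_function_def)

lemma f_continuous: "continuous_map M euclideanreal f"
  using smooth_fun_continuous[OF f_smooth openin_topspace] by simp

lemma bd_sub: "bd \<subseteq> topspace M"
  by (auto simp: boundary_of_manifold_def)

lemma interior_eq: "interior_of_manifold n M A = topspace M - bd"
  by (simp add: interior_of_manifold_def)

text \<open>The boundary is closed as the zero set of the continuous function
  \<open>f\<close>.\<close>

lemma interior_open: "openin M (topspace M - bd)"
proof -
  have "openin M {x \<in> topspace M. f x \<in> -{0}}"
    by (rule openin_continuous_map_preimage[OF f_continuous]) auto
  moreover have "{x \<in> topspace M. f x \<in> -{0}} = topspace M - bd" using f_zero by auto
  ultimately show ?thesis by simp
qed

lemma UM: "openin M UM" "UM \<subseteq> topspace M" "W \<subseteq> topspace M"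
  using free W(1) openin_subset[of M UM] openin_subset[of M W]
  by (auto simp: free_circle_action_near_boundary_def)

lemma act_UM: "a \<in> unit_circle \<Longrightarrow> x \<in> UM \<Longrightarrow> act a x \<in> UM"
  and act_1: "x \<in> UM \<Longrightarrow> act 1 x = x"
  and act_mult: "a \<in> unit_circle \<Longrightarrow> b \<in> unit_circle \<Longrightarrow> x \<in> UM \<Longrightarrow> act (a * b) x = act a (act b x)"
  and act_free: "a \<in> unit_circle \<Longrightarrow> x \<in> UM \<Longrightarrow> act a x = x \<Longrightarrow> a = 1"
  and act_smooth: "smooth_map (1 + n) (prod_topology (top_of_set unit_circle) M) (product_atlas 1 circle_atlas A)
       (unit_circle \<times> UM) M A (\<lambda>(a, x). act a x)"
  using free unfolding free_circle_action_near_boundary_def circle_invariant_def by blast+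

lemma act_W: "a \<in> unit_circle \<Longrightarrow> x \<in> W \<Longrightarrow> act a x \<in> W"
  using W(4) by (auto simp: circle_invariant_def)

text \<open>\<open>f\<close> is invariant near the boundary and vanishes exactly on it.\<close>

lemma act_bd: assumes "a \<in> unit_circle" "x \<in> bd" shows "act a x \<in> bd"
proof -
  have "x \<in> W" using assms W by blast
  then have "f (act a x) = 0" using f_act[OF assms(1)] f_zero[of x] assms bd_sub by auto
  then show ?thesis using f_zero act_W[OF assms(1) \<open>x \<in> W\<close>] UM(3) by blast
qed

lemma unit_circle_mult: "a \<in> unit_circle \<Longrightarrow> b \<in> unit_circle \<Longrightarrow> a * b \<in> unit_circle"
  by (simp add: norm_mult)

lemma unit_circle_inverse: "a \<in> unit_circle \<Longrightarrow> inverse a \<in> unit_circle"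
  by (simp add: norm_inverse)

lemma unit_circle_nz: "a \<in> unit_circle \<Longrightarrow> a \<noteq> 0" by auto

lemma act_inverse: "a \<in> unit_circle \<Longrightarrow> x \<in> UM \<Longrightarrow> act (inverse a) (act a x) = x"
  "a \<in> unit_circle \<Longrightarrow> x \<in> UM \<Longrightarrow> act a (act (inverse a) x) = x"
  using act_mult[OF unit_circle_inverse, of a a x] act_mult[OF _ unit_circle_inverse, of a a x] act_1[of x]
    unit_circle_nz[of a] by simp_all

lemma act_continuous:
  "continuous_map (prod_topology (top_of_set unit_circle) (subtopology M UM)) M (\<lambda>(a, x). act a x)"
proof -
  have "continuous_map (subtopology (prod_topology (top_of_set unit_circle) M) (unit_circle \<times> UM)) M (\<lambda>(a, x). act a x)"
    using act_smooth by (simp add: smooth_map_def)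
  then show ?thesis by (simp add: subtopology_Times subtopology_subtopology)
qed

lemma act_continuous1:
  assumes "a \<in> unit_circle"
  shows "continuous_map (subtopology M UM) M (act a)"
proof -
  have "continuous_map (subtopology M UM) (prod_topology (top_of_set unit_circle) (subtopology M UM)) (\<lambda>x. (a, x))"
    using assms by (auto simp: continuous_map_pairwise o_def)
  from continuous_map_compose[OF this act_continuous] show ?thesis by (simp add: o_def)
qed

lemma act_continuous2:
  assumes "x \<in> UM"
  shows "continuous_map (top_of_set unit_circle) M (\<lambda>a. act a x)"
proof -
  have "continuous_map (top_of_set unit_circle) (prod_topology (top_of_set unit_circle) (subtopology M UM)) (\<lambda>a. (a, x))"
    using assms UM by (auto simp: continuous_map_pairwise o_def)
  from continuous_map_compose[OF this act_continuous] show ?thesis by (simp add: o_def)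
qed

lemma act_image_open:
  assumes "a \<in> unit_circle" "openin M N" "N \<subseteq> UM"
  shows "openin M (act a ` N)"
proof -
  have "openin (subtopology M UM) {x \<in> UM. act (inverse a) x \<in> N}"
    using openin_continuous_map_preimage[OF act_continuous1[OF unit_circle_inverse[OF assms(1)]] assms(2)] UM
    by (simp add: inf_absorb2)
  then have "openin M {x \<in> UM. act (inverse a) x \<in> N}" using UM(1) by (simp add: openin_open_subtopology)
  moreover have "{x \<in> UM. act (inverse a) x \<in> N} = act a ` N"
    using assms act_inverse[OF assms(1)] act_UM by (auto intro!: rev_image_eqI)
  ultimately show ?thesis by simp
qed

text \<open>The tube lemma, in Wallace's form for the compact sets \<open>K\<close> and
  \<open>{x}\<close>: what holds along a compact piece of the orbit of \<open>x\<close> holds for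
  all nearby points simultaneously.\<close>

lemma act_tube:
  assumes N: "openin M N" and x: "x \<in> UM" and K: "compact K" "K \<subseteq> unit_circle" "\<And>a. a \<in> K \<Longrightarrow> act a x \<in> N"
  obtains V where "openin M V" "x \<in> V" "V \<subseteq> UM" "\<And>a y. a \<in> K \<Longrightarrow> y \<in> V \<Longrightarrow> act a y \<in> N"
proof -
  let ?X = "top_of_set unit_circle" and ?Y = "subtopology M UM"
  define P where "P = {p \<in> topspace (prod_topology ?X ?Y). (\<lambda>(a, x). act a x) p \<in> N}"
  have P: "openin (prod_topology ?X ?Y) P"
    unfolding P_def by (rule openin_continuous_map_preimage[OF act_continuous N])
  have "compactin ?X K" using K by (simp add: compactin_subtopology)
  moreover have "compactin ?Y {x}" using x UM by auto
  moreover have "K \<times> {x} \<subseteq> P" using K x UM by (auto simp: P_def)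
  ultimately obtain Q V where V: "openin ?Y V" "K \<subseteq> Q" "{x} \<subseteq> V" "Q \<times> V \<subseteq> P"
    using Wallace_theorem_prod_topology[OF _ _ P] by metis
  have "openin M V" using V(1) UM(1) by (simp add: openin_open_subtopology)
  moreover have "V \<subseteq> UM" using openin_subset[OF V(1)] by auto
  moreover have "act a y \<in> N" if "a \<in> K" "y \<in> V" for a y
  proof -
    have "(a, y) \<in> P" using that V by blast
    then show ?thesis by (simp add: P_def)
  qed
  ultimately show thesis using that V by blast
qed

text \<open>
  The largest invariant subset of \<open>N \<inter> W\<close>; it is open because the circle is compact.
\<close>

definition core :: "'a set \<Rightarrow> 'a set" where
  "core N = {x \<in> W. \<forall>a\<in>unit_circle. act a x \<in> N}"

lemma core_open: assumes "openin M N" shows "openin M (core N)"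
proof (subst openin_subopen, intro ballI)
  fix x assume "x \<in> core N"
  then have x: "x \<in> W" "\<And>a. a \<in> unit_circle \<Longrightarrow> act a x \<in> N" by (auto simp: core_def)
  then have xU: "x \<in> UM" using W by blast
  obtain V where V: "openin M V" "x \<in> V" "V \<subseteq> UM" "\<And>a y. a \<in> unit_circle \<Longrightarrow> y \<in> V \<Longrightarrow> act a y \<in> N"
    using act_tube[OF assms xU compact_sphere, of 0 1] x by blast
  then show "\<exists>T. openin M T \<and> x \<in> T \<and> T \<subseteq> core N"
    using W(1) x by (intro exI[of _ "V \<inter> W"]) (auto simp: core_def)
qed

lemma core_sub: "core N \<subseteq> N" "core N \<subseteq> W"
proof -
  show W': "core N \<subseteq> W" by (auto simp: core_def)
  show "core N \<subseteq> N"
  proof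
    fix x assume x: "x \<in> core N"
    then have "act 1 x \<in> N" unfolding core_def by simp
    then show "x \<in> N" using act_1[of x] x W' W(3) by auto
  qed
qed

lemma core_invariant: "circle_invariant act (core N)"
  unfolding circle_invariant_def core_def
proof (intro ballI CollectI conjI)
  fix a x b assume a: "a \<in> unit_circle" and b: "b \<in> unit_circle" and x: "x \<in> {x \<in> W. \<forall>a\<in>unit_circle. act a x \<in> N}"
  show "act a x \<in> W" using act_W a x by blast
  have "act b (act a x) = act (b * a) x" using act_mult[OF b a] x W(3) by auto
  then show "act b (act a x) \<in> N" using x unit_circle_mult[OF b a] by simp
qed

lemma orbit_compact: assumes "x \<in> UM" shows "compactin M ((\<lambda>a. act a x) ` unit_circle)"
  by (rule image_compactin[OF _ act_continuous2[OF assms]]) (simp add: compactin_subtopology)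

section \<open>Fibres of the cut map and saturated sets\<close>

lemma cut_map_eq_iff:
  assumes "x \<in> topspace M" "y \<in> topspace M"
  shows "cc x = cc y \<longleftrightarrow> x = y \<or> x \<in> bd \<and> y \<in> bd \<and> (\<exists>a\<in>unit_circle. y = act a x)"
proof
  assume "cc x = cc y"
  moreover have "y \<in> cc y" using assms by (simp add: cut_map_def cut_relation_def)
  ultimately have "y \<in> cc x" by simp
  then show "x = y \<or> x \<in> bd \<and> y \<in> bd \<and> (\<exists>a\<in>unit_circle. y = act a x)"
    by (auto simp: cut_map_def cut_relation_def)
next
  assume *: "x = y \<or> x \<in> bd \<and> y \<in> bd \<and> (\<exists>a\<in>unit_circle. y = act a x)"
  show "cc x = cc y"
  proof (cases "x = y")
    case False
    then obtain a where a: "x \<in> bd" "y \<in> bd" "a \<in> unit_circle" "y = act a x" using * by blast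
    have xU: "x \<in> UM" using a W by blast
    have fw: "\<exists>b\<in>unit_circle. z = act b y" if "b \<in> unit_circle" "z = act b x" for z b
    proof -
      have "act (b * inverse a) y = act b (act (inverse a) (act a x))"
        using act_mult[OF that(1) unit_circle_inverse[OF a(3)] act_UM[OF a(3) xU]] a(4) by simp
      then show ?thesis using that act_inverse(1)[OF a(3) xU]
          unit_circle_mult[OF that(1) unit_circle_inverse[OF a(3)]] by (intro bexI[of _ "b * inverse a"]) auto
    qed
    have bw: "\<exists>b\<in>unit_circle. z = act b x" if "b \<in> unit_circle" "z = act b y" for z b
      using that act_mult[OF that(1) a(3) xU] a(4) unit_circle_mult[OF that(1) a(3)]
      by (intro bexI[of _ "b * a"]) auto
    have orb: "cc z = (\<lambda>a. act a z) ` unit_circle" if z: "z \<in> bd" for z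
    proof (intro equalityI subsetI)
      fix w assume "w \<in> cc z"
      then have "w = z \<or> (\<exists>a\<in>unit_circle. w = act a z)" by (auto simp: cut_map_def cut_relation_def)
      moreover have "z = act 1 z" "(1::complex) \<in> unit_circle" using act_1[of z] z W by auto
      ultimately show "w \<in> (\<lambda>a. act a z) ` unit_circle" by blast
    next
      fix w assume "w \<in> (\<lambda>a. act a z) ` unit_circle"
      then obtain a where "a \<in> unit_circle" "w = act a z" by blast
      moreover from this have "w \<in> bd" using act_bd z by simp
      ultimately show "w \<in> cc z" using z bd_sub unfolding cut_map_def cut_relation_def by blast
    qed
    show ?thesis unfolding orb[OF a(1)] orb[OF a(2)]
    proof (intro equalityI subsetI)
      fix w assume "w \<in> (\<lambda>a. act a x) ` unit_circle"
      then show "w \<in> (\<lambda>a. act a y) ` unit_circle" using fw by blast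
    next
      fix w assume "w \<in> (\<lambda>a. act a y) ` unit_circle"
      then show "w \<in> (\<lambda>a. act a x) ` unit_circle" using bw by blast
    qed
  qed simp
qed

lemma cut_map_act: "a \<in> unit_circle \<Longrightarrow> x \<in> bd \<Longrightarrow> cc (act a x) = cc x"
  using cut_map_eq_iff[of x "act a x"] act_bd[of a x] bd_sub by blast

lemma cut_topspace: "topspace Mc = cc ` topspace M"
  using quotient_map_cut_map[of M n A act] by (simp add: quotient_map_def)

lemma cut_continuous: "continuous_map M Mc cc"
  using quotient_map_cut_map quotient_imp_continuous_map by blast

text \<open>The condition concerns boundary points only, since all other classes are
  singletons.\<close>

definition saturated :: "'a set \<Rightarrow> bool" where
  "saturated N \<longleftrightarrow> N \<subseteq> topspace M \<and> (\<forall>a\<in>unit_circle. \<forall>x\<in>N \<inter> bd. act a x \<in> N)"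

lemma saturated_iff:
  assumes "saturated N" "x \<in> topspace M"
  shows "cc x \<in> cc ` N \<longleftrightarrow> x \<in> N"
proof
  assume "cc x \<in> cc ` N"
  then obtain y where y: "y \<in> N" "cc y = cc x" by auto
  then have "y \<in> topspace M" using assms by (auto simp: saturated_def)
  from cut_map_eq_iff[OF this assms(2)] y show "x \<in> N" using assms(1) by (auto simp: saturated_def)
qed auto

lemma saturated_open:
  assumes N: "openin M N" "saturated N"
  shows "openin Mc (cc ` N)"
proof -
  have "{x \<in> topspace M. cc x \<in> cc ` N} = N" using saturated_iff[OF N(2)] openin_subset[OF N(1)] by blast
  moreover have "cc ` N \<subseteq> topspace M // cut_relation n M A act"
    using openin_subset[OF N(1)] cut_topspace by (auto simp: topspace_cut_space)
  ultimately show ?thesis using N by (simp add: openin_cut_space)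
qed

lemma saturated_invariant: "circle_invariant act N \<Longrightarrow> N \<subseteq> topspace M \<Longrightarrow> saturated N"
  by (auto simp: saturated_def circle_invariant_def)

text \<open>The largest saturated subset of an open \<open>N\<close>: a boundary point survives
  exactly when its whole orbit lies in \<open>N\<close>.\<close>

definition sat_interior :: "'a set \<Rightarrow> 'a set" where
  "sat_interior N = (N - bd) \<union> core N"

lemma sat_interior:
  assumes "openin M N"
  shows "openin M (sat_interior N)" "saturated (sat_interior N)" "sat_interior N \<subseteq> N"
proof -
  have "N - bd = N \<inter> (topspace M - bd)" using openin_subset[OF assms] by blast
  then have "openin M (N - bd)" using assms interior_open by auto
  then show "openin M (sat_interior N)" unfolding sat_interior_def using core_open[OF assms] by blast
  show "sat_interior N \<subseteq> N" using core_sub by (auto simp: sat_interior_def)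
  then show "saturated (sat_interior N)"
    using core_invariant openin_subset[OF assms]
    by (auto simp: saturated_def sat_interior_def circle_invariant_def)
qed

text \<open>A basic open set of \<open>M\<close> need not contain a whole boundary orbit. Orbits are
  compact, hence covered by finitely many basic sets inside a given saturated open set; so finite
  unions of basic sets, reduced to their saturated part, yield a countable base.\<close>

lemma cut_second_countable: "second_countable Mc"
proof -
  obtain B where "countable B \<and> (\<forall>V\<in>B. openin M V) \<and> (\<forall>U x. openin M U \<and> x \<in> U \<longrightarrow> (\<exists>V\<in>B. x \<in> V \<and> V \<subseteq> U))"
    using second_count unfolding second_countable_def by (elim exE)
  then have B: "countable B" "\<And>V. V \<in> B \<Longrightarrow> openin M V"
    "\<And>U x. openin M U \<Longrightarrow> x \<in> U \<Longrightarrow> \<exists>V\<in>B. x \<in> V \<and> V \<subseteq> U"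
    by simp_all
  define B' where "B' = (\<lambda>F. cc ` sat_interior (\<Union>F)) ` {F. finite F \<and> F \<subseteq> B}"
  have "countable B'" unfolding B'_def using countable_Collect_finite_subset[OF B(1)] by simp
  moreover have "openin Mc G" if GB: "G \<in> B'" for G
  proof -
    obtain F where F: "finite F" "F \<subseteq> B" "G = cc ` sat_interior (\<Union>F)" using GB by (auto simp: B'_def)
    then have "openin M (\<Union>F)" using B(2) by blast
    then show ?thesis using saturated_open sat_interior F(3) by blast
  qed
  moreover have "\<exists>V\<in>B'. q \<in> V \<and> V \<subseteq> G" if G: "openin Mc G" "q \<in> G" for G q
  proof -
    define N where "N = {x \<in> topspace M. cc x \<in> G}"
    have N: "openin M N" unfolding N_def by (rule openin_continuous_map_preimage[OF cut_continuous G(1)])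
    obtain x where x: "x \<in> topspace M" "q = cc x" using G openin_subset[OF G(1)] cut_topspace by blast
    have "\<exists>F. finite F \<and> F \<subseteq> B \<and> \<Union>F \<subseteq> N \<and> x \<in> sat_interior (\<Union>F)"
    proof (cases "x \<in> bd")
      case False
      obtain V where "V \<in> B" "x \<in> V" "V \<subseteq> N" using B(3)[OF N, of x] x G by (auto simp: N_def)
      then show ?thesis using False by (intro exI[of _ "{V}"]) (auto simp: sat_interior_def)
    next
      case True
      let ?O = "(\<lambda>a. act a x) ` unit_circle"
      have xW: "x \<in> W" "x \<in> UM" using True W by auto
      have ON: "?O \<subseteq> N" using cut_map_act[OF _ True] x G(2) act_UM[OF _ xW(2)] UM by (auto simp: N_def)
      have "?O \<subseteq> \<Union>{V \<in> B. V \<subseteq> N}" using ON B(3)[OF N] by blast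
      then obtain F where F: "finite F" "F \<subseteq> {V \<in> B. V \<subseteq> N}" "?O \<subseteq> \<Union>F"
        using compactinD[OF orbit_compact[OF xW(2)], of "{V \<in> B. V \<subseteq> N}"] B(2) by blast
      then have "x \<in> core (\<Union>F)" using xW by (auto simp: core_def)
      then show ?thesis using F by (intro exI[of _ F]) (auto simp: sat_interior_def)
    qed
    then obtain F where F: "finite F" "F \<subseteq> B" "\<Union>F \<subseteq> N" "x \<in> sat_interior (\<Union>F)" by blast
    then have "openin M (\<Union>F)" using B(2) by blast
    then have "cc ` sat_interior (\<Union>F) \<subseteq> G" using sat_interior(3) F(3) by (fastforce simp: N_def)
    moreover have "q \<in> cc ` sat_interior (\<Union>F)" using x F by blast
    ultimately show ?thesis using F by (auto simp: B'_def)
  qed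
  ultimately show ?thesis unfolding second_countable_def by blast
qed

text \<open>Interior points are separated as in \<open>M\<close>; a boundary point and an interior
  point by the values of \<open>f\<close>, with half the positive value as threshold; two boundary
  points by separating their disjoint compact orbits and passing to cores. The assumption
  \<open>le\<close> in \<open>sep\<close> removes the mirrored mixed case.\<close>

lemma cut_hausdorff: "Hausdorff_space Mc"
proof -
  have sep: "\<exists>N1 N2. openin M N1 \<and> openin M N2 \<and> saturated N1 \<and> saturated N2 \<and> x \<in> N1 \<and> y \<in> N2 \<and> N1 \<inter> N2 = {}"
    if x: "x \<in> topspace M" and y: "y \<in> topspace M" and ne: "cc x \<noteq> cc y" and le: "y \<in> bd \<longrightarrow> x \<in> bd" for x y
  proof -
    have xy: "x \<noteq> y" using ne by auto
    consider "x \<notin> bd" "y \<notin> bd" | "x \<in> bd" "y \<notin> bd" | "x \<in> bd" "y \<in> bd" using le by blast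
    then show ?thesis
    proof cases
      case 1
      obtain N1 N2 where N: "openin M N1" "openin M N2" "x \<in> N1" "y \<in> N2" "disjnt N1 N2"
        using hausdorff x y xy unfolding Hausdorff_space_def by blast
      then show ?thesis using 1 sat_interior[OF N(1)] sat_interior[OF N(2)]
        by (intro exI[of _ "sat_interior N1"] exI[of _ "sat_interior N2"])
          (auto simp: disjnt_iff sat_interior_def)
    next
      case 2
      define e where "e = f y / 2"
      have e: "0 < e" "e < f y" using f_nonneg[OF y] f_zero[OF y] 2 by (auto simp: e_def)
      have 1: "openin M {z \<in> topspace M. f z \<in> {..<e}}" "openin M {z \<in> topspace M. f z \<in> {e<..}}"
        by (rule openin_continuous_map_preimage[OF f_continuous]; simp)+
      have "f x = 0" using 2 f_zero x by blast
      show ?thesis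
      proof (intro exI conjI)
        have "f (act a z) = f z" "act a z \<in> topspace M" if "a \<in> unit_circle" "z \<in> bd" for a z
          using f_act[OF that(1), of z] act_bd[OF that] that W bd_sub by auto
        then show "saturated {z \<in> topspace M. f z \<in> {..<e}}" "saturated {z \<in> topspace M. f z \<in> {e<..}}"
          by (auto simp: saturated_def)
      qed (use 1 x y e \<open>f x = 0\<close> in auto)
    next
      case 3
      let ?O = "\<lambda>x. (\<lambda>a. act a x) ` unit_circle"
      have xyW: "x \<in> W" "y \<in> W" "x \<in> UM" "y \<in> UM" using 3 W by auto
      have dis: "disjnt (?O x) (?O y)"
      proof (rule ccontr)
        assume "\<not> disjnt (?O x) (?O y)"
        then obtain a b where ab: "a \<in> unit_circle" "b \<in> unit_circle" "act a x = act b y" by (auto simp: disjnt_iff)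
        have "cc x = cc (act a x)" using cut_map_act[OF ab(1) 3(1)] by simp
        also have "\<dots> = cc y" using cut_map_act[OF ab(2) 3(2)] ab(3) by simp
        finally show False using ne by simp
      qed
      obtain N1 N2 where N: "openin M N1" "openin M N2" "?O x \<subseteq> N1" "?O y \<subseteq> N2" "disjnt N1 N2"
        using Hausdorff_space_compact_separation[OF hausdorff orbit_compact[OF xyW(3)] orbit_compact[OF xyW(4)] dis]
        by metis
      have "x \<in> core N1" "y \<in> core N2" using N xyW by (auto simp: core_def)
      moreover have "core N1 \<inter> core N2 = {}" using core_sub N(5) by (fastforce simp: disjnt_iff)
      moreover have "saturated (core N)" for N
        using saturated_invariant[OF core_invariant] core_sub UM by blast
      ultimately show ?thesis using core_open[OF N(1)] core_open[OF N(2)]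
        by (intro exI[of _ "core N1"] exI[of _ "core N2"]) simp
    qed
  qed
  have sep': "\<exists>G1 G2. openin Mc G1 \<and> openin Mc G2 \<and> cc x \<in> G1 \<and> cc y \<in> G2 \<and> disjnt G1 G2"
    if x: "x \<in> topspace M" and y: "y \<in> topspace M" and ne: "cc x \<noteq> cc y" and le: "y \<in> bd \<longrightarrow> x \<in> bd" for x y
  proof -
    obtain N1 N2 where N: "openin M N1" "openin M N2" "saturated N1" "saturated N2" "x \<in> N1" "y \<in> N2" "N1 \<inter> N2 = {}"
      using sep[OF x y ne le] by blast
    have "disjnt (cc ` N1) (cc ` N2)"
      using saturated_iff[OF N(4)] N(3,7) by (auto simp: disjnt_iff saturated_def)
    then show ?thesis using N saturated_open by (intro exI[of _ "cc ` N1"] exI[of _ "cc ` N2"]) auto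
  qed
  show ?thesis
    unfolding Hausdorff_space_def
  proof (intro allI impI)
    fix p q assume "p \<in> topspace Mc \<and> q \<in> topspace Mc \<and> p \<noteq> q"
    then obtain x y where xy: "x \<in> topspace M" "y \<in> topspace M" "p = cc x" "q = cc y" "cc x \<noteq> cc y"
      by (auto simp: cut_topspace)
    show "\<exists>U V. openin Mc U \<and> openin Mc V \<and> p \<in> U \<and> q \<in> V \<and> disjnt U V"
    proof (cases "y \<in> bd \<longrightarrow> x \<in> bd")
      case True then show ?thesis using sep'[OF xy(1,2,5)] xy by blast
    next
      case False
      then have "\<exists>G1 G2. openin Mc G1 \<and> openin Mc G2 \<and> cc y \<in> G1 \<and> cc x \<in> G2 \<and> disjnt G1 G2"
        using sep'[OF xy(2,1)] xy(5) by blast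
      then show ?thesis using xy disjnt_sym by blast
    qed
  qed
qed

end

section \<open>Slices for the circle action\<close>

context cut_data
begin

text \<open>Coordinates on products are concatenated: \<open>trunc\<close> reads the
  \<open>M\<close>-part of a point of \<open>M \<times> \<complex>\<close>, while
  \<open>cons\<close> and \<open>shift\<close> add and remove an angle in front of the
  \<open>M\<close>-coordinates.\<close>

definition trunc :: "(nat \<Rightarrow> real) \<Rightarrow> nat \<Rightarrow> real" where
  "trunc y = (\<lambda>i. if i < n then y i else 0)"

definition shift :: "(nat \<Rightarrow> real) \<Rightarrow> nat \<Rightarrow> real" where
  "shift y = (\<lambda>i. y (Suc i))"

definition cons :: "real \<Rightarrow> (nat \<Rightarrow> real) \<Rightarrow> nat \<Rightarrow> real" where
  "cons t u = (\<lambda>i. if i = 0 then t else u (i - 1))"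

lemma shift_cons [simp]: "shift (cons t u) = u" "cons t u 0 = t" "cons t u (Suc i) = u i"
  by (auto simp: shift_def cons_def)

lemma cons_shift: "cons (y 0) (shift y) = y"
  by (auto simp: shift_def cons_def fun_eq_iff)

lemma cons_eucl: "cons t u \<in> eucl (Suc n) \<longleftrightarrow> u \<in> eucl n"
proof
  assume "cons t u \<in> eucl (Suc n)"
  then show "u \<in> eucl n" by (auto simp: in_eucl dest: spec[of _ "Suc _"])
qed (auto simp: in_eucl cons_def)

lemma shift_eucl: "y \<in> eucl (Suc n) \<Longrightarrow> shift y \<in> eucl n"
  by (auto simp: in_eucl shift_def)

lemma cons_upd: "(cons t u)(0 := s) = cons s u"
  by (auto simp: cons_def fun_eq_iff)

text \<open>Unfolds the product charts once and for all: coordinates \<open>n\<close> and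
  \<open>n + 1\<close> are the real and imaginary part of \<open>z\<close>, and smoothness of
  \<open>H\<close> becomes smoothness on a subset of \<open>\<real>^(n + 2)\<close>.\<close>

lemma product_complex_smooth_iff:
  "smooth_fun (n + 2) (product_atlas n A complex_atlas) (V \<times> UNIV) H \<longleftrightarrow>
   (\<forall>(U, \<phi>)\<in>A. smooth_on (n + 2) {y \<in> eucl (n + 2). trunc y \<in> \<phi> ` (U \<inter> V)}
      (\<lambda>y. H (inv_into U \<phi> (trunc y), Complex (y n) (y (n + 1)))))"
proof -
  define \<zeta> where "\<zeta> = (\<lambda>z (i::nat). if i = 0 then Re z else if i = 1 then Im z else (0::real))"
  define g where "g U \<phi> = restrict (\<lambda>(x, z) i. if i < n then \<phi> x i else \<zeta> z (i - n)) (U \<times> UNIV)"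
    for U and \<phi> :: "'a \<Rightarrow> nat \<Rightarrow> real"
  have atl: "product_atlas n A complex_atlas = (\<lambda>(U, \<phi>). (U \<times> UNIV, g U \<phi>)) ` A"
    by (force simp: product_atlas_def complex_atlas_def product_chart_def g_def \<zeta>_def)
  have key: "smooth_on (n + 2) (g U \<phi> ` ((U \<times> UNIV) \<inter> (V \<times> UNIV))) (H \<circ> inv_into (U \<times> UNIV) (g U \<phi>))
     \<longleftrightarrow> smooth_on (n + 2) {y \<in> eucl (n + 2). trunc y \<in> \<phi> ` (U \<inter> V)}
      (\<lambda>y. H (inv_into U \<phi> (trunc y), Complex (y n) (y (n + 1))))" if c: "(U, \<phi>) \<in> A" for U \<phi>
  proof -
    have tr: "trunc (g U \<phi> (x, z)) = \<phi> x" "g U \<phi> (x, z) n = Re z" "g U \<phi> (x, z) (n + 1) = Im z"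
      "g U \<phi> (x, z) \<in> eucl (n + 2)" if "x \<in> U" for x z
      using that chart_eucl[OF c] by (auto simp: g_def trunc_def \<zeta>_def in_eucl fun_eq_iff image_subset_iff)
    have pack: "g U \<phi> (x, Complex (y n) (y (n + 1))) = y" if "x \<in> U" "trunc y = \<phi> x" "y \<in> eucl (n + 2)" for x y
    proof
      fix i
      have "y i = \<phi> x i" if "i < n" using fun_cong[OF \<open>trunc y = \<phi> x\<close>, of i] that by (simp add: trunc_def)
      moreover have "i < n \<or> i = n \<or> i = n + 1 \<or> n + 2 \<le> i" by linarith
      ultimately show "g U \<phi> (x, Complex (y n) (y (n + 1))) i = y i"
        using \<open>x \<in> U\<close> \<open>y \<in> eucl (n + 2)\<close> by (auto simp: g_def \<zeta>_def in_eucl)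
    qed
    have inj: "inj_on (g U \<phi>) (U \<times> UNIV)"
    proof (rule inj_onI, clarify)
      fix x z x' z' assume x: "x \<in> U" "x' \<in> U" and eq: "g U \<phi> (x, z) = g U \<phi> (x', z')"
      have "\<phi> x = \<phi> x'" using tr(1)[OF x(1), of z] tr(1)[OF x(2), of z'] eq by simp
      moreover have "Re z = Re z'" "Im z = Im z'"
        using tr(2,3)[OF x(1), of z] tr(2,3)[OF x(2), of z'] eq by simp_all
      ultimately show "x = x' \<and> z = z'" using x chart_inj[OF c] by (auto simp: inj_on_def complex_eq_iff)
    qed
    have set: "g U \<phi> ` ((U \<times> UNIV) \<inter> (V \<times> UNIV)) = {y \<in> eucl (n + 2). trunc y \<in> \<phi> ` (U \<inter> V)}"
    proof (intro equalityI subsetI)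
      fix y assume "y \<in> {y \<in> eucl (n + 2). trunc y \<in> \<phi> ` (U \<inter> V)}"
      then obtain x where "y \<in> eucl (n + 2)" "x \<in> U" "x \<in> V" "trunc y = \<phi> x" by blast
      with pack[of x y] show "y \<in> g U \<phi> ` ((U \<times> UNIV) \<inter> (V \<times> UNIV))"
        by (intro image_eqI[of _ _ "(x, Complex (y n) (y (n + 1)))"]) auto
    qed (use tr in auto)
    show ?thesis unfolding set
    proof (rule smooth_on_cong)
      fix y assume "y \<in> {y \<in> eucl (n + 2). trunc y \<in> \<phi> ` (U \<inter> V)}"
      then obtain x where x: "y \<in> eucl (n + 2)" "x \<in> U" "trunc y = \<phi> x" by blast
      have "inv_into (U \<times> UNIV) (g U \<phi>) y = (x, Complex (y n) (y (n + 1)))"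
        using inv_into_f_f[OF inj, of "(x, Complex (y n) (y (n + 1)))"] pack[OF x(2,3,1)] x(2) by simp
      then show "(H \<circ> inv_into (U \<times> UNIV) (g U \<phi>)) y = H (inv_into U \<phi> (trunc y), Complex (y n) (y (n + 1)))"
        using x chart_inj[OF c] by simp
    qed
  qed
  show ?thesis unfolding smooth_fun_def atl using key by fastforce
qed

lemma unit_circle_cis:
  assumes "a \<in> unit_circle"
  shows "\<exists>t. a = cis t"
proof
  have "a \<noteq> 0" "norm a = 1" using assms by auto
  then show "a = cis (Arg a)" by (simp add: cis_Arg sgn_div_norm)
qed

lemma inj_on_cis: "inj_on cis {s<..<s + 2 * pi}"
proof (rule inj_onI)
  fix a b assume ab: "a \<in> {s<..<s + 2 * pi}" "b \<in> {s<..<s + 2 * pi}" "cis a = cis b"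
  then have "sin a = sin b \<and> cos a = cos b" by (simp add: complex_eq_iff)
  then obtain k :: int where k: "a = b + 2 * pi * k" using sin_cos_eq_iff by blast
  have "\<bar>a - b\<bar> < 2 * pi" using ab by auto
  then have "\<bar>real_of_int k\<bar> * (2 * pi) < 1 * (2 * pi)" using k by (simp add: abs_mult mult.commute)
  then have "\<bar>real_of_int k\<bar> < 1" using mult_less_cancel_right_pos[of "2 * pi" "\<bar>real_of_int k\<bar>" 1] by simp
  then have "k = 0" by linarith
  then show "a = b" using k by simp
qed

text \<open>The angle ranges over all reals rather than over one chart of the circle. Near a given
  angle some angle chart composed with \<open>cis\<close> is the identity, so smoothness of the
  action in product charts applies.\<close>

lemma act_chart_smooth:
  assumes c: "(U, \<phi>) \<in> A" and d: "(V, \<psi>) \<in> A"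
  shows "smooth_on (Suc n) {y \<in> eucl (Suc n). shift y \<in> \<phi> ` (U \<inter> UM) \<and> act (cis (y 0)) (inv_into U \<phi> (shift y)) \<in> V}
     (\<lambda>y. \<psi> (act (cis (y 0)) (inv_into U \<phi> (shift y))) j)" (is "smooth_on _ ?Z ?F")
proof (rule smooth_on_localI)
  fix y0 assume y0: "y0 \<in> ?Z"
  \<comment> \<open>Centres the angle chart at \<open>y0 0\<close>, which thus lies in the open
    interval \<open>I\<close>.\<close>
  define s where "s = y0 0 - pi"
  define I where "I = {s<..<s + 2 * pi}"
  define C where "C = cis ` I"
  define \<theta> where "\<theta> = restrict (\<lambda>a (i::nat). if i = 0 then inv_into I cis a else (0::real)) C"
  have inj: "inj_on cis I" unfolding I_def by (rule inj_on_cis)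
  have \<theta>: "\<theta> (cis t) 0 = t" if "t \<in> I" for t using that inj by (simp add: \<theta>_def C_def)
  have circ: "(C, \<theta>) \<in> circle_atlas" unfolding circle_atlas_def C_def \<theta>_def I_def by blast
  define g where "g = restrict (\<lambda>(a, x) i. if i < 1 then \<theta> a i else \<phi> x (i - 1)) (C \<times> U)"
  have pc: "(C \<times> U, g) \<in> product_atlas 1 circle_atlas A"
    unfolding product_atlas_def using circ c
    by (intro CollectI exI[of _ "(C, \<theta>)"] exI[of _ "(U, \<phi>)"]) (simp add: product_chart_def g_def One_nat_def[symmetric] del: One_nat_def)
  have gc: "g (cis t, x) = cons t (\<phi> x)" if "t \<in> I" "x \<in> U" for t x
    using that \<theta>[OF that(1)] by (auto simp: g_def cons_def C_def fun_eq_iff)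
  have ginj: "inj_on g (C \<times> U)"
  proof (rule inj_onI, clarify)
    fix a x a' x' assume h: "a \<in> C" "x \<in> U" "a' \<in> C" "x' \<in> U" "g (a, x) = g (a', x')"
    obtain t t' where t: "t \<in> I" "a = cis t" "t' \<in> I" "a' = cis t'" using h by (auto simp: C_def)
    have e: "cons t (\<phi> x) = cons t' (\<phi> x')" using gc[OF t(1) h(2)] gc[OF t(3) h(4)] h(5) t by simp
    have "t = t'" using arg_cong[OF e, of "\<lambda>f. f 0"] by simp
    moreover have "\<phi> x = \<phi> x'" using arg_cong[OF e, of shift] by simp
    ultimately show "a = a' \<and> x = x'" using t h chart_inj[OF c] by (auto simp: inj_on_def)
  qed
  have ginv: "inv_into (C \<times> U) g (cons t (\<phi> x)) = (cis t, x)" if "t \<in> I" "x \<in> U" for t x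
    using inv_into_f_f[OF ginj, of "(cis t, x)"] gc[OF that] that by (simp add: C_def)
  define W' where "W' = {y \<in> eucl (Suc n). s < y 0} \<inter> {y \<in> eucl (Suc n). y 0 < s + 2 * pi}"
  have W': "openin (Euclidean_space (Suc n)) W'"
    unfolding W'_def by (intro openin_Int openin_eucl_less openin_topspace continuous_on_const)
      (auto intro: continuous_on_subset[OF continuous_on_product_coordinates])
  let ?P = "{p \<in> (C \<times> U) \<inter> (unit_circle \<times> UM). (case p of (a, x) \<Rightarrow> act a x) \<in> V}"
  have "smooth_map_on (1 + n) (g ` ?P) (\<psi> \<circ> (\<lambda>(a, x). act a x) \<circ> inv_into (C \<times> U) g)"
    using act_smooth pc d unfolding smooth_map_def by fastforce
  then have sm: "smooth_on (Suc n) (g ` ?P) (\<lambda>y. (\<psi> \<circ> (\<lambda>(a, x). act a x) \<circ> inv_into (C \<times> U) g) y j)"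
    by (simp add: smooth_map_on_def)
  have mem: "y \<in> g ` ?P \<and> (\<psi> \<circ> (\<lambda>(a, x). act a x) \<circ> inv_into (C \<times> U) g) y j = ?F y" if yZ: "y \<in> ?Z \<inter> W'" for y
  proof -
    obtain x where x: "x \<in> U" "x \<in> UM" "shift y = \<phi> x" using yZ by auto
    have t: "y 0 \<in> I" using yZ by (auto simp: W'_def I_def)
    have y: "y = cons (y 0) (\<phi> x)" using cons_shift[of y] x by simp
    have ix: "inv_into U \<phi> (shift y) = x" using x chart_inj[OF c] by simp
    have P: "(cis (y 0), x) \<in> ?P" using x t yZ ix by (auto simp: C_def)
    have "y = g (cis (y 0), x)" using gc[OF t x(1)] y by simp
    moreover have "inv_into (C \<times> U) g y = (cis (y 0), x)" using ginv[OF t x(1)] y by simp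
    ultimately show ?thesis using P ix by auto
  qed
  have "smooth_on (Suc n) (?Z \<inter> W') ?F"
    by (rule smooth_on_eq[OF smooth_on_subset[OF sm]]) (use mem in blast)+
  moreover have "y0 \<in> W'" using y0 by (auto simp: W'_def s_def)
  ultimately show "\<exists>W. openin (Euclidean_space (Suc n)) W \<and> y0 \<in> W \<and> smooth_on (Suc n) (?Z \<inter> W) ?F"
    using W' by blast
qed

lemma smooth_on_cons:
  assumes "smooth_on m S t" "\<And>i. i < n \<Longrightarrow> smooth_on m S (\<lambda>u. v u i)" "j < Suc n"
  shows "smooth_on m S (\<lambda>u. cons (t u) (v u) j)"
  using assms by (cases j) (auto simp: cons_def)

text \<open>Fixing the angle in \<open>act_chart_smooth\<close> gives smoothness of the single map
  \<open>act a\<close>.\<close>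

lemma smooth_fun_act:
  assumes a: "a \<in> unit_circle" and k: "smooth_fun n A D k" and D: "openin M D" "D \<subseteq> UM"
  shows "smooth_fun n A {x \<in> UM. act a x \<in> D} (\<lambda>x. k (act a x))"
proof (rule smooth_fun_localI)
  fix x assume x: "x \<in> {x \<in> UM. act a x \<in> D}"
  then obtain U \<phi> V \<psi> where c: "(U, \<phi>) \<in> A" "x \<in> U" and d: "(V, \<psi>) \<in> A" "act a x \<in> V"
  proof -
    have "x \<in> topspace M" "act a x \<in> topspace M" using x UM D by auto
    with chart_exists[of x] chart_exists[of "act a x"] that show thesis by blast
  qed
  define D' where "D' = {y \<in> UM. act a y \<in> D} \<inter> {y \<in> UM. act a y \<in> V} \<inter> U"
  have op: "openin M {y \<in> UM. act a y \<in> G}" if "openin M G" for G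
    using openin_continuous_map_preimage[OF act_continuous1[OF a] that] UM
    by (simp add: inf_absorb2 openin_open_subtopology)
  have "openin M D'" unfolding D'_def
    using op[OF D(1)] op[OF is_chartD(1)[OF chart[OF d(1)]]] is_chartD(1)[OF chart[OF c(1)]] by blast
  obtain t where t: "a = cis t" using unit_circle_cis[OF a] by blast
  let ?S = "\<phi> ` D'"
  have Se: "?S \<subseteq> eucl n" using chart_eucl[OF c(1)] by (auto simp: D'_def)
  have "smooth_on n ?S (\<lambda>u. (k \<circ> inv_into V \<psi>) ((\<lambda>u. \<psi> (act (cis (cons t u 0)) (inv_into U \<phi> (shift (cons t u))))) u))"
  proof (rule smooth_on_compose[where g = "k \<circ> inv_into V \<psi>"])
    show "smooth_on n (\<psi> ` (V \<inter> D)) (k \<circ> inv_into V \<psi>)" using k d by (auto simp: smooth_fun_def)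
    show "smooth_on n ?S (\<lambda>u. \<psi> (act (cis (cons t u 0)) (inv_into U \<phi> (shift (cons t u)))) j)" for j
    proof (rule smooth_on_compose[OF act_chart_smooth[OF c(1) d(1)], where F = "\<lambda>u. cons t u"])
      show "smooth_on n ?S (\<lambda>u. cons t u i)" if "i < Suc n" for i
        using that by (intro smooth_on_cons smooth_on_const smooth_on_coord Se)
      show "cons t ` ?S \<subseteq> {y \<in> eucl (Suc n). shift y \<in> \<phi> ` (U \<inter> UM) \<and> act (cis (y 0)) (inv_into U \<phi> (shift y)) \<in> V}"
        using Se t chart_inj[OF c(1)] by (auto simp: cons_eucl D'_def)
    qed (use Se in auto)
    show "(\<lambda>u. \<psi> (act (cis (cons t u 0)) (inv_into U \<phi> (shift (cons t u))))) ` ?S \<subseteq> \<psi> ` (V \<inter> D)"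
      using t chart_inj[OF c(1)] by (auto simp: D'_def)
  qed (use chart_eucl[OF d(1)] Se in auto)
  then have "smooth_on n ?S ((\<lambda>x. k (act a x)) \<circ> inv_into U \<phi>)"
    by (rule smooth_on_eq) (use t chart_inj[OF c(1)] chart_inj[OF d(1)] in \<open>auto simp: D'_def\<close>)
  then have "smooth_fun n A D' (\<lambda>x. k (act a x))"
    by (intro smooth_fun_chartI[OF c(1)]) (auto simp: D'_def)
  then have "smooth_fun n A ({x \<in> UM. act a x \<in> D} \<inter> D') (\<lambda>x. k (act a x))"
    by (rule smooth_fun_subset) auto
  then show "\<exists>N. openin M N \<and> x \<in> N \<and> smooth_fun n A ({x \<in> UM. act a x \<in> D} \<inter> N) (\<lambda>x. k (act a x))"
    using \<open>openin M D'\<close> x c d by (intro exI[of _ D']) (auto simp: D'_def)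
qed

section \<open>Smooth functions on the product with the complex plane\<close>

lemma product_smooth_pullback:
  assumes "smooth_fun n A V k"
  shows "smooth_fun (n + 2) (product_atlas n A complex_atlas) (V \<times> UNIV) (\<lambda>(x, z). k x)"
  unfolding product_complex_smooth_iff
proof (clarify)
  fix U \<phi> assume c: "(U, \<phi>) \<in> A"
  have "smooth_on (n + 2) {y \<in> eucl (n + 2). trunc y \<in> \<phi> ` (U \<inter> V)} (\<lambda>y. (k \<circ> inv_into U \<phi>) (trunc y))"
  proof (rule smooth_on_compose[where g = "k \<circ> inv_into U \<phi>" and F = trunc])
    show "smooth_on n (\<phi> ` (U \<inter> V)) (k \<circ> inv_into U \<phi>)" using assms c by (auto simp: smooth_fun_def)
    show "smooth_on (n + 2) {y \<in> eucl (n + 2). trunc y \<in> \<phi> ` (U \<inter> V)} (\<lambda>y. trunc y j)" if "j < n" for j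
      using that by (simp add: trunc_def) (intro smooth_on_coord, auto)
  qed (use chart_eucl[OF c] in auto)
  then show "smooth_on (n + 2) {y \<in> eucl (n + 2). trunc y \<in> \<phi> ` (U \<inter> V)}
      (\<lambda>y. k (inv_into U \<phi> (trunc y)))"
    by simp
qed

lemma product_smooth_Re_Im:
  "smooth_fun (n + 2) (product_atlas n A complex_atlas) (V \<times> UNIV) (\<lambda>(x, z). Re z)"
  "smooth_fun (n + 2) (product_atlas n A complex_atlas) (V \<times> UNIV) (\<lambda>(x, z). Im z)"
  unfolding product_complex_smooth_iff by (auto intro!: smooth_on_coord)

lemma product_smooth_localI:
  assumes "\<And>x. x \<in> V \<Longrightarrow> \<exists>N. openin M N \<and> x \<in> N \<and>
    smooth_fun (n + 2) (product_atlas n A complex_atlas) ((V \<inter> N) \<times> UNIV) H"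
  shows "smooth_fun (n + 2) (product_atlas n A complex_atlas) (V \<times> UNIV) H"
  unfolding product_complex_smooth_iff
proof (clarify)
  fix U \<phi> assume c: "(U, \<phi>) \<in> A"
  let ?F = "\<lambda>y. H (inv_into U \<phi> (trunc y), Complex (y n) (y (n + 1)))"
  let ?Z = "\<lambda>V. {y \<in> eucl (n + 2). trunc y \<in> \<phi> ` (U \<inter> V)}"
  show "smooth_on (n + 2) (?Z V) ?F"
  proof (rule smooth_on_localI)
    fix y assume y: "y \<in> ?Z V"
    then obtain x where x: "x \<in> U" "x \<in> V" "trunc y = \<phi> x" by blast
    obtain N where N: "openin M N" "x \<in> N" "smooth_fun (n + 2) (product_atlas n A complex_atlas) ((V \<inter> N) \<times> UNIV) H"
      using assms[OF x(2)] by blast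
    obtain T where T: "openin (Euclidean_space n) T" "\<And>D. D \<subseteq> U \<Longrightarrow> \<phi> ` D \<inter> T = \<phi> ` (D \<inter> N)"
      using chart_image_open'[OF c N(1)] by metis
    define W' where "W' = {y \<in> eucl (n + 2). trunc y \<in> T}"
    have "openin (Euclidean_space (n + 2)) W'" unfolding W'_def
      by (rule openin_eucl_vimage[OF openin_topspace _ _ T(1)])
        (auto simp: trunc_def in_eucl intro: continuous_on_subset[OF continuous_on_product_coordinates])
    moreover have "y \<in> W'" using y x N(2) T(2)[of "{x}"] by (auto simp: W'_def)
    moreover have "smooth_on (n + 2) (?Z V \<inter> W') ?F"
    proof -
      have "smooth_on (n + 2) (?Z (V \<inter> N)) ?F"
        using N(3) c unfolding product_complex_smooth_iff by blast
      moreover have "?Z V \<inter> W' \<subseteq> ?Z (V \<inter> N)"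
        using T(2)[of "U \<inter> V"] by (auto simp: W'_def Int_assoc)
      ultimately show ?thesis by (rule smooth_on_subset)
    qed
    ultimately show "\<exists>W. openin (Euclidean_space (n + 2)) W \<and> y \<in> W \<and> smooth_on (n + 2) (?Z V \<inter> W) ?F" by blast
  qed
qed

lemma product_smooth_eq:
  assumes "smooth_fun (n + 2) (product_atlas n A complex_atlas) (V \<times> UNIV) H" "\<And>x z. x \<in> V \<Longrightarrow> H (x, z) = H' (x, z)"
  shows "smooth_fun (n + 2) (product_atlas n A complex_atlas) (V \<times> UNIV) H'"
  unfolding product_complex_smooth_iff
proof (clarify)
  fix U \<phi> assume c: "(U, \<phi>) \<in> A"
  have "smooth_on (n + 2) {y \<in> eucl (n + 2). trunc y \<in> \<phi> ` (U \<inter> V)} (\<lambda>y. H (inv_into U \<phi> (trunc y), Complex (y n) (y (n + 1))))"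
    using assms(1) c unfolding product_complex_smooth_iff by blast
  then show "smooth_on (n + 2) {y \<in> eucl (n + 2). trunc y \<in> \<phi> ` (U \<inter> V)} (\<lambda>y. H' (inv_into U \<phi> (trunc y), Complex (y n) (y (n + 1))))"
    by (rule smooth_on_eq) (use assms(2) chart_inj[OF c] in auto)
qed

lemma product_charts:
  assumes "(P, \<pi>) \<in> product_atlas n A complex_atlas"
  shows "inj_on \<pi> P \<and> \<pi> ` P \<subseteq> eucl (n + 2)"
proof -
  obtain U \<phi> where c: "(U, \<phi>) \<in> A" and P: "P = U \<times> UNIV"
    "\<pi> = restrict (\<lambda>(x, z) i. if i < n then \<phi> x i else if i - n = 0 then Re z else if i - n = 1 then Im z else 0) (U \<times> UNIV)"
    using assms by (auto simp: product_atlas_def complex_atlas_def product_chart_def)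
  have v: "\<pi> (x, z) n = Re z" "\<pi> (x, z) (n + 1) = Im z" "i < n \<Longrightarrow> \<pi> (x, z) i = \<phi> x i" if "x \<in> U" for x z i
    using that by (auto simp: P)
  have "inj_on \<pi> P"
  proof (rule inj_onI, clarsimp simp: P(1))
    fix x z x' z' assume h: "x \<in> U" "x' \<in> U" "\<pi> (x, z) = \<pi> (x', z')"
    have "\<phi> x i = \<phi> x' i" for i
    proof (cases "i < n")
      case True then show ?thesis using v(3)[OF h(1) True, of z] v(3)[OF h(2) True, of z'] h(3) by simp
    next
      case False then show ?thesis using chart_eucl[OF c] h by (auto simp: in_eucl image_subset_iff)
    qed
    then have "x = x'" using chart_inj[OF c] h by (auto simp: inj_on_def fun_eq_iff)
    moreover have "z = z'" using v(1,2)[OF h(1), of z] v(1,2)[OF h(2), of z'] h(3) by (simp add: complex_eq_iff)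
    ultimately show "x = x' \<and> z = z'" by simp
  qed
  moreover have "\<pi> ` P \<subseteq> eucl (n + 2)" by (auto simp: P in_eucl)
  ultimately show ?thesis by blast
qed

end

section \<open>Defining function and action in boundary charts\<close>

lemma eventually_in_eucl_open:
  assumes W: "openin (Euclidean_space m) W" and c: "c t0 \<in> W"
    and cont: "\<And>j. j < m \<Longrightarrow> isCont (\<lambda>t. c t j) t0" and ev: "\<forall>\<^sub>F t in nhds t0. c t \<in> eucl m"
  shows "\<forall>\<^sub>F t::real in nhds t0. c t \<in> W"
proof -
  obtain r where r: "r > 0" "cube m (c t0) r \<subseteq> W" using openin_contains_cube[OF W c] by metis
  have "\<forall>\<^sub>F t in nhds t0. \<forall>j\<in>{..<m}. \<bar>c t j - c t0 j\<bar> < r"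
  proof (intro eventually_ball_finite ballI)
    fix j assume "j \<in> {..<m}"
    then have "((\<lambda>t. c t j) \<longlongrightarrow> c t0 j) (nhds t0)"
      using cont[of j] tendsto_at_iff_tendsto_nhds[of "\<lambda>t. c t j" t0] by (simp add: isCont_def)
    from tendstoD[OF this r(1)] show "\<forall>\<^sub>F t in nhds t0. \<bar>c t j - c t0 j\<bar> < r" by (simp add: dist_real_def)
  qed simp
  with ev show ?thesis
  proof eventually_elim
    case (elim t)
    then have "c t \<in> cube m (c t0) r" by (simp add: cube_def)
    then show ?case using r by blast
  qed
qed

context cut_data
begin

lemma bd_chart:
  assumes "x0 \<in> bd"
  obtains U \<phi> where "(U, \<phi>) \<in> A" "x0 \<in> U" "\<phi> x0 0 = 0" "0 < n"
  using assms by (auto simp: boundary_of_manifold_def half_space_boundary_def)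

lemma chart_zero_bd:
  assumes "(U, \<phi>) \<in> A" "x \<in> U" "\<phi> x 0 = 0" "0 < n"
  shows "x \<in> bd"
proof -
  have "x \<in> topspace M" "\<phi> x \<in> topspace (half_space n)" using is_chartD(6,7)[OF chart[OF assms(1)]] assms(2) by auto
  then show ?thesis using assms unfolding boundary_of_manifold_def half_space_boundary_def by fastforce
qed

lemma chart_nonneg: "(U, \<phi>) \<in> A \<Longrightarrow> x \<in> U \<Longrightarrow> 0 \<le> \<phi> x 0"
  using is_chartD(7)[OF chart, of U \<phi>] by (force simp: topspace_half_space)

text \<open>
  Along the boundary \<open>f\<close> vanishes, so only its \<open>0\<close>-th partial derivative is nonzero and \<open>f\<close> can replace
  the coordinate \<open>x\<^sub>0\<close>.  In particular \<open>f\<close> detects the boundary inside every such chart.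
\<close>

lemma boundary_normal_form:
  assumes c: "(U, \<phi>) \<in> A" and x0: "x0 \<in> U" "x0 \<in> bd" and z: "\<phi> x0 0 = 0" and n: "0 < n"
  obtains r1 Y1 g1 where "0 < r1"
    "openin (Euclidean_space n) Y1" "smooth_on n Y1 g1"
    "\<And>x. x \<in> U \<Longrightarrow> \<phi> x \<in> cube n (\<phi> x0) r1 \<Longrightarrow> (\<phi> x)(0 := f x) \<in> Y1 \<and> g1 ((\<phi> x)(0 := f x)) = \<phi> x 0"
    "\<And>y. y \<in> Y1 \<Longrightarrow> 0 \<le> y 0 \<Longrightarrow> y(0 := g1 y) \<in> cube n (\<phi> x0) r1 \<and> 0 \<le> g1 y \<and> f (inv_into U \<phi> (y(0 := g1 y))) = y 0"
    "\<And>x. x \<in> U \<Longrightarrow> \<phi> x \<in> cube n (\<phi> x0) r1 \<Longrightarrow> f x = 0 \<Longrightarrow> \<phi> x 0 = 0"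
proof -
  define p where "p = \<phi> x0"
  note ch = chart[OF c] and inj = chart_inj[OF c]
  have Ut: "U \<subseteq> topspace M" using is_chartD(6)[OF ch] .
  obtain T1 where T1: "openin (Euclidean_space n) T1" "\<phi> ` U = T1 \<inter> {x. 0 \<le> x 0}"
    using openin_half_space[OF is_chartD(3)[OF ch]] by blast
  have "smooth_on n (\<phi> ` U) (f \<circ> inv_into U \<phi>)"
    using f_smooth c Ut by (fastforce simp: smooth_fun_def inf_absorb1)
  then obtain Wf ff where Wf: "openin (Euclidean_space n) Wf" "p \<in> Wf" "smooth_on n Wf ff"
    "\<And>y. y \<in> Wf \<Longrightarrow> y \<in> \<phi> ` U \<Longrightarrow> ff y = (f \<circ> inv_into U \<phi>) y"
    using smooth_on_openE x0(1) unfolding p_def by (metis imageI)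
  \<comment> \<open>On \<open>W1\<close> a nonnegative coordinate 0 guarantees membership in the
    chart image, and \<open>ff\<close> is a smooth extension of \<open>f\<close> across the
    face.\<close>
  define W1 where "W1 = Wf \<inter> T1"
  have W1: "openin (Euclidean_space n) W1" "p \<in> W1" "smooth_on n W1 ff"
    using Wf T1 x0 smooth_on_subset by (auto simp: W1_def p_def)
  have ff: "y \<in> \<phi> ` U" "ff y = f (inv_into U \<phi> y)" if "y \<in> W1" "0 \<le> y 0" for y
    using that Wf(4)[of y] T1 by (auto simp: W1_def)
  have f0: "f (inv_into U \<phi> y) = 0" if y: "y \<in> \<phi> ` U" "y 0 = 0" for y
  proof -
    obtain x where x: "x \<in> U" "y = \<phi> x" using y by blast
    then have "x \<in> bd" using chart_zero_bd[OF c x(1) _ n] y by simp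
    then show ?thesis using f_zero[of x] x Ut inj by auto
  qed
  have ff0: "ff y = 0" if "y \<in> W1" "y 0 = 0" for y using ff[OF that(1)] f0 that(2) by simp
  have p0: "p 0 = 0" using z by (simp add: p_def)
  obtain ff' where ff': "\<And>x. x \<in> W1 \<Longrightarrow> ((\<lambda>t. ff (x(0 := t))) has_real_derivative ff' x) (at (x 0))"
    using smooth_on_partialE[OF W1(1,3) n] by metis
  have d0: "((\<lambda>t. ff (p(0 := t))) has_real_derivative ff' p) (at 0)" using ff'[OF W1(2)] p0 by simp
  obtain e0 where e0: "e0 > 0" "\<And>t. \<bar>t - p 0\<bar> < e0 \<Longrightarrow> p(0 := t) \<in> W1"
    using openin_eucl_line[OF W1(1,2) n] by metis
  \<comment> \<open>A negative derivative contradicts \<open>f \<ge> 0\<close>. It is also nonzero: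
    the partial derivatives along the face vanish because \<open>f\<close> does, so the nonvanishing
    one belongs to coordinate 0, where the one-sided derivative of \<open>f\<close> is the
    derivative of the extension.\<close>
  have pos: "ff' p > 0"
  proof -
    have ge: "0 \<le> ff (p(0 := t))" if "0 \<le> t" "t < e0" for t
    proof -
      have "p(0 := t) \<in> W1" using e0(2)[of t] p0 that by simp
      from ff[OF this] that obtain x where "x \<in> U" "ff (p(0 := t)) = f x" using inj by auto
      then show ?thesis using f_nonneg Ut by auto
    qed
    have "\<not> ff' p < 0"
    proof
      assume "ff' p < 0"
      from DERIV_neg_dec_right[OF d0 this] obtain d where d: "d > 0" "\<And>h. 0 < h \<Longrightarrow> h < d \<Longrightarrow> ff (p(0 := 0 + h)) < ff (p(0 := 0))"
        by auto
      define h where "h = min d e0 / 2"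
      have h: "0 < h" "h < d" "h < e0" using d e0 by (auto simp: h_def)
      have "ff (p(0 := 0)) = 0" using ff0[OF W1(2) p0] p0 by (simp add: fun_upd_idem)
      then show False using d(2)[OF h(1,2)] ge[of h] h by simp
    qed
    moreover have "ff' p \<noteq> 0"
    proof -
      from f_deriv[OF x0(2)] c x0(1) obtain i d where i: "i < n" "d \<noteq> 0"
        "((\<lambda>t. f (inv_into U \<phi> (p(i := t)))) has_real_derivative d) (at (p i) within {t. p(i := t) \<in> \<phi> ` U})"
        unfolding differential_nonzero_at_def p_def by fastforce
      show ?thesis
      proof (cases "i = 0")
        case False
        obtain e where e: "e > 0" "\<And>t. \<bar>t - p i\<bar> < e \<Longrightarrow> p(i := t) \<in> W1"
          using openin_eucl_line[OF W1(1,2) i(1)] by metis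
        have in_U: "p(i := t) \<in> \<phi> ` U" "f (inv_into U \<phi> (p(i := t))) = 0" if "t \<in> ball (p i) e" for t
        proof -
          have "p(i := t) \<in> W1" "(p(i := t)) 0 = 0"
            using e(2)[of t] that p0 False by (auto simp: dist_real_def abs_minus_commute)
          then show "p(i := t) \<in> \<phi> ` U" "f (inv_into U \<phi> (p(i := t))) = 0" using ff(1) f0 by auto
        qed
        have "((\<lambda>t. f (inv_into U \<phi> (p(i := t)))) has_real_derivative d) (at (p i) within ball (p i) e)"
          by (rule DERIV_subset[OF i(3)]) (use in_U in auto)
        then have "((\<lambda>t. f (inv_into U \<phi> (p(i := t)))) has_real_derivative d) (at (p i))"
          using e(1) at_within_open[of "p i" "ball (p i) e"] by simp
        then have "((\<lambda>t. 0) has_real_derivative d) (at (p i))"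
          by (rule has_field_derivative_transform_within_open[of _ _ _ "ball (p i) e"]) (use e in_U in auto)
        then have "d = 0" using DERIV_unique DERIV_const by blast
        then show ?thesis using i by simp
      next
        case True
        have S: "{0<..<e0} \<subseteq> {t. p(0 := t) \<in> \<phi> ` U}" using e0(2) ff(1) p0 by (auto simp del: fun_upd_apply simp: fun_upd_same)
        have atr: "at 0 within {0<..<e0} = at_right 0"
          by (rule at_within_nhd[of 0 "{..<e0}"]) (use e0(1) in auto)
        have "((\<lambda>t. f (inv_into U \<phi> (p(0 := t)))) has_real_derivative d) (at 0 within {0<..<e0})"
          using DERIV_subset[OF i(3)[unfolded True p0] S] .
        then have "((\<lambda>t. (f (inv_into U \<phi> (p(0 := t))) - f (inv_into U \<phi> (p(0 := 0)))) / (t - 0)) \<longlongrightarrow> d) (at_right 0)"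
          by (simp add: has_field_derivative_iff atr)
        moreover have "((\<lambda>t. (f (inv_into U \<phi> (p(0 := t))) - f (inv_into U \<phi> (p(0 := 0)))) / (t - 0)) \<longlongrightarrow> ff' p) (at_right 0)"
        proof (rule Lim_transform_eventually)
          show "((\<lambda>t. (ff (p(0 := t)) - ff (p(0 := 0))) / (t - 0)) \<longlongrightarrow> ff' p) (at_right 0)"
            using has_field_derivative_at_within[OF d0, of "{0<..}"] by (simp add: has_field_derivative_iff)
          have eq: "ff (p(0 := t)) = f (inv_into U \<phi> (p(0 := t)))" if "0 \<le> t" "t < e0" for t
            using ff(2)[of "p(0 := t)"] e0(2)[of t] p0 that by simp
          show "\<forall>\<^sub>F t in at_right 0. (ff (p(0 := t)) - ff (p(0 := 0))) / (t - 0)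
              = (f (inv_into U \<phi> (p(0 := t))) - f (inv_into U \<phi> (p(0 := 0)))) / (t - 0)"
            using e0(1) eq by (auto simp: eventually_at_right_field intro!: exI[of _ e0])
        qed
        ultimately have "d = ff' p" using tendsto_unique trivial_limit_at_right_real by blast
        then show ?thesis using i by simp
      qed
    qed
    ultimately show ?thesis by linarith
  qed
  obtain r1 g1 where r1: "r1 > 0" "cube n p r1 \<subseteq> W1"
    "\<And>x t. x \<in> cube n p r1 \<Longrightarrow> x(0 := t) \<in> cube n p r1 \<Longrightarrow> x 0 < t \<Longrightarrow> ff x < ff (x(0 := t))"
    "openin (Euclidean_space n) ((\<lambda>x. x(0 := ff x)) ` cube n p r1)"
    "smooth_on n ((\<lambda>x. x(0 := ff x)) ` cube n p r1) g1"
    "\<And>x. x \<in> cube n p r1 \<Longrightarrow> g1 (x(0 := ff x)) = x 0"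
    by (rule coordinate_replacement[OF W1(1,2) n W1(3) _ pos, unfolded p0, OF d0]) (rule that)
  define Y1 where "Y1 = (\<lambda>x. x(0 := ff x)) ` cube n p r1"
  have cube0: "x(0 := 0) \<in> cube n p r1" if "x \<in> cube n p r1" for x
    using that cube_upd[OF that n, of 0] p0 r1(1) by simp
  have eqf: "ff (\<phi> x) = f x" if "x \<in> U" "\<phi> x \<in> cube n p r1" for x
    using ff(2)[of "\<phi> x"] that r1(2) chart_nonneg[OF c that(1)] inj by auto
  show thesis
  proof (rule that[of r1 Y1 g1])
    show "(\<phi> x)(0 := f x) \<in> Y1 \<and> g1 ((\<phi> x)(0 := f x)) = \<phi> x 0" if "x \<in> U" "\<phi> x \<in> cube n (\<phi> x0) r1" for x
      using eqf[of x] that r1(6)[of "\<phi> x"] by (auto simp: Y1_def p_def intro!: image_eqI[of _ _ "\<phi> x"])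
    show "y(0 := g1 y) \<in> cube n (\<phi> x0) r1 \<and> 0 \<le> g1 y \<and> f (inv_into U \<phi> (y(0 := g1 y))) = y 0"
      if y: "y \<in> Y1" "0 \<le> y 0" for y
    proof -
      obtain x where x: "x \<in> cube n p r1" "y = x(0 := ff x)" using y by (auto simp: Y1_def)
      have g: "g1 y = x 0" "y(0 := g1 y) = x" using r1(6)[OF x(1)] x by auto
      \<comment> \<open>By monotonicity \<open>ff\<close> is negative beyond the face, so
        nonnegative values are attained only over the half space.\<close>
      have "0 \<le> x 0"
      proof (rule ccontr)
        assume "\<not> 0 \<le> x 0"
        then have "ff x < ff (x(0 := 0))" using r1(3)[OF x(1) cube0[OF x(1)]] by simp
        also have "\<dots> = 0" using ff0[of "x(0 := 0)"] cube0[OF x(1)] r1(2) by auto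
        finally show False using y x by simp
      qed
      moreover have "f (inv_into U \<phi> x) = y 0" using ff(2)[of x] x r1(2) calculation by auto
      ultimately show ?thesis using g x by (simp add: p_def)
    qed
    show "\<phi> x 0 = 0" if x: "x \<in> U" "\<phi> x \<in> cube n (\<phi> x0) r1" "f x = 0" for x
    proof (rule ccontr)
      assume "\<phi> x 0 \<noteq> 0"
      then have lt: "0 < \<phi> x 0" using chart_nonneg[OF c x(1)] by simp
      have cx: "\<phi> x \<in> cube n p r1" using x by (simp add: p_def)
      have "ff ((\<phi> x)(0 := 0)) < ff (((\<phi> x)(0 := 0))(0 := \<phi> x 0))"
        by (rule r1(3)[OF cube0[OF cx]]) (use cx lt in simp_all)
      then show False using ff0[of "(\<phi> x)(0 := 0)"] cube0[OF cx] r1(2) eqf[OF x(1) cx] x(3) by auto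
    qed
  qed (use r1 in \<open>auto simp: Y1_def\<close>)
qed

text \<open>
  The slice is \<open>\<phi>\<^sub>j = const\<close> for a coordinate \<open>j\<close> in which the orbit of \<open>x0\<close> moves, and \<open>\<theta> x\<close> is
  the angle that carries \<open>x\<close> into the slice.
\<close>

lemma local_slice:
  assumes c: "(U, \<phi>) \<in> A" and x0: "x0 \<in> U" "x0 \<in> bd" and z: "\<phi> x0 0 = 0" and n: "0 < n" and r: "0 < r"
    and bdc: "\<And>x. x \<in> U \<Longrightarrow> \<phi> x \<in> cube n (\<phi> x0) r \<Longrightarrow> f x = 0 \<Longrightarrow> \<phi> x 0 = 0"
  obtains j N \<theta> where "0 < j" "j < n" "openin M N" "x0 \<in> N" "N \<subseteq> U" "N \<subseteq> W" "smooth_fun n A N \<theta>"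
    "\<And>x. x \<in> N \<Longrightarrow> act (cis (\<theta> x)) x \<in> U"
    "\<And>x. x \<in> N \<Longrightarrow> \<phi> (act (cis (\<theta> x)) x) \<in> cube n (\<phi> x0) r"
    "\<And>x. x \<in> N \<Longrightarrow> \<phi> (act (cis (\<theta> x)) x) j = \<phi> x0 j"
    "\<And>x a. x \<in> N \<Longrightarrow> a \<in> unit_circle \<Longrightarrow> act a x \<in> N \<Longrightarrow> cis (\<theta> (act a x)) * a = cis (\<theta> x)"
    "\<And>x. x \<in> N \<Longrightarrow> \<phi> x j = \<phi> x0 j \<Longrightarrow> cis (\<theta> x) = 1"
proof -
  define p where "p = \<phi> x0"
  note ch = chart[OF c] and inj = chart_inj[OF c]
  have pe: "p \<in> eucl n" using chart_eucl[OF c] x0 by (auto simp: p_def)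
  have x0U: "x0 \<in> UM" "x0 \<in> W" using x0 W by auto
  have p0: "p 0 = 0" using z by (simp add: p_def)
  have circ: "cis t \<in> unit_circle" for t by simp
  define Z where "Z = {y \<in> eucl (Suc n). shift y \<in> \<phi> ` (U \<inter> UM) \<and> act (cis (y 0)) (inv_into U \<phi> (shift y)) \<in> U}"
  define F where "F j y = \<phi> (act (cis (y 0)) (inv_into U \<phi> (shift y))) j" for j y
  have F_smooth: "smooth_on (Suc n) Z (F j)" for j
    using act_chart_smooth[OF c c, of j] by (simp add: Z_def F_def[abs_def])
  have FU: "F j (cons t (\<phi> x)) = \<phi> (act (cis t) x) j" if "x \<in> U" for j t x
    using that inj by (simp add: F_def)
  have ZU: "cons t (\<phi> x) \<in> Z" if "x \<in> U" "x \<in> UM" "act (cis t) x \<in> U" for t x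
    using that inj chart_eucl[OF c] by (auto simp: Z_def cons_eucl)
  obtain \<delta> V where V: "\<delta> > 0" "openin M V" "x0 \<in> V" "V \<subseteq> UM" "\<And>t x. \<bar>t\<bar> < \<delta> \<Longrightarrow> x \<in> V \<Longrightarrow> act (cis t) x \<in> U"
  proof -
    let ?X = "top_of_set unit_circle" and ?Y = "subtopology M UM"
    define R where "R = {q \<in> topspace (prod_topology ?X ?Y). (\<lambda>(a, x). act a x) q \<in> U}"
    have Ro: "openin (prod_topology ?X ?Y) R"
      unfolding R_def by (rule openin_continuous_map_preimage[OF act_continuous is_chartD(1)[OF ch]])
    have "(1, x0) \<in> R" using x0U x0(1) act_1[OF x0U(1)] UM(2) by (auto simp: R_def)
    from openin_prod_topology_alt[THEN iffD1, OF Ro, rule_format, OF this]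
    obtain Q V where QV: "openin ?X Q" "openin ?Y V" "1 \<in> Q" "x0 \<in> V" "Q \<times> V \<subseteq> R"
      by (elim exE conjE)
    obtain T where T: "open T" "Q = unit_circle \<inter> T" using QV(1) by (auto simp: openin_open)
    have "open (cis -` T)" using T(1) by (intro open_vimage continuous_intros)
    moreover have "0 \<in> cis -` T" using QV(3) T(2) by simp
    ultimately obtain \<delta> where \<delta>: "\<delta> > 0" "ball 0 \<delta> \<subseteq> cis -` T" using open_contains_ball by blast
    show thesis
    proof (rule that[of \<delta> V])
      show "openin M V" using QV(2) UM(1) by (simp add: openin_open_subtopology)
      show "V \<subseteq> UM" using openin_subset[OF QV(2)] by auto
      fix t x assume tx: "\<bar>t\<bar> < \<delta>" "x \<in> V"
      then have "cis t \<in> Q" using \<delta> T by (auto simp: subset_iff dist_real_def)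
      then have "(cis t, x) \<in> R" using QV(5) tx by blast
      then show "act (cis t) x \<in> U" by (simp add: R_def)
    qed (use \<delta> QV in auto)
  qed
  obtain T where T: "openin (Euclidean_space n) T" "\<And>D. D \<subseteq> U \<Longrightarrow> \<phi> ` D \<inter> T = \<phi> ` (D \<inter> V)"
    using chart_image_open'[OF c V(2)] by metis
  obtain T1 where T1: "openin (Euclidean_space n) T1" "\<phi> ` U = T1 \<inter> {x. 0 \<le> x 0}"
    using openin_half_space[OF is_chartD(3)[OF ch]] by blast
  define P where "P = cons 0 p"
  have P0: "P 0 = 0" "shift P = p" by (simp_all add: P_def)
  have PZ: "P \<in> Z" unfolding P_def p_def by (rule ZU) (use x0 x0U act_1 in auto)
  \<comment> \<open>\<open>Z\<close> is not open in \<open>\<real>^(n + 1)\<close>, because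
    \<open>\<phi>\<close> takes values in a half space. \<open>WZ\<close> is an open neighbourhood
    of \<open>P\<close> whose points over the half space belong to \<open>Z\<close>.\<close>
  define WZ where "WZ = {y \<in> {y \<in> eucl (Suc n). shift y \<in> T \<inter> T1}. \<bar>y 0\<bar> < \<delta>}"
  have cc: "continuous_on S (\<lambda>y::nat \<Rightarrow> real. y i)" for S i
    by (rule continuous_on_subset[OF continuous_on_product_coordinates]) simp
  have WZo: "openin (Euclidean_space (Suc n)) WZ"
    unfolding WZ_def
  proof (rule openin_eucl_less)
    show "openin (Euclidean_space (Suc n)) {y \<in> eucl (Suc n). shift y \<in> T \<inter> T1}"
    proof (rule openin_eucl_vimage[OF openin_topspace])
      show "continuous_on (eucl (Suc n)) (\<lambda>y. shift y j)" for j unfolding shift_def by (rule cc)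
      show "shift ` eucl (Suc n) \<subseteq> eucl n" using shift_eucl by blast
    qed (use T T1 in auto)
    show "continuous_on {x \<in> eucl (Suc n). shift x \<in> T \<inter> T1} (\<lambda>x. \<bar>x 0\<bar>)" by (intro continuous_intros cc)
  qed (rule continuous_on_const)
  have "p \<in> T" using T(2)[of "{x0}"] x0(1) V(3) by (auto simp: p_def)
  moreover have "p \<in> T1" using T1(2) x0(1) by (auto simp: p_def)
  ultimately have PW: "P \<in> WZ" using V(1) pe by (auto simp: WZ_def P_def cons_eucl)
  have WZZ: "y \<in> Z" if y: "y \<in> WZ" "0 \<le> shift y 0" for y
  proof -
    have "shift y \<in> \<phi> ` U" using y T1(2) by (auto simp: WZ_def)
    then obtain x where x: "x \<in> U" "shift y = \<phi> x" by blast
    have "\<phi> x \<in> T" using y x by (auto simp: WZ_def)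
    then have "x \<in> V" using T(2)[of "{x}"] x(1) by (auto split: if_splits)
    then have "act (cis (y 0)) x \<in> U" "x \<in> UM" using V(4,5) y by (auto simp: WZ_def)
    then show ?thesis using x y inj by (auto simp: Z_def WZ_def)
  qed
  \<comment> \<open>The components of the action are replaced by smooth extensions
    \<open>e l\<close> to an open set, so that the chain rule and
    \<open>coordinate_replacement\<close> apply.\<close>
  have "\<forall>l\<in>{..<n}. \<exists>V f'. openin (Euclidean_space (Suc n)) V \<and> P \<in> V \<and> smooth_on (Suc n) V f' \<and> (\<forall>y. y \<in> V \<longrightarrow> y \<in> Z \<longrightarrow> f' y = F l y)"
    using smooth_on_openE[OF F_smooth PZ] by (metis lessThan_iff)
  then obtain We e where We: "\<And>l. l < n \<Longrightarrow> openin (Euclidean_space (Suc n)) (We l)" "\<And>l. l < n \<Longrightarrow> P \<in> We l"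
    "\<And>l. l < n \<Longrightarrow> smooth_on (Suc n) (We l) (e l)" "\<And>l y. l < n \<Longrightarrow> y \<in> We l \<Longrightarrow> y \<in> Z \<Longrightarrow> e l y = F l y"
    unfolding lessThan_iff Ball_def by metis
  define Wc where "Wc = WZ \<inter> (\<Inter>l\<in>{..<n}. We l)"
  have Wco: "openin (Euclidean_space (Suc n)) Wc"
  proof -
    have "openin (Euclidean_space (Suc n)) (\<Inter> (We ` {..<n}))" using We(1) n openin_Inter[of "We ` {..<n}"] by auto
    then show ?thesis unfolding Wc_def using WZo by blast
  qed
  have PWc: "P \<in> Wc" using PW We(2) by (simp add: Wc_def)
  have es: "smooth_on (Suc n) Wc (e l)" if "l < n" for l
    using We(3)[OF that] by (rule smooth_on_subset) (use that in \<open>auto simp: Wc_def\<close>)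
  have eF: "e l y = F l y" if "l < n" "y \<in> Wc" "y \<in> Z" for l y using We(4) that by (auto simp: Wc_def)
  have WcZ: "y \<in> Z" if "y \<in> Wc" "0 \<le> shift y 0" for y using WZZ that by (auto simp: Wc_def)
  obtain e' where e': "\<And>l i y. l < n \<Longrightarrow> i < Suc n \<Longrightarrow> y \<in> Wc \<Longrightarrow> ((\<lambda>t. e l (y(i := t))) has_real_derivative e' l i y) (at (y i))"
    "\<And>l i. l < n \<Longrightarrow> i < Suc n \<Longrightarrow> smooth_on (Suc n) Wc (e' l i)"
  proof -
    have "\<exists>g. \<forall>y\<in>Wc. ((\<lambda>t. e l (y(i := t))) has_real_derivative g y) (at (y i)) \<and> smooth_on (Suc n) Wc g"
      if l: "l < n" and i: "i < Suc n" for l i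
    proof -
      obtain g where g: "\<And>y. y \<in> Wc \<Longrightarrow> ((\<lambda>t. e l (y(i := t))) has_real_derivative g y) (at (y i))" "smooth_on (Suc n) Wc g"
        using smooth_on_partialE[OF Wco es[OF l] i] by blast
      then show ?thesis by (intro exI[of _ g]) simp
    qed
    then have "\<forall>q. \<exists>g. fst q < n \<and> snd q < Suc n \<longrightarrow> (\<forall>y\<in>Wc. ((\<lambda>t. e (fst q) (y(snd q := t))) has_real_derivative g y) (at (y (snd q))) \<and> smooth_on (Suc n) Wc g)"
      by simp
    from choice[OF this] obtain g0 where
      g0: "\<forall>q. fst q < n \<and> snd q < Suc n \<longrightarrow> (\<forall>y\<in>Wc. ((\<lambda>t. e (fst q) (y(snd q := t))) has_real_derivative g0 q y) (at (y (snd q))) \<and> smooth_on (Suc n) Wc (g0 q))"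
      by (elim exE)
    define g where "g l i = g0 (l, i)" for l i
    have g: "l < n \<Longrightarrow> i < Suc n \<Longrightarrow> y \<in> Wc \<Longrightarrow>
      ((\<lambda>t. e l (y(i := t))) has_real_derivative g l i y) (at (y i)) \<and> smooth_on (Suc n) Wc (g l i)" for l i y
      using g0[rule_format, of "(l, i)" y] by (simp add: g_def)
    show thesis
    proof (rule that[of g])
      show "((\<lambda>t. e l (y(i := t))) has_real_derivative g l i y) (at (y i))"
        if "l < n" "i < Suc n" "y \<in> Wc" for l i y using g that by simp
      show "smooth_on (Suc n) Wc (g l i)" if "l < n" "i < Suc n" for l i using g that PWc by blast
    qed
  qed
  obtain \<delta>0 where \<delta>0: "\<delta>0 > 0" "\<And>t. \<bar>t\<bar> < \<delta>0 \<Longrightarrow> cons t p \<in> Wc"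
    using openin_eucl_line[OF Wco PWc, of 0] by (auto simp: P0 P_def cons_upd)
  define \<gamma> where "\<gamma> l t = \<phi> (act (cis t) x0) l" for l t
  have tZ: "cons t p \<in> Z" if "\<bar>t\<bar> < \<delta>0" for t using WcZ[OF \<delta>0(2)[OF that]] p0 by simp
  have \<gamma>e: "\<gamma> l t = e l (cons t p)" if "l < n" "\<bar>t\<bar> < \<delta>0" for l t
    using eF[OF that(1) \<delta>0(2) tZ] FU[OF x0(1)] that by (simp add: \<gamma>_def p_def)
  have \<gamma>U: "act (cis t) x0 \<in> U" if "\<bar>t\<bar> < \<delta>0" for t
    using tZ[OF that] inj x0(1) by (auto simp: Z_def p_def)
  have ev0: "\<forall>\<^sub>F t in nhds 0. \<bar>t\<bar> < \<delta>0" using \<delta>0(1) by (auto simp: eventually_nhds_metric dist_real_def)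
  \<comment> \<open>The velocity at time 0 of the orbit of \<open>x0\<close>, whose coordinates are
    the \<open>\<gamma> l\<close>.\<close>
  define \<xi> where "\<xi> l = e' l 0 P" for l
  have e\<xi>: "((\<lambda>t. e l (cons t p)) has_real_derivative \<xi> l) (at 0)" if "l < n" for l
    using e'(1)[OF that, of 0 P] PWc by (simp add: P0 P_def cons_upd \<xi>_def)
  have \<gamma>\<xi>: "(\<gamma> l has_real_derivative \<xi> l) (at 0)" if "l < n" for l
  proof -
    have "\<forall>\<^sub>F t in nhds 0. \<gamma> l t = e l (cons t p)" using ev0 by eventually_elim (use \<gamma>e that in auto)
    from DERIV_cong_ev[OF refl this refl] e\<xi>[OF that] show ?thesis by blast
  qed
  \<comment> \<open>If the velocity at \<open>t = 0\<close> vanished, then by the group law it would vanish for all small \<open>t\<close>, and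
    the orbit would be constant, contradicting freeness.\<close>
  have ex: "\<exists>j<n. \<xi> j \<noteq> 0"
  proof (rule ccontr)
    assume "\<not> (\<exists>j<n. \<xi> j \<noteq> 0)"
    then have \<xi>0: "\<xi> l = 0" if "l < n" for l using that by blast
    have \<gamma>0: "(\<gamma> l has_real_derivative 0) (at t0)" if l: "l < n" and t0: "\<bar>t0\<bar> < \<delta>0" for l t0
    proof -
      \<comment> \<open>By the group law the orbit near time \<open>t0\<close> is the orbit near
        time 0 moved by \<open>cis t0\<close>, that is, \<open>e l\<close> along this curve; all
        coordinates of the curve have derivative 0 at time 0.\<close>
      define c where "c h = cons t0 (\<phi> (act (cis h) x0))" for h
      have c0: "c 0 \<in> Wc" using \<delta>0(2)[OF t0] act_1[OF x0U(1)] by (simp add: c_def p_def)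
      have ce: "\<forall>\<^sub>F h in nhds 0. c h \<in> eucl (Suc n)"
        using ev0 by eventually_elim (use \<gamma>U chart_eucl[OF c] in \<open>auto simp: c_def cons_eucl\<close>)
      have cd: "((\<lambda>h. c h i) has_real_derivative 0) (at 0)" if "i < Suc n" for i
        using that \<gamma>\<xi>[of "i - 1"] \<xi>0[of "i - 1"] by (cases i) (auto simp: c_def cons_def \<gamma>_def[abs_def])
      have "((\<lambda>h. e l (c h)) has_real_derivative (\<Sum>i<Suc n. e' l i (c 0) * 0)) (at 0)"
        by (rule partials_chain_rule[OF Wco smooth_on_open_continuous[OF Wco e'(2)[OF l]] e'(1)[OF l] c0 ce cd])
      moreover have "\<forall>\<^sub>F h in nhds 0. e l (c h) = \<gamma> l (h + t0)"
      proof -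
        have "\<forall>\<^sub>F h in nhds 0. c h \<in> Wc"
          by (rule eventually_in_eucl_open[OF Wco c0 DERIV_isCont[OF cd] ce])
        moreover have "\<forall>\<^sub>F h in nhds 0. \<bar>h\<bar> < \<delta>0 - \<bar>t0\<bar>"
          using t0 by (auto simp: eventually_nhds_metric dist_real_def intro!: exI[of _ "\<delta>0 - \<bar>t0\<bar>"])
        ultimately show ?thesis
        proof eventually_elim
          case (elim h)
          have hU: "act (cis h) x0 \<in> U" "act (cis (h + t0)) x0 \<in> U" using \<gamma>U[of h] \<gamma>U[of "h + t0"] elim(2) by auto
          have eq: "act (cis t0) (act (cis h) x0) = act (cis (h + t0)) x0"
            using act_mult[OF circ[of t0] circ[of h] x0U(1)] by (simp add: cis_mult add.commute)
          have "c h \<in> Z" unfolding c_def by (rule ZU) (use hU eq act_UM[OF circ x0U(1)] in auto)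
          from eF[OF l elim(1) this] show ?case using FU[OF hU(1)] eq by (simp add: c_def \<gamma>_def)
        qed
      qed
      from DERIV_cong_ev[OF refl this refl] calculation have "((\<lambda>h. \<gamma> l (h + t0)) has_real_derivative 0) (at 0)" by simp
      then show ?thesis using DERIV_shift[of "\<gamma> l" 0 0 t0] by simp
    qed
    \<comment> \<open>Below \<open>pi\<close> the sine is positive, so
      \<open>cis t \<noteq> 1\<close>, whereas a constant orbit would force \<open>cis t = 1\<close>
      by freeness.\<close>
    define t where "t = min (\<delta>0 / 2) 1"
    have t: "0 < t" "t < \<delta>0" "t < pi" using \<delta>0(1) pi_gt3 by (auto simp: t_def)
    have "\<gamma> l t = \<gamma> l 0" if "l < n" for l
      by (rule DERIV_isconst3[of "-\<delta>0" \<delta>0]) (use t \<gamma>0 that in auto)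
    then have "\<phi> (act (cis t) x0) l = \<phi> x0 l" if "l < n" for l
      using that act_1[OF x0U(1)] by (simp add: \<gamma>_def)
    moreover have tU: "act (cis t) x0 \<in> U" using \<gamma>U t by simp
    then have "\<phi> (act (cis t) x0) \<in> eucl n" using chart_eucl[OF c] by blast
    ultimately have "\<phi> (act (cis t) x0) = \<phi> x0" using pe by (auto simp: p_def in_eucl fun_eq_iff) (metis not_less)
    then have "act (cis t) x0 = x0" using inj tU x0(1) by (auto simp: inj_on_def)
    then have "cis t = 1" using act_free[OF circ x0U(1)] by blast
    then have "sin t = 0" by (simp add: complex_eq_iff)
    then show False using sin_gt_zero[OF t(1,3)] by simp
  qed
  then obtain j where j: "j < n" "\<xi> j \<noteq> 0" by blast
  \<comment> \<open>Orbits of boundary points stay in the boundary, where coordinate 0 vanishes by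
    \<open>bdc\<close>; so the velocity has no component in direction 0.\<close>
  have j0: "0 < j"
  proof (rule ccontr)
    assume "\<not> 0 < j"
    then have [simp]: "j = 0" by simp
    have "\<forall>\<^sub>F t in nhds 0. \<phi> (act (cis t) x0) \<in> cube n p r"
    proof (rule eventually_in_eucl_open[OF openin_cube])
      show "\<phi> (act (cis 0) x0) \<in> cube n p r" using act_1[OF x0U(1)] cube_center[OF pe r] by (simp add: p_def)
      show "isCont (\<lambda>t. \<phi> (act (cis t) x0) l) 0" if "l < n" for l
        using DERIV_isCont[OF \<gamma>\<xi>[OF that]] by (simp add: \<gamma>_def[abs_def])
      show "\<forall>\<^sub>F t in nhds 0. \<phi> (act (cis t) x0) \<in> eucl n"
        using ev0 by eventually_elim (use \<gamma>U chart_eucl[OF c] in auto)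
    qed
    with ev0 have "\<forall>\<^sub>F t in nhds 0. \<gamma> 0 t = 0"
    proof eventually_elim
      case (elim t)
      have "act (cis t) x0 \<in> bd" using act_bd[OF circ x0(2)] .
      then have "f (act (cis t) x0) = 0" using f_zero bd_sub by blast
      then show ?case using bdc[OF \<gamma>U[OF elim(1)]] elim(2) by (simp add: \<gamma>_def p_def)
    qed
    from DERIV_cong_ev[OF refl this refl] \<gamma>\<xi>[OF n] have "((\<lambda>t. 0) has_real_derivative \<xi> 0) (at (0::real))" by blast
    then have "\<xi> 0 = 0" using DERIV_unique DERIV_const by blast
    then show False using j by simp
  qed
  \<comment> \<open>The sign makes the derivative positive, as \<open>coordinate_replacement\<close>
    demands.\<close>
  define s where "s = sgn (\<xi> j)"
  have s: "s * s = 1" "s * \<xi> j > 0" using j(2) by (auto simp: s_def sgn_if)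
  define G where "G y = s * e j y" for y
  have Gs: "smooth_on (Suc n) Wc G" unfolding G_def
    by (intro smooth_on_mult smooth_on_const es j openin_eucl_subset[OF Wco])
  have Gd: "((\<lambda>t. G (P(0 := t))) has_real_derivative s * \<xi> j) (at (P 0))"
    unfolding G_def using DERIV_cmult[OF e\<xi>[OF j(1)]] by (simp add: P0 P_def cons_upd)
  obtain r2 g2 where r2: "r2 > 0" "cube (Suc n) P r2 \<subseteq> Wc"
    "openin (Euclidean_space (Suc n)) ((\<lambda>x. x(0 := G x)) ` cube (Suc n) P r2)"
    "smooth_on (Suc n) ((\<lambda>x. x(0 := G x)) ` cube (Suc n) P r2) g2"
    "\<And>x. x \<in> cube (Suc n) P r2 \<Longrightarrow> g2 (x(0 := G x)) = x 0"
    by (rule coordinate_replacement[OF Wco PWc zero_less_Suc Gs Gd s(2)]) (rule that; assumption)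
  define Y2 where "Y2 = (\<lambda>x. x(0 := G x)) ` cube (Suc n) P r2"
  have Pe: "P \<in> eucl (Suc n)" using pe by (simp add: P_def cons_eucl)
  have cube_cons: "cons t u \<in> cube (Suc n) P r2 \<longleftrightarrow> \<bar>t\<bar> < r2 \<and> u \<in> cube n p r2" for t u
    by (auto simp: cube_def cons_eucl P_def less_Suc_eq_0_disj)
  have Gval: "G (cons t (\<phi> x)) = s * \<phi> (act (cis t) x) j \<and> act (cis t) x \<in> U"
    if x: "x \<in> U" and t: "cons t (\<phi> x) \<in> cube (Suc n) P r2" for t x
  proof -
    have "cons t (\<phi> x) \<in> Wc" using t r2 by blast
    moreover from this have "cons t (\<phi> x) \<in> Z" using WcZ chart_nonneg[OF c x] by simp
    ultimately show ?thesis using eF[OF j(1)] FU[OF x] x inj by (auto simp: G_def Z_def)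
  qed
  \<comment> \<open>\<open>g2\<close> inverts \<open>G\<close> in the angle coordinate, so
    \<open>\<theta>u u\<close> is the small angle that carries the point with coordinates
    \<open>u\<close> into the slice.\<close>
  define \<theta>u where "\<theta>u u = g2 (cons (s * p j) u)" for u
  define U\<theta> where "U\<theta> = {u \<in> eucl n. cons (s * p j) u \<in> Y2}"
  have GP: "G P = s * p j" using Gval[OF x0(1), of 0] cube_center[OF Pe r2(1)] act_1[OF x0U(1)]
    by (simp add: P_def p_def)
  have U\<theta>: "openin (Euclidean_space n) U\<theta>"
    unfolding U\<theta>_def
  proof (rule openin_eucl_vimage[OF openin_topspace])
    show "openin (Euclidean_space (Suc n)) Y2" using r2(3) by (simp add: Y2_def)
    show "continuous_on (eucl n) (\<lambda>x. cons (s * p j) x i)" for i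
      unfolding cons_def by (cases "i = 0") (auto intro: cc)
  qed (auto simp: cons_eucl)
  have \<theta>s: "smooth_on n U\<theta> \<theta>u"
    unfolding \<theta>u_def
  proof (rule smooth_on_compose[where T = Y2 and m = "Suc n" and g = g2])
    show "smooth_on (Suc n) Y2 g2" using r2(4) by (simp add: Y2_def)
    show "smooth_on n U\<theta> (\<lambda>u. cons (s * p j) u i)" if "i < Suc n" for i
      using that by (intro smooth_on_cons smooth_on_const smooth_on_coord) (auto simp: U\<theta>_def)
  qed (use openin_eucl_subset[OF r2(3)] in \<open>auto simp: Y2_def U\<theta>_def\<close>)
  have \<theta>sol: "cons (\<theta>u u) u \<in> cube (Suc n) P r2 \<and> G (cons (\<theta>u u) u) = s * p j" if u: "u \<in> U\<theta>" for u
  proof -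
    obtain y where y: "y \<in> cube (Suc n) P r2" "cons (s * p j) u = y(0 := G y)" using u by (auto simp: U\<theta>_def Y2_def)
    have "\<theta>u u = y 0" using r2(5)[OF y(1)] y(2) by (simp add: \<theta>u_def)
    moreover have "u = shift y" using arg_cong[OF y(2), of shift] by (simp add: shift_def)
    ultimately have "cons (\<theta>u u) u = y" using cons_shift[of y] by simp
    moreover have "s * p j = G y" using arg_cong[OF y(2), of "\<lambda>f. f 0"] by simp
    ultimately show ?thesis using y(1) by simp
  qed
  have uniq: "t = \<theta>u u" if "cons t u \<in> cube (Suc n) P r2" "G (cons t u) = s * p j" for t u
    using r2(5)[OF that(1)] that(2) by (simp add: \<theta>u_def cons_upd)
  have uniq0: "t = t'" if "cons t u \<in> cube (Suc n) P r2" "G (cons t u) = s * p j"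
    "cons t' u \<in> cube (Suc n) P r2" "G (cons t' u) = s * p j" for t t' u
    using uniq[OF that(1,2)] uniq[OF that(3,4)] by simp
  have \<theta>p: "\<theta>u p = 0" using uniq[of 0 p] GP cube_center[OF Pe r2(1)] by (simp add: P_def)
  have pU\<theta>: "p \<in> U\<theta>"
  proof -
    have "P(0 := G P) \<in> Y2" using cube_center[OF Pe r2(1)] by (auto simp: Y2_def)
    then show ?thesis using GP pe by (simp add: U\<theta>_def P_def cons_upd)
  qed
  \<comment> \<open>Freeness and compactness exclude that an orbit returns to the slice after a large angle.\<close>
  obtain N2 where N2: "openin M N2" "x0 \<in> N2" "\<And>x a. x \<in> N2 \<Longrightarrow> a \<in> unit_circle \<Longrightarrow> act a x \<in> N2 \<Longrightarrow> \<exists>t. \<bar>t\<bar> < r2 \<and> a = cis t"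
  proof -
    \<comment> \<open>The large angles: a compact set of circle elements that does not contain
      1.\<close>
    define K where "K = cis ` {t \<in> {-pi..pi}. r2 \<le> \<bar>t\<bar>}"
    have "closed {t::real. r2 \<le> \<bar>t\<bar>}" by (intro closed_Collect_le continuous_intros)
    then have "compact ({-pi..pi} \<inter> {t. r2 \<le> \<bar>t\<bar>})" by (intro compact_Int_closed) auto
    moreover have "{-pi..pi} \<inter> {t. r2 \<le> \<bar>t\<bar>} = {t \<in> {-pi..pi}. r2 \<le> \<bar>t\<bar>}" by auto
    ultimately have K: "compact K" unfolding K_def
      by (intro compact_continuous_image continuous_intros) simp
    have Ks: "K \<subseteq> unit_circle" by (auto simp: K_def)
    have "1 \<notin> K"
    proof
      assume "1 \<in> K"
      then obtain t where t: "t \<in> {-pi..pi}" "r2 \<le> \<bar>t\<bar>" "1 = cis t" by (auto simp: K_def)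
      then have "cos t = 1" by (simp add: complex_eq_iff)
      then obtain k :: int where "t = real_of_int k * 2 * pi" using cos_one_2pi_int by blast
      then have k: "t = real_of_int k * (2 * pi)" by simp
      have "\<bar>t\<bar> \<le> pi" using t(1) by auto
      moreover have "\<bar>t\<bar> = \<bar>real_of_int k\<bar> * (2 * pi)" using k by (simp add: abs_mult)
      ultimately have "\<bar>real_of_int k\<bar> * (2 * pi) < 1 * (2 * pi)" using pi_gt_zero by linarith
      then have "\<bar>real_of_int k\<bar> < 1" using mult_less_cancel_right_pos[of "2 * pi" "\<bar>real_of_int k\<bar>" 1] by simp
      then have "k = 0" by linarith
      then show False using k t(2) r2(1) by simp
    qed
    then have "act a x0 \<noteq> x0" if "a \<in> K" for a using act_free[of a x0] that Ks x0U by blast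
    then have dis: "disjnt ((\<lambda>a. act a x0) ` K) {x0}" by (metis disjnt_insert2 disjnt_empty2 imageE)
    have cK: "compactin M ((\<lambda>a. act a x0) ` K)"
      by (rule image_compactin[OF _ act_continuous2[OF x0U(1)]]) (use K Ks in \<open>simp add: compactin_subtopology\<close>)
    have "compactin M {x0}" using x0(2) bd_sub by auto
    from Hausdorff_space_compact_separation[OF hausdorff cK this dis]
    obtain N' N'' where N': "openin M N'" "openin M N''" "(\<lambda>a. act a x0) ` K \<subseteq> N'" "{x0} \<subseteq> N''" "disjnt N' N''" by metis
    have KN: "act a x0 \<in> N'" if "a \<in> K" for a using N'(3) that by blast
    from act_tube[OF N'(1) x0U(1) K Ks KN] obtain V' where
      V': "openin M V'" "x0 \<in> V'" "V' \<subseteq> UM" "\<And>a y. a \<in> K \<Longrightarrow> y \<in> V' \<Longrightarrow> act a y \<in> N'" by metis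
    show thesis
    proof (rule that[of "V' \<inter> N''"])
      fix x a assume h: "x \<in> V' \<inter> N''" "a \<in> unit_circle" "act a x \<in> V' \<inter> N''"
      have "a \<noteq> 0" "norm a = 1" using h(2) by auto
      then have "a = cis (Arg a)" by (simp add: cis_Arg sgn_div_norm)
      moreover have "\<bar>Arg a\<bar> < r2"
      proof (rule ccontr)
        assume "\<not> \<bar>Arg a\<bar> < r2"
        then have "a \<in> K" using Arg_bounded[of a] \<open>a = cis (Arg a)\<close> unfolding K_def by (intro image_eqI[of _ _ "Arg a"]) auto
        then show False using V'(4)[of a x] h N'(5) by (auto simp: disjnt_iff)
      qed
      ultimately show "\<exists>t. \<bar>t\<bar> < r2 \<and> a = cis t" by blast
    qed (use V' N' in auto)
  qed
  define N' where "N' = U \<inter> W \<inter> {x \<in> U. \<phi> x \<in> {u \<in> T1. u \<in> U\<theta> \<and> u \<in> cube n p r2}}"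
  define \<theta> where "\<theta> x = \<theta>u (\<phi> x)" for x
  define ret where "ret x = act (cis (\<theta> x)) x" for x
  have hso: "openin (half_space n) (S \<inter> {x. 0 \<le> x 0})" if "openin (Euclidean_space n) S" for S
    using that by (auto simp: half_space_def openin_subtopology)
  have chv: "openin M {x \<in> U. \<phi> x \<in> S}" if "openin (Euclidean_space n) S" for S
  proof -
    have "{x \<in> U. \<phi> x \<in> S} = {x \<in> U. \<phi> x \<in> S \<inter> {x. 0 \<le> x 0}}" using chart_nonneg[OF c] by auto
    then show ?thesis using chart_vimage_open[OF ch hso[OF that]] by simp
  qed
  have N'o: "openin M N'"
  proof -
    have "openin (Euclidean_space n) (T1 \<inter> U\<theta> \<inter> cube n p r2)" using T1(1) U\<theta> openin_cube by blast
    from chv[OF this] have "openin M {x \<in> U. \<phi> x \<in> {u \<in> T1. u \<in> U\<theta> \<and> u \<in> cube n p r2}}" by simp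
    then show ?thesis unfolding N'_def using W(1) is_chartD(1)[OF ch] by blast
  qed
  have N's: "N' \<subseteq> U" "N' \<subseteq> W" "N' \<subseteq> UM" using W(3) by (auto simp: N'_def)
  have \<theta>smooth: "smooth_fun n A N' \<theta>"
  proof (rule smooth_fun_chartI[OF c N's(1)])
    show "smooth_on n (\<phi> ` N') (\<theta> \<circ> inv_into U \<phi>)"
      by (rule smooth_on_eq[OF smooth_on_subset[OF \<theta>s]]) (use inj in \<open>auto simp: N'_def \<theta>_def\<close>)
  qed
  have ret: "ret x \<in> U" "\<phi> (ret x) j = p j" if x: "x \<in> N'" for x
  proof -
    have xU: "x \<in> U" "\<phi> x \<in> U\<theta>" using x by (auto simp: N'_def)
    have "G (cons (\<theta> x) (\<phi> x)) = s * \<phi> (ret x) j" "ret x \<in> U"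
      using Gval[OF xU(1), of "\<theta> x"] \<theta>sol[OF xU(2)] by (auto simp: \<theta>_def ret_def)
    moreover have "G (cons (\<theta> x) (\<phi> x)) = s * p j" using \<theta>sol[OF xU(2)] by (simp add: \<theta>_def)
    ultimately have "s * \<phi> (ret x) j = s * p j" by linarith
    then show "\<phi> (ret x) j = p j" using s(2) by auto
    show "ret x \<in> U" by fact
  qed
  have retc: "continuous_map (subtopology M N') M ret"
  proof -
    have "continuous_map (subtopology M N') euclideanreal \<theta>" using smooth_fun_continuous[OF \<theta>smooth N'o] .
    then have "continuous_map (subtopology M N') euclidean (\<lambda>x. cis (\<theta> x))"
      using continuous_map_compose[of _ _ \<theta> euclidean cis] by (auto simp: o_def continuous_intros)
    then have "continuous_map (subtopology M N') (prod_topology (top_of_set unit_circle) (subtopology M UM)) (\<lambda>x. (cis (\<theta> x), x))"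
      using N's(3) by (auto simp: continuous_map_pairwise o_def continuous_map_in_subtopology)
    from continuous_map_compose[OF this act_continuous] show ?thesis by (simp add: o_def ret_def[abs_def])
  qed
  define N3 where "N3 = N2 \<inter> {x \<in> U. \<phi> x \<in> cube n p r \<inter> cube n p r2}"
  have N3o: "openin M N3" unfolding N3_def using N2(1) chv[of "cube n p r \<inter> cube n p r2"] openin_cube by blast
  \<comment> \<open>Demanding that the slice point lie in \<open>N3\<close> makes it unique on its
    orbit: \<open>N2\<close> allows only a small angle between two such points, and
    \<open>uniq0\<close> then leaves only the angle 0.\<close>
  define N where "N = {x \<in> N'. ret x \<in> N3}"
  have No: "openin M N"
  proof -
    have "openin (subtopology M N') {x \<in> topspace (subtopology M N'). ret x \<in> N3}"
      by (rule openin_continuous_map_preimage[OF retc N3o])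
    moreover have "{x \<in> topspace (subtopology M N'). ret x \<in> N3} = N" using openin_subset[OF N'o] by (auto simp: N_def)
    ultimately show ?thesis using N'o by (simp add: openin_open_subtopology)
  qed
  have x0N': "x0 \<in> N'" using x0 x0U pU\<theta> cube_center[OF pe r2(1)] \<open>p \<in> T1\<close> by (auto simp: N'_def p_def)
  have "ret x0 = x0" using \<theta>p act_1[OF x0U(1)] by (simp add: ret_def \<theta>_def p_def)
  then have x0N: "x0 \<in> N" using x0N' x0 N2(2) cube_center[OF pe r] cube_center[OF pe r2(1)] by (auto simp: N_def N3_def p_def)
  show thesis
  proof (rule that[OF j0 j(1) No x0N])
    show "N \<subseteq> U" "N \<subseteq> W" using N's by (auto simp: N_def)
    show "smooth_fun n A N \<theta>" using \<theta>smooth by (rule smooth_fun_subset) (auto simp: N_def)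
    show "act (cis (\<theta> x)) x \<in> U" "\<phi> (act (cis (\<theta> x)) x) \<in> cube n (\<phi> x0) r"
      "\<phi> (act (cis (\<theta> x)) x) j = \<phi> x0 j" if "x \<in> N" for x
      using ret[of x] that by (auto simp: N_def N3_def ret_def p_def)
    show "cis (\<theta> (act a x)) * a = cis (\<theta> x)" if x: "x \<in> N" and a: "a \<in> unit_circle" and y: "act a x \<in> N" for x a
    proof -
      \<comment> \<open>\<open>b\<close> carries the slice point of \<open>x\<close> to that of
        \<open>act a x\<close>. Both lie in \<open>N2\<close>, so \<open>b\<close> has a small
        angle, and uniqueness of the small solution gives \<open>b = 1\<close>.\<close>
      define b where "b = cis (\<theta> (act a x)) * a * inverse (cis (\<theta> x))"
      have bS: "b \<in> unit_circle" unfolding b_def by (intro unit_circle_mult unit_circle_inverse a circ)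
      have xM: "x \<in> UM" using x N's by (auto simp: N_def)
      have rU: "ret x \<in> UM" unfolding ret_def by (rule act_UM[OF circ xM])
      have "act (inverse (cis (\<theta> x))) (ret x) = x" unfolding ret_def by (rule act_inverse(1)[OF circ xM])
      then have "act b (ret x) = act (cis (\<theta> (act a x)) * a) x"
        using act_mult[OF unit_circle_mult[OF circ[of "\<theta> (act a x)"] a] unit_circle_inverse[OF circ[of "\<theta> x"]] rU] by (simp add: b_def)
      also have "\<dots> = ret (act a x)" using act_mult[OF circ a xM] by (simp add: ret_def)
      finally have br: "act b (ret x) = ret (act a x)" .
      have r3: "ret x \<in> N3" "ret (act a x) \<in> N3" using x y by (auto simp: N_def)
      obtain t where t: "\<bar>t\<bar> < r2" "b = cis t" using N2(3)[OF _ bS, of "ret x"] r3 br by (auto simp: N3_def)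
      have rxU: "ret x \<in> U" "\<phi> (ret x) \<in> cube n p r2" using r3 by (auto simp: N3_def)
      have c1: "cons t (\<phi> (ret x)) \<in> cube (Suc n) P r2" "cons 0 (\<phi> (ret x)) \<in> cube (Suc n) P r2"
        using t rxU r2(1) by (auto simp: cube_cons)
      have "G (cons t (\<phi> (ret x))) = s * p j"
        using Gval[OF rxU(1) c1(1)] br t(2) ret(2)[of "act a x"] y by (auto simp: N_def)
      moreover have "G (cons 0 (\<phi> (ret x))) = s * p j"
        using Gval[OF rxU(1) c1(2)] act_1[OF rU] ret(2)[of x] x by (auto simp: N_def)
      ultimately have "t = 0" using uniq0[OF c1(1) _ c1(2)] by blast
      then have "b = 1" using t(2) by simp
      then show ?thesis unfolding b_def using unit_circle_nz[OF circ[of "\<theta> x"]] by (simp add: field_simps)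
    qed
    show "cis (\<theta> x) = 1" if x: "x \<in> N" and xj: "\<phi> x j = \<phi> x0 j" for x
    proof -
      have xN: "x \<in> U" "\<phi> x \<in> cube n p r2" "\<phi> x \<in> U\<theta>" "x \<in> UM" using x N's by (auto simp: N_def N'_def)
      have c1: "cons 0 (\<phi> x) \<in> cube (Suc n) P r2" using xN r2(1) by (simp add: cube_cons)
      have "G (cons 0 (\<phi> x)) = s * p j" using Gval[OF xN(1) c1] act_1[OF xN(4)] xj by (simp add: p_def)
      from uniq[OF c1 this] show ?thesis by (simp add: \<theta>_def)
    qed
  qed
qed

end

section \<open>Charts of the cut space near the boundary\<close>

text \<open>Packages the output of \<open>boundary_normal_form\<close> and
  \<open>local_slice\<close> at one boundary point, so that the maps on the tube can be introduced
  by definitions.\<close>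

locale cut_tube = cut_data +
  fixes U :: "'a set" and \<phi> :: "'a \<Rightarrow> nat \<Rightarrow> real" and x0 :: 'a and j :: nat and N :: "'a set" and \<theta> :: "'a \<Rightarrow> real"
    and r1 :: real and Y1 :: "(nat \<Rightarrow> real) set" and g1 :: "(nat \<Rightarrow> real) \<Rightarrow> real"
  assumes c: "(U, \<phi>) \<in> A" and x0: "x0 \<in> U" "x0 \<in> bd" "\<phi> x0 0 = 0"
    and nf: "openin (Euclidean_space n) Y1" "smooth_on n Y1 g1"
      "\<And>x. x \<in> U \<Longrightarrow> \<phi> x \<in> cube n (\<phi> x0) r1 \<Longrightarrow> (\<phi> x)(0 := f x) \<in> Y1 \<and> g1 ((\<phi> x)(0 := f x)) = \<phi> x 0"
      "\<And>y. y \<in> Y1 \<Longrightarrow> 0 \<le> y 0 \<Longrightarrow> y(0 := g1 y) \<in> cube n (\<phi> x0) r1 \<and> 0 \<le> g1 y \<and> f (inv_into U \<phi> (y(0 := g1 y))) = y 0"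
    and j: "0 < j" "j < n"
    and N: "openin M N" "x0 \<in> N" "N \<subseteq> U" "N \<subseteq> W"
    and \<theta>: "smooth_fun n A N \<theta>"
    and slice: "\<And>x. x \<in> N \<Longrightarrow> act (cis (\<theta> x)) x \<in> U"
      "\<And>x. x \<in> N \<Longrightarrow> \<phi> (act (cis (\<theta> x)) x) \<in> cube n (\<phi> x0) r1"
      "\<And>x. x \<in> N \<Longrightarrow> \<phi> (act (cis (\<theta> x)) x) j = \<phi> x0 j"
    and slice_unique: "\<And>x a. x \<in> N \<Longrightarrow> a \<in> unit_circle \<Longrightarrow> act a x \<in> N \<Longrightarrow> cis (\<theta> (act a x)) * a = cis (\<theta> x)"
    and slice_id: "\<And>x. x \<in> N \<Longrightarrow> \<phi> x j = \<phi> x0 j \<Longrightarrow> cis (\<theta> x) = 1"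

lemma (in cut_data) cut_tube_exists:
  assumes "x0 \<in> bd"
  shows "\<exists>U \<phi> j N \<theta> r1 Y1 g1. cut_tube n M A UM act f W U \<phi> x0 j N \<theta> r1 Y1 g1"
proof -
  obtain U \<phi> where c: "(U, \<phi>) \<in> A" "x0 \<in> U" "\<phi> x0 0 = 0" "0 < n" using bd_chart[OF assms] by metis
  obtain r1 Y1 g1 where nf: "0 < r1"
    "openin (Euclidean_space n) Y1" "smooth_on n Y1 g1"
    "\<And>x. x \<in> U \<Longrightarrow> \<phi> x \<in> cube n (\<phi> x0) r1 \<Longrightarrow> (\<phi> x)(0 := f x) \<in> Y1 \<and> g1 ((\<phi> x)(0 := f x)) = \<phi> x 0"
    "\<And>y. y \<in> Y1 \<Longrightarrow> 0 \<le> y 0 \<Longrightarrow> y(0 := g1 y) \<in> cube n (\<phi> x0) r1 \<and> 0 \<le> g1 y \<and> f (inv_into U \<phi> (y(0 := g1 y))) = y 0"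
    "\<And>x. x \<in> U \<Longrightarrow> \<phi> x \<in> cube n (\<phi> x0) r1 \<Longrightarrow> f x = 0 \<Longrightarrow> \<phi> x 0 = 0"
    by (rule boundary_normal_form[OF c(1,2) assms c(3,4)]) (rule that; assumption)
  show ?thesis
  \<comment> \<open>The radius of the normal form serves as slice radius, so slice points fall into
    the domain of the normal form.\<close>
  proof (rule local_slice[OF c(1,2) assms c(3,4) nf(1,6)], assumption+)
    fix j N \<theta>
    assume s: "0 < j" "j < n" "openin M N" "x0 \<in> N" "N \<subseteq> U" "N \<subseteq> W" "smooth_fun n A N \<theta>"
      "\<And>x. x \<in> N \<Longrightarrow> act (cis (\<theta> x)) x \<in> U"
      "\<And>x. x \<in> N \<Longrightarrow> \<phi> (act (cis (\<theta> x)) x) \<in> cube n (\<phi> x0) r1"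
      "\<And>x. x \<in> N \<Longrightarrow> \<phi> (act (cis (\<theta> x)) x) j = \<phi> x0 j"
      "\<And>x a. x \<in> N \<Longrightarrow> a \<in> unit_circle \<Longrightarrow> act a x \<in> N \<Longrightarrow> cis (\<theta> (act a x)) * a = cis (\<theta> x)"
      "\<And>x. x \<in> N \<Longrightarrow> \<phi> x j = \<phi> x0 j \<Longrightarrow> cis (\<theta> x) = 1"
    have "cut_tube n M A UM act f W U \<phi> x0 j N \<theta> r1 Y1 g1"
      by unfold_locales (fact c assms nf s)+
    then show ?thesis by blast
  qed
qed

context cut_tube
begin

text \<open>
  On the tube \<open>T = S\<^sup>1 \<cdot> N\<close> every point is \<open>x = \<alpha> x \<cdot> R x\<close> with an equivariant phase \<open>\<alpha> x\<close> and an invariant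
  slice point \<open>R x\<close>, whose coordinates are \<open>S k x\<close>.  Neither depends on the choice made in \<open>base\<close>.
\<close>

definition p where "p = \<phi> x0"
definition ret where "ret x = act (cis (\<theta> x)) x"
definition T where "T = (\<Union>a\<in>unit_circle. act a ` N)"
definition base where "base x = (SOME a. a \<in> unit_circle \<and> act a x \<in> N)"
definition bet where "bet x = cis (\<theta> (act (base x) x)) * base x"
definition \<alpha> where "\<alpha> x = inverse (bet x)"
definition R where "R x = act (bet x) x"
definition S where "S k x = \<phi> (R x) k"

lemma n0: "0 < n" using j by simp

lemma p0: "p 0 = 0" using x0 by (simp add: p_def)

lemma inj: "inj_on \<phi> U" using chart_inj[OF c] .

lemma pe: "p \<in> eucl n" using chart_eucl[OF c] x0 by (auto simp: p_def)

lemma cis_circle: "cis t \<in> unit_circle" by simp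

lemma NU: "N \<subseteq> UM" using N W by blast

lemma T_open: "openin M T"
  unfolding T_def using act_image_open[OF _ N(1) NU] by (intro openin_Union) auto

lemma T_W: "T \<subseteq> W"
  using N(4) act_W by (auto simp: T_def)

lemma T_UM: "T \<subseteq> UM" using T_W W by blast

lemma N_T: "N \<subseteq> T"
proof
  fix x assume "x \<in> N"
  then have "act 1 x \<in> T" unfolding T_def by (intro UN_I[of 1]) auto
  then show "x \<in> T" using act_1[of x] NU \<open>x \<in> N\<close> by auto
qed

lemma T_act: assumes "a \<in> unit_circle" "x \<in> T" shows "act a x \<in> T"
proof -
  obtain b y where b: "b \<in> unit_circle" "y \<in> N" "x = act b y" using assms by (auto simp: T_def)
  have "act a x = act (a * b) y" using act_mult[OF assms(1) b(1)] b NU by auto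
  then show ?thesis using unit_circle_mult[OF assms(1) b(1)] b(2) unfolding T_def by blast
qed

lemma T_act_iff: assumes "a \<in> unit_circle" "x \<in> W" shows "act a x \<in> T \<longleftrightarrow> x \<in> T"
proof
  assume "act a x \<in> T"
  then have "act (inverse a) (act a x) \<in> T" using T_act[OF unit_circle_inverse[OF assms(1)]] by blast
  then show "x \<in> T" using act_inverse(1)[OF assms(1)] assms(2) W by auto
qed (use T_act assms in blast)

lemma T_base: assumes "x \<in> T" shows "base x \<in> unit_circle" "act (base x) x \<in> N"
proof -
  obtain b y where b: "b \<in> unit_circle" "y \<in> N" "x = act b y" using assms by (auto simp: T_def)
  have "act (inverse b) x \<in> N" using act_inverse(1)[OF b(1)] b NU by auto
  then have "\<exists>a. a \<in> unit_circle \<and> act a x \<in> N" using unit_circle_inverse[OF b(1)] by blast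
  from someI_ex[OF this] show "base x \<in> unit_circle" "act (base x) x \<in> N" by (auto simp: base_def)
qed

lemma bet_circle: "x \<in> T \<Longrightarrow> bet x \<in> unit_circle"
  unfolding bet_def by (intro unit_circle_mult cis_circle T_base)

text \<open>Two group elements that carry \<open>x\<close> into \<open>N\<close> differ by one that
  relates two points of \<open>N\<close> on the same orbit, and \<open>slice_unique\<close> compares
  the angles of these points.\<close>

lemma bet_eq:
  assumes x: "x \<in> T" and a: "a \<in> unit_circle" "act a x \<in> N"
  shows "bet x = cis (\<theta> (act a x)) * a"
proof -
  let ?b = "base x"
  note b = T_base[OF x]
  have xU: "x \<in> UM" using x T_UM by blast
  have e: "act (?b * inverse a) (act a x) = act ?b x"
    using act_mult[OF b(1) unit_circle_inverse[OF a(1)] act_UM[OF a(1) xU]] act_inverse(1)[OF a(1) xU] by simp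
  have "cis (\<theta> (act ?b x)) * (?b * inverse a) = cis (\<theta> (act a x))"
    using slice_unique[OF a(2) unit_circle_mult[OF b(1) unit_circle_inverse[OF a(1)]]] b(2) e by simp
  then have "cis (\<theta> (act ?b x)) * ?b * (inverse a * a) = cis (\<theta> (act a x)) * a" by (metis mult.assoc)
  then show ?thesis using unit_circle_nz[OF a(1)] by (simp add: bet_def)
qed

text \<open>\<open>base x * inverse a\<close> carries \<open>act a x\<close> to the same point of
  \<open>N\<close> to which \<open>base x\<close> carries \<open>x\<close>.\<close>

lemma bet_act:
  assumes x: "x \<in> T" and a: "a \<in> unit_circle"
  shows "bet (act a x) = bet x * inverse a" "R (act a x) = R x" "\<alpha> (act a x) = a * \<alpha> x"
proof -
  note b = T_base[OF x]
  have xU: "x \<in> UM" using x T_UM by blast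
  have e: "act (base x * inverse a) (act a x) = act (base x) x"
    using act_mult[OF b(1) unit_circle_inverse[OF a] act_UM[OF a xU]] act_inverse(1)[OF a xU] by simp
  show 1: "bet (act a x) = bet x * inverse a"
    using bet_eq[OF T_act[OF a x] unit_circle_mult[OF b(1) unit_circle_inverse[OF a]]] e b(2)
    by (simp add: bet_def mult.assoc)
  show "R (act a x) = R x"
    unfolding R_def 1
    using act_mult[OF bet_circle[OF x] unit_circle_inverse[OF a] act_UM[OF a xU]] act_inverse(1)[OF a xU] by simp
  show "\<alpha> (act a x) = a * \<alpha> x" by (simp add: \<alpha>_def 1)
qed

lemma R_eq:
  assumes x: "x \<in> T" and a: "a \<in> unit_circle" "act a x \<in> N"
  shows "R x = ret (act a x)"
  unfolding R_def ret_def bet_eq[OF assms] using act_mult[OF cis_circle a(1)] x T_UM by auto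

lemma R_props:
  assumes x: "x \<in> T"
  shows "R x \<in> U" "\<phi> (R x) \<in> cube n p r1" "S j x = p j" "f (R x) = f x" "R x \<in> T"
    "act (\<alpha> x) (R x) = x" "\<alpha> x \<in> unit_circle"
proof -
  note b = T_base[OF x]
  show "R x \<in> U" "\<phi> (R x) \<in> cube n p r1" "S j x = p j"
    using slice[OF b(2)] R_eq[OF x b] by (simp_all add: ret_def p_def S_def)
  show "f (R x) = f x" unfolding R_def using f_act[OF bet_circle[OF x]] x T_W by blast
  show "R x \<in> T" unfolding R_def by (rule T_act[OF bet_circle[OF x] x])
  show "act (\<alpha> x) (R x) = x" unfolding R_def \<alpha>_def using act_inverse(1)[OF bet_circle[OF x]] x T_UM by blast
  show "\<alpha> x \<in> unit_circle" unfolding \<alpha>_def by (rule unit_circle_inverse[OF bet_circle[OF x]])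
qed

lemma S_act: "x \<in> T \<Longrightarrow> a \<in> unit_circle \<Longrightarrow> S k (act a x) = S k x"
  by (simp add: S_def bet_act(2))

lemma S_eucl: "x \<in> T \<Longrightarrow> n \<le> k \<Longrightarrow> S k x = 0"
  using R_props(1) chart_eucl[OF c] by (fastforce simp: S_def in_eucl)

lemma ret_smooth: "smooth_fun n A N (\<lambda>x. \<phi> (ret x) k)"
proof (rule smooth_fun_chartI[OF c N(3)])
  have Ne: "\<phi> ` N \<subseteq> eucl n" using chart_eucl[OF c] N by blast
  have "smooth_on n (\<phi> ` N) (\<lambda>u. (\<lambda>y. \<phi> (act (cis (y 0)) (inv_into U \<phi> (shift y))) k) ((\<lambda>u. cons (\<theta> (inv_into U \<phi> u)) u) u))"
  proof (rule smooth_on_compose[OF act_chart_smooth[OF c c]])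
    show "smooth_on n (\<phi> ` N) (\<lambda>u. cons (\<theta> (inv_into U \<phi> u)) u i)" if "i < Suc n" for i
    proof (rule smooth_on_cons[OF _ _ that])
      show "smooth_on n (\<phi> ` N) (\<lambda>u. \<theta> (inv_into U \<phi> u))"
        using \<theta> c N(3) by (fastforce simp: smooth_fun_def o_def inf_absorb2)
    qed (rule smooth_on_coord[OF Ne])
    show "(\<lambda>u. cons (\<theta> (inv_into U \<phi> u)) u) ` \<phi> ` N \<subseteq>
      {y \<in> eucl (Suc n). shift y \<in> \<phi> ` (U \<inter> UM) \<and> act (cis (y 0)) (inv_into U \<phi> (shift y)) \<in> U}"
    proof clarify
      fix x assume x: "x \<in> N"
      then have "x \<in> U" "x \<in> UM" "\<phi> x \<in> eucl n" using N NU Ne by auto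
      then show "cons (\<theta> (inv_into U \<phi> (\<phi> x))) (\<phi> x) \<in> eucl (Suc n) \<and>
        shift (cons (\<theta> (inv_into U \<phi> (\<phi> x))) (\<phi> x)) \<in> \<phi> ` (U \<inter> UM) \<and>
        act (cis (cons (\<theta> (inv_into U \<phi> (\<phi> x))) (\<phi> x) 0)) (inv_into U \<phi> (shift (cons (\<theta> (inv_into U \<phi> (\<phi> x))) (\<phi> x)))) \<in> U"
        using slice(1)[OF x] inj by (simp add: cons_eucl)
    qed
  qed (use Ne in auto)
  then show "smooth_on n (\<phi> ` N) ((\<lambda>x. \<phi> (ret x) k) \<circ> inv_into U \<phi>)"
    by (rule smooth_on_eq) (use N(3) inj in \<open>auto simp: ret_def\<close>)
qed

text \<open>\<open>base\<close> need not be continuous. Smoothness on the tube is therefore checked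
  on each translate of \<open>N\<close>, where one fixed group element takes the place of
  \<open>base\<close>.\<close>

lemma tube_localI:
  assumes "\<And>a. a \<in> unit_circle \<Longrightarrow> smooth_fun n A {x \<in> UM. act a x \<in> N} h"
  shows "smooth_fun n A T h"
proof (rule smooth_fun_localI)
  fix x assume x: "x \<in> T"
  note b = T_base[OF x]
  have "openin (subtopology M UM) {y \<in> topspace (subtopology M UM). act (base x) y \<in> N}"
    by (rule openin_continuous_map_preimage[OF act_continuous1[OF b(1)] N(1)])
  then have "openin M {y \<in> UM. act (base x) y \<in> N}" using UM by (simp add: inf_absorb2 openin_open_subtopology)
  moreover have "x \<in> {y \<in> UM. act (base x) y \<in> N}" using x T_UM b by auto
  ultimately show "\<exists>N. openin M N \<and> x \<in> N \<and> smooth_fun n A (T \<inter> N) h"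
    using smooth_fun_subset[OF assms[OF b(1)], of "T \<inter> {y \<in> UM. act (base x) y \<in> N}"]
    by (intro exI[of _ "{y \<in> UM. act (base x) y \<in> N}"]) simp
qed

lemma act_N_T: assumes "a \<in> unit_circle" "x \<in> UM" "act a x \<in> N" shows "x \<in> T"
proof -
  have "act (inverse a) (act a x) \<in> T" using T_act[OF unit_circle_inverse[OF assms(1)]] N_T assms(3) by blast
  then show ?thesis using act_inverse(1)[OF assms(1,2)] by simp
qed

lemma S_smooth: "smooth_fun n A T (S k)"
proof (rule tube_localI)
  fix a assume a: "a \<in> unit_circle"
  show "smooth_fun n A {x \<in> UM. act a x \<in> N} (S k)"
    by (rule smooth_fun_eq[OF smooth_fun_act[OF a ret_smooth[of k] N(1) NU]])
      (use R_eq[OF act_N_T[OF a] a] chart_inj in \<open>auto simp: S_def\<close>)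
qed

lemma bet_smooth: "smooth_fun n A T (\<lambda>x. Re (bet x))" "smooth_fun n A T (\<lambda>x. Im (bet x))"
proof -
  have co: "\<And>U \<phi>. (U, \<phi>) \<in> A \<Longrightarrow> \<phi> ` U \<subseteq> eucl n" by (rule chart_eucl)
  have sc: "smooth_fun n A {x \<in> UM. act a x \<in> N} (\<lambda>x. cos (\<theta> (act a x)))"
    "smooth_fun n A {x \<in> UM. act a x \<in> N} (\<lambda>x. sin (\<theta> (act a x)))" if a: "a \<in> unit_circle" for a
    using smooth_fun_sin_cos[OF smooth_fun_act[OF a \<theta> N(1) NU]] by auto
  have v: "bet x = cis (\<theta> (act a x)) * a" if "a \<in> unit_circle" "x \<in> UM" "act a x \<in> N" for a x
    using bet_eq[OF act_N_T] that by blast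
  show "smooth_fun n A T (\<lambda>x. Re (bet x))"
  proof (rule tube_localI)
    fix a assume a: "a \<in> unit_circle"
    have "smooth_fun n A {x \<in> UM. act a x \<in> N} (\<lambda>x. cos (\<theta> (act a x)) * Re a + sin (\<theta> (act a x)) * (- Im a))"
      by (intro smooth_fun_add smooth_fun_mult sc[OF a] smooth_fun_const co)
    then show "smooth_fun n A {x \<in> UM. act a x \<in> N} (\<lambda>x. Re (bet x))"
      by (rule smooth_fun_eq) (use v[OF a] chart_inj in auto)
  qed
  show "smooth_fun n A T (\<lambda>x. Im (bet x))"
  proof (rule tube_localI)
    fix a assume a: "a \<in> unit_circle"
    have "smooth_fun n A {x \<in> UM. act a x \<in> N} (\<lambda>x. cos (\<theta> (act a x)) * Im a + sin (\<theta> (act a x)) * Re a)"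
      by (intro smooth_fun_add smooth_fun_mult sc[OF a] smooth_fun_const co)
    then show "smooth_fun n A {x \<in> UM. act a x \<in> N} (\<lambda>x. Im (bet x))"
      by (rule smooth_fun_eq) (use v[OF a] chart_inj in auto)
  qed
qed

lemma \<alpha>_bet: assumes "x \<in> T" shows "Re (\<alpha> x) = Re (bet x)" "Im (\<alpha> x) = - Im (bet x)"
proof -
  have "norm (bet x) = 1" using bet_circle[OF assms] by simp
  then have "(Re (bet x))\<^sup>2 + (Im (bet x))\<^sup>2 = 1" by (simp add: cmod_def)
  then show "Re (\<alpha> x) = Re (bet x)" "Im (\<alpha> x) = - Im (bet x)" by (simp_all add: \<alpha>_def)
qed

lemma \<alpha>_smooth: "smooth_fun n A T (\<lambda>x. Re (\<alpha> x))" "smooth_fun n A T (\<lambda>x. Im (\<alpha> x))"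
proof -
  have co: "\<And>U \<phi>. (U, \<phi>) \<in> A \<Longrightarrow> \<phi> ` U \<subseteq> eucl n" by (rule chart_eucl)
  show "smooth_fun n A T (\<lambda>x. Re (\<alpha> x))"
    by (rule smooth_fun_eq[OF bet_smooth(1)]) (use \<alpha>_bet chart_inj in auto)
  have "smooth_fun n A T (\<lambda>x. (-1) * Im (bet x))"
    by (intro smooth_fun_mult smooth_fun_const co bet_smooth)
  then show "smooth_fun n A T (\<lambda>x. Im (\<alpha> x))"
    by (rule smooth_fun_eq) (use \<alpha>_bet chart_inj in auto)
qed

text \<open>
  The coordinates \<open>0\<close> and \<open>j\<close> of \<open>\<Phi>\<close> are the real and imaginary part of \<open>w = \<surd>f \<cdot> \<alpha>\<close>.  The inverse \<open>\<Psi>\<close> finds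
  the slice point \<open>\<sigma>\<close> from \<open>f = |w|\<^sup>2\<close>.  The value of \<open>phase\<close> at \<open>w = 0\<close> is arbitrary, since the cut
  collapses the orbit there.
\<close>

definition \<Phi> where
  "\<Phi> x = (\<lambda>k. if k = 0 then sqrt (f x) * Re (\<alpha> x) else if k = j then sqrt (f x) * Im (\<alpha> x) else S k x)"

text \<open>With \<open>w = Complex (u 0) (u j)\<close>, the slice point sought has
  \<open>f = |w|^2\<close> and \<open>j\<close>-th coordinate \<open>p j\<close>. \<open>v\<close>
  lists its coordinates with \<open>f\<close> in place of coordinate 0, and \<open>ex\<close>
  converts them back to coordinates of the chart \<open>\<phi>\<close>.\<close>

definition v where "v u = u(0 := (u 0)\<^sup>2 + (u j)\<^sup>2, j := p j)"
definition ex where "ex u = (v u)(0 := g1 (v u))"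
definition \<sigma> where "\<sigma> u = inv_into U \<phi> (ex u)"
definition phase where "phase u = (if Complex (u 0) (u j) = 0 then 1 else sgn (Complex (u 0) (u j)))"
definition \<Psi> where "\<Psi> u = cc (act (phase u) (\<sigma> u))"
text \<open>The chart image of \<open>N\<close> is open only in the half space. An ambient open set
  is fixed so that \<open>O0\<close> becomes open in Euclidean space as a preimage.\<close>

definition TN where "TN = (SOME T. openin (Euclidean_space n) T \<and> \<phi> ` N = T \<inter> {x. 0 \<le> x 0})"
definition O0 where "O0 = {u \<in> {u \<in> eucl n. v u \<in> Y1}. ex u \<in> TN}"

lemma TN: "openin (Euclidean_space n) TN" "\<phi> ` N = TN \<inter> {x. 0 \<le> x 0}"
proof -
  have "openin (half_space n) (\<phi> ` N)" using chart_image_open[OF chart[OF c] N(1)] N(3) by (simp add: inf_absorb2)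
  from someI_ex[OF openin_half_space[OF this]] show "openin (Euclidean_space n) TN" "\<phi> ` N = TN \<inter> {x. 0 \<le> x 0}"
    by (auto simp: TN_def)
qed

lemma \<Phi>_eucl: "x \<in> T \<Longrightarrow> \<Phi> x \<in> eucl n"
  using S_eucl j by (auto simp: \<Phi>_def in_eucl)

lemma v_eucl: "u \<in> eucl n \<Longrightarrow> v u \<in> eucl n"
  using j by (auto simp: v_def in_eucl)

lemma v_smooth: "D \<subseteq> eucl n \<Longrightarrow> smooth_on n D (\<lambda>u. v u k)"
proof -
  assume D: "D \<subseteq> eucl n"
  consider "k = j" | "k = 0" "k \<noteq> j" | "k \<noteq> 0" "k \<noteq> j" by blast
  then show ?thesis
    by cases (auto simp: v_def intro!: smooth_on_const smooth_on_coord smooth_on_add smooth_on_power D)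
qed

lemma ex_smooth:
  assumes D: "D \<subseteq> eucl n" "\<And>u. u \<in> D \<Longrightarrow> v u \<in> Y1"
  shows "smooth_on n D (\<lambda>u. ex u k)"
proof (cases "k = 0")
  case True
  have "smooth_on n D (\<lambda>u. g1 (v u))"
    by (rule smooth_on_compose[OF nf(2)]) (use v_smooth[OF D(1)] D openin_eucl_subset[OF nf(1)] in auto)
  then show ?thesis using True by (simp add: ex_def)
next
  case False
  then show ?thesis using v_smooth[OF D(1), of k] by (simp add: ex_def)
qed

lemma O0_open: "openin (Euclidean_space n) O0"
proof -
  have 1: "openin (Euclidean_space n) {u \<in> eucl n. v u \<in> Y1}"
    by (rule openin_eucl_vimage[OF openin_topspace _ _ nf(1)])
      (use smooth_on_continuous_on[OF v_smooth] v_eucl in auto)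
  show ?thesis unfolding O0_def
  proof (rule openin_eucl_vimage[OF 1 _ _ TN(1)])
    show "continuous_on {u \<in> eucl n. v u \<in> Y1} (\<lambda>u. ex u k)" for k
      by (rule smooth_on_continuous_on[OF ex_smooth]) auto
    show "ex ` {u \<in> eucl n. v u \<in> Y1} \<subseteq> eucl n" using v_eucl n0 eucl_upd by (auto simp: ex_def)
  qed
qed

lemma O0_props:
  assumes u: "u \<in> O0"
  shows "u \<in> eucl n" "v u \<in> Y1" "\<sigma> u \<in> N" "\<phi> (\<sigma> u) = ex u" "f (\<sigma> u) = (u 0)\<^sup>2 + (u j)\<^sup>2" "ex u \<in> \<phi> ` N"
proof -
  show "u \<in> eucl n" "v u \<in> Y1" using u by (auto simp: O0_def)
  have v0: "v u 0 = (u 0)\<^sup>2 + (u j)\<^sup>2" using j by (simp add: v_def)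
  then have v0': "0 \<le> v u 0" by simp
  have "ex u \<in> TN" using u by (auto simp: O0_def)
  moreover have "0 \<le> ex u 0" using nf(4)[OF \<open>v u \<in> Y1\<close> v0'] by (simp add: ex_def)
  ultimately show ex: "ex u \<in> \<phi> ` N" using TN(2) by blast
  then obtain x where x: "x \<in> N" "ex u = \<phi> x" by blast
  then have "\<sigma> u = x" using inj N(3) by (auto simp: \<sigma>_def)
  then show "\<sigma> u \<in> N" "\<phi> (\<sigma> u) = ex u" using x by auto
  show "f (\<sigma> u) = (u 0)\<^sup>2 + (u j)\<^sup>2" using nf(4)[OF \<open>v u \<in> Y1\<close> v0'] v0 by (simp add: \<sigma>_def ex_def)
qed

lemma phase_circle: "phase u \<in> unit_circle"
  by (auto simp: phase_def norm_sgn)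

lemma \<sigma>_props:
  assumes u: "u \<in> O0"
  shows "\<sigma> u \<in> T" "R (\<sigma> u) = \<sigma> u" "\<alpha> (\<sigma> u) = 1"
proof -
  note o = O0_props[OF u]
  show t: "\<sigma> u \<in> T" using o N_T by blast
  have "\<sigma> u \<in> UM" using o NU by blast
  have "\<phi> (\<sigma> u) j = \<phi> x0 j" using o(4) j by (simp add: ex_def v_def p_def)
  then have "cis (\<theta> (\<sigma> u)) = 1" using slice_id o by blast
  then have "bet (\<sigma> u) = 1" using bet_eq[OF t, of 1] act_1[OF \<open>\<sigma> u \<in> UM\<close>] o by simp
  then show "R (\<sigma> u) = \<sigma> u" "\<alpha> (\<sigma> u) = 1" using act_1[OF \<open>\<sigma> u \<in> UM\<close>] by (simp_all add: R_def \<alpha>_def)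
qed

text \<open>Polar decomposition of \<open>w\<close>: the modulus is recovered from the invariant
  \<open>f\<close>, the phase from equivariance of \<open>\<alpha>\<close>, which is 1 at
  \<open>\<sigma> u\<close>; the remaining coordinates are unaffected by the rotation.\<close>

lemma \<Phi>_act_\<sigma>:
  assumes u: "u \<in> O0"
  shows "\<Phi> (act (phase u) (\<sigma> u)) = u" "act (phase u) (\<sigma> u) \<in> T"
proof -
  note o = O0_props[OF u] and s = \<sigma>_props[OF u]
  let ?w = "Complex (u 0) (u j)" and ?x = "act (phase u) (\<sigma> u)"
  show "?x \<in> T" using T_act[OF phase_circle s(1)] .
  have a: "\<alpha> ?x = phase u" using bet_act(3)[OF s(1) phase_circle] s(3) by simp
  have "f ?x = (norm ?w)\<^sup>2" using f_act[OF phase_circle] s(1) T_W o(5) by (auto simp: cmod_power2)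
  then have sf: "sqrt (f ?x) = norm ?w" by simp
  have "of_real (norm ?w) * phase u = ?w"
    by (auto simp: phase_def sgn_eq)
  then have "norm ?w * Re (phase u) = u 0" "norm ?w * Im (phase u) = u j"
    by (metis Re_complex_of_real Im_complex_of_real complex.sel scaleR_conv_of_real scaleR_complex.simps)+
  moreover have "S k ?x = u k" if "k \<noteq> 0" "k \<noteq> j" for k
    using S_act[OF s(1) phase_circle] that s(2) o(4) by (simp add: S_def ex_def v_def)
  ultimately show "\<Phi> ?x = u" by (auto simp: \<Phi>_def a sf fun_eq_iff)
qed

lemma \<alpha>_square: assumes "x \<in> T" shows "(Re (\<alpha> x))\<^sup>2 + (Im (\<alpha> x))\<^sup>2 = 1"
  using R_props(7)[OF assms] by (simp add: cmod_def)

text \<open>\<open>\<alpha> x\<close> has modulus 1, so the squared modulus of \<open>w\<close> is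
  \<open>f x = f (R x)\<close>, and \<open>v (\<Phi> x)\<close> is the normal form of the slice
  point \<open>R x\<close>.\<close>

lemma \<sigma>_\<Phi>:
  assumes x: "x \<in> T"
  shows "v (\<Phi> x) \<in> Y1" "ex (\<Phi> x) = \<phi> (R x)" "\<sigma> (\<Phi> x) = R x"
proof -
  have fx: "0 \<le> f x" using f_nonneg x T_UM UM by blast
  have "(\<Phi> x 0)\<^sup>2 + (\<Phi> x j)\<^sup>2 = f x * ((Re (\<alpha> x))\<^sup>2 + (Im (\<alpha> x))\<^sup>2)"
    using j fx by (simp add: \<Phi>_def power_mult_distrib distrib_left)
  then have sq: "(\<Phi> x 0)\<^sup>2 + (\<Phi> x j)\<^sup>2 = f x" using \<alpha>_square[OF x] by simp
  have ve: "v (\<Phi> x) = (\<phi> (R x))(0 := f (R x))"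
    using sq R_props(3,4)[OF x] j by (auto simp: v_def fun_eq_iff S_def \<Phi>_def)
  note nf3 = nf(3)[OF R_props(1)[OF x]] R_props(2)[OF x]
  show "v (\<Phi> x) \<in> Y1" using nf3 by (simp add: ve p_def)
  show "ex (\<Phi> x) = \<phi> (R x)" using nf3 by (simp add: ex_def ve p_def)
  then show "\<sigma> (\<Phi> x) = R x" using inj R_props(1)[OF x] by (simp add: \<sigma>_def)
qed

lemma \<Psi>_\<Phi>:
  assumes x: "x \<in> T"
  shows "\<Psi> (\<Phi> x) = cc x"
proof (cases "f x = 0")
  case True
  have xM: "x \<in> topspace M" using x T_UM UM by blast
  then have bd: "x \<in> bd" using True f_zero by blast
  have "act (phase (\<Phi> x)) (\<sigma> (\<Phi> x)) = act (phase (\<Phi> x) * bet x) x"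
    unfolding \<sigma>_\<Phi>(3)[OF x] R_def using act_mult[OF phase_circle bet_circle[OF x]] x T_UM by auto
  then show ?thesis unfolding \<Psi>_def using cut_map_act[OF unit_circle_mult[OF phase_circle bet_circle[OF x]] bd] by simp
next
  case False
  then have fx: "0 < f x" using f_nonneg x T_UM UM by (metis less_le subsetD)
  have w: "Complex (\<Phi> x 0) (\<Phi> x j) = of_real (sqrt (f x)) * \<alpha> x"
    using j by (simp add: \<Phi>_def complex_eq_iff)
  have "norm (\<alpha> x) = 1" using R_props(7)[OF x] by simp
  then have "phase (\<Phi> x) = \<alpha> x" using fx by (auto simp: phase_def w sgn_eq norm_mult)
  then show ?thesis using R_props(6)[OF x] \<sigma>_\<Phi>(3)[OF x] by (simp add: \<Psi>_def)
qed

text \<open>Distinct points identified by the cut lie on one boundary orbit, where the factor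
  \<open>sqrt (f x) = 0\<close> erases the phase, and the \<open>S k\<close> are invariant.\<close>

lemma \<Phi>_invariant:
  assumes x: "x \<in> T" and y: "y \<in> topspace M" and eq: "cc x = cc y"
  shows "y \<in> T" "\<Phi> y = \<Phi> x"
proof -
  have xM: "x \<in> topspace M" using x T_UM UM by blast
  have "y \<in> T \<and> \<Phi> y = \<Phi> x"
  proof (cases "x = y")
    case False
    then obtain a where a: "x \<in> bd" "y \<in> bd" "a \<in> unit_circle" "y = act a x"
      using eq cut_map_eq_iff[OF xM y] by blast
    have "f x = 0" "f y = 0" using a f_zero xM y by auto
    then show ?thesis using T_act[OF a(3) x] S_act[OF x a(3)] a(4) by (auto simp: \<Phi>_def fun_eq_iff)
  qed (use x in simp)
  then show "y \<in> T" "\<Phi> y = \<Phi> x" by auto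
qed

lemma x0_T: "x0 \<in> T" using N(2) N_T by blast

text \<open>Coordinate \<open>j\<close> of \<open>\<Phi> x0\<close> is 0 and not \<open>p j\<close>,
  because it holds the imaginary part of \<open>w\<close>.\<close>

lemma x0_O0: "\<Phi> x0 \<in> O0" "\<sigma> (\<Phi> x0) = x0" "\<Phi> x0 = p(j := 0)"
proof -
  have xM: "x0 \<in> UM" "x0 \<in> topspace M" using N(2) NU UM by auto
  have f0: "f x0 = 0" using x0 f_zero xM by blast
  have "cis (\<theta> x0) = 1" using slice_id N(2) by blast
  then have "bet x0 = 1" using bet_eq[OF x0_T, of 1] act_1[OF xM(1)] N(2) by simp
  then have R: "R x0 = x0" using act_1[OF xM(1)] by (simp add: R_def)
  show "\<sigma> (\<Phi> x0) = x0" using \<sigma>_\<Phi>[OF x0_T] R by simp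
  have "\<phi> x0 \<in> TN" using TN(2) N(2) by blast
  then show "\<Phi> x0 \<in> O0" using \<sigma>_\<Phi>[OF x0_T] R \<Phi>_eucl[OF x0_T] by (simp add: O0_def)
  show "\<Phi> x0 = p(j := 0)" using f0 R p0 j by (auto simp: \<Phi>_def S_def p_def fun_eq_iff)
qed

section \<open>Topology of the boundary charts\<close>

lemma \<Phi>_continuous: "continuous_map (subtopology M T) (Euclidean_space n) \<Phi>"
proof -
  have ct: "continuous_map (subtopology M T) euclideanreal h" if "smooth_fun n A T h" for h
    by (rule smooth_fun_continuous[OF that T_open])
  have fc: "continuous_map (subtopology M T) euclideanreal (\<lambda>x. sqrt (f x))"
    using continuous_map_compose[OF continuous_map_from_subtopology[OF f_continuous], where g = sqrt and X'' = euclideanreal]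
    by (simp add: o_def continuous_on_real_sqrt continuous_on_id)
  have "continuous_map (subtopology M T) euclideanreal (\<lambda>x. \<Phi> x k)" for k
  proof -
    consider "k = 0" | "k = j" "k \<noteq> 0" | "k \<noteq> 0" "k \<noteq> j" by blast
    then show ?thesis
      by cases (auto simp: \<Phi>_def intro!: continuous_map_real_mult fc ct[OF \<alpha>_smooth(1)] ct[OF \<alpha>_smooth(2)] ct[OF S_smooth])
  qed
  then have "continuous_map (subtopology M T) (Euclidean_space n) (\<lambda>x k. if k < n then \<Phi> x k else 0)"
    by (simp add: continuous_map_componentwise_Euclidean_space)
  then show ?thesis
  proof (rule continuous_map_eq)
    fix x assume "x \<in> topspace (subtopology M T)"
    then have "\<Phi> x \<in> eucl n" using \<Phi>_eucl by simp
    then show "(\<lambda>k. if k < n then \<Phi> x k else 0) = \<Phi> x" by (auto simp: in_eucl fun_eq_iff)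
  qed
qed

lemma \<Phi>_vimage:
  assumes "openin (Euclidean_space n) G"
  shows "openin M {x \<in> T. \<Phi> x \<in> G}" "saturated {x \<in> T. \<Phi> x \<in> G}"
proof -
  have "openin (subtopology M T) {x \<in> topspace (subtopology M T). \<Phi> x \<in> G}"
    by (rule openin_continuous_map_preimage[OF \<Phi>_continuous assms])
  moreover have "{x \<in> topspace (subtopology M T). \<Phi> x \<in> G} = {x \<in> T. \<Phi> x \<in> G}"
    using openin_subset[OF T_open] by auto
  ultimately show "openin M {x \<in> T. \<Phi> x \<in> G}" using T_open by (simp add: openin_open_subtopology)
  have "act a x \<in> T \<and> \<Phi> (act a x) = \<Phi> x" if "a \<in> unit_circle" "x \<in> T" "x \<in> bd" for a x
    using \<Phi>_invariant[OF that(2), of "act a x"] cut_map_act[OF that(1,3)] T_act[OF that(1,2)] T_UM UM by auto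
  then show "saturated {x \<in> T. \<Phi> x \<in> G}" using T_UM UM by (auto simp: saturated_def)
qed

lemma \<sigma>_continuous: "continuous_map (subtopology (Euclidean_space n) O0) M \<sigma>"
proof -
  have O0e: "O0 \<subseteq> eucl n" using openin_eucl_subset[OF O0_open] .
  have "continuous_on O0 (\<lambda>u. ex u k)" for k
    by (rule smooth_on_continuous_on[OF ex_smooth]) (auto simp: O0_def)
  then have "continuous_on O0 ex" by (rule continuous_on_coordinatewise_then_product)
  moreover have "ex \<in> O0 \<rightarrow> eucl n" using O0_props(6) chart_eucl[OF c] N(3) by blast
  ultimately have "continuous_map (subtopology (Euclidean_space n) O0) (Euclidean_space n) ex"
    using O0e by (simp add: cm_Euclidean_space_iff_continuous_on inf_absorb2)
  then have "continuous_map (subtopology (Euclidean_space n) O0) (subtopology (half_space n) (\<phi> ` U)) ex"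
  proof -
    have "ex u \<in> \<phi> ` U" "0 \<le> ex u 0" if "u \<in> O0" for u
      using O0_props(6)[OF that] N(3) TN(2) by blast+
    then have "ex \<in> O0 \<rightarrow> \<phi> ` U" "ex \<in> O0 \<rightarrow> {x. 0 \<le> x 0}" by auto
    moreover have "topspace (subtopology (Euclidean_space n) O0) = O0" using O0e by auto
    ultimately show ?thesis using \<open>continuous_map (subtopology (Euclidean_space n) O0) (Euclidean_space n) ex\<close>
      by (simp add: half_space_def continuous_map_in_subtopology)
  qed
  from continuous_map_compose[OF this chart_inv_continuous[OF chart[OF c]]]
  show ?thesis by (simp add: o_def \<sigma>_def[abs_def])
qed

lemma punctured_open:
  assumes "openin (Euclidean_space n) O'" "O' \<subseteq> O0"
  shows "openin (Euclidean_space n) {u \<in> O'. 0 < (u 0)\<^sup>2 + (u j)\<^sup>2}"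
  by (intro openin_eucl_less assms continuous_intros continuous_on_subset[OF continuous_on_product_coordinates]) auto

text \<open>The zeros of \<open>w\<close> are removed because \<open>phase\<close> jumps
  there.\<close>

lemma phase_act_continuous:
  assumes O': "openin (Euclidean_space n) O'" "O' \<subseteq> O0"
  shows "continuous_map (subtopology (Euclidean_space n) {u \<in> O'. 0 < (u 0)\<^sup>2 + (u j)\<^sup>2}) M (\<lambda>u. act (phase u) (\<sigma> u))"
proof -
  have O'e: "O' \<subseteq> eucl n" using openin_eucl_subset[OF O'(1)] .
  have \<sigma>c: "continuous_map (subtopology (Euclidean_space n) O') M \<sigma>"
    using continuous_map_from_subtopology_mono[OF \<sigma>_continuous O'(2)] .
  define O1 where "O1 = {u \<in> O'. 0 < (u 0)\<^sup>2 + (u j)\<^sup>2}"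
  have cc': "continuous_on D (\<lambda>u::nat \<Rightarrow> real. u i)" for D i
    by (rule continuous_on_subset[OF continuous_on_product_coordinates]) simp
  have O1e: "O1 \<subseteq> eucl n" using O'e by (auto simp: O1_def)
  have nz: "Complex (u 0) (u j) \<noteq> 0" if "u \<in> O1" for u
    using that by (auto simp: O1_def complex_eq_iff)
  have "continuous_on O1 (\<lambda>u. sgn (Complex (u 0) (u j)))"
    using nz by (intro continuous_intros cc' continuous_on_sgn) (auto simp: Complex_eq intro!: continuous_intros cc')
  then have "continuous_on O1 phase"
    by (rule continuous_on_eq) (use nz in \<open>auto simp: phase_def\<close>)
  then have "continuous_map (subtopology (Euclidean_space n) O1) euclidean phase"
    using O1e by (simp add: Euclidean_space_eq subtopology_subtopology inf_absorb2 topspace_Euclidean_space)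
  then have "continuous_map (subtopology (Euclidean_space n) O1) (top_of_set unit_circle) phase"
    using phase_circle by (auto simp: continuous_map_in_subtopology)
  moreover have "continuous_map (subtopology (Euclidean_space n) O1) (subtopology M UM) \<sigma>"
    using continuous_map_from_subtopology_mono[OF \<sigma>c, of O1] O0_props(3) NU O'(2)
    by (auto simp: O1_def continuous_map_in_subtopology)
  ultimately have "continuous_map (subtopology (Euclidean_space n) O1)
      (prod_topology (top_of_set unit_circle) (subtopology M UM)) (\<lambda>u. (phase u, \<sigma> u))"
    by (simp add: continuous_map_pairwise o_def)
  from continuous_map_compose[OF this act_continuous]
  have "continuous_map (subtopology (Euclidean_space n) O1) M (\<lambda>u. act (phase u) (\<sigma> u))" by (simp add: o_def)
  then show ?thesis by (simp add: O1_def)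
qed

text \<open>Continuity of \<open>\<Psi>\<close> in spite of the jump of \<open>phase\<close> at
  \<open>w = 0\<close>. Points whose slice point lies in the core of the preimage are mapped into
  \<open>G\<close> whatever the phase is; this covers a neighbourhood of the solutions with
  \<open>w = 0\<close>, and elsewhere \<open>phase\<close> is continuous.\<close>

lemma \<Psi>_vimage:
  assumes G: "openin Mc G" and O': "openin (Euclidean_space n) O'" "O' \<subseteq> O0"
  shows "openin (Euclidean_space n) {u \<in> O'. \<Psi> u \<in> G}"
proof -
  define N' where "N' = {x \<in> topspace M. cc x \<in> G}"
  have N': "openin M N'" unfolding N'_def by (rule openin_continuous_map_preimage[OF cut_continuous G])
  have O'e: "O' \<subseteq> eucl n" using openin_eucl_subset[OF O'(1)] .
  have \<sigma>c: "continuous_map (subtopology (Euclidean_space n) O') M \<sigma>"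
    using continuous_map_from_subtopology_mono[OF \<sigma>_continuous O'(2)] .
  have opn: "openin (Euclidean_space n) {u \<in> O'. h u \<in> G}" if "continuous_map (subtopology (Euclidean_space n) O') X h" "openin X G"
    for h :: "(nat \<Rightarrow> real) \<Rightarrow> 'c" and X G
    using openin_continuous_map_preimage[OF that] O' O'e by (simp add: inf_absorb2 openin_open_subtopology)
  have A1: "openin (Euclidean_space n) {u \<in> O'. \<sigma> u \<in> core N'}" by (rule opn[OF \<sigma>c core_open[OF N']])
  define O1 where "O1 = {u \<in> O'. 0 < (u 0)\<^sup>2 + (u j)\<^sup>2}"
  note O1 = punctured_open[OF O', folded O1_def]
  have O1e: "O1 \<subseteq> eucl n" using O'e by (auto simp: O1_def)
  have "continuous_map (subtopology (Euclidean_space n) O1) M (\<lambda>u. act (phase u) (\<sigma> u))"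
    using phase_act_continuous[OF O'] by (simp add: O1_def)
  from openin_continuous_map_preimage[OF this N']
  have A2: "openin (Euclidean_space n) {u \<in> O1. act (phase u) (\<sigma> u) \<in> N'}"
    using O1 O1e by (simp add: inf_absorb2 openin_open_subtopology)
  have "{u \<in> O'. \<Psi> u \<in> G} = {u \<in> O'. \<sigma> u \<in> core N'} \<union> {u \<in> O1. act (phase u) (\<sigma> u) \<in> N'}"
  proof (intro equalityI subsetI)
    fix u assume u: "u \<in> {u \<in> O'. \<Psi> u \<in> G}"
    then have uO: "u \<in> O0" using O' by blast
    have sM: "\<sigma> u \<in> W" "\<sigma> u \<in> UM" using O0_props(3)[OF uO] N NU by auto
    show "u \<in> {u \<in> O'. \<sigma> u \<in> core N'} \<union> {u \<in> O1. act (phase u) (\<sigma> u) \<in> N'}"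
    proof (cases "u \<in> O1")
      case True
      then show ?thesis using u act_UM[OF phase_circle sM(2)] UM by (auto simp: N'_def \<Psi>_def)
    next
      case False
      then have "\<not> 0 < (u 0)\<^sup>2 + (u j)\<^sup>2" using u by (auto simp: O1_def)
      then have "(u 0)\<^sup>2 + (u j)\<^sup>2 = 0" using sum_power2_ge_zero[of "u 0" "u j"] by linarith
      then have "\<sigma> u \<in> bd" using O0_props(5)[OF uO] f_zero sM(2) UM by auto
      then have "cc (act a (\<sigma> u)) \<in> G" if "a \<in> unit_circle" for a
        using cut_map_act[OF that] cut_map_act[OF phase_circle, of "\<sigma> u" u] u by (simp add: \<Psi>_def)
      then have "\<sigma> u \<in> core N'" using sM act_UM[OF _ sM(2)] UM by (auto simp: core_def N'_def)
      then show ?thesis using u by blast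
    qed
  next
    fix u assume "u \<in> {u \<in> O'. \<sigma> u \<in> core N'} \<union> {u \<in> O1. act (phase u) (\<sigma> u) \<in> N'}"
    then show "u \<in> {u \<in> O'. \<Psi> u \<in> G}"
      using phase_circle by (auto simp: core_def N'_def \<Psi>_def O1_def)
  qed
  then show ?thesis using A1 A2 by auto
qed

text \<open>The range \<open>O'\<close> is a parameter so that the chart can later be shrunk to
  where a bump function is 1.\<close>

definition cut_chart where
  "cut_chart O' = (cc ` {x \<in> T. \<Phi> x \<in> O'},
     restrict (\<lambda>q. \<Phi> (SOME x. x \<in> topspace M \<and> cc x = q)) (cc ` {x \<in> T. \<Phi> x \<in> O'}))"

lemma cut_chart_value:
  assumes "x \<in> T" "\<Phi> x \<in> O'"
  shows "snd (cut_chart O') (cc x) = \<Phi> x"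
proof -
  have "x \<in> topspace M \<and> cc x = cc x" using assms T_UM UM by blast
  from someI[of "\<lambda>y. y \<in> topspace M \<and> cc y = cc x", OF this]
  have "\<Phi> (SOME y. y \<in> topspace M \<and> cc y = cc x) = \<Phi> x" using \<Phi>_invariant[OF assms(1)] by metis
  then show ?thesis using assms by (auto simp: cut_chart_def)
qed

text \<open>The inverse is \<open>\<Psi>\<close>. The chart is continuous because preimages under
  \<open>\<Phi>\<close> are open and saturated, its inverse by \<open>\<Psi>_vimage\<close>.\<close>

lemma cut_chart_is_chart:
  assumes O': "openin (Euclidean_space n) O'" "O' \<subseteq> O0"
  shows "is_chart (Euclidean_space n) Mc (cut_chart O')"
    "\<And>u. u \<in> O' \<Longrightarrow> inv_into (fst (cut_chart O')) (snd (cut_chart O')) u = \<Psi> u"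
    "snd (cut_chart O') ` fst (cut_chart O') = O'"
proof -
  let ?D = "{x \<in> T. \<Phi> x \<in> O'}" and ?\<psi> = "snd (cut_chart O')"
  have fst: "fst (cut_chart O') = cc ` ?D" by (simp add: cut_chart_def)
  have op: "openin Mc (cc ` ?D)" using saturated_open \<Phi>_vimage[OF O'(1)] by blast
  have im1: "?\<psi> q \<in> O'" if "q \<in> cc ` ?D" for q using that cut_chart_value by auto
  have \<Psi>D: "\<Psi> u \<in> cc ` ?D" "?\<psi> (\<Psi> u) = u" if "u \<in> O'" for u
  proof -
    have u: "u \<in> O0" using that O' by blast
    have x: "act (phase u) (\<sigma> u) \<in> ?D" using \<Phi>_act_\<sigma>[OF u] that by simp
    then show "\<Psi> u \<in> cc ` ?D" by (simp add: \<Psi>_def)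
    show "?\<psi> (\<Psi> u) = u" using cut_chart_value[of "act (phase u) (\<sigma> u)" O'] x \<Phi>_act_\<sigma>[OF u] by (simp add: \<Psi>_def)
  qed
  have \<Psi>\<psi>: "\<Psi> (?\<psi> q) = q" if "q \<in> cc ` ?D" for q using that cut_chart_value \<Psi>_\<Phi> by auto
  show im: "?\<psi> ` fst (cut_chart O') = O'" unfolding fst
  proof (intro equalityI subsetI)
    fix u assume "u \<in> O'"
    then show "u \<in> ?\<psi> ` (cc ` ?D)" using \<Psi>D(1)[of u] \<Psi>D(2)[of u] by (intro image_eqI[of _ _ "\<Psi> u"]) simp_all
  next
    fix u assume "u \<in> ?\<psi> ` (cc ` ?D)"
    then show "u \<in> O'" using im1 by blast
  qed
  have inj': "inj_on ?\<psi> (cc ` ?D)" by (rule inj_on_inverseI[of _ \<Psi>]) (rule \<Psi>\<psi>)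
  show "inv_into (fst (cut_chart O')) ?\<psi> u = \<Psi> u" if "u \<in> O'" for u
    unfolding fst using inv_into_f_f[OF inj' \<Psi>D(1)[OF that]] \<Psi>D(2)[OF that] by simp
  have Dt: "topspace (subtopology Mc (cc ` ?D)) = cc ` ?D" using openin_subset[OF op] by auto
  have Ot: "topspace (subtopology (Euclidean_space n) O') = O'" using openin_subset[OF O'(1)] by auto
  have "homeomorphic_maps (subtopology Mc (cc ` ?D)) (subtopology (Euclidean_space n) O') ?\<psi> \<Psi>"
    unfolding homeomorphic_maps_def Dt Ot
  proof (intro conjI ballI)
    show "continuous_map (subtopology Mc (cc ` ?D)) (subtopology (Euclidean_space n) O') ?\<psi>"
      unfolding continuous_map_def Dt Ot
    proof (intro conjI allI impI)
      show "?\<psi> \<in> cc ` ?D \<rightarrow> O'" using im1 by blast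
      fix G assume "openin (subtopology (Euclidean_space n) O') G"
      then have G: "openin (Euclidean_space n) G" "G \<subseteq> O'" using O'(1) by (auto simp: openin_open_subtopology)
      have "{q \<in> cc ` ?D. ?\<psi> q \<in> G} = cc ` {x \<in> T. \<Phi> x \<in> G}" using cut_chart_value G(2) by auto
      moreover have "openin Mc (cc ` {x \<in> T. \<Phi> x \<in> G})" using saturated_open \<Phi>_vimage[OF G(1)] by blast
      ultimately show "openin (subtopology Mc (cc ` ?D)) {q \<in> cc ` ?D. ?\<psi> q \<in> G}"
        using op by (simp add: openin_open_subtopology) blast
    qed
    show "continuous_map (subtopology (Euclidean_space n) O') (subtopology Mc (cc ` ?D)) \<Psi>"
      unfolding continuous_map_def Dt Ot
    proof (intro conjI allI impI)
      show "\<Psi> \<in> O' \<rightarrow> cc ` ?D" using \<Psi>D(1) by blast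
      fix G assume "openin (subtopology Mc (cc ` ?D)) G"
      then have G: "openin Mc G" using op by (auto simp: openin_open_subtopology)
      show "openin (subtopology (Euclidean_space n) O') {u \<in> O'. \<Psi> u \<in> G}"
        using \<Psi>_vimage[OF G O'] O'(1) by (auto simp: openin_open_subtopology)
    qed
  qed (use \<Psi>D \<Psi>\<psi> in auto)
  then have "homeomorphic_map (subtopology Mc (cc ` ?D)) (subtopology (Euclidean_space n) (?\<psi> ` (cc ` ?D))) ?\<psi>"
    using im unfolding fst by (auto simp: homeomorphic_map_maps)
  then show "is_chart (Euclidean_space n) Mc (cut_chart O')"
    using op O'(1) im unfolding fst by (auto simp: is_chart_def cut_chart_def)
qed

end

text \<open>Multiplication by the conjugate of \<open>z0\<close> rotates the values into the right
  half-plane, where the argument is the arctangent of a quotient; the angle of \<open>z0\<close> is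
  then added back.\<close>

lemma local_angle:
  assumes z0: "z0 \<noteq> 0" and D: "D \<subseteq> eucl n" "\<And>u. u \<in> D \<Longrightarrow> 0 < Re (Complex (u i) (u j) * cnj z0)"
  obtains \<omega> where "smooth_on n D \<omega>" "\<And>u. u \<in> D \<Longrightarrow> cis (\<omega> u) = sgn (Complex (u i) (u j))"
proof -
  define \<omega> where "\<omega> u = arctan ((u j * Re z0 - u i * Im z0) / (u i * Re z0 + u j * Im z0)) + Arg z0" for u
  have q: "0 < u i * Re z0 + u j * Im z0" if "u \<in> D" for u using D(2)[OF that] by simp
  have "smooth_on n D \<omega>"
    unfolding \<omega>_def
    by (intro smooth_on_add smooth_on_arctan smooth_on_divide smooth_on_diff smooth_on_mult smooth_on_const smooth_on_coord D)
      (use q in force)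
  moreover have "cis (\<omega> u) = sgn (Complex (u i) (u j))" if u: "u \<in> D" for u
  proof -
    let ?w = "Complex (u i) (u j)" and ?y = "Complex (u i) (u j) * cnj z0"
    have "arctan (Im ?y / Re ?y) = Arg ?y" using arg_conv_arctan[OF D(2)[OF u]] by simp
    moreover have "Im ?y = u j * Re z0 - u i * Im z0" "Re ?y = u i * Re z0 + u j * Im z0" by simp_all
    ultimately have "\<omega> u = Arg ?y + Arg z0" by (simp add: \<omega>_def)
    moreover have "?y \<noteq> 0" using D(2)[OF u] by force
    ultimately have "cis (\<omega> u) = sgn ?y * sgn z0"
      using z0 by (simp add: cis_mult[symmetric] cis_Arg del: mult_eq_0_iff)
    also have "\<dots> = sgn ?w * (sgn (cnj z0) * sgn z0)" by (simp add: sgn_mult)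
    also have "sgn (cnj z0) * sgn z0 = 1"
    proof -
      have "sgn (cnj z0) * sgn z0 = sgn (z0 * cnj z0)" by (simp only: sgn_mult mult.commute)
      also have "z0 * cnj z0 = complex_of_real ((norm z0)\<^sup>2)" by (rule complex_norm_square[symmetric])
      also have "sgn (complex_of_real ((norm z0)\<^sup>2)) = 1" using z0 by (simp only: sgn_of_real) simp
      finally show ?thesis .
    qed
    finally show ?thesis by simp
  qed
  ultimately show thesis using that by blast
qed

section \<open>Members of the function space\<close>

context cut_data
begin

abbreviation FF where "FF \<equiv> cut_functions n M A UM act f"
abbreviation PA where "PA \<equiv> product_atlas n A complex_atlas"

text \<open>Descends a function from \<open>M\<close> by choosing representatives, which is
  meaningful if it is constant on boundary orbits. Off the cut space the value is arbitrary;
  membership in \<open>FF\<close> does not see it.\<close>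

definition desc :: "('a \<Rightarrow> real) \<Rightarrow> 'a set \<Rightarrow> real" where
  "desc \<kappa> q = \<kappa> (SOME x. x \<in> topspace M \<and> cc x = q)"

lemma desc_cc:
  assumes "\<And>a x. a \<in> unit_circle \<Longrightarrow> x \<in> bd \<Longrightarrow> \<kappa> (act a x) = \<kappa> x" "x \<in> topspace M"
  shows "desc \<kappa> (cc x) = \<kappa> x"
proof -
  define y where "y = (SOME y. y \<in> topspace M \<and> cc y = cc x)"
  have "x \<in> topspace M \<and> cc x = cc x" using assms by simp
  from someI[of "\<lambda>y. y \<in> topspace M \<and> cc y = cc x", OF this]
  have y: "y \<in> topspace M" "cc y = cc x" by (auto simp: y_def)
  have "\<kappa> y = \<kappa> x" using cut_map_eq_iff[OF y(1) assms(2)] y(2) assms(1) by metis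
  then show ?thesis by (simp add: desc_def y_def)
qed

text \<open>\<open>f\<close> vanishes on boundary orbits and equivariance gives
  \<open>H (act a x, 0) = H (x, 0)\<close>, so \<open>\<kappa>\<close> is automatically constant on
  these orbits and descends.\<close>

lemma FF_I:
  assumes k: "smooth_fun n A (topspace M - bd) \<kappa>"
    and V: "openin M V" "bd \<subseteq> V" "V \<subseteq> UM" "circle_invariant act V"
    and H: "smooth_fun (n + 2) PA (V \<times> UNIV) H"
      "\<And>a x z. a \<in> unit_circle \<Longrightarrow> x \<in> V \<Longrightarrow> H (act a x, z) = H (x, a * z)"
      "\<And>x. x \<in> V \<Longrightarrow> \<kappa> x = H (x, complex_of_real (sqrt (f x)))"
  shows "desc \<kappa> \<in> FF" "\<And>x. x \<in> topspace M \<Longrightarrow> desc \<kappa> (cc x) = \<kappa> x"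
proof -
  have inv: "\<kappa> (act a x) = \<kappa> x" if a: "a \<in> unit_circle" and x: "x \<in> bd" for a x
  proof -
    have z: "f x = 0" "f (act a x) = 0" using f_zero x act_bd[OF a x] bd_sub by auto
    have "\<kappa> (act a x) = H (act a x, 0)" using H(3)[of "act a x"] act_bd[OF a x] V(2) z by auto
    also have "\<dots> = H (x, 0)" using H(2)[OF a, of x 0] x V(2) by auto
    also have "\<dots> = \<kappa> x" using H(3)[of x] x V(2) z by auto
    finally show ?thesis .
  qed
  show d: "desc \<kappa> (cc x) = \<kappa> x" if "x \<in> topspace M" for x by (rule desc_cc[OF inv that])
  have Vt: "V \<subseteq> topspace M" using openin_subset[OF V(1)] .
  have "smooth_fun n A (topspace M - bd) (desc \<kappa> \<circ> cc)"
    by (rule smooth_fun_eq[OF k]) (use d chart_inj in auto)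
  moreover have "(desc \<kappa> \<circ> cc) x = H (x, complex_of_real (sqrt (f x)))" if "x \<in> V" for x
    using d H(3)[OF that] that Vt by auto
  ultimately show "desc \<kappa> \<in> FF"
    unfolding cut_functions_def interior_eq
    by (intro CollectI conjI exI[of _ V] exI[of _ H] ballI allI V H(1,2)) auto
qed

lemma FF_D:
  assumes "h \<in> FF"
  shows "smooth_fun n A (topspace M - bd) (h \<circ> cc)"
    "\<exists>V H. openin M V \<and> bd \<subseteq> V \<and> V \<subseteq> UM \<and> circle_invariant act V \<and> smooth_fun (n + 2) PA (V \<times> UNIV) H \<and>
       (\<forall>a\<in>unit_circle. \<forall>x\<in>V. \<forall>z. H (act a x, z) = H (x, a * z)) \<and>
       (\<forall>x\<in>V. h (cc x) = H (x, complex_of_real (sqrt (f x))))"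
  using assms unfolding cut_functions_def interior_eq by auto

lemma compact_compl_open: "compactin M K \<Longrightarrow> openin M (topspace M - K)"
  using compactin_imp_closedin[OF hausdorff] by (auto simp: closedin_def)

text \<open>\<open>T\<close> and the complement of \<open>K\<close>, open because \<open>M\<close>
  is Hausdorff, cover \<open>D\<close>, and the extended function is smooth on both.\<close>

lemma extend_by_zero:
  assumes T: "openin M T" and K: "compactin M K" "K \<subseteq> T" and D: "D \<subseteq> topspace M"
    and g: "smooth_fun n A (D \<inter> T) g" and z: "\<And>x. x \<in> T \<Longrightarrow> x \<notin> K \<Longrightarrow> g x = 0"
  shows "smooth_fun n A D (\<lambda>x. if x \<in> T then g x else 0)"
proof (rule smooth_fun_localI)
  fix x assume x: "x \<in> D"
  show "\<exists>N. openin M N \<and> x \<in> N \<and> smooth_fun n A (D \<inter> N) (\<lambda>x. if x \<in> T then g x else 0)"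
  proof (cases "x \<in> T")
    case True
    have "smooth_fun n A (D \<inter> T) (\<lambda>x. if x \<in> T then g x else 0)"
      by (rule smooth_fun_eq[OF g]) (use chart_inj in auto)
    then show ?thesis using T True by blast
  next
    case False
    have "smooth_fun n A (D \<inter> (topspace M - K)) (\<lambda>x. if x \<in> T then g x else 0)"
      by (rule smooth_fun_eq[OF smooth_fun_const[of A n _ 0]]) (use z chart_inj chart_eucl in auto)
    then show ?thesis using False K x D compact_compl_open[OF K(1)] by (intro exI[of _ "topspace M - K"]) auto
  qed
qed

lemma product_extend_by_zero:
  assumes T: "openin M T" and K: "compactin M K" "K \<subseteq> T" and D: "D \<subseteq> topspace M"
    and g: "smooth_fun (n + 2) PA ((D \<inter> T) \<times> UNIV) g" and z: "\<And>x y. x \<in> T \<Longrightarrow> x \<notin> K \<Longrightarrow> g (x, y) = 0"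
  shows "smooth_fun (n + 2) PA (D \<times> UNIV) (\<lambda>(x, y). if x \<in> T then g (x, y) else 0)"
proof (rule product_smooth_localI)
  fix x assume x: "x \<in> D"
  show "\<exists>N. openin M N \<and> x \<in> N \<and> smooth_fun (n + 2) PA ((D \<inter> N) \<times> UNIV) (\<lambda>(x, y). if x \<in> T then g (x, y) else 0)"
  proof (cases "x \<in> T")
    case True
    have "smooth_fun (n + 2) PA ((D \<inter> T) \<times> UNIV) (\<lambda>(x, y). if x \<in> T then g (x, y) else 0)"
      by (rule product_smooth_eq[OF g]) auto
    then show ?thesis using T True by blast
  next
    case False
    have "smooth_fun (n + 2) PA ((D \<inter> (topspace M - K)) \<times> UNIV) (\<lambda>(x, y). if x \<in> T then g (x, y) else 0)"
      by (rule product_smooth_eq[OF smooth_fun_const[of PA "n + 2" _ 0]]) (use z product_charts in auto)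
    then show ?thesis using False K x D compact_compl_open[OF K(1)] by (intro exI[of _ "topspace M - K"]) auto
  qed
qed

end

section \<open>Cutoffs, coordinates and pullbacks on a tube\<close>

context cut_tube
begin

lemma \<Phi>_smooth: "smooth_fun n A (T - bd) (\<lambda>x. \<Phi> x k)"
proof -
  have Tt: "T \<subseteq> topspace M" using T_UM UM by blast
  have "smooth_fun n A (T - bd) (\<lambda>x. sqrt (f x))"
  proof (rule smooth_fun_sqrt)
    show "smooth_fun n A (T - bd) f" using f_smooth Tt by (auto elim!: smooth_fun_subset)
    show "0 < f x" if "x \<in> T - bd" for x using f_nonneg[of x] f_zero[of x] that Tt by (auto simp: less_le)
  qed (rule chart_inj)
  moreover have "smooth_fun n A (T - bd) (\<lambda>x. Re (\<alpha> x))" "smooth_fun n A (T - bd) (\<lambda>x. Im (\<alpha> x))" "smooth_fun n A (T - bd) (S k)"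
    by (rule smooth_fun_subset[OF \<alpha>_smooth(1)] smooth_fun_subset[OF \<alpha>_smooth(2)] smooth_fun_subset[OF S_smooth]; blast)+
  ultimately have *: "smooth_fun n A (T - bd) (\<lambda>x. sqrt (f x) * Re (\<alpha> x))"
    "smooth_fun n A (T - bd) (\<lambda>x. sqrt (f x) * Im (\<alpha> x))" "smooth_fun n A (T - bd) (S k)"
    by (auto intro: smooth_fun_mult)
  consider "k = 0" | "k = j" "k \<noteq> 0" | "k \<noteq> 0" "k \<noteq> j" by blast
  then show ?thesis by cases (use * in \<open>simp_all add: \<Phi>_def\<close>)
qed

text \<open>The bump is composed of \<open>f\<close> and the \<open>S k\<close>, which are smooth on
  the tube and invariant; \<open>f\<close>, being \<open>|w|^2\<close>, stands for both coordinates
  of \<open>w\<close>. The support lies in the union \<open>K\<close> of the orbits through a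
  compact set of slice points, and these orbits stay in \<open>N'\<close> because the slice points
  are taken from its core.\<close>

lemma bump:
  assumes N': "openin M N'" "x0 \<in> core N'"
  obtains b K O' where "smooth_fun n A (topspace M) b" "compactin M K" "K \<subseteq> T" "K \<subseteq> N'" "\<And>x. x \<notin> K \<Longrightarrow> b x = 0"
    "\<And>a x. a \<in> unit_circle \<Longrightarrow> x \<in> W \<Longrightarrow> b (act a x) = b x"
    "openin (Euclidean_space n) O'" "\<Phi> x0 \<in> O'" "O' \<subseteq> O0" "\<And>x. x \<in> T \<Longrightarrow> \<Phi> x \<in> O' \<Longrightarrow> b x = 1"
proof -
  define q where "q = \<Phi> x0"
  have q: "q \<in> O0" "\<sigma> q = x0" "q = p(j := 0)" using x0_O0 by (simp_all add: q_def)
  have O0e: "O0 \<subseteq> eucl n" using openin_eucl_subset[OF O0_open] .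
  have q0: "q 0 = 0" "q j = 0" "k \<noteq> j \<Longrightarrow> q k = p k" for k using q(3) p0 j by auto
  define O2 where "O2 = {u \<in> O0. \<sigma> u \<in> core N'}"
  have "openin (subtopology (Euclidean_space n) O0) {u \<in> topspace (subtopology (Euclidean_space n) O0). \<sigma> u \<in> core N'}"
    by (rule openin_continuous_map_preimage[OF \<sigma>_continuous core_open[OF N'(1)]])
  then have O2: "openin (Euclidean_space n) O2" "q \<in> O2"
    using O0_open O0e q N'(2) by (simp_all add: O2_def inf_absorb2 openin_open_subtopology)
  obtain d0 where d0: "d0 > 0" "cube n q d0 \<subseteq> O2" using openin_contains_cube[OF O2] by metis
  \<comment> \<open>Halving makes the closed cube \<open>C\<close> fit into the open cube of radius
    \<open>d0\<close>.\<close>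
  define d where "d = d0 / 2"
  define C where "C = {u \<in> eucl n. \<forall>i<n. \<bar>u i - q i\<bar> \<le> d}"
  have d: "d > 0" "C \<subseteq> O2" using d0 by (force simp: d_def C_def cube_def)+
  have CO: "C \<subseteq> O0" using d by (auto simp: O2_def)
  have C: "compactin (Euclidean_space n) C" unfolding C_def by (rule compactin_closed_cube)
  define K where "K = (\<lambda>(a, x). act a x) ` (unit_circle \<times> \<sigma> ` C)"
  have "compactin M K"
    unfolding K_def
  proof (rule image_compactin[OF _ act_continuous])
    have "compactin (subtopology (Euclidean_space n) O0) C" using C CO by (simp add: compactin_subtopology)
    then have "compactin M (\<sigma> ` C)" by (rule image_compactin[OF _ \<sigma>_continuous])
    moreover have "\<sigma> ` C \<subseteq> UM" using O0_props(3) CO NU by blast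
    ultimately have "compactin (subtopology M UM) (\<sigma> ` C)" by (simp add: compactin_subtopology)
    then show "compactin (prod_topology (top_of_set unit_circle) (subtopology M UM)) (unit_circle \<times> \<sigma> ` C)"
      by (simp add: compactin_Times compactin_subtopology)
  qed
  have KT: "K \<subseteq> T" using T_act \<sigma>_props(1) CO by (auto simp: K_def)
  have KN: "K \<subseteq> N'" using d(2) by (auto simp: K_def O2_def core_def)
  \<comment> \<open>The factor 8 serves both ends. Where \<open>g\<close> is nonzero,
    \<open>sqrt (f x) < d / 2\<close> and the \<open>S k\<close> deviate by at most
    \<open>d\<close>, so \<open>\<Phi> x\<close> lies in \<open>C\<close>. Where
    \<open>\<Phi> x\<close> is within \<open>d / 4\<close> of \<open>q\<close>, \<open>f x\<close>
    is a sum of two squares of at most \<open>d^2 / 16\<close>, so the first argument is at most 1.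
    Coordinates 0 and \<open>j\<close> are absent from the product, since the factor in
    \<open>f\<close> controls \<open>w\<close>.\<close>
  define g where "g x = smooth_step (8 * f x / d\<^sup>2) * (\<Prod>k\<in>{..<n} - {0, j}. smooth_step (8 * (S k x - p k)\<^sup>2 / d\<^sup>2))" for x
  have Tt: "T \<subseteq> topspace M" using T_UM UM by blast
  have gs: "smooth_fun n A T g"
    unfolding smooth_fun_def
  proof clarify
    fix U' \<phi>' assume c': "(U', \<phi>') \<in> A"
    have e: "\<phi>' ` (U' \<inter> T) \<subseteq> eucl n" using chart_eucl[OF c'] by blast
    have s: "smooth_on n (\<phi>' ` (U' \<inter> T)) (h \<circ> inv_into U' \<phi>')" if "smooth_fun n A T h" for h
      using that c' by (auto simp: smooth_fun_def)
    have "smooth_on n (\<phi>' ` (U' \<inter> T)) (f \<circ> inv_into U' \<phi>')" using smooth_fun_subset[OF f_smooth Tt] s by blast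
    then show "smooth_on n (\<phi>' ` (U' \<inter> T)) (g \<circ> inv_into U' \<phi>')"
      using s[OF S_smooth] d(1) unfolding g_def o_def
      by (intro smooth_on_mult smooth_on_prod smooth_on_smooth_step smooth_on_divide smooth_on_power
          smooth_on_diff smooth_on_const e) auto
  qed
  have gz: "g x = 0" if x: "x \<in> T" "x \<notin> K" for x
  proof (rule ccontr)
    assume nz: "g x \<noteq> 0"
    have fx: "0 \<le> f x" using f_nonneg x Tt by blast
    have "smooth_step (8 * f x / d\<^sup>2) \<noteq> 0" using nz by (auto simp: g_def)
    then have "8 * f x / d\<^sup>2 < 2" using smooth_step_0 by (metis not_less)
    then have f1: "f x < d\<^sup>2 / 4" using d(1) by (simp add: field_simps)
    then have "sqrt (f x) < d / 2" using d(1) by (intro real_less_lsqrt) (auto simp: power_divide)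
    moreover have "\<bar>Re (\<alpha> x)\<bar> \<le> 1" "\<bar>Im (\<alpha> x)\<bar> \<le> 1"
      using abs_Re_le_cmod[of "\<alpha> x"] abs_Im_le_cmod[of "\<alpha> x"] R_props(7)[OF x(1)] by auto
    moreover have "0 \<le> sqrt (f x)" using fx by simp
    ultimately have "\<bar>sqrt (f x) * Re (\<alpha> x)\<bar> \<le> d" "\<bar>sqrt (f x) * Im (\<alpha> x)\<bar> \<le> d"
      using mult_left_le[of "\<bar>Re (\<alpha> x)\<bar>" "sqrt (f x)"] mult_left_le[of "\<bar>Im (\<alpha> x)\<bar>" "sqrt (f x)"] d(1)
      by (auto simp: abs_mult)
    moreover have "\<bar>S k x - p k\<bar> \<le> d" if k: "k < n" "k \<noteq> 0" "k \<noteq> j" for k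
    proof -
      have "smooth_step (8 * (S k x - p k)\<^sup>2 / d\<^sup>2) \<noteq> 0" using nz k by (auto simp: g_def)
      then have "8 * (S k x - p k)\<^sup>2 / d\<^sup>2 < 2" using smooth_step_0 by (metis not_less)
      then have "4 * (S k x - p k)\<^sup>2 < d\<^sup>2" using d(1) by (simp add: field_simps)
      then have "(S k x - p k)\<^sup>2 \<le> d\<^sup>2" using zero_le_power2[of "S k x - p k"] by linarith
      then show ?thesis using d(1) abs_le_square_iff[of "S k x - p k" d] by simp
    qed
    ultimately have "\<Phi> x \<in> C" using \<Phi>_eucl[OF x(1)] q0 by (auto simp: C_def \<Phi>_def)
    moreover have "x = act (\<alpha> x) (\<sigma> (\<Phi> x))" using R_props(6)[OF x(1)] \<sigma>_\<Phi>(3)[OF x(1)] by simp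
    ultimately have "x \<in> K" unfolding K_def using R_props(7)[OF x(1)] by (intro image_eqI[of _ _ "(\<alpha> x, \<sigma> (\<Phi> x))"]) auto
    then show False using x by blast
  qed
  define b where "b x = (if x \<in> T then g x else 0)" for x
  have "smooth_fun n A (topspace M) b"
    unfolding b_def using gs Tt by (intro extend_by_zero[OF T_open \<open>compactin M K\<close> KT]) (auto simp: inf_absorb2 gz)
  moreover have "b (act a x) = b x" if ax: "a \<in> unit_circle" "x \<in> W" for a x
    using T_act_iff[OF ax] S_act[OF _ ax(1)] f_act[OF ax] by (simp add: b_def g_def)
  moreover have "b x = 1" if x: "x \<in> T" "\<Phi> x \<in> cube n q (d / 4)" for x
  proof -
    have fx: "0 \<le> f x" using f_nonneg x Tt by blast
    have sm: "8 * y\<^sup>2 / d\<^sup>2 \<le> 1/2" if "\<bar>y\<bar> < d / 4" for y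
    proof -
      have "\<bar>y\<bar> \<le> \<bar>d / 4\<bar>" using that by simp
      then have "y\<^sup>2 \<le> (d / 4)\<^sup>2" by (simp only: abs_le_square_iff)
      then have "16 * y\<^sup>2 \<le> d\<^sup>2" by (simp add: power_divide)
      then show ?thesis using d(1) by (simp add: field_simps)
    qed
    have "\<bar>\<Phi> x 0\<bar> < d / 4" "\<bar>\<Phi> x j\<bar> < d / 4" using x(2) q0 j by (auto simp: cube_def)
    from sm[OF this(1)] sm[OF this(2)] have "8 * ((\<Phi> x 0)\<^sup>2 + (\<Phi> x j)\<^sup>2) / d\<^sup>2 \<le> 1"
      by (simp add: add_divide_distrib distrib_left)
    moreover have "(\<Phi> x 0)\<^sup>2 + (\<Phi> x j)\<^sup>2 = f x * ((Re (\<alpha> x))\<^sup>2 + (Im (\<alpha> x))\<^sup>2)"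
      using j fx by (simp add: \<Phi>_def power_mult_distrib distrib_left)
    ultimately have "smooth_step (8 * f x / d\<^sup>2) = 1" using \<alpha>_square[OF x(1)] by (intro smooth_step_1) simp
    moreover have "smooth_step (8 * (S k x - p k)\<^sup>2 / d\<^sup>2) = 1" if k: "k < n" "k \<noteq> 0" "k \<noteq> j" for k
    proof -
      have "\<bar>\<Phi> x k - q k\<bar> < d / 4" using x(2) k by (auto simp: cube_def)
      then have "\<bar>S k x - p k\<bar> < d / 4" using k q0 by (simp add: \<Phi>_def)
      then show ?thesis using sm by (intro smooth_step_1) fastforce
    qed
    ultimately show ?thesis using x(1) by (simp add: b_def g_def)
  qed
  moreover have "cube n q (d / 4) \<subseteq> O0" using d0(2) cube_mono[of "d/4" d0 n q] d(1) by (auto simp: O2_def d_def)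
  moreover have "q \<in> cube n q (d / 4)" using q O0e d(1) by (intro cube_center) auto
  ultimately show thesis
    using that[of b K "cube n q (d / 4)"] \<open>compactin M K\<close> KT KN gz openin_cube by (auto simp: b_def q_def)
qed

text \<open>
  The required functions \<open>H\<close> are linear in \<open>z\<close>, for example \<open>b x \<cdot> Re (\<alpha> x \<cdot> z)\<close>, so no cutoff in the
  \<open>z\<close> direction is needed.
\<close>

lemma coordinate_member:
  assumes b: "smooth_fun n A (topspace M) b" "compactin M K" "K \<subseteq> T" "\<And>x. x \<notin> K \<Longrightarrow> b x = 0"
    "\<And>a x. a \<in> unit_circle \<Longrightarrow> x \<in> W \<Longrightarrow> b (act a x) = b x"
  shows "\<exists>h\<in>FF. \<forall>x\<in>T. b x = 1 \<longrightarrow> h (cc x) = \<Phi> x k"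
proof -
  define \<kappa> where "\<kappa> x = (if x \<in> T then b x * \<Phi> x k else 0)" for x
  \<comment> \<open>Equivariance is built in, as
    \<open>\<alpha> (act a x) * z = \<alpha> x * (a * z)\<close> and the \<open>S k\<close> are
    invariant; inserting \<open>z = sqrt (f x)\<close> gives \<open>\<Phi> x k\<close>.\<close>
  define G where "G x z = (if k = 0 then Re (\<alpha> x * z) else if k = j then Im (\<alpha> x * z) else S k x)" for x z
  define H where "H = (\<lambda>(x, z). if x \<in> T then b x * G x z else 0)"
  have Tt: "T \<subseteq> topspace M" using T_UM UM by blast
  have "smooth_fun n A (topspace M - bd) \<kappa>"
    unfolding \<kappa>_def
  proof (rule extend_by_zero[OF T_open b(2,3)])
    show "smooth_fun n A ((topspace M - bd) \<inter> T) (\<lambda>x. b x * \<Phi> x k)"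
      by (intro smooth_fun_mult smooth_fun_subset[OF b(1)] smooth_fun_subset[OF \<Phi>_smooth]) auto
  qed (use b(4) in auto)
  moreover have "smooth_fun (n + 2) PA (W \<times> UNIV) H"
  proof -
    have pb: "smooth_fun (n + 2) PA ((W \<inter> T) \<times> UNIV) (\<lambda>q. h (fst q))" if "smooth_fun n A T h" for h
      using product_smooth_pullback[OF smooth_fun_subset[OF that, of "W \<inter> T"]] by (simp add: case_prod_unfold)
    note ri = product_smooth_Re_Im[of "W \<inter> T", unfolded case_prod_unfold]
    note bT = smooth_fun_subset[OF b(1) Tt]
    have co: "\<And>P \<pi>. (P, \<pi>) \<in> PA \<Longrightarrow> \<pi> ` P \<subseteq> eucl (n + 2)" using product_charts by blast
    have "smooth_fun (n + 2) PA ((W \<inter> T) \<times> UNIV) (\<lambda>q. G (fst q) (snd q))"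
    proof -
      have 1: "smooth_fun (n + 2) PA ((W \<inter> T) \<times> UNIV) (\<lambda>q. Re (\<alpha> (fst q)) * Re (snd q) + (-1) * (Im (\<alpha> (fst q)) * Im (snd q)))"
        by (intro smooth_fun_add smooth_fun_mult pb[OF \<alpha>_smooth(1)] pb[OF \<alpha>_smooth(2)] ri smooth_fun_const co)
      have 2: "smooth_fun (n + 2) PA ((W \<inter> T) \<times> UNIV) (\<lambda>q. Re (\<alpha> (fst q)) * Im (snd q) + Im (\<alpha> (fst q)) * Re (snd q))"
        by (intro smooth_fun_add smooth_fun_mult pb[OF \<alpha>_smooth(1)] pb[OF \<alpha>_smooth(2)] ri)
      consider "k = 0" | "k = j" "k \<noteq> 0" | "k \<noteq> 0" "k \<noteq> j" by blast
      then show ?thesis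
        by cases (use 1 2 pb[OF S_smooth[of k]] j in \<open>simp_all add: G_def\<close>)
    qed
    then have "smooth_fun (n + 2) PA ((W \<inter> T) \<times> UNIV) (\<lambda>q. b (fst q) * G (fst q) (snd q))"
      by (intro smooth_fun_mult pb[OF bT])
    from product_extend_by_zero[OF T_open b(2,3) UM(3) this]
    have "smooth_fun (n + 2) PA (W \<times> UNIV) (\<lambda>(x, y). if x \<in> T then b (fst (x, y)) * G (fst (x, y)) (snd (x, y)) else 0)"
      using b(4) by simp
    then show ?thesis by (rule product_smooth_eq) (auto simp: H_def)
  qed
  moreover have "H (act a x, z) = H (x, a * z)" if ax: "a \<in> unit_circle" "x \<in> W" for a x z
    using T_act_iff[OF ax] b(5)[OF ax] bet_act(3)[OF _ ax(1)] S_act[OF _ ax(1)]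
    by (auto simp: H_def G_def mult_ac)
  moreover have "\<kappa> x = H (x, complex_of_real (sqrt (f x)))" if "x \<in> W" for x
    by (auto simp: \<kappa>_def H_def G_def \<Phi>_def mult_ac)
  ultimately have m: "desc \<kappa> \<in> FF" "\<And>x. x \<in> topspace M \<Longrightarrow> desc \<kappa> (cc x) = \<kappa> x"
    using FF_I[OF _ W] by blast+
  have "desc \<kappa> (cc x) = \<Phi> x k" if "x \<in> T" "b x = 1" for x
    using m(2)[of x] that Tt by (auto simp: \<kappa>_def)
  then show ?thesis using m(1) by blast
qed

text \<open>
  At boundary points \<open>h (\<Psi> u) = H (\<sigma> u, |w| \<cdot> phase u) = H (\<sigma> u, w)\<close> by equivariance, which is smooth in \<open>u\<close>.
\<close>

lemma pullback_smooth:
  assumes h: "h \<in> FF" and O': "openin (Euclidean_space n) O'" "O' \<subseteq> O0"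
  shows "smooth_on n O' (\<lambda>u. h (\<Psi> u))"
proof (rule smooth_on_localI)
  fix u0 assume u0: "u0 \<in> O'"
  note O'e = openin_eucl_subset[OF O'(1)]
  have u0O: "u0 \<in> O0" using u0 O' by blast
  have \<sigma>c: "continuous_map (subtopology (Euclidean_space n) O') M \<sigma>"
    using continuous_map_from_subtopology_mono[OF \<sigma>_continuous O'(2)] .
  have exs: "smooth_on n E (\<lambda>u. ex u i)" if "E \<subseteq> O'" for E i
    by (rule ex_smooth) (use that O'e O' O0_props(2) in blast)+
  show "\<exists>W. openin (Euclidean_space n) W \<and> u0 \<in> W \<and> smooth_on n (O' \<inter> W) (\<lambda>u. h (\<Psi> u))"
  proof (cases "0 < (u0 0)\<^sup>2 + (u0 j)\<^sup>2")
    case False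
    then have "(u0 0)\<^sup>2 + (u0 j)\<^sup>2 = 0" using sum_power2_ge_zero[of "u0 0" "u0 j"] by linarith
    then have bd0: "\<sigma> u0 \<in> bd" using O0_props(3,5)[OF u0O] f_zero NU UM by fastforce
    obtain V H where V: "openin M V" "bd \<subseteq> V" "V \<subseteq> UM" "circle_invariant act V"
      "smooth_fun (n + 2) PA (V \<times> UNIV) H"
      "\<And>a x z. a \<in> unit_circle \<Longrightarrow> x \<in> V \<Longrightarrow> H (act a x, z) = H (x, a * z)"
      "\<And>x. x \<in> V \<Longrightarrow> h (cc x) = H (x, complex_of_real (sqrt (f x)))"
      using FF_D(2)[OF h] by blast
    define E where "E = {u \<in> O'. \<sigma> u \<in> V}"
    have E: "openin (Euclidean_space n) E"
      using openin_continuous_map_preimage[OF \<sigma>c V(1)] O'(1) O'e by (simp add: E_def inf_absorb2 openin_open_subtopology)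
    have EO: "E \<subseteq> O'" "E \<subseteq> O0" using O' by (auto simp: E_def)
    \<comment> \<open>Coordinates of the pair \<open>(\<sigma> u, w)\<close> in the product chart of
      \<open>M \<times> \<complex>\<close>.\<close>
    define pk where "pk u = (\<lambda>i. if i < n then ex u i else if i = n then u 0 else if i = n + 1 then u j else 0)" for u :: "nat \<Rightarrow> real"
    have tr: "trunc (pk u) = ex u" if "u \<in> E" for u
    proof -
      have "ex u \<in> eucl n" using O0_props(6)[of u] that EO chart_eucl[OF c] N(3) by blast
      then show ?thesis by (auto simp: trunc_def pk_def in_eucl fun_eq_iff)
    qed
    have eq: "h (\<Psi> u) = H (inv_into U \<phi> (trunc (pk u)), Complex (pk u n) (pk u (n + 1)))" if u: "u \<in> E" for u
    proof -
      have uO: "u \<in> O0" and uV: "\<sigma> u \<in> V" using u EO by (auto simp: E_def)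
      let ?w = "Complex (u 0) (u j)"
      have "act (phase u) (\<sigma> u) \<in> V" using V(4) phase_circle uV by (auto simp: circle_invariant_def)
      then have "h (\<Psi> u) = H (act (phase u) (\<sigma> u), complex_of_real (sqrt (f (act (phase u) (\<sigma> u)))))"
        using V(7) by (simp add: \<Psi>_def)
      also have "f (act (phase u) (\<sigma> u)) = (norm ?w)\<^sup>2"
        using f_act[OF phase_circle, of "\<sigma> u" u] \<sigma>_props(1)[OF uO] T_W O0_props(5)[OF uO] by (auto simp: cmod_power2)
      also have "H (act (phase u) (\<sigma> u), complex_of_real (sqrt ((norm ?w)\<^sup>2))) = H (\<sigma> u, phase u * complex_of_real (norm ?w))"
        using V(6)[OF phase_circle uV] by simp
      also have "phase u * complex_of_real (norm ?w) = ?w" by (auto simp: phase_def sgn_eq)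
      finally show ?thesis using tr[OF u] by (simp add: \<sigma>_def pk_def)
    qed
    have "smooth_on n E (\<lambda>u. (\<lambda>y. H (inv_into U \<phi> (trunc y), Complex (y n) (y (n + 1)))) (pk u))"
    proof (rule smooth_on_compose[where F = pk and g = "\<lambda>y. H (inv_into U \<phi> (trunc y), Complex (y n) (y (n + 1)))"])
      show "smooth_on (n + 2) {y \<in> eucl (n + 2). trunc y \<in> \<phi> ` (U \<inter> V)} (\<lambda>y. H (inv_into U \<phi> (trunc y), Complex (y n) (y (n + 1))))"
        using V(5) c unfolding product_complex_smooth_iff by blast
      show "smooth_on n E (\<lambda>u. pk u i)" if "i < n + 2" for i
      proof -
        consider "i < n" | "i = n" | "i = n + 1" using \<open>i < n + 2\<close> by linarith
        then show ?thesis
          by cases (use exs[OF EO(1)] O'e EO in \<open>auto simp: pk_def intro!: smooth_on_coord\<close>)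
      qed
      show "pk ` E \<subseteq> {y \<in> eucl (n + 2). trunc y \<in> \<phi> ` (U \<inter> V)}"
      proof clarify
        fix u assume u: "u \<in> E"
        have "ex u = \<phi> (\<sigma> u)" "\<sigma> u \<in> U" "\<sigma> u \<in> V" using O0_props(3,4)[of u] u EO N(3) by (auto simp: E_def)
        then show "pk u \<in> eucl (n + 2) \<and> trunc (pk u) \<in> \<phi> ` (U \<inter> V)" using tr[OF u] by (auto simp: pk_def in_eucl)
      qed
    qed (use O'e EO in auto)
    then have "smooth_on n E (\<lambda>u. h (\<Psi> u))" by (rule smooth_on_eq) (simp add: eq)
    moreover have "O' \<inter> E = E" using EO by blast
    ultimately have "smooth_on n (O' \<inter> E) (\<lambda>u. h (\<Psi> u))" by simp
    then show ?thesis using E u0 bd0 V(2) by (intro exI[of _ E]) (auto simp: E_def)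
  next
    case True
    \<comment> \<open>Where \<open>w \<noteq> 0\<close> the point \<open>X u\<close> is interior and
      \<open>phase\<close> has a smooth local angle, so the claim follows from smoothness of
      \<open>h\<close> on the interior and of the action in charts.\<close>
    define z0 where "z0 = Complex (u0 0) (u0 j)"
    have z0: "z0 \<noteq> 0" using True by (auto simp: z0_def complex_eq_iff)
    define X where "X u = act (phase u) (\<sigma> u)" for u
    have XU: "X u \<in> UM" "f (X u) = (u 0)\<^sup>2 + (u j)\<^sup>2" if "u \<in> O0" for u
      using act_UM[OF phase_circle] f_act[OF phase_circle] O0_props(3,5)[OF that] NU N(4) by (auto simp: X_def)
    have X0: "X u0 \<in> topspace M - bd" using XU[OF u0O] True UM f_zero by force
    then obtain V \<psi> where d: "(V, \<psi>) \<in> A" "X u0 \<in> V" using chart_exists by blast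
    note dV = is_chartD[OF chart[OF d(1)]]
    define G where "G = V \<inter> (topspace M - bd)"
    have G: "openin M G" unfolding G_def using dV(1) interior_open by blast
    define O1 where "O1 = {u \<in> O'. 0 < (u 0)\<^sup>2 + (u j)\<^sup>2}"
    have O1: "openin (Euclidean_space n) O1" unfolding O1_def by (rule punctured_open[OF O'])
    have O1e: "O1 \<subseteq> eucl n" using O'e by (auto simp: O1_def)
    have "continuous_map (subtopology (Euclidean_space n) O1) M X"
      unfolding O1_def X_def by (rule phase_act_continuous[OF O'])
    from openin_continuous_map_preimage[OF this G]
    have E1: "openin (Euclidean_space n) {u \<in> O1. X u \<in> G}" using O1 O1e by (simp add: inf_absorb2 openin_open_subtopology)
    \<comment> \<open>The last condition places \<open>w\<close> in the half-plane around
      \<open>z0\<close>, as \<open>local_angle\<close> requires.\<close>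
    define E where "E = {u \<in> {u \<in> O1. X u \<in> G}. 0 < u 0 * Re z0 + u j * Im z0}"
    have E: "openin (Euclidean_space n) E" unfolding E_def
      by (intro openin_eucl_less E1 continuous_intros continuous_on_subset[OF continuous_on_product_coordinates]) auto
    have EO: "E \<subseteq> O'" "E \<subseteq> O0" "E \<subseteq> eucl n" using O' O1e by (auto simp: E_def O1_def)
    obtain \<omega> where \<omega>: "smooth_on n E \<omega>" "\<And>u. u \<in> E \<Longrightarrow> cis (\<omega> u) = sgn (Complex (u 0) (u j))"
      by (rule local_angle[OF z0 EO(3), of 0 j]) (auto simp: E_def)
    have ph: "phase u = cis (\<omega> u)" if "u \<in> E" for u
      using \<omega>(2)[OF that] that by (auto simp: phase_def E_def)
    have ZE: "cons (\<omega> u) (ex u) \<in> {y \<in> eucl (Suc n). shift y \<in> \<phi> ` (U \<inter> UM) \<and> act (cis (y 0)) (inv_into U \<phi> (shift y)) \<in> V}"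
      "act (cis (\<omega> u)) (inv_into U \<phi> (ex u)) = X u" if u: "u \<in> E" for u
    proof -
      have uO: "u \<in> O0" using u EO by blast
      note o = O0_props[OF uO]
      show X: "act (cis (\<omega> u)) (inv_into U \<phi> (ex u)) = X u" using ph[OF u] by (simp add: X_def \<sigma>_def)
      have "ex u \<in> \<phi> ` (U \<inter> UM)" "ex u \<in> eucl n" using o(6) N(3) NU chart_eucl[OF c] by blast+
      then show "cons (\<omega> u) (ex u) \<in> {y \<in> eucl (Suc n). shift y \<in> \<phi> ` (U \<inter> UM) \<and> act (cis (y 0)) (inv_into U \<phi> (shift y)) \<in> V}"
        using X u by (simp add: cons_eucl E_def G_def)
    qed
    have "smooth_on n E (\<lambda>u. ((h \<circ> cc) \<circ> inv_into V \<psi>) ((\<lambda>u. \<psi> (act (cis (cons (\<omega> u) (ex u) 0)) (inv_into U \<phi> (shift (cons (\<omega> u) (ex u)))))) u))"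
    proof (rule smooth_on_compose[where g = "(h \<circ> cc) \<circ> inv_into V \<psi>"])
      show "smooth_on n (\<psi> ` (V \<inter> (topspace M - bd))) ((h \<circ> cc) \<circ> inv_into V \<psi>)"
        using FF_D(1)[OF h] d(1) by (auto simp: smooth_fun_def)
      show "smooth_on n E (\<lambda>u. \<psi> (act (cis (cons (\<omega> u) (ex u) 0)) (inv_into U \<phi> (shift (cons (\<omega> u) (ex u))))) i)" for i
      proof (rule smooth_on_compose[OF act_chart_smooth[OF c d(1)], where F = "\<lambda>u. cons (\<omega> u) (ex u)"])
        show "smooth_on n E (\<lambda>u. cons (\<omega> u) (ex u) i)" if "i < Suc n" for i
          by (rule smooth_on_cons[OF \<omega>(1) exs[OF EO(1)] that])
      qed (use ZE EO in auto)
      show "(\<lambda>u. \<psi> (act (cis (cons (\<omega> u) (ex u) 0)) (inv_into U \<phi> (shift (cons (\<omega> u) (ex u)))))) ` E \<subseteq> \<psi> ` (V \<inter> (topspace M - bd))"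
        using ZE(2) by (auto simp: E_def G_def)
    qed (use chart_eucl[OF d(1)] EO in auto)
    then have "smooth_on n E (\<lambda>u. h (\<Psi> u))"
    proof (rule smooth_on_eq)
      fix u assume u: "u \<in> E"
      have "X u \<in> V" using u by (auto simp: E_def G_def)
      then show "((h \<circ> cc) \<circ> inv_into V \<psi>) (\<psi> (act (cis (cons (\<omega> u) (ex u) 0)) (inv_into U \<phi> (shift (cons (\<omega> u) (ex u)))))) = h (\<Psi> u)"
        using ZE(2)[OF u] chart_inj[OF d(1)] by (simp add: \<Psi>_def X_def)
    qed
    moreover have "u0 \<in> E"
    proof -
      have "0 < u0 0 * Re z0 + u0 j * Im z0" using True by (simp add: z0_def power2_eq_square)
      then show ?thesis using u0 True d(2) X0 by (simp add: E_def O1_def G_def)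
    qed
    ultimately show ?thesis using E EO by (intro exI[of _ E]) (auto simp: inf_absorb2)
  qed
qed

end

section \<open>The sheaf property\<close>

text \<open>Telescoping: each summand is the difference of two consecutive products.\<close>

lemma sum_prod_one_minus:
  "(\<Sum>i<m. (\<Prod>l<i. 1 - b l) * b i) = 1 - (\<Prod>l<m. 1 - (b l :: real))" for m :: nat
  by (induction m) (auto simp: algebra_simps)

context cut_data
begin

lemma PA_eucl: "(P, \<pi>) \<in> PA \<Longrightarrow> \<pi> ` P \<subseteq> eucl (n + 2)"
  using product_charts by blast

text \<open>The same composition is applied to the extensions \<open>H i\<close> on the intersection
  of their finitely many neighbourhoods; equivariance and the representation of \<open>hs i\<close>
  pass through \<open>G\<close> componentwise.\<close>

lemma FF_compose:
  assumes G: "smooth_on m (eucl m) G" and hs: "\<And>i. i < m \<Longrightarrow> hs i \<in> FF"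
  shows "(\<lambda>q. G (\<lambda>i. if i < m then hs i q else 0)) \<in> FF"
proof -
  define ext where "ext i V H \<longleftrightarrow> openin M V \<and> bd \<subseteq> V \<and> V \<subseteq> UM \<and> circle_invariant act V \<and> smooth_fun (n + 2) PA (V \<times> UNIV) H \<and>
       (\<forall>a\<in>unit_circle. \<forall>x\<in>V. \<forall>z. H (act a x, z) = H (x, a * z)) \<and>
       (\<forall>x\<in>V. hs i (cc x) = H (x, complex_of_real (sqrt (f x))))" for i V H
  have "\<exists>V H. ext i V H" if "i < m" for i unfolding ext_def by (rule FF_D(2)[OF hs[OF that]])
  then have "\<forall>i\<in>{..<m}. \<exists>t. ext i (fst t) (snd t)" by simp
  from bchoice[OF this] obtain t where t: "\<And>i. i < m \<Longrightarrow> ext i (fst (t i)) (snd (t i))" by auto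
  define V where "V i = fst (t i)" for i
  define H where "H i = snd (t i)" for i
  note VH = t[folded V_def H_def, unfolded ext_def]
  \<comment> \<open>\<open>W\<close> keeps the set inside \<open>UM\<close> when
    \<open>m = 0\<close> and the family is empty.\<close>
  define V0 where "V0 = W \<inter> (\<Inter>i\<in>{..<m}. V i)"
  define H0 where "H0 q = G (\<lambda>i. if i < m then H i q else 0)" for q
  have V0: "openin M V0"
  proof (cases "m = 0")
    case False
    have "openin M (\<Inter> (V ` {..<m}))" by (rule openin_Inter) (use False VH in auto)
    then show ?thesis unfolding V0_def using W(1) by blast
  qed (simp add: V0_def W(1))
  have V0s: "V0 \<subseteq> V i" if "i < m" for i using that by (auto simp: V0_def)
  have ge: "(\<lambda>i. if i < m then r i else 0) \<in> eucl m" for r by (simp add: in_eucl)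
  have "smooth_fun n A (topspace M - bd) (\<lambda>x. G (\<lambda>i. if i < m then (hs i \<circ> cc) x else 0))"
    by (rule smooth_fun_compose[OF FF_D(1)[OF hs] G order_refl ge]) (use chart_inj chart_eucl in auto)
  then have F1: "smooth_fun n A (topspace M - bd) ((\<lambda>q. G (\<lambda>i. if i < m then hs i q else 0)) \<circ> cc)"
    unfolding o_def .
  have Hs: "smooth_fun (n + 2) PA (V0 \<times> UNIV) (H i)" if "i < m" for i
    by (rule smooth_fun_subset[of _ _ "V i \<times> UNIV"]) (use VH[OF that] V0s[OF that] in auto)
  have "smooth_fun (n + 2) PA (V0 \<times> UNIV) H0" unfolding H0_def
    by (rule smooth_fun_compose[OF Hs G order_refl ge product_charts])
  moreover have "circle_invariant act V0"
    unfolding circle_invariant_def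
  proof (intro ballI)
    fix a x assume ax: "a \<in> unit_circle" "x \<in> V0"
    have "act a x \<in> V i" if "i < m" for i
      using VH[OF that] V0s[OF that] ax by (auto simp: circle_invariant_def)
    then show "act a x \<in> V0" using act_W ax by (auto simp: V0_def)
  qed
  moreover have "H0 (act a x, z) = H0 (x, a * z)" if ax: "a \<in> unit_circle" "x \<in> V0" for a x z
  proof -
    have "H i (act a x, z) = H i (x, a * z)" if "i < m" for i using VH[OF that] V0s[OF that] ax by blast
    then show ?thesis unfolding H0_def by (simp cong: if_cong)
  qed
  moreover have "G (\<lambda>i. if i < m then hs i (cc x) else 0) = H0 (x, complex_of_real (sqrt (f x)))" if x: "x \<in> V0" for x
  proof -
    have "hs i (cc x) = H i (x, complex_of_real (sqrt (f x)))" if "i < m" for i using VH[OF that] V0s[OF that] x by blast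
    then show ?thesis unfolding H0_def by (simp cong: if_cong)
  qed
  moreover have "bd \<subseteq> V i" if "i < m" for i using VH[OF that] by blast
  then have "bd \<subseteq> V0" "V0 \<subseteq> UM" using W by (auto simp: V0_def)
  ultimately show ?thesis
    unfolding cut_functions_def interior_eq using F1 V0
    by (intro CollectI conjI exI[of _ V0] exI[of _ H0] ballI allI) simp_all
qed

text \<open>An invariant bump, supported where \<open>h\<close> agrees with \<open>h'\<close> and
  where the extension of \<open>h'\<close> is defined, turns the local extension into one of
  \<open>b * h\<close> on all of \<open>W\<close>. The common domain \<open>W\<close> allows such
  pieces to be added later.\<close>

lemma FF_local_extension:
  assumes x0: "x0 \<in> bd" and N: "openin Mc N" "cc x0 \<in> N" and h': "h' \<in> FF" and eq: "\<And>q. q \<in> N \<Longrightarrow> h q = h' q"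
  shows "\<exists>b Q H. smooth_fun n A (topspace M) b \<and> (\<forall>a\<in>unit_circle. \<forall>x\<in>W. b (act a x) = b x) \<and>
    openin M Q \<and> x0 \<in> Q \<and> circle_invariant act Q \<and> Q \<subseteq> W \<and> (\<forall>x\<in>Q. b x = 1) \<and>
    smooth_fun (n + 2) PA (W \<times> UNIV) H \<and> (\<forall>a\<in>unit_circle. \<forall>x\<in>W. \<forall>z. H (act a x, z) = H (x, a * z)) \<and>
    (\<forall>x\<in>W. b x * h (cc x) = H (x, complex_of_real (sqrt (f x))))"
proof -
  obtain V H where V: "openin M V" "bd \<subseteq> V" "V \<subseteq> UM" "circle_invariant act V"
    "smooth_fun (n + 2) PA (V \<times> UNIV) H"
    "\<And>a x z. a \<in> unit_circle \<Longrightarrow> x \<in> V \<Longrightarrow> H (act a x, z) = H (x, a * z)"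
    "\<And>x. x \<in> V \<Longrightarrow> h' (cc x) = H (x, complex_of_real (sqrt (f x)))"
    using FF_D(2)[OF h'] by blast
  define N' where "N' = {x \<in> topspace M. cc x \<in> N} \<inter> V"
  have N': "openin M N'" unfolding N'_def
    using openin_continuous_map_preimage[OF cut_continuous N(1)] V(1) by blast
  have "x0 \<in> core N'"
    unfolding core_def N'_def
    using x0 W(2) act_bd[OF _ x0] bd_sub V(2) cut_map_act[OF _ x0] N(2) by auto
  obtain U \<phi> j N1 \<theta> r1 Y1 g1 where "cut_tube n M A UM act f W U \<phi> x0 j N1 \<theta> r1 Y1 g1"
    using cut_tube_exists[OF x0] by blast
  then interpret t: cut_tube n M A UM act f W U \<phi> x0 j N1 \<theta> r1 Y1 g1 .
  obtain b K O' where b: "smooth_fun n A (topspace M) b" "compactin M K" "K \<subseteq> t.T" "K \<subseteq> N'" "\<And>x. x \<notin> K \<Longrightarrow> b x = 0"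
    "\<And>a x. a \<in> unit_circle \<Longrightarrow> x \<in> W \<Longrightarrow> b (act a x) = b x"
    "openin (Euclidean_space n) O'" "t.\<Phi> x0 \<in> O'" "\<And>x. x \<in> t.T \<Longrightarrow> t.\<Phi> x \<in> O' \<Longrightarrow> b x = 1"
    using t.bump[OF N' \<open>x0 \<in> core N'\<close>] by metis
  define P where "P = {x \<in> t.T. t.\<Phi> x \<in> O'}"
  have P: "openin M P" "saturated P" unfolding P_def using t.\<Phi>_vimage[OF b(7)] by auto
  have "x0 \<in> core P"
    using P(2) x0 t.x0_T b(8) W(2) unfolding core_def saturated_def P_def by auto
  define Hb where "Hb = (\<lambda>(x, z). if x \<in> N' then b x * H (x, z) else 0)"
  have "smooth_fun (n + 2) PA ((W \<inter> N') \<times> UNIV) (\<lambda>(x, z). b x * H (x, z))"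
  proof -
    have "smooth_fun (n + 2) PA ((W \<inter> N') \<times> UNIV) (\<lambda>q. (\<lambda>(x, z). b x) q * H q)"
      by (intro smooth_fun_mult product_smooth_pullback smooth_fun_subset[OF b(1)] smooth_fun_subset[OF V(5)])
        (use UM in \<open>auto simp: N'_def\<close>)
    then show ?thesis by (rule product_smooth_eq) auto
  qed
  from product_extend_by_zero[OF N' b(2,4) UM(3) this]
  have "smooth_fun (n + 2) PA (W \<times> UNIV) (\<lambda>(x, z). if x \<in> N' then (\<lambda>(x, z). b x * H (x, z)) (x, z) else 0)"
    using b(5) by simp
  then have Hs: "smooth_fun (n + 2) PA (W \<times> UNIV) Hb"
    by (rule product_smooth_eq) (auto simp: Hb_def)
  have He: "Hb (act a x, z) = Hb (x, a * z)" if ax: "a \<in> unit_circle" "x \<in> W" for a x z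
  proof (cases "b x = 0")
    case True
    then show ?thesis using b(6)[OF ax] by (simp add: Hb_def)
  next
    case False
    then have "x \<in> N'" "act a x \<in> N'" using b(4) b(5)[of x] b(5)[of "act a x"] b(6)[OF ax] by auto
    then show ?thesis using b(6)[OF ax] V(6)[OF ax(1), of x z] by (simp add: Hb_def N'_def)
  qed
  have Hv: "b x * h (cc x) = Hb (x, complex_of_real (sqrt (f x)))" for x
  proof (cases "b x = 0")
    case False
    then have "x \<in> N'" using b(4) b(5)[of x] by auto
    then show ?thesis using eq[of "cc x"] V(7)[of x] by (simp add: Hb_def N'_def)
  qed (simp add: Hb_def)
  have "b x = 1" if "x \<in> core P" for x
  proof -
    have "x \<in> P" using that core_sub(1) by blast
    then show ?thesis using b(9) by (simp add: P_def)
  qed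
  then show ?thesis
    using b(1,6) core_open[OF P(1)] \<open>x0 \<in> core P\<close> core_invariant core_sub(2) Hs He Hv
    by (intro exI[of _ b] exI[of _ "core P"] exI[of _ Hb]) auto
qed

text \<open>
  With countably many invariant bump functions \<open>b\<^sub>i\<close> whose sets \<open>b\<^sub>i = 1\<close> have interiors covering the
  boundary, the functions \<open>b\<^sub>i \<cdot> \<Prod>l<i. (1 - b\<^sub>l)\<close> form a partition of unity: on the set \<open>b\<^sub>k = 1\<close> all
  terms beyond \<open>k\<close> vanish, so local finiteness is automatic.
\<close>

lemma FF_local:
  assumes loc: "\<And>p. p \<in> topspace Mc \<Longrightarrow> \<exists>N h'. openin Mc N \<and> p \<in> N \<and> h' \<in> FF \<and> (\<forall>q\<in>N. h q = h' q)"
  shows "h \<in> FF"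
proof -
  have F1: "smooth_fun n A (topspace M - bd) (h \<circ> cc)"
  proof (rule smooth_fun_localI)
    fix x assume x: "x \<in> topspace M - bd"
    then have "cc x \<in> topspace Mc" by (auto simp: cut_topspace)
    from loc[OF this] obtain N h' where N: "openin Mc N" "cc x \<in> N" "h' \<in> FF" "\<And>q. q \<in> N \<Longrightarrow> h q = h' q" by blast
    have "openin M {y \<in> topspace M. cc y \<in> N}" by (rule openin_continuous_map_preimage[OF cut_continuous N(1)])
    moreover have "smooth_fun n A ((topspace M - bd) \<inter> {y \<in> topspace M. cc y \<in> N}) (h \<circ> cc)"
      by (rule smooth_fun_eq[OF smooth_fun_subset[OF FF_D(1)[OF N(3)]]]) (use N(4) chart_inj in auto)
    ultimately show "\<exists>N. openin M N \<and> x \<in> N \<and> smooth_fun n A ((topspace M - bd) \<inter> N) (h \<circ> cc)"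
      using x N(2) by (intro exI[of _ "{y \<in> topspace M. cc y \<in> N}"]) auto
  qed
  define ext_at where "ext_at x0 b Q H \<longleftrightarrow> smooth_fun n A (topspace M) b \<and> (\<forall>a\<in>unit_circle. \<forall>x\<in>W. b (act a x) = b x) \<and>
    openin M Q \<and> x0 \<in> Q \<and> circle_invariant act Q \<and> Q \<subseteq> W \<and> (\<forall>x\<in>Q. b x = 1) \<and>
    smooth_fun (n + 2) PA (W \<times> UNIV) H \<and> (\<forall>a\<in>unit_circle. \<forall>x\<in>W. \<forall>z. H (act a x, z) = H (x, a * z)) \<and>
    (\<forall>x\<in>W. b x * h (cc x) = H (x, complex_of_real (sqrt (f x))))" for x0 b Q H
  have "\<exists>b Q H. ext_at x0 b Q H" if x0: "x0 \<in> bd" for x0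
  proof -
    have "cc x0 \<in> topspace Mc" using x0 bd_sub by (auto simp: cut_topspace)
    from loc[OF this] obtain N h' where "openin Mc N" "cc x0 \<in> N" "h' \<in> FF" "\<And>q. q \<in> N \<Longrightarrow> h q = h' q" by blast
    from FF_local_extension[OF x0 this] show ?thesis unfolding ext_at_def .
  qed
  then have "\<forall>x0\<in>bd. \<exists>t. ext_at x0 (fst t) (fst (snd t)) (snd (snd t))" by simp
  from bchoice[OF this] obtain t where t: "\<And>x0. x0 \<in> bd \<Longrightarrow> ext_at x0 (fst (t x0)) (fst (snd (t x0))) (snd (snd (t x0)))" by blast
  define bb where "bb x0 = fst (t x0)" for x0
  define QQ where "QQ x0 = fst (snd (t x0))" for x0
  define HH where "HH x0 = snd (snd (t x0))" for x0
  have pr: "ext_at x0 (bb x0) (QQ x0) (HH x0)" if "x0 \<in> bd" for x0 using t[OF that] by (simp add: bb_def QQ_def HH_def)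
  have "\<exists>V H. openin M V \<and> bd \<subseteq> V \<and> V \<subseteq> UM \<and> circle_invariant act V \<and> smooth_fun (n + 2) PA (V \<times> UNIV) H \<and>
       (\<forall>a\<in>unit_circle. \<forall>x\<in>V. \<forall>z. H (act a x, z) = H (x, a * z)) \<and>
       (\<forall>x\<in>V. h (cc x) = H (x, complex_of_real (sqrt (f x))))"
  \<comment> \<open>An empty boundary has no cover to enumerate; the empty neighbourhood then
    suffices.\<close>
  proof (cases "bd = {}")
    case True
    show ?thesis
      by (rule exI[of _ "{}"], rule exI[of _ "\<lambda>q. 0"]) (simp add: True circle_invariant_def smooth_fun_def smooth_on_def)
  next
    case False
    have "second_countable (subtopology M bd)" by (rule second_countable_subtopology[OF second_count])
    then have Lin: "Lindelof_space (subtopology M bd)" by (rule second_countable_imp_Lindelof_space)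
    have tb: "topspace (subtopology M bd) = bd" using bd_sub by auto
    have "\<Union> ((\<lambda>x. bd \<inter> QQ x) ` bd) = bd" using pr unfolding ext_at_def by blast
    moreover have "openin (subtopology M bd) (bd \<inter> QQ x)" if "x \<in> bd" for x
      using pr[OF that] unfolding ext_at_def by (simp add: openin_subtopology_Int2)
    ultimately have "\<exists>\<V>. countable \<V> \<and> \<V> \<subseteq> (\<lambda>x. bd \<inter> QQ x) ` bd \<and> \<Union>\<V> = bd"
      using Lindelof_spaceD[OF Lin, of "(\<lambda>x. bd \<inter> QQ x) ` bd"] unfolding tb by auto
    then obtain \<V> where \<V>: "countable \<V>" "\<V> \<subseteq> (\<lambda>x. bd \<inter> QQ x) ` bd" "\<Union>\<V> = bd"
      by (elim exE conjE)
    obtain C where C: "C \<subseteq> bd" "countable C" "\<V> = (\<lambda>x. bd \<inter> QQ x) ` C"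
      using countable_subset_image[of \<V> "\<lambda>x. bd \<inter> QQ x" bd] \<V>(1,2) by blast
    have Cne: "C \<noteq> {}" using False \<V>(3) C(3) by auto
    \<comment> \<open>An enumeration of \<open>C\<close>, with repetitions if \<open>C\<close> is
      finite; the telescoping identity tolerates them.\<close>
    define pt where "pt i = from_nat_into C i" for i :: nat
    have ptC: "pt i \<in> bd" for i using from_nat_into[OF Cne] C(1) by (auto simp: pt_def)
    define b where "b i = bb (pt i)" for i
    define Q where "Q i = QQ (pt i)" for i
    define H where "H i = HH (pt i)" for i
    have P: "ext_at (pt i) (b i) (Q i) (H i)" for i using pr[OF ptC[of i]] by (simp add: b_def Q_def H_def)
    have bs: "smooth_fun n A (topspace M) (b i)" and ba: "a \<in> unit_circle \<Longrightarrow> x \<in> W \<Longrightarrow> b i (act a x) = b i x"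
      and Qo: "openin M (Q i)" and Qi: "circle_invariant act (Q i)" and QW: "Q i \<subseteq> W" and b1: "x \<in> Q i \<Longrightarrow> b i x = 1"
      and Hs: "smooth_fun (n + 2) PA (W \<times> UNIV) (H i)"
      and Ha: "a \<in> unit_circle \<Longrightarrow> x \<in> W \<Longrightarrow> H i (act a x, z) = H i (x, a * z)"
      and Hv: "x \<in> W \<Longrightarrow> b i x * h (cc x) = H i (x, complex_of_real (sqrt (f x)))" for i a x z
      using P[of i] unfolding ext_at_def by blast+
    define V where "V = (\<Union>i. Q i)"
    have Vo: "openin M V" unfolding V_def using Qo by blast
    have VW: "V \<subseteq> W" unfolding V_def using QW by blast
    have bdV: "bd \<subseteq> V"
    proof
      fix x assume "x \<in> bd"
      then obtain y where "y \<in> C" "x \<in> QQ y" using \<V>(3) C(3) by blast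
      moreover obtain i where "pt i = y" using from_nat_into_surj[OF C(2) \<open>y \<in> C\<close>] by (auto simp: pt_def)
      ultimately show "x \<in> V" by (auto simp: V_def Q_def)
    qed
    have Vinv: "circle_invariant act V" using Qi by (fastforce simp: V_def circle_invariant_def)
    define \<rho> where "\<rho> i x = (\<Prod>l<i. 1 - b l x)" for i x
    \<comment> \<open>The sum is truncated at the first \<open>Q i\<close> that contains
      \<open>x\<close>. By \<open>HVe\<close> every index \<open>k\<close> with
      \<open>x \<in> Q k\<close> gives the same value, so on \<open>Q k\<close> the sum has a fixed
      number of smooth terms.\<close>
    define m where "m x = (LEAST i. x \<in> Q i)" for x
    define HV where "HV = (\<lambda>(x, z). \<Sum>i<Suc (m x). \<rho> i x * H i (x, z))"
    have mQ: "x \<in> Q (m x)" if "x \<in> V" for x using that LeastI_ex[of "\<lambda>i. x \<in> Q i"] by (auto simp: m_def V_def)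
    have \<rho>0: "\<rho> i x = 0" if "x \<in> Q k" "k < i" for i k x
      unfolding \<rho>_def using b1[OF that(1)] that(2) by (intro prod_zero bexI[of _ k]) auto
    have HVe: "HV (x, z) = (\<Sum>i<Suc k. \<rho> i x * H i (x, z))" if "x \<in> Q k" for x z k
    proof -
      have mk: "m x \<le> k" unfolding m_def using that by (rule Least_le)
      have mx: "x \<in> Q (m x)" using mQ that by (auto simp: V_def)
      have "(\<Sum>i<Suc (m x). \<rho> i x * H i (x, z)) = (\<Sum>i<Suc k. \<rho> i x * H i (x, z))"
        by (rule sum.mono_neutral_left) (use mk \<rho>0[OF mx] in auto)
      then show ?thesis by (simp add: HV_def)
    qed
    have "smooth_fun (n + 2) PA (V \<times> UNIV) HV"
    proof (rule product_smooth_localI)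
      fix x assume "x \<in> V"
      then obtain k where k: "x \<in> Q k" by (auto simp: V_def)
      have \<rho>s: "smooth_fun n A (Q k) (\<rho> i)" for i
      proof -
        have Qt: "Q k \<subseteq> topspace M" using openin_subset[OF Qo] .
        show ?thesis
          unfolding smooth_fun_def
        proof clarify
          fix U \<phi> assume c: "(U, \<phi>) \<in> A"
          have e: "\<phi> ` (U \<inter> Q k) \<subseteq> eucl n" using chart_eucl[OF c] by blast
          have "smooth_on n (\<phi> ` (U \<inter> Q k)) (\<lambda>y. b l (inv_into U \<phi> y))" for l
            using smooth_fun_subset[OF bs Qt] c by (fastforce simp: smooth_fun_def o_def)
          then show "smooth_on n (\<phi> ` (U \<inter> Q k)) (\<rho> i \<circ> inv_into U \<phi>)"
            unfolding \<rho>_def o_def by (intro smooth_on_prod smooth_on_diff smooth_on_const e)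
        qed
      qed
      have "smooth_fun (n + 2) PA ((V \<inter> Q k) \<times> UNIV) (\<lambda>q. \<Sum>i<K. (\<lambda>(x, z). \<rho> i x) q * H i q)" for K
      proof (induction K)
        case 0
        then show ?case using smooth_fun_const[OF PA_eucl] by simp
      next
        case (Suc K)
        have "smooth_fun (n + 2) PA ((V \<inter> Q k) \<times> UNIV) (\<lambda>q. (\<lambda>(x, z). \<rho> K x) q * H K q)"
          by (intro smooth_fun_mult product_smooth_pullback smooth_fun_subset[OF \<rho>s] smooth_fun_subset[OF Hs])
            (use QW in auto)
        from smooth_fun_add[OF Suc this] show ?case by simp
      qed
      from this[of "Suc k"] have "smooth_fun (n + 2) PA ((V \<inter> Q k) \<times> UNIV) HV"
        by (rule product_smooth_eq) (use HVe in auto)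
      then show "\<exists>N. openin M N \<and> x \<in> N \<and> smooth_fun (n + 2) PA ((V \<inter> N) \<times> UNIV) HV"
        using k Qo by blast
    qed
    moreover have "HV (act a x, z) = HV (x, a * z)" if ax: "a \<in> unit_circle" "x \<in> V" for a x z
    proof -
      have xW: "x \<in> W" and aQ: "act a x \<in> Q (m x)" using ax VW mQ[OF ax(2)] Qi by (auto simp: circle_invariant_def)
      have "\<rho> i (act a x) = \<rho> i x" for i unfolding \<rho>_def using ba[OF ax(1) xW] by simp
      then show ?thesis using HVe[OF aQ] HVe[OF mQ[OF ax(2)]] Ha[OF ax(1) xW] by simp
    qed
    moreover have "h (cc x) = HV (x, complex_of_real (sqrt (f x)))" if x: "x \<in> V" for x
    proof -
      have xW: "x \<in> W" using x VW by blast
      have "HV (x, complex_of_real (sqrt (f x))) = (\<Sum>i<Suc (m x). \<rho> i x * b i x) * h (cc x)"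
        unfolding HVe[OF mQ[OF x]] sum_distrib_right
        by (rule sum.cong[OF refl]) (use Hv[OF xW] in \<open>simp add: mult.assoc\<close>)
      \<comment> \<open>The telescoped remainder contains the factor
        \<open>1 - b (m x) x = 0\<close>.\<close>
      also have "(\<Sum>i<Suc (m x). \<rho> i x * b i x) = 1 - \<rho> (Suc (m x)) x"
        unfolding \<rho>_def by (rule sum_prod_one_minus)
      also have "\<rho> (Suc (m x)) x = 0" using \<rho>0[OF mQ[OF x]] by simp
      finally show ?thesis by simp
    qed
    ultimately show ?thesis using Vo bdV VW W(3) Vinv
      by (intro exI[of _ V] exI[of _ HV]) auto
  qed
  then show ?thesis unfolding cut_functions_def interior_eq using F1 by simp
qed

section \<open>Admissible charts and the manifold structure\<close>

lemma FF_sheaf: "function_sheaf Mc FF"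
proof
  show "h \<in> FF" if "\<And>p. p \<in> topspace Mc \<Longrightarrow> \<exists>N h'. openin Mc N \<and> p \<in> N \<and> h' \<in> FF \<and> (\<forall>q\<in>N. h q = h' q)" for h
    using FF_local[of h] that by blast
  show "(\<lambda>q. G (\<lambda>j. if j < m then hs j q else 0)) \<in> FF"
    if "smooth_on m (eucl m) G" "\<And>j. j < m \<Longrightarrow> hs j \<in> FF" for m G hs
    using FF_compose[OF that] .
qed

text \<open>The chart is shrunk to where an invariant bump is 1, so that the cut off coordinates of
  \<open>coordinate_member\<close> are the coordinates themselves; \<open>pullback_smooth\<close>
  supplies the other half of admissibility.\<close>

lemma boundary_sheaf_chart:
  assumes x0: "x0 \<in> bd"
  shows "\<exists>c. function_sheaf.sheaf_chart Mc FF n c \<and> cc x0 \<in> fst c"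
proof -
  interpret F: function_sheaf Mc FF by (rule FF_sheaf)
  obtain U \<phi> j N1 \<theta> r1 Y1 g1 where "cut_tube n M A UM act f W U \<phi> x0 j N1 \<theta> r1 Y1 g1"
    using cut_tube_exists[OF x0] by blast
  then interpret t: cut_tube n M A UM act f W U \<phi> x0 j N1 \<theta> r1 Y1 g1 .
  have "x0 \<in> core (topspace M)" using x0 W(2) act_bd[OF _ x0] bd_sub by (auto simp: core_def)
  then obtain b K O' where b: "smooth_fun n A (topspace M) b" "compactin M K" "K \<subseteq> t.T" "\<And>x. x \<notin> K \<Longrightarrow> b x = 0"
    "\<And>a x. a \<in> unit_circle \<Longrightarrow> x \<in> W \<Longrightarrow> b (act a x) = b x"
    "openin (Euclidean_space n) O'" "t.\<Phi> x0 \<in> O'" "O' \<subseteq> t.O0" "\<And>x. x \<in> t.T \<Longrightarrow> t.\<Phi> x \<in> O' \<Longrightarrow> b x = 1"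
    using t.bump[OF openin_topspace] by metis
  obtain D \<psi> where D: "t.cut_chart O' = (D, \<psi>)" by (cases "t.cut_chart O'")
  note ch = t.cut_chart_is_chart[OF b(6,8), unfolded D fst_conv snd_conv]
  have Dd: "D = cc ` {x \<in> t.T. t.\<Phi> x \<in> O'}" using D by (simp add: t.cut_chart_def)
  have val: "\<psi> (cc x) = t.\<Phi> x" if "x \<in> t.T" "t.\<Phi> x \<in> O'" for x
    using t.cut_chart_value[OF that] by (simp add: D)
  have "smooth_on n (\<psi> ` D) (h \<circ> inv_into D \<psi>)" if "h \<in> FF" for h
    unfolding ch(3) by (rule smooth_on_eq[OF t.pullback_smooth[OF that b(6,8)]]) (use ch(2) in simp)
  moreover have "\<exists>h\<in>FF. \<exists>N. openin Mc N \<and> q \<in> N \<and> N \<subseteq> D \<and> (\<forall>q\<in>N. \<psi> q k = h q)" if q: "q \<in> D" for q k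
  proof -
    obtain h where h: "h \<in> FF" "\<forall>x\<in>t.T. b x = 1 \<longrightarrow> h (cc x) = t.\<Phi> x k"
      using t.coordinate_member[OF b(1-5)] by blast
    have "\<psi> q k = h q" if "q \<in> D" for q using that h(2) b(9) val by (auto simp: Dd)
    then show ?thesis using q h(1) is_chartD(1)[OF ch(1)] by blast
  qed
  ultimately have "F.sheaf_chart n (D, \<psi>)" using ch(1) by (simp add: F.sheaf_chart_def)
  moreover have "cc x0 \<in> D" using t.x0_T b(7) by (auto simp: Dd)
  ultimately show ?thesis by (intro exI[of _ "(D, \<psi>)"]) simp
qed

text \<open>The cut map is injective on the interior, so charts of \<open>M\<close> that miss the
  boundary descend, and members pull back smoothly by the interior condition alone. A coordinate cut
  off inside such a chart vanishes near the boundary and is therefore represented there by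
  \<open>H = 0\<close>.\<close>

lemma interior_sheaf_chart:
  assumes x: "x \<in> topspace M" "x \<notin> bd"
  shows "\<exists>c. function_sheaf.sheaf_chart Mc FF n c \<and> cc x \<in> fst c"
proof -
  interpret F: function_sheaf Mc FF by (rule FF_sheaf)
  obtain U \<phi> where c: "(U, \<phi>) \<in> A" "x \<in> U" using chart_exists x by blast
  note ch = chart[OF c(1)] and inj = chart_inj[OF c(1)] and U = is_chartD[OF chart[OF c(1)]]
  define D where "D = U \<inter> (topspace M - bd)"
  have D: "openin M D" "D \<subseteq> U" "D \<subseteq> topspace M" "D \<inter> bd = {}" unfolding D_def using U(1) interior_open by auto
  have \<phi>D: "openin (Euclidean_space n) (\<phi> ` D)"
  proof (rule openin_half_space_eucl)
    show "openin (half_space n) (\<phi> ` D)" using chart_image_open[OF ch D(1)] D(2) by (simp add: inf_absorb2)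
    assume n: "0 < n"
    show "\<forall>y\<in>\<phi> ` D. 0 < y 0"
    proof clarify
      fix y assume y: "y \<in> D"
      then have "\<phi> y 0 \<noteq> 0" "0 \<le> \<phi> y 0" using chart_zero_bd[OF c(1) _ _ n, of y] chart_nonneg[OF c(1), of y] D by auto
      then show "0 < \<phi> y 0" by simp
    qed
  qed
  have sat: "saturated D'" if "D' \<subseteq> D" for D' using that D by (auto simp: saturated_def)
  define \<psi> where "\<psi> = restrict (\<lambda>q. \<phi> (SOME y. y \<in> topspace M \<and> cc y = q)) (cc ` D)"
  have val: "\<psi> (cc y) = \<phi> y" if y: "y \<in> D" for y
  proof -
    define z where "z = (SOME z. z \<in> topspace M \<and> cc z = cc y)"
    have "y \<in> topspace M \<and> cc y = cc y" using y D by blast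
    from someI[of "\<lambda>z. z \<in> topspace M \<and> cc z = cc y", OF this] have z: "z \<in> topspace M" "cc z = cc y" by (auto simp: z_def)
    then have "z = y" using cut_map_eq_iff[OF z(1), of y] y D by auto
    then show ?thesis using y by (simp add: \<psi>_def z_def)
  qed
  define \<Psi> where "\<Psi> u = cc (inv_into U \<phi> u)" for u
  have \<Psi>: "\<Psi> (\<phi> y) = cc y" if "y \<in> D" for y using that D(2) inj by (auto simp: \<Psi>_def)
  have op: "openin Mc (cc ` D)" using saturated_open[OF D(1) sat] by blast
  have im: "\<psi> ` (cc ` D) = \<phi> ` D" using val by (force simp: image_image)
  have Dt: "topspace (subtopology Mc (cc ` D)) = cc ` D" using openin_subset[OF op] by auto
  have Ot: "topspace (subtopology (Euclidean_space n) (\<phi> ` D)) = \<phi> ` D" using openin_subset[OF \<phi>D] by auto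
  have "homeomorphic_maps (subtopology Mc (cc ` D)) (subtopology (Euclidean_space n) (\<phi> ` D)) \<psi> \<Psi>"
    unfolding homeomorphic_maps_def Dt Ot
  proof (intro conjI ballI)
    show "continuous_map (subtopology Mc (cc ` D)) (subtopology (Euclidean_space n) (\<phi> ` D)) \<psi>"
      unfolding continuous_map_def Dt Ot
    proof (intro conjI allI impI)
      show "\<psi> \<in> cc ` D \<rightarrow> \<phi> ` D" using val by auto
      fix G assume "openin (subtopology (Euclidean_space n) (\<phi> ` D)) G"
      then have G: "openin (Euclidean_space n) G" "G \<subseteq> \<phi> ` D" using \<phi>D by (auto simp: openin_open_subtopology)
      have "openin (half_space n) G"
      proof -
        have "G \<subseteq> {x. 0 \<le> x 0}" using G(2) D(2) chart_nonneg[OF c(1)] by blast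
        then have "G = G \<inter> {x. 0 \<le> x 0}" by blast
        then show ?thesis using G(1) unfolding half_space_def openin_subtopology by blast
      qed
      from chart_vimage_open[OF ch this] have "openin M {y \<in> U. \<phi> y \<in> G}" .
      moreover have "{y \<in> U. \<phi> y \<in> G} = {y \<in> D. \<phi> y \<in> G}"
        using G(2) D(2) inj by (auto simp: inj_on_def)
      ultimately have "openin Mc (cc ` {y \<in> D. \<phi> y \<in> G})" using saturated_open sat by auto
      moreover have "{q \<in> cc ` D. \<psi> q \<in> G} = cc ` {y \<in> D. \<phi> y \<in> G}" using val by auto
      ultimately show "openin (subtopology Mc (cc ` D)) {q \<in> cc ` D. \<psi> q \<in> G}"
        using op by (simp add: openin_open_subtopology) blast
    qed
    have "continuous_map (subtopology (half_space n) (\<phi> ` U)) Mc \<Psi>"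
      using continuous_map_compose[OF chart_inv_continuous[OF ch] cut_continuous] by (simp add: o_def \<Psi>_def[abs_def])
    then have "continuous_map (subtopology (half_space n) (\<phi> ` D)) Mc \<Psi>"
      using D(2) by (rule continuous_map_from_subtopology_mono[OF _ image_mono])
    moreover have "subtopology (half_space n) (\<phi> ` D) = subtopology (Euclidean_space n) (\<phi> ` D)"
    proof -
      have "\<phi> ` D \<subseteq> {x. 0 \<le> x 0}" using D(2) chart_nonneg[OF c(1)] by blast
      then show ?thesis by (simp add: half_space_def subtopology_subtopology inf_absorb2)
    qed
    ultimately show "continuous_map (subtopology (Euclidean_space n) (\<phi> ` D)) (subtopology Mc (cc ` D)) \<Psi>"
      using \<Psi> by (auto simp: continuous_map_in_subtopology)
  qed (use val \<Psi> in auto)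
  then have "homeomorphic_map (subtopology Mc (cc ` D)) (subtopology (Euclidean_space n) (\<psi> ` (cc ` D))) \<psi>"
    unfolding im by (auto simp: homeomorphic_map_maps)
  then have chart': "is_chart (Euclidean_space n) Mc (cc ` D, \<psi>)"
    using op \<phi>D im by (auto simp: is_chart_def \<psi>_def)
  have inv: "inv_into (cc ` D) \<psi> u = \<Psi> u" if u: "u \<in> \<phi> ` D" for u
  proof -
    obtain y where y: "y \<in> D" "u = \<phi> y" using u by blast
    then show ?thesis using chart_inv[OF chart', of "cc y"] val \<Psi> by auto
  qed
  have "smooth_on n (\<psi> ` (cc ` D)) (h \<circ> inv_into (cc ` D) \<psi>)" if h: "h \<in> FF" for h
    unfolding im
  proof (rule smooth_on_eq)
    show "smooth_on n (\<phi> ` D) ((h \<circ> cc) \<circ> inv_into U \<phi>)" using FF_D(1)[OF h] c(1) by (auto simp: smooth_fun_def D_def)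
  qed (use inv in \<open>auto simp: \<Psi>_def\<close>)
  moreover have "\<exists>h\<in>FF. \<exists>N. openin Mc N \<and> q \<in> N \<and> N \<subseteq> cc ` D \<and> (\<forall>q\<in>N. \<psi> q k = h q)" if q: "q \<in> cc ` D" for q k
  proof -
    obtain y where y: "y \<in> D" "q = cc y" using q by blast
    obtain G V K where G: "smooth_on n (eucl n) G" "openin (Euclidean_space n) V" "\<phi> y \<in> V" "V \<subseteq> \<phi> ` D"
      "\<And>u. u \<in> V \<Longrightarrow> G u = u k" and K: "compactin (Euclidean_space n) K" "K \<subseteq> \<phi> ` D"
      "\<And>u. u \<in> eucl n \<Longrightarrow> u \<notin> K \<Longrightarrow> G u = 0"
      using smooth_cutoff[OF \<phi>D _ smooth_on_coord[OF openin_eucl_subset[OF \<phi>D]], of "\<phi> y" k] y(1) by blast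
    define \<kappa> where "\<kappa> x = (if x \<in> D then G (\<phi> x) else 0)" for x
    define K' where "K' = inv_into U \<phi> ` K"
    have K'D: "K' \<subseteq> D" using K(2) D(2) inj by (force simp: K'_def)
    have K'mem: "x \<in> K'" if "x \<in> D" "\<phi> x \<in> K" for x using that D(2) inj by (force simp: K'_def)
    have "K \<subseteq> {x. 0 \<le> x 0}" using K(2) D(2) chart_nonneg[OF c(1)] by blast
    then have "compactin (subtopology (half_space n) (\<phi> ` U)) K"
      using K(1) subset_trans[OF K(2) image_mono[OF D(2)]] by (simp add: half_space_def compactin_subtopology)
    then have K': "compactin M K'" unfolding K'_def by (rule image_compactin[OF _ chart_inv_continuous[OF ch]])
    have G0: "G (\<phi> x) = 0" if "x \<in> D" "x \<notin> K'" for x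
      using K'mem[of x] that K(3)[of "\<phi> x"] chart_eucl[OF c(1)] D(2) by auto
    then have \<kappa>0: "\<kappa> x = 0" if "x \<notin> K'" for x using that by (simp add: \<kappa>_def)
    have "smooth_fun n A D (\<lambda>x. G (\<phi> x))"
    proof (rule smooth_fun_chartI[OF c(1) D(2)])
      show "smooth_on n (\<phi> ` D) ((\<lambda>x. G (\<phi> x)) \<circ> inv_into U \<phi>)"
        by (rule smooth_on_eq[OF smooth_on_subset[OF G(1) openin_eucl_subset[OF \<phi>D]]]) (use D(2) inj in auto)
    qed
    then have g: "smooth_fun n A ((topspace M - bd) \<inter> D) (\<lambda>x. G (\<phi> x))" by (rule smooth_fun_subset) auto
    have "smooth_fun n A (topspace M - bd) \<kappa>"
      unfolding \<kappa>_def by (rule extend_by_zero[OF D(1) K' K'D _ g]) (use G0 in auto)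
    note \<kappa>s = this
    \<comment> \<open>An invariant neighbourhood of the boundary that misses the support of
      \<open>\<kappa>\<close>; it exists because the support is compact and disjoint from the
      boundary.\<close>
    define Z where "Z = core (topspace M - K')"
    have Z: "openin M Z" "bd \<subseteq> Z" "Z \<subseteq> UM" "circle_invariant act Z"
      unfolding Z_def
    proof -
      show "openin M (core (topspace M - K'))" by (rule core_open[OF compact_compl_open[OF K']])
      show "bd \<subseteq> core (topspace M - K')" using W(2) act_bd bd_sub K'D D(4) by (auto simp: core_def)
      show "core (topspace M - K') \<subseteq> UM" using core_sub(2) W(3) by blast
      show "circle_invariant act (core (topspace M - K'))" by (rule core_invariant)
    qed
    have "\<kappa> x = 0" if "x \<in> Z" for x using \<kappa>0 that core_sub(1) by (auto simp: Z_def)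
    note m = FF_I[OF \<kappa>s Z, of "\<lambda>q. 0", OF smooth_fun_const[OF PA_eucl] refl this]
    define N where "N = cc ` {x \<in> U. \<phi> x \<in> V}"
    have sub: "{x \<in> U. \<phi> x \<in> V} \<subseteq> D" using G(4) D(2) inj by (auto simp: inj_on_def)
    have Vh: "openin (half_space n) V"
    proof -
      have "V = V \<inter> {x. 0 \<le> x 0}" using G(4) D(2) chart_nonneg[OF c(1)] by blast
      then show ?thesis using G(2) unfolding half_space_def openin_subtopology by blast
    qed
    have "openin Mc N" unfolding N_def using saturated_open[OF chart_vimage_open[OF ch Vh] sat[OF sub]] .
    moreover have "q \<in> N" "N \<subseteq> cc ` D" using y G(3) D(2) sub by (auto simp: N_def)
    moreover have "\<psi> q k = desc \<kappa> q" if qN: "q \<in> N" for q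
    proof -
      obtain z where z: "z \<in> D" "\<phi> z \<in> V" "q = cc z" using qN sub by (auto simp: N_def)
      then show ?thesis using m(2)[of z] D(3) val[OF z(1)] G(5) by (auto simp: \<kappa>_def)
    qed
    ultimately show ?thesis using m(1) by blast
  qed
  ultimately have "F.sheaf_chart n (cc ` D, \<psi>)" using chart' by (simp add: F.sheaf_chart_def)
  moreover have "cc x \<in> cc ` D" using x c(2) by (auto simp: D_def)
  ultimately show ?thesis by (intro exI[of _ "(cc ` D, \<psi>)"]) simp
qed

theorem cut_manifold_unique: "\<exists>!B. \<exists>m. manifold m Mc B \<and> FF = smooth_functions m Mc B"
proof -
  interpret F: function_sheaf Mc FF by (rule FF_sheaf)
  show ?thesis
  proof (rule F.sheaf_manifold_unique[OF cut_hausdorff cut_second_countable])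
    fix p assume "p \<in> topspace Mc"
    then obtain x where "x \<in> topspace M" "p = cc x" by (auto simp: cut_topspace)
    then show "\<exists>c. F.sheaf_chart n c \<and> p \<in> fst c"
      using boundary_sheaf_chart[of x] interior_sheaf_chart[of x] by blast
  qed
qed

end

theorem theorem1p5:
  fixes n :: nat and M :: "'a topology" and A :: "'a chart set"
    and UM :: "'a set" and act :: "complex \<Rightarrow> 'a \<Rightarrow> 'a" and f :: "'a \<Rightarrow> real"
  assumes "manifold_with_boundary n M A"
    and "free_circle_action_near_boundary n M A UM act"
    and "invariant_boundary_defining_function n M A UM act f"
  shows "\<exists>!B. \<exists>m. manifold m (cut_space n M A act) B \<and>
           cut_functions n M A UM act f = smooth_functions m (cut_space n M A act) B"
proof -
  obtain W where W: "openin M W" "boundary_of_manifold n M A \<subseteq> W" "W \<subseteq> UM" "circle_invariant act W"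
    "\<forall>a\<in>unit_circle. \<forall>x\<in>W. f (act a x) = f x"
    using assms(3) unfolding invariant_boundary_defining_function_def by blast
  interpret cut_data n M A UM act f W
    by unfold_locales (use assms W in auto)
  show ?thesis by (rule cut_manifold_unique)
qed

end
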